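(* Let $(\phi,\xi,\eta,g)$ be a contact metric structure on $M^{p+1}$, let $\widetilde{\mathcal D}$ be spanned by $\xi$, and let $\Omega\subset M$ be a relatively compact domain. Then $g$ is critical for the action $J_{\tilde T,\Omega}(g)=\int_\Omega\langle\tilde T,\tilde T\rangle\,d\mathrm{vol}_g$ with respect to both $\bar g^\perp$-variations and $\bar g^\top$-variations.
   Context: A contact manifold $(M^{2m+1},\eta)$ has a contact form $\eta$ and Reeb field $\xi$, with $\eta(\xi)=1$, $d\eta(\xi,\cdot)=0$; convention: $d\eta(X,Y)=\frac12(X\eta(Y)-Y\eta(X)-\eta([X,Y]))$. A contact metric structure $(\phi,\xi,\eta,g)$ consists in addition of a Riemannian metric $g$ and a $(1,1)$-tensor $\phi$ with $\eta(X)=g(\xi,X)$, $d\eta(X,Y)=g(X,\phi Y)$, $\phi^2=-I+\eta\otimes\xi$. Here $p=2m$ and $\mathcal D=\xi^\perp$. For any metric, $\tilde T$ is the integrability tensor of the orthogonal complement $\mathcal D$ of $\widetilde{\mathcal D}$ for that metric: $\tilde T(X,Y)=\frac12[X,Y]^\top$ ($X,Y\in\mathcal D$), where $^\top$ is the orthogonal projection onto $\widetilde{\mathcal D}$, and $\langle\tilde T,\tilde T\rangle=\sum_{i,j}\epsilon_i\epsilon_jg(\tilde T(\mathcal E_i,\mathcal E_j),\tilde T(\mathcal E_i,\mathcal E_j))$ for a local orthonormal frame $\{\mathcal E_i\}$ of $\mathcal D$, $\epsilon_i=g(\mathcal E_i,\mathcal E_i)$. Variations are smooth families $g_t$ ($|t|<\varepsilon$,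 $g_0=g$) of metrics. A $g^\perp$-variation satisfies $g_t(X,Y)=g(X,Y)$ for $X,Y\in\widetilde{\mathcal D}$; a $g^\top$-variation satisfies $g_t(X,Y)=g(X,Y)$ for $X,Y\in\mathcal D$ and keeps $\widetilde{\mathcal D},\mathcal D$ orthogonal. Given a $g^\perp$-variation $g_t$ with support contained in $\Omega$, let $\mathcal D(t)$ be the $g_t$-orthogonal complement of $\widetilde{\mathcal D}$; the associated $\bar g^\perp$-variation is $\bar g_t=\phi^\perp_t\,g_t|_{\mathcal D(t)\times\mathcal D(t)}+g|_{\widetilde{\mathcal D}\times\widetilde{\mathcal D}}$ (with respect to $TM=\widetilde{\mathcal D}\oplus\mathcal D(t)$), $\phi_t^\perp=(\mathrm{Vol}(\Omega,g_t)/\mathrm{Vol}(\Omega,g))^{-2/p}$. Given a $g^\top$-variation $g_t$ with support contained in $\Omega$, the associated $\bar g^\top$-variation is $\bar g_t=g|_{\mathcal D\times\mathcal D}+\phi^\top_t\,g_t|_{\widetilde{\mathcal D}\times\widetilde{\mathcal D}}$, $\phi_t^\top=(\mathrm{Vol}(\Omega,g_t)/\mathrm{Vol}(\Omega,g))^{-2/n}$ with $n=\operatorname{rank}\widetilde{\mathcal D}=1$. $g$ is critical with respect to a class of variations if $\frac{d}{dt}J_{\tilde T,\Omega}(\bar g_t)|_{t=0}=0$ for all of them. *)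

theory Defs
  imports "HOL-Analysis.Analysis" "HOL-Combinatorics.Permutations"
begin

section \<open>Smooth maps between Euclidean spaces\<close>

text \<open>\<open>Ck k f S\<close> is meant for open \<open>S\<close> in a finite-dimensional space, where \<open>C\<^sup>k\<close> can be expressed by
  iterated directional derivatives.\<close>

primrec Ck :: "nat \<Rightarrow> ('a::euclidean_space \<Rightarrow> 'b::real_normed_vector) \<Rightarrow> 'a set \<Rightarrow> bool" where
  "Ck 0 f S \<longleftrightarrow> continuous_on S f"
| "Ck (Suc k) f S \<longleftrightarrow> (\<forall>x\<in>S. f differentiable (at x)) \<and>
     (\<forall>v. Ck k (\<lambda>x. frechet_derivative f (at x) v) S)"

definition smooth_on :: "'a::euclidean_space set \<Rightarrow> ('a \<Rightarrow> 'b::real_normed_vector) \<Rightarrow> bool" where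
  "smooth_on S f \<longleftrightarrow> (\<forall>k. Ck k f S)"


section \<open>Smooth manifolds, tangent vectors and vector fields\<close>

text \<open>A chart is a domain together with a coordinate map, whose values outside the domain are
  irrelevant. The manifold is the whole of a type \<open>'a\<close> of sort
  \<open>{t2_space, second_countable_topology}\<close>; its dimension is \<open>CARD('n)\<close>.\<close>

type_synonym ('a, 'n) chart = "'a set \<times> ('a \<Rightarrow> real ^ 'n)"

definition chart_inv :: "('a, 'n) chart \<Rightarrow> real ^ 'n \<Rightarrow> 'a" where
  "chart_inv c = inv_into (fst c) (snd c)"

definition is_chart :: "('a::topological_space, 'n::finite) chart \<Rightarrow> bool" where
  "is_chart c \<longleftrightarrow> open (fst c) \<and> open (snd c ` fst c) \<and>
     homeomorphism (fst c) (snd c ` fst c) (snd c) (chart_inv c)"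

definition smooth_atlas :: "('a::{t2_space, second_countable_topology}, 'n::finite) chart set \<Rightarrow> bool" where
  "smooth_atlas A \<longleftrightarrow> (\<forall>c\<in>A. is_chart c) \<and> (\<Union>c\<in>A. fst c) = UNIV \<and>
     (\<forall>c\<in>A. \<forall>d\<in>A. smooth_on (snd c ` (fst c \<inter> fst d)) (snd d \<circ> chart_inv c))"

text \<open>The tangent space at \<open>x\<close> is \<open>real ^ 'n\<close>: the vector \<open>v\<close> stands for
  \<open>\<Sum>i. v $ i *\<^sub>R \<partial>/\<partial>\<kappa>\<^sub>i\<close>, where \<open>\<kappa>\<close> is the coordinate map of the preferred chart \<open>chart_at A x\<close>.
  Components in another chart are obtained by differentiating the change of charts.\<close>

definition chart_at :: "('a, 'n) chart set \<Rightarrow> 'a \<Rightarrow> ('a, 'n) chart" where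
  "chart_at A x = (SOME c. c \<in> A \<and> x \<in> fst c)"

definition components :: "('a, 'n::finite) chart set \<Rightarrow> ('a, 'n) chart \<Rightarrow> 'a \<Rightarrow> real ^ 'n \<Rightarrow> real ^ 'n" where
  "components A c x v =
     frechet_derivative (snd c \<circ> chart_inv (chart_at A x)) (at (snd (chart_at A x) x)) v"

definition coordinate_vector :: "('a, 'n::finite) chart set \<Rightarrow> ('a, 'n) chart \<Rightarrow> 'n \<Rightarrow> 'a \<Rightarrow> real ^ 'n" where
  "coordinate_vector A c i x =
     frechet_derivative (snd (chart_at A x) \<circ> chart_inv c) (at (snd c x)) (axis i 1)"

definition smooth_function_on :: "('a, 'n::finite) chart set \<Rightarrow> 'a set \<Rightarrow> ('a \<Rightarrow> real) \<Rightarrow> bool" where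
  "smooth_function_on A U f \<longleftrightarrow> (\<forall>c\<in>A. smooth_on (snd c ` (U \<inter> fst c)) (f \<circ> chart_inv c))"

definition local_rep :: "('a, 'n::finite) chart set \<Rightarrow> ('a, 'n) chart \<Rightarrow> ('a \<Rightarrow> real ^ 'n) \<Rightarrow> real ^ 'n \<Rightarrow> real ^ 'n" where
  "local_rep A c X z = components A c (chart_inv c z) (X (chart_inv c z))"

definition smooth_field_on :: "('a, 'n::finite) chart set \<Rightarrow> 'a set \<Rightarrow> ('a \<Rightarrow> real ^ 'n) \<Rightarrow> bool" where
  "smooth_field_on A U X \<longleftrightarrow> (\<forall>c\<in>A. smooth_on (snd c ` (U \<inter> fst c)) (local_rep A c X))"

text \<open>The derivative \<open>X f\<close> of a function along a vector field, and the Lie bracket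
  \<open>[X,Y]\<^sup>i = X(Y\<^sup>i) - Y(X\<^sup>i)\<close>. At \<open>x\<close> both are computed in the preferred chart of \<open>x\<close>, where
  the components of a tangent vector at \<open>x\<close> are the vector itself.\<close>

definition field_deriv :: "('a, 'n::finite) chart set \<Rightarrow> ('a \<Rightarrow> real ^ 'n) \<Rightarrow> ('a \<Rightarrow> real) \<Rightarrow> 'a \<Rightarrow> real" where
  "field_deriv A X f x =
     frechet_derivative (f \<circ> chart_inv (chart_at A x)) (at (snd (chart_at A x) x)) (X x)"

definition lie_bracket :: "('a, 'n::finite) chart set \<Rightarrow> ('a \<Rightarrow> real ^ 'n) \<Rightarrow> ('a \<Rightarrow> real ^ 'n) \<Rightarrow> 'a \<Rightarrow> real ^ 'n" where
  "lie_bracket A X Y x = (let c = chart_at A x; z = snd c x in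
     frechet_derivative (local_rep A c Y) (at z) (X x) - frechet_derivative (local_rep A c X) (at z) (Y x))"


section \<open>Tensor fields\<close>

text \<open>Smoothness of a tensor field is tested on all smooth vector fields on open sets.\<close>

type_synonym ('a, 'n) one_form = "'a \<Rightarrow> real ^ 'n \<Rightarrow> real"
type_synonym ('a, 'n) endo_field = "'a \<Rightarrow> real ^ 'n \<Rightarrow> real ^ 'n"
type_synonym ('a, 'n) two_tensor = "'a \<Rightarrow> real ^ 'n \<Rightarrow> real ^ 'n \<Rightarrow> real"
type_synonym ('a, 'n) distribution = "'a \<Rightarrow> (real ^ 'n) set"

definition smooth_one_form ::
  "('a::{t2_space, second_countable_topology}, 'n::finite) chart set \<Rightarrow> ('a, 'n) one_form \<Rightarrow> bool" where
  "smooth_one_form A \<eta> \<longleftrightarrow> (\<forall>x. linear (\<eta> x)) \<and>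
     (\<forall>U X. open U \<longrightarrow> smooth_field_on A U X \<longrightarrow> smooth_function_on A U (\<lambda>x. \<eta> x (X x)))"

definition smooth_endo_field ::
  "('a::{t2_space, second_countable_topology}, 'n::finite) chart set \<Rightarrow> ('a, 'n) endo_field \<Rightarrow> bool" where
  "smooth_endo_field A \<phi> \<longleftrightarrow> (\<forall>x. linear (\<phi> x)) \<and>
     (\<forall>U X. open U \<longrightarrow> smooth_field_on A U X \<longrightarrow> smooth_field_on A U (\<lambda>x. \<phi> x (X x)))"

definition riemannian_metric ::
  "('a::{t2_space, second_countable_topology}, 'n::finite) chart set \<Rightarrow> ('a, 'n) two_tensor \<Rightarrow> bool" where
  "riemannian_metric A g \<longleftrightarrow>
     (\<forall>x. bilinear (g x) \<and> (\<forall>u v. g x u v = g x v u) \<and> (\<forall>u. u \<noteq> 0 \<longrightarrow> g x u u > 0)) \<and>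
     (\<forall>U X Y. open U \<longrightarrow> smooth_field_on A U X \<longrightarrow> smooth_field_on A U Y \<longrightarrow>
        smooth_function_on A U (\<lambda>x. g x (X x) (Y x)))"

definition ext_deriv ::
  "('a, 'n::finite) chart set \<Rightarrow> ('a, 'n) one_form \<Rightarrow> ('a \<Rightarrow> real ^ 'n) \<Rightarrow> ('a \<Rightarrow> real ^ 'n) \<Rightarrow> 'a \<Rightarrow> real" where
  "ext_deriv A \<eta> X Y x = 1/2 * (field_deriv A X (\<lambda>y. \<eta> y (Y y)) x
     - field_deriv A Y (\<lambda>y. \<eta> y (X y)) x - \<eta> x (lie_bracket A X Y x))"


section \<open>Contact metric structures\<close>

text \<open>The value of \<open>\<eta> \<and> (d\<eta>)\<^sup>m\<close> on \<open>V 0, \<dots>, V (2 * m)\<close>, up to a positive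
  normalisation constant depending only on \<open>m\<close>.\<close>

definition contact_volume ::
  "('a, 'n::finite) chart set \<Rightarrow> nat \<Rightarrow> ('a, 'n) one_form \<Rightarrow> (nat \<Rightarrow> 'a \<Rightarrow> real ^ 'n) \<Rightarrow> 'a \<Rightarrow> real" where
  "contact_volume A m \<eta> V x =
     (\<Sum>p | p permutes {..2 * m}. of_int (sign p) * \<eta> x (V (p 0) x) *
        (\<Prod>k<m. ext_deriv A \<eta> (V (p (2 * k + 1))) (V (p (2 * k + 2))) x))"

definition contact_form ::
  "('a::{t2_space, second_countable_topology}, 'n::finite) chart set \<Rightarrow> nat \<Rightarrow> ('a, 'n) one_form \<Rightarrow> bool" where
  "contact_form A m \<eta> \<longleftrightarrow> CARD('n) = 2 * m + 1 \<and> smooth_one_form A \<eta> \<and>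
     (\<forall>x. \<exists>U V. open U \<and> x \<in> U \<and> (\<forall>i\<le>2 * m. smooth_field_on A U (V i)) \<and> contact_volume A m \<eta> V x \<noteq> 0)"

definition reeb_field ::
  "('a::{t2_space, second_countable_topology}, 'n::finite) chart set \<Rightarrow> ('a, 'n) one_form \<Rightarrow> ('a \<Rightarrow> real ^ 'n) \<Rightarrow> bool" where
  "reeb_field A \<eta> \<xi> \<longleftrightarrow> smooth_field_on A UNIV \<xi> \<and> (\<forall>x. \<eta> x (\<xi> x) = 1) \<and>
     (\<forall>U X. open U \<longrightarrow> smooth_field_on A U X \<longrightarrow> (\<forall>x\<in>U. ext_deriv A \<eta> \<xi> X x = 0))"

definition contact_metric_structure ::
  "('a::{t2_space, second_countable_topology}, 'n::finite) chart set \<Rightarrow> nat \<Rightarrow>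
   ('a, 'n) endo_field \<Rightarrow> ('a \<Rightarrow> real ^ 'n) \<Rightarrow> ('a, 'n) one_form \<Rightarrow> ('a, 'n) two_tensor \<Rightarrow> bool" where
  "contact_metric_structure A m \<phi> \<xi> \<eta> g \<longleftrightarrow>
     contact_form A m \<eta> \<and> reeb_field A \<eta> \<xi> \<and> smooth_endo_field A \<phi> \<and> riemannian_metric A g \<and>
     (\<forall>x v. \<eta> x v = g x (\<xi> x) v) \<and>
     (\<forall>U X Y. open U \<longrightarrow> smooth_field_on A U X \<longrightarrow> smooth_field_on A U Y \<longrightarrow>
        (\<forall>x\<in>U. ext_deriv A \<eta> X Y x = g x (X x) (\<phi> x (Y x)))) \<and>
     (\<forall>x v. \<phi> x (\<phi> x v) = - v + \<eta> x v *\<^sub>R \<xi> x)"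


section \<open>The integrability tensor\<close>

text \<open>In this section \<open>E\<close> plays the role of \<open>\<D>\<close> with a tilde; \<open>perp E g\<close> is its
  \<open>g\<close>-orthogonal complement, and \<open>tang\<close> and \<open>norl\<close> are the two \<open>g\<close>-orthogonal projections.\<close>

definition perp :: "('a, 'n::finite) distribution \<Rightarrow> ('a, 'n) two_tensor \<Rightarrow> ('a, 'n) distribution" where
  "perp E g x = {v. \<forall>u\<in>E x. g x u v = 0}"

definition tang :: "('a, 'n::finite) distribution \<Rightarrow> ('a, 'n) two_tensor \<Rightarrow> ('a, 'n) endo_field" where
  "tang E g x v = (THE w. w \<in> E x \<and> v - w \<in> perp E g x)"

definition norl :: "('a, 'n::finite) distribution \<Rightarrow> ('a, 'n) two_tensor \<Rightarrow> ('a, 'n) endo_field" where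
  "norl E g x v = v - tang E g x v"

definition integrability_tensor ::
  "('a, 'n::finite) chart set \<Rightarrow> ('a, 'n) distribution \<Rightarrow> ('a, 'n) two_tensor \<Rightarrow>
   ('a \<Rightarrow> real ^ 'n) \<Rightarrow> ('a \<Rightarrow> real ^ 'n) \<Rightarrow> 'a \<Rightarrow> real ^ 'n" where
  "integrability_tensor A E g X Y x = (1/2) *\<^sub>R tang E g x (lie_bracket A X Y x)"

definition local_orthonormal_frame ::
  "('a::{t2_space, second_countable_topology}, 'n::finite) chart set \<Rightarrow> ('a, 'n) two_tensor \<Rightarrow>
   ('a, 'n) distribution \<Rightarrow> 'a set \<Rightarrow> nat \<Rightarrow> (nat \<Rightarrow> 'a \<Rightarrow> real ^ 'n) \<Rightarrow> bool" where
  "local_orthonormal_frame A g D U q F \<longleftrightarrow> open U \<and> (\<forall>i<q. smooth_field_on A U (F i)) \<and>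
     (\<forall>y\<in>U. span ((\<lambda>i. F i y) ` {..<q}) = D y \<and>
        (\<forall>i<q. \<forall>j<q. \<bar>g y (F i y) (F j y)\<bar> = (if i = j then 1 else 0)))"

text \<open>The value at \<open>x\<close> of \<open>\<langle>T, T\<rangle>\<close>, where \<open>T\<close> is the integrability tensor; it does not
  depend on the frame.\<close>

definition integrability_normsq ::
  "('a::{t2_space, second_countable_topology}, 'n::finite) chart set \<Rightarrow> ('a, 'n) distribution \<Rightarrow>
   ('a, 'n) two_tensor \<Rightarrow> 'a \<Rightarrow> real" where
  "integrability_normsq A E g x =
     (SOME s. \<exists>U q F. x \<in> U \<and> local_orthonormal_frame A g (perp E g) U q F \<and>
        s = (\<Sum>i<q. \<Sum>j<q. g x (F i x) (F i x) * g x (F j x) (F j x) *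
               g x (integrability_tensor A E g (F i) (F j) x) (integrability_tensor A E g (F i) (F j) x)))"


section \<open>Riemannian volume and the action\<close>

definition gram_det ::
  "('a, 'n::finite) chart set \<Rightarrow> ('a, 'n) two_tensor \<Rightarrow> ('a, 'n) chart \<Rightarrow> 'a \<Rightarrow> real" where
  "gram_det A g c x = det (\<chi> i j. g x (coordinate_vector A c i x) (coordinate_vector A c j x))"

text \<open>The Riemannian volume is the unique Borel measure having density \<open>sqrt (det (g\<^sub>i\<^sub>j))\<close> with
  respect to Lebesgue measure in every chart.\<close>

definition volume_measure ::
  "('a::{t2_space, second_countable_topology}, 'n::finite) chart set \<Rightarrow> ('a, 'n) two_tensor \<Rightarrow> 'a measure" where
  "volume_measure A g = (THE \<mu>. sets \<mu> = sets borel \<and>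
     (\<forall>c\<in>A. \<forall>B\<in>sets borel. B \<subseteq> fst c \<longrightarrow>
        emeasure \<mu> B = (\<integral>\<^sup>+z\<in>snd c ` B. ennreal (sqrt (gram_det A g c (chart_inv c z))) \<partial>lborel)))"

definition Vol ::
  "('a::{t2_space, second_countable_topology}, 'n::finite) chart set \<Rightarrow> 'a set \<Rightarrow> ('a, 'n) two_tensor \<Rightarrow> real" where
  "Vol A \<Omega> g = measure (volume_measure A g) \<Omega>"

definition action ::
  "('a::{t2_space, second_countable_topology}, 'n::finite) chart set \<Rightarrow> ('a, 'n) distribution \<Rightarrow> 'a set \<Rightarrow>
   ('a, 'n) two_tensor \<Rightarrow> real" where
  "action A E \<Omega> g = (LINT x:\<Omega>|volume_measure A g. integrability_normsq A E g x)"

definition relatively_compact_domain :: "'a::topological_space set \<Rightarrow> bool" where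
  "relatively_compact_domain \<Omega> \<longleftrightarrow> \<Omega> \<noteq> {} \<and> open \<Omega> \<and> connected \<Omega> \<and> compact (closure \<Omega>)"


section \<open>Variations of metrics and criticality\<close>

text \<open>Only the values \<open>G t\<close> with \<open>\<bar>t\<bar> < \<epsilon>\<close> matter. Smoothness is joint in \<open>t\<close> and the point.\<close>

definition metric_variation ::
  "('a::{t2_space, second_countable_topology}, 'n::finite) chart set \<Rightarrow> ('a, 'n) two_tensor \<Rightarrow> real \<Rightarrow>
   (real \<Rightarrow> ('a, 'n) two_tensor) \<Rightarrow> bool" where
  "metric_variation A g \<epsilon> G \<longleftrightarrow> \<epsilon> > 0 \<and> G 0 = g \<and> (\<forall>t. \<bar>t\<bar> < \<epsilon> \<longrightarrow> riemannian_metric A (G t)) \<and>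
     (\<forall>U X Y. open U \<longrightarrow> smooth_field_on A U X \<longrightarrow> smooth_field_on A U Y \<longrightarrow>
        (\<forall>c\<in>A. smooth_on ({-\<epsilon><..<\<epsilon>} \<times> snd c ` (U \<inter> fst c))
           (\<lambda>(t, z). G t (chart_inv c z) (X (chart_inv c z)) (Y (chart_inv c z)))))"

definition supported_in ::
  "('a::topological_space, 'n::finite) two_tensor \<Rightarrow> real \<Rightarrow> (real \<Rightarrow> ('a, 'n) two_tensor) \<Rightarrow> 'a set \<Rightarrow> bool" where
  "supported_in g \<epsilon> G \<Omega> \<longleftrightarrow> (\<forall>t. \<bar>t\<bar> < \<epsilon> \<longrightarrow> closure {x. G t x \<noteq> g x} \<subseteq> \<Omega>)"

definition perp_variation ::
  "('a::{t2_space, second_countable_topology}, 'n::finite) chart set \<Rightarrow> ('a, 'n) distribution \<Rightarrow>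
   ('a, 'n) two_tensor \<Rightarrow> real \<Rightarrow> (real \<Rightarrow> ('a, 'n) two_tensor) \<Rightarrow> bool" where
  "perp_variation A E g \<epsilon> G \<longleftrightarrow> metric_variation A g \<epsilon> G \<and>
     (\<forall>t x. \<bar>t\<bar> < \<epsilon> \<longrightarrow> (\<forall>u\<in>E x. \<forall>v\<in>E x. G t x u v = g x u v))"

definition top_variation ::
  "('a::{t2_space, second_countable_topology}, 'n::finite) chart set \<Rightarrow> ('a, 'n) distribution \<Rightarrow>
   ('a, 'n) two_tensor \<Rightarrow> real \<Rightarrow> (real \<Rightarrow> ('a, 'n) two_tensor) \<Rightarrow> bool" where
  "top_variation A E g \<epsilon> G \<longleftrightarrow> metric_variation A g \<epsilon> G \<and>
     (\<forall>t x. \<bar>t\<bar> < \<epsilon> \<longrightarrow> (\<forall>u\<in>perp E g x. \<forall>v\<in>perp E g x. G t x u v = g x u v) \<and>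
        (\<forall>u\<in>E x. \<forall>v\<in>perp E g x. G t x u v = 0))"

text \<open>The volume-normalised variations. For \<open>bar_perp\<close> the splitting of tangent vectors is the one
  orthogonal for \<open>G t\<close>, for \<open>bar_top\<close> the one orthogonal for \<open>g\<close>; \<open>p\<close> and \<open>n\<close> are the ranks of
  the complement of \<open>E\<close> and of \<open>E\<close>.\<close>

definition bar_perp ::
  "('a::{t2_space, second_countable_topology}, 'n::finite) chart set \<Rightarrow> ('a, 'n) distribution \<Rightarrow> nat \<Rightarrow> 'a set \<Rightarrow>
   ('a, 'n) two_tensor \<Rightarrow> (real \<Rightarrow> ('a, 'n) two_tensor) \<Rightarrow> real \<Rightarrow> ('a, 'n) two_tensor" where
  "bar_perp A E p \<Omega> g G t x u v =
     (Vol A \<Omega> (G t) / Vol A \<Omega> g) powr (- 2 / real p) * G t x (norl E (G t) x u) (norl E (G t) x v)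
     + g x (tang E (G t) x u) (tang E (G t) x v)"

definition bar_top ::
  "('a::{t2_space, second_countable_topology}, 'n::finite) chart set \<Rightarrow> ('a, 'n) distribution \<Rightarrow> nat \<Rightarrow> 'a set \<Rightarrow>
   ('a, 'n) two_tensor \<Rightarrow> (real \<Rightarrow> ('a, 'n) two_tensor) \<Rightarrow> real \<Rightarrow> ('a, 'n) two_tensor" where
  "bar_top A E n \<Omega> g G t x u v = g x (norl E g x u) (norl E g x v)
     + (Vol A \<Omega> (G t) / Vol A \<Omega> g) powr (- 2 / real n) * G t x (tang E g x u) (tang E g x v)"

definition critical_bar_perp ::
  "('a::{t2_space, second_countable_topology}, 'n::finite) chart set \<Rightarrow> ('a, 'n) distribution \<Rightarrow> nat \<Rightarrow> 'a set \<Rightarrow>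
   ('a, 'n) two_tensor \<Rightarrow> bool" where
  "critical_bar_perp A E p \<Omega> g \<longleftrightarrow>
     (\<forall>\<epsilon> G. perp_variation A E g \<epsilon> G \<longrightarrow> supported_in g \<epsilon> G \<Omega> \<longrightarrow>
        ((\<lambda>t. action A E \<Omega> (bar_perp A E p \<Omega> g G t)) has_real_derivative 0) (at 0))"

definition critical_bar_top ::
  "('a::{t2_space, second_countable_topology}, 'n::finite) chart set \<Rightarrow> ('a, 'n) distribution \<Rightarrow> nat \<Rightarrow> 'a set \<Rightarrow>
   ('a, 'n) two_tensor \<Rightarrow> bool" where
  "critical_bar_top A E n \<Omega> g \<longleftrightarrow>
     (\<forall>\<epsilon> G. top_variation A E g \<epsilon> G \<longrightarrow> supported_in g \<epsilon> G \<Omega> \<longrightarrow>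
        ((\<lambda>t. action A E \<Omega> (bar_top A E n \<Omega> g G t)) has_real_derivative 0) (at 0))"

end

(* Near a point let P be the inverse metric on the orthogonal complement of xi, omega = d(g(xi,.)) and
kappa = g(xi,xi).  Then <T~,T~> = - tr(P omega P omega) / (4 kappa), which involves only first derivatives
of the one-form dual to xi.

For a g^perp-variation put v = Vol(g_t) / Vol(g).  The action of the normalised metric is v^(4/p - 1) times
the integral of f_t dvol_(g_t), where f_t is the squared norm for g_t, and f_0 = p.  So its derivative at 0
is the integral of (f_t' + 4 rho_t') for the volume density rho_t relative to g.  With beta = h(xi,.),
h = dg_t/dt, the integrand is the contraction of d beta with the bivector dual to d eta.  It equals
4 div W for W = 1/2 phi (g^-1 beta): the form N = d eta + eta (x) eta satisfies
L_W N = 1/2 d beta + beta (x) eta + eta (x) beta and (det N)^2 = (det g)^2, hence the trace of N^-1 L_W N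
computes the divergence.  Since beta vanishes outside Omega, the integral is 0.

A g^top-variation has the form g + (u_t - 1) eta (x) eta.  Both f and the volume scale by powers of u_t, and
the normalised action is p Vol_t^(-3) times the integral of u_t^(3/2), up to a constant factor, where
Vol_t is the integral of u_t^(1/2).  The two contributions to its derivative at 0 cancel. *)

theory Submission
  imports Defs
begin

section \<open>Calculus of \<open>C\<^sup>k\<close> maps\<close>

text \<open>The coefficient 4 comes from the weight v^(4/p - 1): its derivative against f_0 = p
  contributes (4 - p) rho_t', and the product rule for f_t dvol contributes f_t' + p rho_t'. The
  condition h(xi,xi) = 0 makes the trace of h cancel between f_t' and 4 rho_t', so that only d beta
  survives. The field W is chosen so that, up to normalisation, its contraction with d eta is beta
  while eta(W) = 0. Cartan's formula then expresses L_W eta and L_W d eta by beta and d beta alone.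
  This is the reason for measuring volume by N: no derivative of phi or of g has to be known
  separately, and the only second-order fact about eta is that d eta is closed. Two definitions
  shape the rest. The squared norm is read off from an arbitrarily chosen frame and the volume is a
  definite description, so local frames and the volume measure have to be constructed before
  anything can be differentiated. The integral of the divergence is reduced to charts by bump
  functions that are only C^1, so one-forms are kept at that regularity.\<close>

abbreviation dd :: "('a::real_normed_vector \<Rightarrow> 'b::real_normed_vector) \<Rightarrow> 'a \<Rightarrow> 'a \<Rightarrow> 'b" where
  "dd f v x \<equiv> frechet_derivative f (at x) v"

lemma frechet_derivative_cong_open:
  assumes "open S" "x \<in> S" "\<And>y. y \<in> S \<Longrightarrow> f y = g y"
  shows "frechet_derivative f (at x) = frechet_derivative g (at x)"
proof -
  have "(f has_derivative f') (at x) \<longleftrightarrow> (g has_derivative f') (at x)" for f'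
    using has_derivative_transform_within_open[of f f' x UNIV S g]
      has_derivative_transform_within_open[of g f' x UNIV S f] assms by metis
  then show ?thesis by (simp add: frechet_derivative_def)
qed

lemma Ck_cong:
  assumes "open S" "\<And>x. x \<in> S \<Longrightarrow> f x = g x" "Ck k f S"
  shows "Ck k g S"
  using assms(2,3)
proof (induction k arbitrary: f g)
  case 0
  then show ?case using continuous_on_cong by (metis Ck.simps(1))
next
  case (Suc k)
  have d: "frechet_derivative f (at x) = frechet_derivative g (at x)" if "x \<in> S" for x
    by (rule frechet_derivative_cong_open[OF assms(1) that]) (simp add: Suc.prems)
  have "g differentiable (at x)" if "x \<in> S" for x
  proof -
    have "(f has_derivative frechet_derivative f (at x)) (at x)"
      using Suc.prems(2) that by (auto simp: frechet_derivative_works)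
    then have "(g has_derivative frechet_derivative f (at x)) (at x)"
      by (rule has_derivative_transform_within_open[OF _ assms(1) that]) (simp add: Suc.prems)
    then show ?thesis by (auto simp: differentiable_def)
  qed
  moreover have "Ck k (dd g v) S" for v
    by (rule Suc.IH[of "dd f v"]) (use d Suc.prems in auto)
  ultimately show ?case by simp
qed

lemma Ck_subset: "Ck k f S \<Longrightarrow> T \<subseteq> S \<Longrightarrow> Ck k f T"
  by (induction k arbitrary: f) (auto intro: continuous_on_subset)

lemma Ck_SucD: "Ck (Suc k) f S \<Longrightarrow> Ck k f S"
proof (induction k arbitrary: f)
  case 0
  then show ?case
    by (auto intro!: continuous_at_imp_continuous_on differentiable_imp_continuous_within)
qed auto

lemma Ck_le: "Ck k f S \<Longrightarrow> j \<le> k \<Longrightarrow> Ck j f S"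
  by (induction k) (auto simp: le_Suc_eq simp del: Ck.simps(2) dest: Ck_SucD)

lemma Ck_continuous_on: "Ck k f S \<Longrightarrow> continuous_on S f"
  using Ck_le[of k f S 0] by simp

lemma Ck_has_derivative:
  "Ck (Suc k) f S \<Longrightarrow> x \<in> S \<Longrightarrow> (f has_derivative frechet_derivative f (at x)) (at x)"
  by (auto simp: frechet_derivative_works)

lemma Ck_dd: "Ck (Suc k) f S \<Longrightarrow> Ck k (dd f v) S"
  by simp

lemma dd_eq: "(f has_derivative f') (at x) \<Longrightarrow> dd f v x = f' v"
  by (metis frechet_derivative_at)

lemma Ck_SucI:
  assumes "open S" "\<And>x. x \<in> S \<Longrightarrow> (f has_derivative f' x) (at x)" "\<And>v. Ck k (\<lambda>x. f' x v) S"
  shows "Ck (Suc k) f S"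
proof -
  have "Ck k (dd f v) S" for v
    by (rule Ck_cong[OF assms(1) _ assms(3)[of v]]) (simp add: dd_eq[OF assms(2)])
  then show ?thesis using assms(2) by (auto simp: differentiable_def)
qed

lemma Ck_local:
  assumes "\<And>x. x \<in> S \<Longrightarrow> \<exists>T. open T \<and> x \<in> T \<and> Ck k f T"
  shows "Ck k f S"
  using assms
proof (induction k arbitrary: f)
  case 0
  show ?case
    unfolding Ck.simps
  proof (intro continuous_at_imp_continuous_on ballI)
    fix x assume "x \<in> S"
    then obtain T where "open T" "x \<in> T" "continuous_on T f" using 0 by auto
    then show "isCont f x" by (simp add: continuous_on_eq_continuous_at)
  qed
next
  case (Suc k)
  have "f differentiable (at x)" if "x \<in> S" for x using Suc.prems[OF that] unfolding Ck.simps by blast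
  moreover have "Ck k (dd f v) S" for v
  proof (rule Suc.IH)
    fix x assume "x \<in> S"
    then obtain T where "open T" "x \<in> T" "Ck (Suc k) f T" using Suc.prems by blast
    then show "\<exists>T. open T \<and> x \<in> T \<and> Ck k (dd f v) T" by auto
  qed
  ultimately show ?case by simp
qed

section \<open>Closure of C^k maps under algebraic operations and composition\<close>

lemma Ck_const [simp]: "Ck k (\<lambda>x. c) S"
proof (induction k arbitrary: c)
  case (Suc k)
  have "dd (\<lambda>x. c) v = (\<lambda>x. 0)" for v
    by (simp add: fun_eq_iff dd_eq[OF has_derivative_const])
  then show ?case using Suc by auto
qed simp

lemma Ck_linear:
  assumes "bounded_linear h" "Ck k f S" "open S"
  shows "Ck k (\<lambda>x. h (f x)) S"
  using assms(2)
proof (induction k arbitrary: f)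
  case 0
  then show ?case using assms(1) by (auto intro: bounded_linear.continuous_on)
next
  case (Suc k)
  show ?case
    by (rule Ck_SucI[OF assms(3)])
      (use Suc in \<open>auto intro!: bounded_linear.has_derivative[OF assms(1)] Ck_has_derivative simp del: Ck.simps intro: Ck_dd\<close>)
qed

lemma Ck_id: "open S \<Longrightarrow> Ck k (\<lambda>x. x) S"
  by (cases k) (auto intro!: Ck_SucI derivative_intros)

lemma Ck_bounded_linear: "bounded_linear h \<Longrightarrow> open S \<Longrightarrow> Ck k h S"
  using Ck_linear[OF _ Ck_id] by blast

lemma Ck_add:
  assumes "Ck k f S" "Ck k g S" "open S"
  shows "Ck k (\<lambda>x. f x + g x) S"
  using assms(1,2)
proof (induction k arbitrary: f g)
  case 0
  then show ?case by (auto intro: continuous_intros)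
next
  case (Suc k)
  show ?case
    by (rule Ck_SucI[OF assms(3)])
      (use Suc in \<open>auto intro!: has_derivative_add Ck_has_derivative simp del: Ck.simps intro: Ck_dd\<close>)
qed

lemma Ck_bilinear:
  assumes h: "bounded_bilinear h" and "Ck k f S" "Ck k g S" "open S"
  shows "Ck k (\<lambda>x. h (f x) (g x)) S"
  using assms(2,3)
proof (induction k arbitrary: f g)
  case 0
  then show ?case using h by (auto intro: bounded_bilinear.continuous_on)
next
  case (Suc k)
  show ?case
  proof (rule Ck_SucI[OF assms(4)])
    show "((\<lambda>x. h (f x) (g x)) has_derivative (\<lambda>v. h (f x) (dd g v x) + h (dd f v x) (g x))) (at x)"
      if "x \<in> S" for x
      by (intro bounded_bilinear.FDERIV[OF h] Ck_has_derivative[OF Suc.prems(1) that]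
          Ck_has_derivative[OF Suc.prems(2) that])
    show "Ck k (\<lambda>x. h (f x) (dd g v x) + h (dd f v x) (g x)) S" for v
      by (intro Ck_add Suc.IH assms(4) Ck_dd Suc.prems Suc.prems[THEN Ck_SucD])
  qed
qed

lemmas Ck_scaleR = Ck_bilinear[OF bounded_bilinear_scaleR]
lemmas Ck_mult = Ck_bilinear[OF bounded_bilinear_mult]
lemmas Ck_inner = Ck_bilinear[OF bounded_bilinear_inner]

lemma Ck_minus: "Ck k f S \<Longrightarrow> open S \<Longrightarrow> Ck k (\<lambda>x. - f x) S"
  using Ck_linear[of uminus] bounded_linear_minus[OF bounded_linear_ident] by auto

lemma Ck_diff: "Ck k f S \<Longrightarrow> Ck k g S \<Longrightarrow> open S \<Longrightarrow> Ck k (\<lambda>x. f x - g x) S"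
  using Ck_add[of k f S "\<lambda>x. - g x"] Ck_minus[of k g S] by simp

lemma Ck_sum: "(\<And>i. i \<in> I \<Longrightarrow> Ck k (f i) S) \<Longrightarrow> open S \<Longrightarrow> Ck k (\<lambda>x. \<Sum>i\<in>I. f i x) S"
  by (induction I rule: infinite_finite_induct) (auto intro: Ck_add)

lemma Ck_prod:
  fixes f :: "'i \<Rightarrow> 'a::euclidean_space \<Rightarrow> real"
  shows "(\<And>i. i \<in> I \<Longrightarrow> Ck k (f i) S) \<Longrightarrow> open S \<Longrightarrow> Ck k (\<lambda>x. \<Prod>i\<in>I. f i x) S"
  by (induction I rule: infinite_finite_induct) (auto intro: Ck_mult)

lemma Ck_compose:
  fixes f :: "'a::euclidean_space \<Rightarrow> 'b::euclidean_space"
  assumes "Ck k g T" "Ck k f S" "f ` S \<subseteq> T" "open S"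
  shows "Ck k (\<lambda>x. g (f x)) S"
  using assms(1,2)
proof (induction k arbitrary: g)
  case 0
  then show ?case using assms(3) by (auto intro: continuous_on_compose2)
next
  case (Suc k)
  have lin: "linear (frechet_derivative g (at (f x)))" if "x \<in> S" for x
    using Ck_has_derivative[OF Suc.prems(1)] assms(3) that has_derivative_linear by blast
  have "Ck k (\<lambda>x. frechet_derivative g (at (f x)) (frechet_derivative f (at x) v)) S" for v
  proof (rule Ck_cong[OF assms(4)])
    \<comment> \<open>In the chain rule the direction of the outer derivative varies with the point,
      whereas \<open>Ck\<close> speaks of fixed directions. Expanding that direction in
      \<open>Basis\<close> leaves products of maps to which the induction hypothesis
      applies.\<close>
    show "Ck k (\<lambda>x. \<Sum>b\<in>Basis. (dd f v x \<bullet> b) *\<^sub>R dd g b (f x)) S"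
      by (intro Ck_sum Ck_scaleR Ck_inner Suc.IH Ck_dd Ck_const Suc.prems Ck_SucD[OF Suc.prems(2)] assms(4))
    show "(\<Sum>b\<in>Basis. (dd f v x \<bullet> b) *\<^sub>R dd g b (f x))
        = frechet_derivative g (at (f x)) (frechet_derivative f (at x) v)" if "x \<in> S" for x
      using lin[OF that]
      by (subst (5) euclidean_representation[symmetric]) (simp add: linear_sum linear_scale)
  qed
  moreover have "((\<lambda>x. g (f x)) has_derivative
      (\<lambda>v. frechet_derivative g (at (f x)) (frechet_derivative f (at x) v))) (at x)" if "x \<in> S" for x
    using has_derivative_compose[OF Ck_has_derivative[OF Suc.prems(2) that]
        Ck_has_derivative[OF Suc.prems(1)]] assms(3) that by blast
  ultimately show ?case by (intro Ck_SucI[OF assms(4)])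
qed

text \<open>The induction closes because the derivative of \<open>inverse\<close> is a polynomial in
  \<open>inverse\<close> itself.\<close>

lemma Ck_inverse_real: "Ck k inverse {x::real. x \<noteq> 0}"
proof (induction k)
  case 0
  then show ?case by (auto intro: continuous_intros)
next
  case (Suc k)
  have o: "open {x::real. x \<noteq> 0}" by (simp add: open_Collect_neq)
  have "(inverse has_derivative (\<lambda>h. - (inverse x * h * inverse x))) (at x)" if "x \<noteq> 0" for x :: real
    using has_derivative_inverse'[OF that] .
  then show ?case
    by (intro Ck_SucI[OF o]) (auto intro!: Ck_minus Ck_mult Suc o)
qed

lemma Ck_sqrt_real: "Ck k sqrt {x::real. x > 0}"
proof (induction k)
  case 0
  then show ?case by (auto intro: continuous_intros)
next
  case (Suc k)
  have o: "open {x::real. x > 0}" by (simp add: open_Collect_less)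
  have "(sqrt has_derivative (\<lambda>h. h * (inverse (sqrt x) / 2))) (at x)" if "x > 0" for x :: real
    using DERIV_real_sqrt[OF that] unfolding has_field_derivative_def
    by (rule has_derivative_eq_rhs) (simp add: fun_eq_iff)
  moreover have "Ck k (\<lambda>x. v * (inverse (sqrt x) / 2)) {x::real. x > 0}" for v
    unfolding divide_inverse by (intro Ck_mult Ck_compose[OF Ck_inverse_real Suc _ o] Ck_const o) auto
  ultimately show ?case by (intro Ck_SucI[OF o]) auto
qed

lemma Ck_inverse:
  fixes f :: "'a::euclidean_space \<Rightarrow> real"
  assumes "Ck k f S" "\<And>x. x \<in> S \<Longrightarrow> f x \<noteq> 0" "open S"
  shows "Ck k (\<lambda>x. inverse (f x)) S"
  by (rule Ck_compose[OF Ck_inverse_real assms(1) _ assms(3)]) (use assms(2) in auto)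

lemma Ck_divide:
  fixes f g :: "'a::euclidean_space \<Rightarrow> real"
  assumes "Ck k g S" "Ck k f S" "\<And>x. x \<in> S \<Longrightarrow> f x \<noteq> 0" "open S"
  shows "Ck k (\<lambda>x. g x / f x) S"
  unfolding divide_inverse by (intro Ck_mult Ck_inverse assms)

lemma Ck_sqrt:
  fixes f :: "'a::euclidean_space \<Rightarrow> real"
  assumes "Ck k f S" "\<And>x. x \<in> S \<Longrightarrow> f x > 0" "open S"
  shows "Ck k (\<lambda>x. sqrt (f x)) S"
  by (rule Ck_compose[OF Ck_sqrt_real assms(1) _ assms(3)]) (use assms(2) in auto)

lemma Ck_vec:
  fixes f :: "'a::euclidean_space \<Rightarrow> 'b::euclidean_space ^ 'n"
  assumes "\<And>i. Ck k (\<lambda>x. f x $ i) S" "open S"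
  shows "Ck k f S"
proof (rule Ck_cong[OF assms(2)])
  show "Ck k (\<lambda>x. \<Sum>i\<in>UNIV. axis i (f x $ i)) S"
  proof (intro Ck_sum assms(2))
    fix i
    have "linear (axis i :: 'b \<Rightarrow> 'b ^ 'n)"
      by (rule linearI) (auto simp: vec_eq_iff axis_def)
    then show "Ck k (\<lambda>x. axis i (f x $ i)) S"
      using Ck_linear[OF _ assms(1)[of i] assms(2)] linear_linear by blast
  qed
  show "(\<Sum>i\<in>UNIV. axis i (f x $ i)) = f x" for x
    by (simp add: vec_eq_iff axis_def if_distrib[of "\<lambda>v. v $ _"] cong: if_cong)
qed

lemma Ck_vec_nth:
  fixes f :: "'a::euclidean_space \<Rightarrow> 'b::euclidean_space ^ 'n"
  shows "Ck k f S \<Longrightarrow> open S \<Longrightarrow> Ck k (\<lambda>x. f x $ i) S"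
  by (rule Ck_linear[OF bounded_linear_vec_nth])

lemma Ck_Pair:
  assumes "Ck k f S" "Ck k g S" "open S"
  shows "Ck k (\<lambda>x. (f x, g x)) S"
proof -
  have "bounded_linear (\<lambda>x::'b. (x, 0::'c))" "bounded_linear (\<lambda>x::'c. (0::'b, x))"
    by (auto intro!: bounded_linear_Pair bounded_linear_ident bounded_linear_zero)
  then have "Ck k (\<lambda>x. (f x, 0::'c) + (0::'b, g x)) S"
    using assms by (intro Ck_add Ck_linear[of "\<lambda>x. (x, 0)"] Ck_linear[of "\<lambda>x. (0, x)"]) auto
  then show ?thesis by simp
qed

section \<open>Symmetry of second derivatives\<close>

lemma second_difference:
  fixes f :: "'a::euclidean_space \<Rightarrow> real"
  assumes C: "Ck (Suc (Suc 0)) f S" and "h > 0"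
    and S: "\<And>s t. \<lbrakk>0 \<le> s; s \<le> h; 0 \<le> t; t \<le> h\<rbrakk> \<Longrightarrow> x + s *\<^sub>R u + t *\<^sub>R v \<in> S"
  shows "\<exists>s t. 0 \<le> s \<and> s \<le> h \<and> 0 \<le> t \<and> t \<le> h \<and>
    f (x + h *\<^sub>R u + h *\<^sub>R v) - f (x + h *\<^sub>R u) - f (x + h *\<^sub>R v) + f x
      = h * h * dd (dd f u) v (x + s *\<^sub>R u + t *\<^sub>R v)"
proof -
  have D: "((\<lambda>s. F (y + s *\<^sub>R w)) has_real_derivative dd F w (y + s *\<^sub>R w)) (at s)"
    if "Ck (Suc k) F S" "y + s *\<^sub>R w \<in> S" for F :: "'a \<Rightarrow> real" and k y s w
  proof -
    have "((\<lambda>s. y + s *\<^sub>R w) has_derivative (\<lambda>r. r *\<^sub>R w)) (at s)"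
      by (auto intro!: derivative_eq_intros)
    from has_derivative_compose[OF this Ck_has_derivative[OF that]]
    have "((\<lambda>s. F (y + s *\<^sub>R w)) has_derivative (\<lambda>r. dd F (r *\<^sub>R w) (y + s *\<^sub>R w))) (at s)" .
    moreover have "linear (frechet_derivative F (at (y + s *\<^sub>R w)))"
      using Ck_has_derivative[OF that] has_derivative_linear by blast
    then have "(\<lambda>r. dd F (r *\<^sub>R w) (y + s *\<^sub>R w)) = (*) (dd F w (y + s *\<^sub>R w))"
      by (auto simp: linear_scale)
    ultimately show ?thesis by (simp add: has_field_derivative_def)
  qed
  \<comment> \<open>\<open>F h - F 0\<close> is the second difference. The mean value theorem along
    \<open>u\<close> turns it into a first difference of \<open>dd f u\<close> in the direction
    \<open>v\<close>, to which the theorem is applied again.\<close>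
  define F where "F s = f ((x + h *\<^sub>R v) + s *\<^sub>R u) - f (x + s *\<^sub>R u)" for s
  have "\<exists>s>0. s < h \<and> F h - F 0 = (h - 0) * (dd f u ((x + h *\<^sub>R v) + s *\<^sub>R u) - dd f u (x + s *\<^sub>R u))"
    unfolding F_def
    by (rule MVT2[OF \<open>h > 0\<close>])
      (intro derivative_intros D[OF C]; use S[of _ h] S[of _ 0] \<open>h > 0\<close> in \<open>force simp: algebra_simps\<close>)
  then obtain s where s: "0 < s" "s < h"
    "F h - F 0 = h * (dd f u ((x + h *\<^sub>R v) + s *\<^sub>R u) - dd f u (x + s *\<^sub>R u))" by auto
  have "\<exists>t>0. t < h \<and> dd f u ((x + s *\<^sub>R u) + h *\<^sub>R v) - dd f u ((x + s *\<^sub>R u) + 0 *\<^sub>R v)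
      = (h - 0) * dd (dd f u) v ((x + s *\<^sub>R u) + t *\<^sub>R v)"
    by (rule MVT2[OF \<open>h > 0\<close>], rule D[OF Ck_dd[OF C]]) (use S[of s] s in auto)
  then obtain t where t: "0 < t" "t < h"
    "dd f u ((x + s *\<^sub>R u) + h *\<^sub>R v) - dd f u (x + s *\<^sub>R u) = h * dd (dd f u) v ((x + s *\<^sub>R u) + t *\<^sub>R v)"
    by auto
  have "F h - F 0 = h * h * dd (dd f u) v (x + s *\<^sub>R u + t *\<^sub>R v)"
    using s(3) t(3) by (simp add: algebra_simps)
  then show ?thesis using s t unfolding F_def
    by (intro exI[of _ s] exI[of _ t]) (simp add: algebra_simps)
qed

text \<open>The second difference is symmetric in \<open>u\<close> and \<open>v\<close>. Divided by
  \<open>h * h\<close> it is a value of either mixed derivative at a point close to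
  \<open>x\<close>, so by continuity the two cannot differ at \<open>x\<close>.\<close>

lemma dd_commute_real:
  fixes f :: "'a::euclidean_space \<Rightarrow> real"
  assumes C: "Ck (Suc (Suc 0)) f S" and S: "open S" "x \<in> S"
  shows "dd (dd f u) v x = dd (dd f v) u x"
proof (rule ccontr)
  assume ne: "\<not> ?thesis"
  define e where "e = \<bar>dd (dd f u) v x - dd (dd f v) u x\<bar> / 2"
  have "e > 0" using ne by (simp add: e_def)
  have c: "continuous_on S (dd (dd f u) v)" "continuous_on S (dd (dd f v) u)" using C by auto
  obtain d1 where d1: "d1 > 0" "\<And>y. dist y x < d1 \<Longrightarrow> dist (dd (dd f u) v y) (dd (dd f u) v x) < e"
    using c(1) S \<open>e > 0\<close> unfolding continuous_on_eq_continuous_at[OF S(1)] continuous_at_eps_delta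
    by (metis dist_commute dist_norm)
  obtain d2 where d2: "d2 > 0" "\<And>y. dist y x < d2 \<Longrightarrow> dist (dd (dd f v) u y) (dd (dd f v) u x) < e"
    using c(2) S \<open>e > 0\<close> unfolding continuous_on_eq_continuous_at[OF S(1)] continuous_at_eps_delta
    by (metis dist_commute dist_norm)
  obtain d3 where d3: "d3 > 0" "ball x d3 \<subseteq> S" using S open_contains_ball by blast
  define d where "d = min d1 (min d2 d3)"
  \<comment> \<open>With this size every point of the parallelogram spanned by \<open>h\<close>
    times \<open>u\<close> and \<open>v\<close> is within \<open>d / 2\<close> of \<open>x\<close>;
    the added 1 keeps the denominator positive.\<close>
  define h where "h = d / (2 * (norm u + norm v + 1))"
  have pos: "norm u + norm v + 1 > 0" by (simp add: add_nonneg_pos)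
  have "d > 0" using d1 d2 d3 by (simp add: d_def)
  then have "h > 0" using pos by (simp add: h_def)
  have near: "dist (x + s *\<^sub>R u + t *\<^sub>R v) x < d" if "0 \<le> s" "s \<le> h" "0 \<le> t" "t \<le> h" for s t
  proof -
    have "dist (x + s *\<^sub>R u + t *\<^sub>R v) x \<le> norm (s *\<^sub>R u) + norm (t *\<^sub>R v)"
      by (simp add: dist_norm add.assoc norm_triangle_ineq del: norm_scaleR)
    also have "\<dots> \<le> h * norm u + h * norm v"
      using that by (auto intro!: add_mono mult_right_mono)
    also have "\<dots> \<le> h * (norm u + norm v + 1)" using \<open>h > 0\<close> by (simp add: algebra_simps)
    also have "\<dots> = d / 2" using pos by (simp add: h_def divide_simps)
    finally show ?thesis using \<open>d > 0\<close> by linarith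
  qed
  have in1: "x + s *\<^sub>R u + t *\<^sub>R v \<in> S" if "0 \<le> s" "s \<le> h" "0 \<le> t" "t \<le> h" for s t
    using near[OF that] d3 by (auto simp: d_def dist_commute)
  then have in2: "x + s *\<^sub>R v + t *\<^sub>R u \<in> S" if "0 \<le> s" "s \<le> h" "0 \<le> t" "t \<le> h" for s t
    using in1[of t s] that by (simp add: add_ac)
  obtain s t where st: "0 \<le> s" "s \<le> h" "0 \<le> t" "t \<le> h"
    "f (x + h *\<^sub>R u + h *\<^sub>R v) - f (x + h *\<^sub>R u) - f (x + h *\<^sub>R v) + f x
      = h * h * dd (dd f u) v (x + s *\<^sub>R u + t *\<^sub>R v)"
    using second_difference[OF C \<open>h > 0\<close> in1] by blast
  obtain s' t' where st': "0 \<le> s'" "s' \<le> h" "0 \<le> t'" "t' \<le> h"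
    "f (x + h *\<^sub>R v + h *\<^sub>R u) - f (x + h *\<^sub>R v) - f (x + h *\<^sub>R u) + f x
      = h * h * dd (dd f v) u (x + s' *\<^sub>R v + t' *\<^sub>R u)"
    using second_difference[OF C \<open>h > 0\<close> in2] by blast
  have "h * h * dd (dd f u) v (x + s *\<^sub>R u + t *\<^sub>R v) = h * h * dd (dd f v) u (x + s' *\<^sub>R v + t' *\<^sub>R u)"
    using st(5) st'(5) by (simp add: algebra_simps)
  then have "dd (dd f u) v (x + s *\<^sub>R u + t *\<^sub>R v) = dd (dd f v) u (x + t' *\<^sub>R u + s' *\<^sub>R v)"
    using \<open>h > 0\<close> by (simp add: add_ac)
  moreover have "dist (dd (dd f u) v (x + s *\<^sub>R u + t *\<^sub>R v)) (dd (dd f u) v x) < e"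
    using d1(2) near[OF st(1-4)] by (simp add: d_def)
  moreover have "dist (dd (dd f v) u (x + t' *\<^sub>R u + s' *\<^sub>R v)) (dd (dd f v) u x) < e"
    using d2(2) near[OF st'(3,4,1,2)] by (simp add: d_def)
  ultimately show False unfolding e_def dist_real_def by (smt (verit) field_sum_of_halves)
qed

lemma dd_linear_comp:
  assumes "bounded_linear h" "f differentiable (at x)"
  shows "dd (\<lambda>x. h (f x)) v x = h (dd f v x)"
  by (rule dd_eq, rule bounded_linear.has_derivative[OF assms(1)])
    (use assms(2) in \<open>simp add: frechet_derivative_works\<close>)

lemma dd_commute:
  fixes f :: "'a::euclidean_space \<Rightarrow> 'b::euclidean_space"
  assumes C: "Ck (Suc (Suc 0)) f S" and S: "open S" "x \<in> S"
  shows "dd (dd f u) v x = dd (dd f v) u x"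
proof (rule euclidean_eqI)
  fix b :: 'b
  have bl: "bounded_linear (\<lambda>y::'b. y \<bullet> b)" by (rule bounded_linear_inner_left)
  have Cb: "Ck (Suc (Suc 0)) (\<lambda>x. f x \<bullet> b) S" by (rule Ck_linear[OF bl C S(1)])
  have 1: "dd (\<lambda>x. f x \<bullet> b) w y = dd f w y \<bullet> b" if "y \<in> S" for w y
    by (rule dd_linear_comp[OF bl]) (use C that in simp)
  have "dd (dd f w) w' x \<bullet> b = dd (dd (\<lambda>x. f x \<bullet> b) w) w' x" for w w'
  proof -
    have "dd (dd (\<lambda>x. f x \<bullet> b) w) w' x = dd (\<lambda>y. dd f w y \<bullet> b) w' x"
      using frechet_derivative_cong_open[OF S, of "dd (\<lambda>x. f x \<bullet> b) w" "\<lambda>y. dd f w y \<bullet> b"] 1 by simp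
    also have "\<dots> = dd (dd f w) w' x \<bullet> b" by (rule dd_linear_comp[OF bl]) (use C S in simp)
    finally show ?thesis by simp
  qed
  then show "dd (dd f u) v x \<bullet> b = dd (dd f v) u x \<bullet> b"
    using dd_commute_real[OF Cb S] by simp
qed

section \<open>Charts and coordinate expressions\<close>

definition tdiff :: "('a, 'n::finite) chart \<Rightarrow> ('a, 'n) chart \<Rightarrow> 'a \<Rightarrow> real ^ 'n \<Rightarrow> real ^ 'n" where
  "tdiff c d x = frechet_derivative (snd d \<circ> chart_inv c) (at (snd c x))"

text \<open>Identifies coordinate vectors of the chart \<open>c\<close> with tangent vectors at
  \<open>x\<close>; at points of the chart it is inverse to \<open>components A c x\<close>. A fixed
  \<open>v\<close> thus gives a coordinate field on the chart domain.\<close>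

definition cvec :: "('a, 'n::finite) chart set \<Rightarrow> ('a, 'n) chart \<Rightarrow> 'a \<Rightarrow> real ^ 'n \<Rightarrow> real ^ 'n" where
  "cvec A c x v = tdiff c (chart_at A x) x v"

definition form_rep ::
  "('a, 'n::finite) chart set \<Rightarrow> ('a, 'n) chart \<Rightarrow> ('a, 'n) one_form \<Rightarrow> real ^ 'n \<Rightarrow> real ^ 'n \<Rightarrow> real" where
  "form_rep A c \<beta> v z = \<beta> (chart_inv c z) (cvec A c (chart_inv c z) v)"

text \<open>Twice the exterior derivative in the normalisation of \<^const>\<open>ext_deriv\<close>, in coordinates.\<close>

definition dform ::
  "('a, 'n::finite) chart set \<Rightarrow> ('a, 'n) chart \<Rightarrow> ('a, 'n) one_form \<Rightarrow> 'a \<Rightarrow> real ^ 'n \<Rightarrow> real ^ 'n \<Rightarrow> real" where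
  "dform A c \<beta> x u v = dd (form_rep A c \<beta> v) u (snd c x) - dd (form_rep A c \<beta> u) v (snd c x)"

text \<open>One derivative is the right regularity here: multiplying by the bump functions used for
  localisation leaves a form that is only C^1.\<close>

definition C1_form :: "('a, 'n::finite) chart set \<Rightarrow> ('a, 'n) one_form \<Rightarrow> bool" where
  "C1_form A \<beta> \<longleftrightarrow> (\<forall>x. linear (\<beta> x)) \<and> (\<forall>c\<in>A. \<forall>v. Ck (Suc 0) (form_rep A c \<beta> v) (snd c ` fst c))"

locale smooth_manifold =
  fixes A :: "('a::{t2_space, second_countable_topology}, 'n::finite) chart set"
  assumes atlas: "smooth_atlas A"
begin

lemma chart_at: "chart_at A x \<in> A" "x \<in> fst (chart_at A x)"
proof -
  have "\<exists>c. c \<in> A \<and> x \<in> fst c" using atlas unfolding smooth_atlas_def by blast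
  then have "chart_at A x \<in> A \<and> x \<in> fst (chart_at A x)"
    unfolding chart_at_def by (rule someI_ex)
  then show "chart_at A x \<in> A" "x \<in> fst (chart_at A x)" by auto
qed

lemma is_chart: "c \<in> A \<Longrightarrow> is_chart c"
  using atlas by (auto simp: smooth_atlas_def)

lemma open_chart [simp]: "c \<in> A \<Longrightarrow> open (fst c)" "c \<in> A \<Longrightarrow> open (snd c ` fst c)"
  using is_chart by (auto simp: is_chart_def)

lemma chart_continuous:
  "c \<in> A \<Longrightarrow> continuous_on (fst c) (snd c)" "c \<in> A \<Longrightarrow> continuous_on (snd c ` fst c) (chart_inv c)"
  using is_chart by (auto simp: is_chart_def homeomorphism_def)

lemma chart_inv_left [simp]: "c \<in> A \<Longrightarrow> x \<in> fst c \<Longrightarrow> chart_inv c (snd c x) = x"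
  using is_chart by (auto simp: is_chart_def homeomorphism_def)

lemma inj_on_chart: "c \<in> A \<Longrightarrow> inj_on (snd c) (fst c)"
  by (metis chart_inv_left inj_onI)

lemma open_chart_image:
  assumes "c \<in> A" "open U"
  shows "open (snd c ` (U \<inter> fst c))"
proof -
  have "snd c ` (U \<inter> fst c) = snd c ` fst c \<inter> chart_inv c -` U"
    using assms(1) by (auto simp: image_iff)
  then show ?thesis
    using continuous_open_preimage[OF chart_continuous(2)] assms by simp
qed

lemma open_chart_image': "c \<in> A \<Longrightarrow> open U \<Longrightarrow> U \<subseteq> fst c \<Longrightarrow> open (snd c ` U)"
  using open_chart_image[of c U] by (simp add: Int_absorb2)

lemma Ck_transition:
  "c \<in> A \<Longrightarrow> d \<in> A \<Longrightarrow> Ck k (snd d \<circ> chart_inv c) (snd c ` (fst c \<inter> fst d))"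
  using atlas by (auto simp: smooth_atlas_def smooth_on_def)

lemma open_chart_inter: "c \<in> A \<Longrightarrow> d \<in> A \<Longrightarrow> open (snd c ` (fst c \<inter> fst d))"
  using open_chart_image[of c "fst d"] by (simp add: Int_commute)

lemma tdiff_has_derivative:
  assumes "c \<in> A" "d \<in> A" "x \<in> fst c" "x \<in> fst d"
  shows "((snd d \<circ> chart_inv c) has_derivative tdiff c d x) (at (snd c x))"
  unfolding tdiff_def using Ck_has_derivative[OF Ck_transition] assms by blast

lemma tdiff_linear:
  assumes "c \<in> A" "d \<in> A" "x \<in> fst c" "x \<in> fst d"
  shows "linear (tdiff c d x)"
  using tdiff_has_derivative[OF assms] has_derivative_linear by blast

lemma tdiff_compose:
  assumes "c \<in> A" "d \<in> A" "e \<in> A" "x \<in> fst c" "x \<in> fst d" "x \<in> fst e"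
  shows "tdiff d e x (tdiff c d x v) = tdiff c e x v"
proof -
  have 1: "((\<lambda>z. (snd e \<circ> chart_inv d) ((snd d \<circ> chart_inv c) z)) has_derivative
      (\<lambda>v. tdiff d e x (tdiff c d x v))) (at (snd c x))"
  proof (rule has_derivative_compose[OF tdiff_has_derivative])
    have "(snd d \<circ> chart_inv c) (snd c x) = snd d x" using assms by simp
    then show "((snd e \<circ> chart_inv d) has_derivative tdiff d e x) (at ((snd d \<circ> chart_inv c) (snd c x)))"
      using assms tdiff_has_derivative[of d e x] by (simp only:)
  qed (use assms in auto)
  have "((snd e \<circ> chart_inv c) has_derivative (\<lambda>v. tdiff d e x (tdiff c d x v))) (at (snd c x))"
  proof (rule has_derivative_transform_within_open[OF 1])
    show "open (snd c ` (fst c \<inter> fst d))" "snd c x \<in> snd c ` (fst c \<inter> fst d)"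
      using open_chart_inter assms by auto
  qed (use assms in auto)
  then show ?thesis unfolding tdiff_def using dd_eq by fastforce
qed

lemma tdiff_refl:
  assumes "c \<in> A" "x \<in> fst c"
  shows "tdiff c c x v = v"
proof -
  have "((snd c \<circ> chart_inv c) has_derivative (\<lambda>v. v)) (at (snd c x))"
    by (rule has_derivative_transform_within_open[OF has_derivative_ident, of "snd c ` fst c"])
      (use assms in auto)
  then show ?thesis unfolding tdiff_def using dd_eq by fastforce
qed

lemma components_eq: "components A c x v = tdiff (chart_at A x) c x v"
  by (simp add: components_def tdiff_def)

lemma coordinate_vector_eq: "coordinate_vector A c i x = cvec A c x (axis i 1)"
  by (simp add: coordinate_vector_def tdiff_def cvec_def)

lemma cvec_linear: "c \<in> A \<Longrightarrow> x \<in> fst c \<Longrightarrow> linear (cvec A c x)"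
  using tdiff_linear[of c "chart_at A x" x] chart_at by (simp add: cvec_def[abs_def])

lemma components_linear: "c \<in> A \<Longrightarrow> x \<in> fst c \<Longrightarrow> linear (components A c x)"
  using tdiff_linear[of "chart_at A x" c x] chart_at by (simp add: components_eq[abs_def])

lemma components_cvec:
  "c \<in> A \<Longrightarrow> x \<in> fst c \<Longrightarrow> d \<in> A \<Longrightarrow> x \<in> fst d \<Longrightarrow> components A d x (cvec A c x v) = tdiff c d x v"
  using tdiff_compose[of c "chart_at A x" d x] chart_at by (simp add: components_eq cvec_def)

lemma components_cvec_same [simp]: "c \<in> A \<Longrightarrow> x \<in> fst c \<Longrightarrow> components A c x (cvec A c x v) = v"
  by (simp add: components_cvec tdiff_refl)

lemma cvec_components [simp]: "c \<in> A \<Longrightarrow> x \<in> fst c \<Longrightarrow> cvec A c x (components A c x v) = v"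
  using tdiff_compose[of "chart_at A x" c "chart_at A x" x] chart_at
  by (simp add: components_eq cvec_def tdiff_refl)

lemma cvec_tdiff:
  "c \<in> A \<Longrightarrow> x \<in> fst c \<Longrightarrow> d \<in> A \<Longrightarrow> x \<in> fst d \<Longrightarrow> cvec A d x (tdiff c d x v) = cvec A c x v"
  using tdiff_compose[of c d "chart_at A x" x] chart_at by (simp add: cvec_def)

lemma cvec_chart_at [simp]: "cvec A (chart_at A x) x v = v"
  using tdiff_refl chart_at by (simp add: cvec_def)

text \<open>Tensor fields are smooth by their effect on smooth vector fields, so coordinate fields
  are the way to extract smooth components. In another chart they are columns of the derivative of a
  transition map.\<close>

lemma smooth_field_cvec:
  assumes "c \<in> A"
  shows "smooth_field_on A (fst c) (\<lambda>x. cvec A c x v)"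
  unfolding smooth_field_on_def smooth_on_def
proof (intro ballI allI)
  fix d k assume d: "d \<in> A"
  have o: "open (snd d ` (fst c \<inter> fst d))" using open_chart_image assms d by simp
  show "Ck k (local_rep A d (\<lambda>x. cvec A c x v)) (snd d ` (fst c \<inter> fst d))"
  proof (rule Ck_cong[OF o])
    show "Ck k (\<lambda>z. dd (snd d \<circ> chart_inv c) v ((snd c \<circ> chart_inv d) z)) (snd d ` (fst c \<inter> fst d))"
    proof (rule Ck_compose[OF Ck_dd[OF Ck_transition[OF assms d]] _ _ o])
      show "Ck k (snd c \<circ> chart_inv d) (snd d ` (fst c \<inter> fst d))"
        using Ck_transition[OF d assms] by (simp add: Int_commute)
    qed (use assms d in auto)
  next
    fix z assume "z \<in> snd d ` (fst c \<inter> fst d)"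
    then show "dd (snd d \<circ> chart_inv c) v ((snd c \<circ> chart_inv d) z) = local_rep A d (\<lambda>x. cvec A c x v) z"
      using components_cvec[of c _ d v] assms d by (auto simp: local_rep_def tdiff_def)
  qed
qed

lemma smooth_field_on_subset: "smooth_field_on A U X \<Longrightarrow> V \<subseteq> U \<Longrightarrow> smooth_field_on A V X"
  unfolding smooth_field_on_def smooth_on_def by (meson Ck_subset Int_mono image_mono order_refl)

lemma smooth_function_on_subset: "smooth_function_on A U f \<Longrightarrow> V \<subseteq> U \<Longrightarrow> smooth_function_on A V f"
  unfolding smooth_function_on_def smooth_on_def by (meson Ck_subset Int_mono image_mono order_refl)

lemma smooth_functionI:
  "(\<And>c k. c \<in> A \<Longrightarrow> open (snd c ` (U \<inter> fst c)) \<Longrightarrow> Ck k (\<lambda>z. f (chart_inv c z)) (snd c ` (U \<inter> fst c)))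
    \<Longrightarrow> open U \<Longrightarrow> smooth_function_on A U f"
  unfolding smooth_function_on_def smooth_on_def o_def using open_chart_image by blast

lemma smooth_functionD:
  "smooth_function_on A U f \<Longrightarrow> c \<in> A \<Longrightarrow> Ck k (\<lambda>z. f (chart_inv c z)) (snd c ` (U \<inter> fst c))"
  unfolding smooth_function_on_def smooth_on_def o_def by blast

lemma smooth_fieldD:
  "smooth_field_on A U X \<Longrightarrow> c \<in> A \<Longrightarrow> Ck k (local_rep A c X) (snd c ` (U \<inter> fst c))"
  unfolding smooth_field_on_def smooth_on_def by blast

lemma smooth_function_const: "smooth_function_on A U (\<lambda>x. a)"
  by (simp add: smooth_function_on_def smooth_on_def o_def)

lemma smooth_function_add:
  "open U \<Longrightarrow> smooth_function_on A U f \<Longrightarrow> smooth_function_on A U h \<Longrightarrow> smooth_function_on A U (\<lambda>x. f x + h x)"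
  by (rule smooth_functionI) (rule Ck_add; simp add: smooth_functionD)+

lemma smooth_function_mult:
  "open U \<Longrightarrow> smooth_function_on A U f \<Longrightarrow> smooth_function_on A U h \<Longrightarrow> smooth_function_on A U (\<lambda>x. f x * h x)"
  by (rule smooth_functionI) (rule Ck_mult; simp add: smooth_functionD)+

lemma smooth_function_diff:
  "open U \<Longrightarrow> smooth_function_on A U f \<Longrightarrow> smooth_function_on A U h \<Longrightarrow> smooth_function_on A U (\<lambda>x. f x - h x)"
  by (rule smooth_functionI) (rule Ck_diff; simp add: smooth_functionD)+

lemma smooth_function_inverse:
  assumes "open U" "smooth_function_on A U f" "\<And>x. x \<in> U \<Longrightarrow> f x \<noteq> 0"
  shows "smooth_function_on A U (\<lambda>x. inverse (f x))"
proof (rule smooth_functionI[OF _ assms(1)])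
  fix c k assume c: "c \<in> A" and o: "open (snd c ` (U \<inter> fst c))"
  show "Ck k (\<lambda>z. inverse (f (chart_inv c z))) (snd c ` (U \<inter> fst c))"
    by (rule Ck_inverse[OF smooth_functionD[OF assms(2) c] _ o]) (use assms(3) c in auto)
qed

lemma smooth_function_sqrt:
  assumes "open U" "smooth_function_on A U f" "\<And>x. x \<in> U \<Longrightarrow> f x > 0"
  shows "smooth_function_on A U (\<lambda>x. sqrt (f x))"
proof (rule smooth_functionI[OF _ assms(1)])
  fix c k assume c: "c \<in> A" and o: "open (snd c ` (U \<inter> fst c))"
  show "Ck k (\<lambda>z. sqrt (f (chart_inv c z))) (snd c ` (U \<inter> fst c))"
    by (rule Ck_sqrt[OF smooth_functionD[OF assms(2) c] _ o]) (use assms(3) c in auto)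
qed

lemma smooth_field_add:
  assumes "open U" "smooth_field_on A U X" "smooth_field_on A U Y"
  shows "smooth_field_on A U (\<lambda>x. X x + Y x)"
  unfolding smooth_field_on_def smooth_on_def
proof (intro ballI allI)
  fix c k assume c: "c \<in> A"
  show "Ck k (local_rep A c (\<lambda>x. X x + Y x)) (snd c ` (U \<inter> fst c))"
  proof (rule Ck_cong[OF open_chart_image[OF c assms(1)]])
    show "Ck k (\<lambda>z. local_rep A c X z + local_rep A c Y z) (snd c ` (U \<inter> fst c))"
      by (intro Ck_add smooth_fieldD assms open_chart_image c)
  qed (use linear_add[OF components_linear[OF c]] c in \<open>auto simp: local_rep_def\<close>)
qed

lemma smooth_field_scale:
  assumes "open U" "smooth_function_on A U f" "smooth_field_on A U X"
  shows "smooth_field_on A U (\<lambda>x. f x *\<^sub>R X x)"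
  unfolding smooth_field_on_def smooth_on_def
proof (intro ballI allI)
  fix c k assume c: "c \<in> A"
  show "Ck k (local_rep A c (\<lambda>x. f x *\<^sub>R X x)) (snd c ` (U \<inter> fst c))"
  proof (rule Ck_cong[OF open_chart_image[OF c assms(1)]])
    show "Ck k (\<lambda>z. f (chart_inv c z) *\<^sub>R local_rep A c X z) (snd c ` (U \<inter> fst c))"
      by (intro Ck_scaleR smooth_fieldD smooth_functionD assms open_chart_image c)
  qed (use linear_scale[OF components_linear[OF c]] c in \<open>auto simp: local_rep_def\<close>)
qed

lemma smooth_field_zero: "smooth_field_on A U (\<lambda>x. 0)"
  unfolding smooth_field_on_def smooth_on_def
proof (intro ballI allI)
  fix c k assume c: "c \<in> A"
  have "open (snd c ` fst c)" using c by simp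
  then have "Ck k (local_rep A c (\<lambda>x. 0)) (snd c ` fst c)"
    by (rule Ck_cong[where f = "\<lambda>z. 0"])
      (use c linear_0[OF components_linear[OF c]] in \<open>auto simp: local_rep_def\<close>)
  then show "Ck k (local_rep A c (\<lambda>x. 0)) (snd c ` (U \<inter> fst c))"
    by (rule Ck_subset) auto
qed

lemma smooth_field_sum:
  assumes "open U" "\<And>i. i \<in> I \<Longrightarrow> smooth_field_on A U (X i)"
  shows "smooth_field_on A U (\<lambda>x. \<Sum>i\<in>I. X i x)"
  using assms(2)
  by (induction I rule: infinite_finite_induct) (auto intro: smooth_field_add[OF assms(1)] smooth_field_zero)

lemma continuous_on_chartwise:
  assumes "open U" "\<And>c. c \<in> A \<Longrightarrow> continuous_on (snd c ` (U \<inter> fst c)) (f \<circ> chart_inv c)"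
  shows "continuous_on U f"
  unfolding continuous_on_eq_continuous_at[OF assms(1)]
proof
  fix x assume x: "x \<in> U"
  define c where "c = chart_at A x"
  have c: "c \<in> A" "x \<in> fst c" using chart_at by (auto simp: c_def)
  have "continuous_on (U \<inter> fst c) (\<lambda>y. (f \<circ> chart_inv c) (snd c y))"
    by (rule continuous_on_compose2[OF assms(2)[OF c(1)]])
      (use continuous_on_subset[OF chart_continuous(1)[OF c(1)]] in auto)
  then have "continuous_on (U \<inter> fst c) f"
    by (rule continuous_on_eq) (use c in auto)
  then show "isCont f x"
    using continuous_on_eq_continuous_at[of "U \<inter> fst c" f] assms(1) c x by (simp add: open_Int)
qed

lemma smooth_function_continuous: "open U \<Longrightarrow> smooth_function_on A U f \<Longrightarrow> continuous_on U f"
  using smooth_functionD[of U f] Ck_continuous_on unfolding o_def[symmetric]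
  by (intro continuous_on_chartwise) blast+

section \<open>The exterior derivative of a one-form\<close>

lemma form_rep_linear:
  "linear (\<beta> (chart_inv c z)) \<Longrightarrow> c \<in> A \<Longrightarrow> z \<in> snd c ` fst c \<Longrightarrow> linear (\<lambda>v. form_rep A c \<beta> v z)"
  unfolding form_rep_def
  by (rule linear_compose[of "cvec A c (chart_inv c z)" "\<beta> (chart_inv c z)", unfolded o_def])
    (auto intro: cvec_linear)

lemma form_rep_expand:
  assumes "linear (\<beta> (chart_inv c z))" "c \<in> A" "z \<in> snd c ` fst c"
  shows "form_rep A c \<beta> v z = (\<Sum>b\<in>Basis. (v \<bullet> b) * form_rep A c \<beta> b z)"
proof -
  note lin = form_rep_linear[of \<beta> c z, OF assms]
  have "form_rep A c \<beta> (\<Sum>b\<in>Basis. (v \<bullet> b) *\<^sub>R b) z = (\<Sum>b\<in>Basis. form_rep A c \<beta> ((v \<bullet> b) *\<^sub>R b) z)"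
    by (rule linear_sum[OF lin])
  also have "\<dots> = (\<Sum>b\<in>Basis. (v \<bullet> b) * form_rep A c \<beta> b z)"
    by (rule sum.cong[OF refl]) (simp add: linear_scale[OF lin])
  finally show ?thesis by (simp add: euclidean_representation)
qed

lemma dd_form_rep_expand:
  assumes "C1_form A \<beta>" "c \<in> A" "z \<in> snd c ` fst c"
  shows "dd (form_rep A c \<beta> v) u z = (\<Sum>b\<in>Basis. (v \<bullet> b) * dd (form_rep A c \<beta> b) u z)"
proof -
  have lin: "linear (\<beta> x)" for x using assms(1) by (simp add: C1_form_def)
  have "((\<lambda>z. \<Sum>b\<in>Basis. (v \<bullet> b) * form_rep A c \<beta> b z) has_derivative
      (\<lambda>u. \<Sum>b\<in>Basis. (v \<bullet> b) * dd (form_rep A c \<beta> b) u z)) (at z)"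
    by (intro has_derivative_sum has_derivative_mult_right, rule Ck_has_derivative)
      (use assms in \<open>auto simp: C1_form_def simp del: Ck.simps\<close>)
  then have "(form_rep A c \<beta> v has_derivative
      (\<lambda>u. \<Sum>b\<in>Basis. (v \<bullet> b) * dd (form_rep A c \<beta> b) u z)) (at z)"
    by (rule has_derivative_transform_within_open[of _ _ _ _ "snd c ` fst c"])
      (use assms form_rep_expand[of \<beta> c _ v] lin in auto)
  then show ?thesis by (rule dd_eq)
qed

lemma dform_expand:
  assumes "C1_form A \<beta>" "c \<in> A" "x \<in> fst c"
  shows "dform A c \<beta> x u v = (\<Sum>a\<in>Basis. \<Sum>b\<in>Basis. (u \<bullet> a) * (v \<bullet> b) * dform A c \<beta> x a b)"
proof -
  have z: "snd c x \<in> snd c ` fst c" using assms by auto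
  have lin: "linear (frechet_derivative (form_rep A c \<beta> v) (at (snd c x)))" for v
    using assms z has_derivative_linear[OF Ck_has_derivative] unfolding C1_form_def by blast
  have e: "dd (form_rep A c \<beta> v) u (snd c x)
      = (\<Sum>a\<in>Basis. \<Sum>b\<in>Basis. (u \<bullet> a) * (v \<bullet> b) * dd (form_rep A c \<beta> b) a (snd c x))" for u v
  proof -
    have "dd (form_rep A c \<beta> v) u (snd c x) = (\<Sum>a\<in>Basis. (u \<bullet> a) * dd (form_rep A c \<beta> v) a (snd c x))"
      using lin[of v] by (subst euclidean_representation[symmetric, of u]) (simp add: linear_sum linear_scale)
    then show ?thesis
      by (simp add: dd_form_rep_expand[OF assms(1,2) z, of v] sum_distrib_left mult_ac)
  qed
  show ?thesis
    unfolding dform_def right_diff_distrib sum_subtractf e[of v u] e[of u v]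
    by (subst (2) sum.swap) (simp add: mult_ac)
qed

lemma dform_linear:
  assumes "C1_form A \<beta>" "c \<in> A" "x \<in> fst c"
  shows "linear (dform A c \<beta> x u)"
proof (rule linearI)
  show "dform A c \<beta> x u (v + w) = dform A c \<beta> x u v + dform A c \<beta> x u w" for v w
    unfolding dform_expand[OF assms, of u] by (simp add: algebra_simps sum.distrib inner_add_left)
  show "dform A c \<beta> x u (r *\<^sub>R v) = r *\<^sub>R dform A c \<beta> x u v" for r v
    unfolding dform_expand[OF assms, of u] by (simp add: mult_ac sum_distrib_left)
qed

lemma dform_swap: "dform A c \<beta> x u v = - dform A c \<beta> x v u"
  by (simp add: dform_def)

text \<open>Naturality of the exterior derivative. Differentiating the transformation rule of the
  components produces a term with the second derivative of the change of charts; it is symmetric in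
  \<open>u\<close> and \<open>v\<close> and cancels.\<close>

lemma dform_transition:
  assumes \<beta>: "C1_form A \<beta>" and c: "c \<in> A" "x \<in> fst c" and d: "d \<in> A" "x \<in> fst d"
  shows "dform A d \<beta> x (tdiff c d x u) (tdiff c d x v) = dform A c \<beta> x u v"
proof -
  define \<psi> where "\<psi> = snd d \<circ> chart_inv c"
  define z where "z = snd c x"
  define O' where "O' = snd c ` (fst c \<inter> fst d)"
  have O': "open O'" "z \<in> O'" using open_chart_inter c d by (auto simp: O'_def z_def)
  have C: "Ck k \<psi> O'" for k using Ck_transition c d by (simp add: \<psi>_def O'_def)
  have lin: "linear (\<beta> x)" for x using \<beta> by (simp add: C1_form_def)
  have \<psi>z: "\<psi> z = snd d x" using c by (simp add: \<psi>_def z_def)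
  have D: "dd (form_rep A c \<beta> v) u z = (\<Sum>b\<in>Basis. (dd \<psi> v z \<bullet> b) * dd (form_rep A d \<beta> b) (dd \<psi> u z) (\<psi> z)
     + (dd (dd \<psi> v) u z \<bullet> b) * form_rep A d \<beta> b (\<psi> z))" for u v
  proof (rule dd_eq, rule has_derivative_transform_within_open[OF _ O'])
    show "((\<lambda>z. \<Sum>b\<in>Basis. (dd \<psi> v z \<bullet> b) * form_rep A d \<beta> b (\<psi> z)) has_derivative
       (\<lambda>u. \<Sum>b\<in>Basis. (dd \<psi> v z \<bullet> b) * dd (form_rep A d \<beta> b) (dd \<psi> u z) (\<psi> z)
     + (dd (dd \<psi> v) u z \<bullet> b) * form_rep A d \<beta> b (\<psi> z))) (at z)"
    proof (rule has_derivative_sum, rule has_derivative_mult)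
      fix b :: "real ^ 'n"
      show "((\<lambda>z. dd \<psi> v z \<bullet> b) has_derivative (\<lambda>u. dd (dd \<psi> v) u z \<bullet> b)) (at z)"
        by (rule has_derivative_inner_left[OF Ck_has_derivative[OF Ck_dd[OF C[of "Suc (Suc 0)"]] O'(2)]])
      show "((\<lambda>z. form_rep A d \<beta> b (\<psi> z)) has_derivative
          (\<lambda>u. dd (form_rep A d \<beta> b) (dd \<psi> u z) (\<psi> z))) (at z)"
        by (rule has_derivative_compose[OF Ck_has_derivative[OF C O'(2)]], rule Ck_has_derivative)
          (use \<beta> d \<psi>z in \<open>auto simp: C1_form_def simp del: Ck.simps\<close>)
    qed
    fix y assume y: "y \<in> O'"
    then obtain w where w: "y = snd c w" "w \<in> fst c" "w \<in> fst d" by (auto simp: O'_def)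
    have "form_rep A c \<beta> v y = form_rep A d \<beta> (dd \<psi> v y) (\<psi> y)"
      using w c d cvec_tdiff[of c w d v] by (simp add: form_rep_def \<psi>_def tdiff_def)
    also have "\<dots> = (\<Sum>b\<in>Basis. (dd \<psi> v y \<bullet> b) * form_rep A d \<beta> b (\<psi> y))"
      by (rule form_rep_expand) (use lin w c d in \<open>auto simp: \<psi>_def\<close>)
    finally show "(\<Sum>b\<in>Basis. (dd \<psi> v y \<bullet> b) * form_rep A d \<beta> b (\<psi> y)) = form_rep A c \<beta> v y" by simp
  qed
  have t: "tdiff c d x u = dd \<psi> u z" for u by (simp add: tdiff_def \<psi>_def z_def)
  have E: "dd (form_rep A d \<beta> (dd \<psi> v z)) u' (\<psi> z)
      = (\<Sum>b\<in>Basis. (dd \<psi> v z \<bullet> b) * dd (form_rep A d \<beta> b) u' (\<psi> z))" for v u'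
    by (rule dd_form_rep_expand[OF \<beta> d(1)]) (use d \<psi>z in auto)
  show ?thesis
    unfolding dform_def t z_def[symmetric] \<psi>z[symmetric] D E
    by (simp add: sum.distrib dd_commute[OF C O', of u v])
qed

lemma smooth_one_form_C1:
  assumes "smooth_one_form A \<beta>"
  shows "C1_form A \<beta>"
proof -
  have "Ck (Suc 0) (form_rep A c \<beta> v) (snd c ` fst c)" if "c \<in> A" for c v
  proof -
    have "smooth_function_on A (fst c) (\<lambda>x. \<beta> x (cvec A c x v))"
      using assms smooth_field_cvec[OF that] that open_chart(1) unfolding smooth_one_form_def by blast
    then have "Ck (Suc 0) ((\<lambda>x. \<beta> x (cvec A c x v)) \<circ> chart_inv c) (snd c ` (fst c \<inter> fst c))"
      using that unfolding smooth_function_on_def smooth_on_def by blast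
    then show ?thesis by (simp add: form_rep_def[abs_def] o_def)
  qed
  then show ?thesis using assms by (simp add: C1_form_def smooth_one_form_def)
qed

text \<open>The product rule separates the derivative of the components of \<open>Y\<close> from
  that of the components of \<open>\<beta>\<close>. The first summand is the one that the Lie
  bracket later removes.\<close>

lemma field_deriv_form:
  assumes \<beta>: "C1_form A \<beta>" and U: "open U" "x \<in> U" and Y: "smooth_field_on A U Y"
  defines "c \<equiv> chart_at A x"
  shows "field_deriv A X (\<lambda>y. \<beta> y (Y y)) x
    = \<beta> x (frechet_derivative (local_rep A c Y) (at (snd c x)) (X x)) + dd (form_rep A c \<beta> (Y x)) (X x) (snd c x)"
proof -
  define z where "z = snd c x"
  define u where "u = X x"
  define L where "L = local_rep A c Y"
  define O' where "O' = snd c ` (U \<inter> fst c)"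
  have c: "c \<in> A" "x \<in> fst c" using chart_at by (auto simp: c_def)
  have O': "open O'" "z \<in> O'" "O' \<subseteq> snd c ` fst c" using open_chart_image c U by (auto simp: O'_def z_def)
  have lin: "linear (\<beta> x)" for x using \<beta> by (simp add: C1_form_def)
  have L: "Ck k L O'" for k using Y c unfolding smooth_field_on_def smooth_on_def L_def O'_def by blast
  have xz: "chart_inv c z = x" using c by (simp add: z_def)
  have Lz: "L z = Y x" using components_cvec_same[OF c, of "Y x"] cvec_chart_at[of x "Y x"]
    unfolding L_def local_rep_def xz by (simp add: c_def)
  have fz: "form_rep A c \<beta> v z = \<beta> x v" for v
    using cvec_chart_at[of x v] unfolding form_rep_def xz by (simp add: c_def)
  have "field_deriv A X (\<lambda>y. \<beta> y (Y y)) x = dd ((\<lambda>y. \<beta> y (Y y)) \<circ> chart_inv c) u z"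
    by (simp add: field_deriv_def c_def z_def u_def)
  also have "\<dots> = (\<Sum>b\<in>Basis. (L z \<bullet> b) * dd (form_rep A c \<beta> b) u z + (dd L u z \<bullet> b) * form_rep A c \<beta> b z)"
  proof (rule dd_eq, rule has_derivative_transform_within_open[OF _ O'(1,2)])
    show "((\<lambda>z. \<Sum>b\<in>Basis. (L z \<bullet> b) * form_rep A c \<beta> b z) has_derivative
      (\<lambda>u. \<Sum>b\<in>Basis. (L z \<bullet> b) * dd (form_rep A c \<beta> b) u z + (dd L u z \<bullet> b) * form_rep A c \<beta> b z)) (at z)"
    proof (rule has_derivative_sum, rule has_derivative_mult)
      fix b :: "real ^ 'n"
      show "((\<lambda>z. L z \<bullet> b) has_derivative (\<lambda>u. dd L u z \<bullet> b)) (at z)"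
        by (rule has_derivative_inner_left[OF Ck_has_derivative[OF L O'(2)]])
      show "(form_rep A c \<beta> b has_derivative (\<lambda>u. dd (form_rep A c \<beta> b) u z)) (at z)"
        by (rule Ck_has_derivative[of 0 _ "snd c ` fst c"])
          (use \<beta> c z_def in \<open>auto simp: C1_form_def simp del: Ck.simps\<close>)
    qed
    fix y assume y: "y \<in> O'"
    then obtain w where w: "y = snd c w" "w \<in> fst c" "w \<in> U" by (auto simp: O'_def)
    have "((\<lambda>y. \<beta> y (Y y)) \<circ> chart_inv c) y = form_rep A c \<beta> (L y) y"
      using w c by (simp add: form_rep_def L_def local_rep_def)
    also have "\<dots> = (\<Sum>b\<in>Basis. (L y \<bullet> b) * form_rep A c \<beta> b y)"
      by (rule form_rep_expand) (use lin w c in auto)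
    finally show "(\<Sum>b\<in>Basis. (L y \<bullet> b) * form_rep A c \<beta> b y) = ((\<lambda>y. \<beta> y (Y y)) \<circ> chart_inv c) y" by simp
  qed
  also have "\<dots> = dd (form_rep A c \<beta> (L z)) u z + form_rep A c \<beta> (dd L u z) z"
    using form_rep_expand[of \<beta> c z "dd L u z", OF lin c(1)] dd_form_rep_expand[OF \<beta> c(1), of z "L z" u] O'
    by (simp add: sum.distrib subset_iff)
  finally show ?thesis unfolding Lz fz unfolding L_def u_def z_def by (simp only: add.commute)
qed

text \<open>The derivatives of the components of \<open>X\<close> and \<open>Y\<close> cancel
  against the bracket, so the value depends only on the two vectors at \<open>x\<close>. The factor
  1/2 is the normalisation of \<open>ext_deriv\<close>.\<close>

lemma ext_deriv_eq_dform:
  assumes "C1_form A \<beta>" "open U" "x \<in> U" "smooth_field_on A U X" "smooth_field_on A U Y"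
  shows "ext_deriv A \<beta> X Y x = 1/2 * dform A (chart_at A x) \<beta> x (X x) (Y x)"
proof -
  have lin: "linear (\<beta> x)" using assms by (simp add: C1_form_def)
  show ?thesis
    unfolding ext_deriv_def field_deriv_form[OF assms(1-3,5)] field_deriv_form[OF assms(1-4)]
      lie_bracket_def Let_def dform_def linear_diff[OF lin] by simp
qed

text \<open>On fields in the kernel of \<open>\<beta>\<close> only the bracket term of the exterior
  derivative is left. This converts the integrability tensor of a complement into the differential
  of the form that cuts it out.\<close>

lemma form_lie_bracket:
  assumes \<beta>: "C1_form A \<beta>" and U: "open U" "x \<in> U"
    and XY: "smooth_field_on A U X" "smooth_field_on A U Y"
    and ker: "\<And>y. y \<in> U \<Longrightarrow> \<beta> y (X y) = 0" "\<And>y. y \<in> U \<Longrightarrow> \<beta> y (Y y) = 0"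
  shows "\<beta> x (lie_bracket A X Y x) = - dform A (chart_at A x) \<beta> x (X x) (Y x)"
proof -
  define c where "c = chart_at A x"
  have c: "c \<in> A" "x \<in> fst c" using chart_at by (auto simp: c_def)
  have z: "field_deriv A Z (\<lambda>y. \<beta> y (W y)) x = 0" if "\<And>y. y \<in> U \<Longrightarrow> \<beta> y (W y) = 0" for Z W
  proof -
    have "frechet_derivative ((\<lambda>y. \<beta> y (W y)) \<circ> chart_inv c) (at (snd c x))
        = frechet_derivative (\<lambda>z. 0) (at (snd c x))"
      by (rule frechet_derivative_cong_open[OF open_chart_image[OF c(1) U(1)]])
        (use c U that in auto)
    then show ?thesis
      using dd_eq[OF has_derivative_const[of "0::real"]] by (simp add: field_deriv_def c_def)
  qed
  show ?thesis
    using ext_deriv_eq_dform[OF \<beta> U XY] z ker by (simp add: ext_deriv_def)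
qed

end

section \<open>Bilinear forms and matrices\<close>

definition outer :: "real ^ 'n \<Rightarrow> real ^ 'n \<Rightarrow> real ^ 'n ^ 'n" where
  "outer u v = (\<chi> i j. u $ i * v $ j)"

definition bmat :: "(real ^ 'n::finite \<Rightarrow> real ^ 'n \<Rightarrow> real) \<Rightarrow> real ^ 'n ^ 'n" where
  "bmat f = (\<chi> i j. f (axis i 1) (axis j 1))"

lemma inner_matrix_vector:
  fixes M :: "real ^ 'n::finite ^ 'n"
  shows "u \<bullet> (M *v v) = (\<Sum>i\<in>UNIV. \<Sum>j\<in>UNIV. u $ i * v $ j * M $ i $ j)"
  by (simp add: inner_vec_def matrix_vector_mult_def sum_distrib_left mult_ac)

lemma bilinear_bmat:
  fixes f :: "real ^ 'n::finite \<Rightarrow> real ^ 'n \<Rightarrow> real"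
  assumes "bilinear f"
  shows "f u v = u \<bullet> (bmat f *v v)"
proof -
  have "f u v = f (\<Sum>i\<in>UNIV. u $ i *\<^sub>R axis i 1) (\<Sum>j\<in>UNIV. v $ j *\<^sub>R axis j 1)"
    using basis_expansion[of u] basis_expansion[of v] by (simp add: scalar_mult_eq_scaleR)
  also have "\<dots> = (\<Sum>(i, j)\<in>UNIV \<times> UNIV. f (u $ i *\<^sub>R axis i 1) (v $ j *\<^sub>R axis j 1))"
    by (rule bilinear_sum[OF assms])
  also have "\<dots> = (\<Sum>i\<in>UNIV. \<Sum>j\<in>UNIV. u $ i * v $ j * f (axis i 1) (axis j 1))"
    unfolding sum.cartesian_product[symmetric]
    by (simp add: bilinear_lmul[OF assms] bilinear_rmul[OF assms] mult_ac)
  finally show ?thesis by (simp add: inner_matrix_vector bmat_def)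
qed

lemma outer_mult_vector: "outer u v *v w = (v \<bullet> w) *\<^sub>R u"
  by (simp add: vec_eq_iff outer_def matrix_vector_mult_def inner_vec_def sum_distrib_left mult_ac)

lemma sum_matrix_vector: "(\<Sum>i\<in>I. M i) *v (w :: real ^ 'n::finite) = (\<Sum>i\<in>I. M i *v w)"
  by (induction I rule: infinite_finite_induct) (auto simp: matrix_vector_mult_add_rdistrib)

lemma scaleR_matrix_vector: "(a *\<^sub>R M) *v (w :: real ^ 'n::finite) = a *\<^sub>R (M *v w)"
  by (simp add: vec_eq_iff matrix_vector_mult_def sum_distrib_left mult_ac)

lemma trace_outer_mult:
  fixes M :: "real ^ 'n::finite ^ 'n"
  shows "trace (outer u v ** M) = v \<bullet> (M *v u)"
  unfolding inner_matrix_vector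
  by (subst sum.swap) (simp add: trace_def outer_def matrix_matrix_mult_def mult_ac)

lemma matrix_add_rdistrib: "((M :: real ^ 'n::finite ^ 'm) + N) ** (C :: real ^ 'k ^ 'n) = M ** C + N ** C"
  by (simp add: vec_eq_iff matrix_matrix_mult_def sum.distrib algebra_simps)

lemma matrix_minus_left: "(- (M :: real ^ 'n::finite ^ 'm)) ** (C :: real ^ 'k ^ 'n) = - (M ** C)"
  by (simp add: vec_eq_iff matrix_matrix_mult_def sum_negf)

lemma matrix_minus_right: "(M :: real ^ 'n::finite ^ 'm) ** (- (C :: real ^ 'k ^ 'n)) = - (M ** C)"
  by (simp add: vec_eq_iff matrix_matrix_mult_def sum_negf)

lemma matrix_diff_left: "((M :: real ^ 'n::finite ^ 'm) - N) ** (C :: real ^ 'k ^ 'n) = M ** C - N ** C"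
  using matrix_add_rdistrib[of M "- N" C] by (simp add: matrix_minus_left)

lemma matrix_diff_right: "(M :: real ^ 'n::finite ^ 'm) ** ((C :: real ^ 'k ^ 'n) - D) = M ** C - M ** D"
  using matrix_add_ldistrib[of M C "- D"] by (simp add: matrix_minus_right)

lemma matrix_scaleR_left: "(a *\<^sub>R (M :: real ^ 'n::finite ^ 'm)) ** (C :: real ^ 'k ^ 'n) = a *\<^sub>R (M ** C)"
  by (simp add: vec_eq_iff matrix_matrix_mult_def sum_distrib_left mult_ac)

lemma matrix_scaleR_right: "(M :: real ^ 'n::finite ^ 'm) ** (a *\<^sub>R (C :: real ^ 'k ^ 'n)) = a *\<^sub>R (M ** C)"
  by (simp add: vec_eq_iff matrix_matrix_mult_def sum_distrib_left mult_ac)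

lemma matrix_vector_minus_left: "(- (M :: real ^ 'n::finite ^ 'm)) *v x = - (M *v x)"
  by (simp add: vec_eq_iff matrix_vector_mult_def sum_negf)

lemma trace_minus: "trace (- (M :: real ^ 'n::finite ^ 'n)) = - trace M"
  by (simp add: trace_def sum_negf)

lemma trace_scaleR: "trace (a *\<^sub>R (M :: real ^ 'n::finite ^ 'n)) = a * trace M"
  by (simp add: trace_def sum_distrib_left)

lemmas matrix_ring = matrix_add_rdistrib matrix_add_ldistrib matrix_minus_left matrix_minus_right
  matrix_diff_left matrix_diff_right matrix_scaleR_left matrix_scaleR_right

lemmas trace_ring = trace_add trace_sub trace_minus trace_scaleR

lemma matrix_inv:
  fixes M :: "real ^ 'n::finite ^ 'n"
  assumes "invertible M"
  shows "matrix_inv M ** M = mat 1" "M ** matrix_inv M = mat 1"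
proof -
  have "M ** matrix_inv M = mat 1 \<and> matrix_inv M ** M = mat 1"
    unfolding matrix_inv_def using assms unfolding invertible_def by (rule someI_ex)
  then show "matrix_inv M ** M = mat 1" "M ** matrix_inv M = mat 1" by auto
qed

lemma matrix_mult_sum_left:
  "(\<Sum>i\<in>I. M i) ** (N :: real ^ 'n::finite ^ 'n) = (\<Sum>i\<in>I. M i ** N)"
  by (induction I rule: infinite_finite_induct) (auto simp: matrix_add_rdistrib)

lemma trace_sum: "trace (\<Sum>i\<in>I. M i :: real ^ 'n::finite ^ 'n) = (\<Sum>i\<in>I. trace (M i))"
  unfolding trace_def by (simp add: sum.swap[of _ UNIV I])

text \<open>Expanding the trace gives products of the entries at (i, j) and (j, i), which skewness
  turns into negative squares. The right-hand side sees the vectors only through the sum of their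
  outer squares, and this is how the frame is eliminated.\<close>

lemma sum_sq_eq_trace:
  fixes W :: "real ^ 'n::finite ^ 'n"
  assumes skew: "transpose W = - W"
  shows "(\<Sum>i\<in>I. \<Sum>j\<in>I. (f i \<bullet> (W *v f j))\<^sup>2)
    = - trace ((\<Sum>i\<in>I. outer (f i) (f i)) ** W ** (\<Sum>i\<in>I. outer (f i) (f i)) ** W)"
proof -
  have sk: "u \<bullet> (W *v v) = - (v \<bullet> (W *v u))" for u v
  proof -
    have "v \<bullet> (W *v u) = (transpose W *v v) \<bullet> u" by (simp add: dot_lmul_matrix)
    then show ?thesis unfolding skew matrix_vector_minus_left by (simp add: inner_commute)
  qed
  have "trace ((\<Sum>i\<in>I. outer (f i) (f i)) ** (W ** (\<Sum>i\<in>I. outer (f i) (f i)) ** W))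
    = (\<Sum>i\<in>I. \<Sum>j\<in>I. (f i \<bullet> (W *v f j)) * (f j \<bullet> (W *v f i)))"
    unfolding matrix_mult_sum_left trace_sum trace_outer_mult matrix_vector_mul_assoc[symmetric]
      sum_matrix_vector outer_mult_vector linear_sum[OF matrix_vector_mul_linear]
      linear_scale[OF matrix_vector_mul_linear] inner_sum_right inner_scaleR_right
    by (subst mult.commute) (rule refl)
  then show ?thesis
    by (simp add: matrix_mul_assoc power2_eq_square sum_negf[symmetric])
      (intro sum.cong refl, metis sk mult_minus_right)
qed

text \<open>The squared norm of the integrability tensor in terms of the Gram matrix, the components of
  \<open>\<xi>\<close>, and the differential \<open>W\<close> of the one-form dual to \<open>\<xi>\<close>; \<open>inv_perp\<close> is the inverse
  of the metric restricted to the complement of \<open>\<xi>\<close>.\<close>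

definition inv_perp :: "real ^ 'n::finite ^ 'n \<Rightarrow> real ^ 'n \<Rightarrow> real ^ 'n ^ 'n" where
  "inv_perp G x = matrix_inv G - (1 / (x \<bullet> (G *v x))) *\<^sub>R outer x x"

definition normsq_coord :: "real ^ 'n::finite ^ 'n \<Rightarrow> real ^ 'n ^ 'n \<Rightarrow> real ^ 'n \<Rightarrow> real" where
  "normsq_coord G W x = - trace (inv_perp G x ** W ** inv_perp G x ** W) / (4 * (x \<bullet> (G *v x)))"

lemma matrix_inv_eqI:
  fixes M N :: "real ^ 'n::finite ^ 'n"
  assumes "N ** M = mat 1"
  shows "matrix_inv M = N"
proof -
  have 1: "M ** N = mat 1" using assms by (simp add: matrix_left_right_inverse)
  then have "invertible M" using assms by (auto simp: invertible_def)
  then have "matrix_inv M = matrix_inv M ** (M ** N)" by (simp add: 1)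
  also have "\<dots> = N" using \<open>invertible M\<close> by (simp add: matrix_mul_assoc matrix_inv)
  finally show ?thesis .
qed

section \<open>Inner products and the splitting of a vector along \<xi>\<close>

locale inner_form =
  fixes h :: "real ^ 'n::finite \<Rightarrow> real ^ 'n \<Rightarrow> real"
  assumes bil: "bilinear h" and sym: "h u v = h v u" and pos: "u \<noteq> 0 \<Longrightarrow> h u u > 0"
begin

lemmas simps = bilinear_ladd[OF bil] bilinear_radd[OF bil] bilinear_lmul[OF bil] bilinear_rmul[OF bil]
  bilinear_lsub[OF bil] bilinear_rsub[OF bil] bilinear_lzero[OF bil] bilinear_rzero[OF bil]
  bilinear_lneg[OF bil] bilinear_rneg[OF bil]

lemma linear_left: "linear (\<lambda>u. h u v)" and linear_right: "linear (h u)"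
  using bil by (auto simp: bilinear_def)

lemma sum_left: "h (\<Sum>i\<in>I. f i) v = (\<Sum>i\<in>I. h (f i) v)"
  using linear_sum[OF linear_left] .

lemma sum_right: "h v (\<Sum>i\<in>I. f i) = (\<Sum>i\<in>I. h v (f i))"
  using linear_sum[OF linear_right] .

lemma eq_zeroI: "h v v = 0 \<Longrightarrow> v = 0"
  using pos by fastforce

lemma orthogonal_card:
  assumes "\<And>i. i < k \<Longrightarrow> b i \<noteq> 0" "\<And>i j. i < k \<Longrightarrow> j < k \<Longrightarrow> i \<noteq> j \<Longrightarrow> h (b i) (b j) = 0"
  shows "k \<le> CARD('n)"
proof -
  have inj: "inj_on b {..<k}"
    by (intro inj_onI) (metis assms eq_zeroI lessThan_iff)
  have "independent (b ` {..<k})"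
  proof (rule ccontr)
    assume "\<not> ?thesis"
    then obtain u w where u: "(\<Sum>v\<in>b ` {..<k}. u v *\<^sub>R v) = 0" "w \<in> b ` {..<k}" "u w \<noteq> 0"
      using dependent_finite[of "b ` {..<k}"] by auto
    then obtain i where i: "i < k" "w = b i" by auto
    have "0 = h (\<Sum>j<k. u (b j) *\<^sub>R b j) (b i)"
      using u(1) by (simp add: sum.reindex[OF inj] simps)
    also have "\<dots> = (\<Sum>j<k. if j = i then u (b i) * h (b i) (b i) else 0)"
      unfolding sum_left by (rule sum.cong) (use assms(2) i in \<open>auto simp: simps\<close>)
    also have "\<dots> = u w * h w w" using i by simp
    finally show False using u(3) eq_zeroI assms(1) i by auto
  qed
  then have "card (b ` {..<k}) \<le> DIM(real ^ 'n)" using independent_bound by blast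
  then show ?thesis using card_image[OF inj] by simp
qed

lemma tang_eq:
  assumes "H x = h" "\<xi> x \<noteq> 0"
  shows "tang (\<lambda>x. span {\<xi> x}) H x v = (h (\<xi> x) v / h (\<xi> x) (\<xi> x)) *\<^sub>R \<xi> x"
  unfolding tang_def
proof (rule the_equality)
  have "h (\<xi> x) (\<xi> x) \<noteq> 0" using pos[OF assms(2)] by simp
  then show "(h (\<xi> x) v / h (\<xi> x) (\<xi> x)) *\<^sub>R \<xi> x \<in> span {\<xi> x} \<and>
      v - (h (\<xi> x) v / h (\<xi> x) (\<xi> x)) *\<^sub>R \<xi> x \<in> perp (\<lambda>x. span {\<xi> x}) H x"
    by (auto simp: span_singleton perp_def assms(1) simps)
  fix w assume w: "w \<in> span {\<xi> x} \<and> v - w \<in> perp (\<lambda>x. span {\<xi> x}) H x"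
  then obtain a where a: "w = a *\<^sub>R \<xi> x" by (auto simp: span_singleton)
  have "h (\<xi> x) (v - w) = 0" using w span_base[of "\<xi> x" "{\<xi> x}"] by (auto simp: perp_def assms(1))
  then have "h (\<xi> x) v = a * h (\<xi> x) (\<xi> x)" by (simp add: a simps)
  then show "w = (h (\<xi> x) v / h (\<xi> x) (\<xi> x)) *\<^sub>R \<xi> x"
    using \<open>h (\<xi> x) (\<xi> x) \<noteq> 0\<close> by (simp add: a)
qed

lemma perp_span_iff: "H x = h \<Longrightarrow> v \<in> perp (\<lambda>x. span {\<xi> x}) H x \<longleftrightarrow> h (\<xi> x) v = 0"
  using span_base[of "\<xi> x" "{\<xi> x}"] by (auto simp: perp_def span_singleton simps)

lemma orthonormal_expand:
  fixes q :: nat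
  assumes "\<And>i j. i < q \<Longrightarrow> j < q \<Longrightarrow> h (f i) (f j) = (if i = j then 1 else 0)"
    and "v \<in> span (f ` {..<q})"
  shows "v = (\<Sum>i<q. h (f i) v *\<^sub>R f i)"
  using assms(2)
proof (induction rule: span_induct_alt)
  case base
  then show ?case by (simp add: simps)
next
  case (step a x y)
  then obtain j where j: "j < q" "x = f j" by auto
  have "(\<Sum>i<q. h (f i) x *\<^sub>R f i) = (\<Sum>i<q. if i = j then f j else 0)"
    by (rule sum.cong) (use assms(1) j in auto)
  also have "\<dots> = x" by (subst sum.delta) (use j in auto)
  finally have "(\<Sum>i<q. h (f i) x *\<^sub>R f i) = x" .
  then have "(\<Sum>i<q. h (f i) (a *\<^sub>R x + y) *\<^sub>R f i) = a *\<^sub>R x + y"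
    using step by (simp add: simps scaleR_add_left sum.distrib scaleR_scaleR[symmetric] scaleR_sum_right[symmetric]
        del: scaleR_scaleR)
  then show ?case by simp
qed

text \<open>Subtracting the expansion along the \<open>f i\<close> leaves a vector orthogonal to
  them and to \<open>\<xi>\<close>. Were it nonzero, there would be more mutually orthogonal nonzero
  vectors than the dimension allows.\<close>

lemma orthonormal_span_perp:
  assumes on: "\<And>i j. i < q \<Longrightarrow> j < q \<Longrightarrow> h (f i) (f j) = (if i = j then 1 else 0)"
    and perp: "\<And>i. i < q \<Longrightarrow> h \<xi> (f i) = 0" and "\<xi> \<noteq> 0" and q: "Suc q = CARD('n)"
  shows "span (f ` {..<q}) = {v. h \<xi> v = 0}"
proof (intro equalityI subsetI)
  fix v assume "v \<in> span (f ` {..<q})"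
  then show "v \<in> {v. h \<xi> v = 0}"
    by (induction rule: span_induct_alt) (auto simp: simps perp)
next
  fix v assume "v \<in> {v. h \<xi> v = 0}"
  then have v: "h \<xi> v = 0" by simp
  define u where "u = v - (\<Sum>i<q. h (f i) v *\<^sub>R f i)"
  have u1: "h (f j) u = 0" if "j < q" for j
  proof -
    have "(\<Sum>i<q. h (f i) v * h (f j) (f i)) = (\<Sum>i<q. if i = j then h (f j) v else 0)"
      by (rule sum.cong) (use on that in auto)
    then show ?thesis using that by (simp add: u_def simps sum_right)
  qed
  have u2: "h \<xi> u = 0" using v perp by (simp add: u_def simps sum_right)
  have "u = 0"
  proof (rule ccontr)
    assume u0: "u \<noteq> 0"
    define b where "b i = (if i < q then f i else if i = q then \<xi> else u)" for i
    have "f i \<noteq> 0" if "i < q" for i using on[OF that that] by (auto simp: simps)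
    then have "Suc (Suc q) \<le> CARD('n)"
      by (intro orthogonal_card[of _ b])
        (use on perp u1 u2 u0 assms(3) sym in \<open>auto simp: b_def\<close>)
    then show False using q by simp
  qed
  then have "v = (\<Sum>i<q. h (f i) v *\<^sub>R f i)" by (simp add: u_def)
  also have "\<dots> \<in> span (f ` {..<q})" by (intro span_sum span_scale span_base) auto
  finally show "v \<in> span (f ` {..<q})" .
qed

end

section \<open>Orthonormal frames and the norm of the integrability tensor\<close>

definition gmat ::
  "('a, 'n::finite) chart set \<Rightarrow> ('a, 'n) chart \<Rightarrow> ('a, 'n) two_tensor \<Rightarrow> 'a \<Rightarrow> real ^ 'n ^ 'n" where
  "gmat A c H x = bmat (\<lambda>u v. H x (cvec A c x u) (cvec A c x v))"

definition omat ::
  "('a, 'n::finite) chart set \<Rightarrow> ('a, 'n) chart \<Rightarrow> ('a, 'n) one_form \<Rightarrow> 'a \<Rightarrow> real ^ 'n ^ 'n" where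
  "omat A c \<beta> x = bmat (dform A c \<beta> x)"

lemma inner_form_metric: "riemannian_metric A H \<Longrightarrow> inner_form (H x)"
  by (auto simp: riemannian_metric_def inner_form_def)

lemma bilinear_pullback:
  assumes "bilinear h" "linear f"
  shows "bilinear (\<lambda>u v. h (f u) (f v))"
  using assms linear_compose[OF assms(2)] unfolding bilinear_def by (auto simp: o_def)

context smooth_manifold
begin

lemma dform_bilinear:
  assumes "C1_form A \<beta>" "c \<in> A" "x \<in> fst c"
  shows "bilinear (dform A c \<beta> x)"
proof -
  have "(\<lambda>u. dform A c \<beta> x u v) = (\<lambda>u. - dform A c \<beta> x v u)" for v
    by (rule ext) (rule dform_swap)
  then show ?thesis
    using dform_linear[OF assms] linear_compose_neg by (auto simp: bilinear_def)
qed

lemma dform_omat: "C1_form A \<beta> \<Longrightarrow> c \<in> A \<Longrightarrow> x \<in> fst c \<Longrightarrow> dform A c \<beta> x u v = u \<bullet> (omat A c \<beta> x *v v)"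
  unfolding omat_def by (rule bilinear_bmat[OF dform_bilinear])

lemma transpose_omat: "transpose (omat A c \<beta> x) = - omat A c \<beta> x"
  unfolding omat_def bmat_def transpose_def vec_eq_iff by (simp, metis dform_swap)

lemma gmat_eq:
  assumes "riemannian_metric A H" "c \<in> A" "x \<in> fst c"
  shows "H x (cvec A c x u) (cvec A c x v) = u \<bullet> (gmat A c H x *v v)"
  unfolding gmat_def
  by (rule bilinear_bmat[OF bilinear_pullback])
    (use assms cvec_linear[OF assms(2,3)] in \<open>auto simp: riemannian_metric_def\<close>)

lemma gmat_components:
  assumes "riemannian_metric A H" "c \<in> A" "x \<in> fst c"
  shows "H x u v = components A c x u \<bullet> (gmat A c H x *v components A c x v)"
  using gmat_eq[OF assms, of "components A c x u" "components A c x v"] assms by simp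

lemma gram_det_eq: "gram_det A H c x = det (gmat A c H x)"
  by (simp add: gram_det_def gmat_def bmat_def coordinate_vector_eq)

lemma metric_smooth:
  "riemannian_metric A H \<Longrightarrow> open U \<Longrightarrow> smooth_field_on A U X \<Longrightarrow> smooth_field_on A U Y \<Longrightarrow>
    smooth_function_on A U (\<lambda>x. H x (X x) (Y x))"
  unfolding riemannian_metric_def by blast

lemma dual_form_C1:
  assumes "riemannian_metric A H" "smooth_field_on A UNIV \<xi>"
  shows "C1_form A (\<lambda>x. H x (\<xi> x))"
proof (rule smooth_one_form_C1)
  show "smooth_one_form A (\<lambda>x. H x (\<xi> x))"
    unfolding smooth_one_form_def
  proof (intro conjI allI impI)
    show "linear (H x (\<xi> x))" for x by (rule inner_form.linear_right[OF inner_form_metric[OF assms(1)]])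
    fix U :: "'a set" and X assume U: "open U" and X: "smooth_field_on A U X"
    show "smooth_function_on A U (\<lambda>x. H x (\<xi> x) (X x))"
      by (rule metric_smooth[OF assms(1) U _ X]) (rule smooth_field_on_subset[OF assms(2)], simp)
  qed
qed

text \<open>Gram-Schmidt with fields instead of vectors, started from \<open>\<xi>\<close>. The
  neighbourhood shrinks at each step to where the new field stays nonzero.\<close>

lemma orthonormal_fields_exist:
  assumes H: "riemannian_metric A H" and \<xi>: "smooth_field_on A UNIV \<xi>" "\<And>x. \<xi> x \<noteq> 0"
    and "q < CARD('n)"
  shows "\<exists>U F. open U \<and> x \<in> U \<and> (\<forall>i<q. smooth_field_on A U (F i)) \<and>
    (\<forall>y\<in>U. \<forall>i<q. H y (\<xi> y) (F i y) = 0 \<and> (\<forall>j<q. H y (F i y) (F j y) = (if i = j then 1 else 0)))"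
  using assms(4)
proof (induction q)
  case 0
  show ?case by (rule exI[of _ UNIV]) auto
next
  case (Suc q)
  then obtain U F where U: "open U" "x \<in> U" and F: "\<And>i. i < q \<Longrightarrow> smooth_field_on A U (F i)"
    and on: "\<And>y i. y \<in> U \<Longrightarrow> i < q \<Longrightarrow> H y (\<xi> y) (F i y) = 0"
    "\<And>y i j. y \<in> U \<Longrightarrow> i < q \<Longrightarrow> j < q \<Longrightarrow> H y (F i y) (F j y) = (if i = j then 1 else 0)"
    by (metis Suc_lessD)
  interpret h: inner_form "H y" for y using inner_form_metric[OF H] .
  define c where "c = chart_at A x"
  have c: "c \<in> A" "x \<in> fst c" using chart_at by (auto simp: c_def)
  have "dim (insert (\<xi> x) ((\<lambda>i. F i x) ` {..<q})) \<le> card (insert (\<xi> x) ((\<lambda>i. F i x) ` {..<q}))"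
    by (rule dim_le_card') simp
  also have "\<dots> \<le> Suc (card ((\<lambda>i. F i x) ` {..<q}))" by (rule card_insert_le_m1) auto
  also have "\<dots> \<le> Suc q" using card_image_le[of "{..<q}" "\<lambda>i. F i x"] by simp
  finally have "dim (insert (\<xi> x) ((\<lambda>i. F i x) ` {..<q})) < DIM(real ^ 'n)" using Suc.prems by simp
  then have "span (insert (\<xi> x) ((\<lambda>i. F i x) ` {..<q})) \<noteq> UNIV"
    by (metis dim_UNIV dim_span less_irrefl)
  then obtain w where w: "w \<notin> span (insert (\<xi> x) ((\<lambda>i. F i x) ` {..<q}))" by blast
  define V' where "V' = U \<inter> fst c"
  have V': "open V'" "V' \<subseteq> U" "V' \<subseteq> fst c" "x \<in> V'" using U c by (auto simp: V'_def)
  define W where "W y = cvec A c y w" for y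
  have W: "smooth_field_on A V' W"
    unfolding W_def[abs_def] by (rule smooth_field_on_subset[OF smooth_field_cvec[OF c(1)] V'(3)])
  have F': "smooth_field_on A V' (F i)" if "i < q" for i
    by (rule smooth_field_on_subset[OF F[OF that] V'(2)])
  have \<xi>': "smooth_field_on A V' \<xi>" by (rule smooth_field_on_subset[OF \<xi>(1)]) simp
  \<comment> \<open>The components along the earlier fields and along \<open>\<xi>\<close> are
    removed from \<open>W\<close>. The field \<open>\<xi>\<close> is not normalised, hence the
    inverse of its squared length.\<close>
  define Z where "Z y = W y + ((-1) *\<^sub>R (\<Sum>i<q. H y (W y) (F i y) *\<^sub>R F i y)
      + (-1) *\<^sub>R ((H y (W y) (\<xi> y) * inverse (H y (\<xi> y) (\<xi> y))) *\<^sub>R \<xi> y))" for y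
  have \<kappa>: "H y (\<xi> y) (\<xi> y) \<noteq> 0" for y using h.pos[OF \<xi>(2)] by (metis less_irrefl)
  have Z: "smooth_field_on A V' Z"
    unfolding Z_def[abs_def]
    by (rule smooth_field_add[OF V'(1) W] smooth_field_add[OF V'(1)] smooth_field_scale[OF V'(1)]
        smooth_function_const smooth_field_sum[OF V'(1)] smooth_function_mult[OF V'(1)]
        smooth_function_inverse[OF V'(1)] metric_smooth[OF H V'(1)] W F' \<xi>' \<kappa> | simp)+
  have HZ: "smooth_function_on A V' (\<lambda>y. H y (Z y) (Z y))" by (rule metric_smooth[OF H V'(1) Z Z])
  define N where "N = {y \<in> V'. H y (Z y) (Z y) > 0}"
  have "open N"
    unfolding N_def using continuous_open_preimage[OF smooth_function_continuous[OF V'(1) HZ] V'(1), of "{0<..}"]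
    by (simp add: vimage_def Int_def)
  \<comment> \<open>If \<open>Z\<close> vanished at \<open>x\<close>, the vector \<open>w\<close>
    would lie in the span that it was chosen to avoid; at \<open>x\<close> the coordinate field
    \<open>W\<close> has the value \<open>w\<close> because \<open>c\<close> is the preferred
    chart.\<close>
  have "Z x \<noteq> 0"
  proof
    assume "Z x = 0"
    then have "W x = (\<Sum>i<q. H x (W x) (F i x) *\<^sub>R F i x)
      + (H x (W x) (\<xi> x) * inverse (H x (\<xi> x) (\<xi> x))) *\<^sub>R \<xi> x" by (simp add: Z_def algebra_simps)
    also have "\<dots> \<in> span (insert (\<xi> x) ((\<lambda>i. F i x) ` {..<q}))"
      by (intro span_add span_sum span_scale span_base) auto
    finally show False using w by (simp add: W_def c_def)
  qed
  then have xN: "x \<in> N" using V' h.pos by (simp add: N_def)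
  define E where "E y = inverse (sqrt (H y (Z y) (Z y))) *\<^sub>R Z y" for y
  have N: "N \<subseteq> V'" "\<And>y. y \<in> N \<Longrightarrow> H y (Z y) (Z y) > 0" by (auto simp: N_def)
  have sq: "sqrt (H y (Z y) (Z y)) \<noteq> 0" if "y \<in> N" for y using N(2)[OF that] by simp
  have E: "smooth_field_on A N E"
    unfolding E_def[abs_def]
    by (intro smooth_field_scale \<open>open N\<close> smooth_function_inverse smooth_function_sqrt N(2) sq
        smooth_function_on_subset[OF HZ N(1)] smooth_field_on_subset[OF Z N(1)])
  have Z1: "H y (\<xi> y) (Z y) = 0" if "y \<in> N" for y
    using on(1)[of y] that N(1) V'(2) \<kappa>[of y] h.sym[of y "\<xi> y" "W y"]
    by (simp add: Z_def h.simps h.sum_right subset_iff)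
  have Z2: "H y (F j y) (Z y) = 0" if y: "y \<in> N" and j: "j < q" for y j
  proof -
    have y: "y \<in> U" using y N V' by auto
    have "(\<Sum>i<q. H y (W y) (F i y) * H y (F j y) (F i y)) = (\<Sum>i<q. if i = j then H y (W y) (F j y) else 0)"
      by (rule sum.cong) (use on(2)[OF y j] in auto)
    then show ?thesis
      using on(1)[OF y j] j h.sym[of y "F j y" "\<xi> y"] h.sym[of y "F j y" "W y"]
      by (simp add: Z_def h.simps h.sum_right)
  qed
  define F2 where "F2 i = (if i < q then F i else E)" for i
  show ?case
  proof (intro exI[of _ N] exI[of _ F2] conjI allI impI ballI)
    show "open N" "x \<in> N" by fact+
    show "smooth_field_on A N (F2 i)" for i
      using E smooth_field_on_subset[OF F'[of i] N(1)] by (simp add: F2_def)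
    fix y i assume y: "y \<in> N" and i: "i < Suc q"
    have yU: "y \<in> U" using y N V' by auto
    show "H y (\<xi> y) (F2 i y) = 0"
      using on(1)[OF yU] Z1[OF y] by (simp add: F2_def E_def h.simps)
    fix j assume j: "j < Suc q"
    have "H y (E y) (E y) = 1"
      using N(2)[OF y] by (simp add: E_def h.simps field_simps)
    moreover have "H y (F k y) (E y) = 0" "H y (E y) (F k y) = 0" if "k < q" for k
      using Z2[OF y that] h.sym[of y "E y" "F k y"] by (simp_all add: E_def h.simps)
    ultimately show "H y (F2 i y) (F2 j y) = (if i = j then 1 else 0)"
      using i j on(2)[OF yU, of i j] by (auto simp: F2_def less_Suc_eq)
  qed
qed

text \<open>Guarantees that the choice in \<open>integrability_normsq\<close> is made from a
  nonempty set of values.\<close>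

lemma local_frame_exists:
  assumes H: "riemannian_metric A H" and \<xi>: "smooth_field_on A UNIV \<xi>" "\<And>x. \<xi> x \<noteq> 0"
  shows "\<exists>U q F. x \<in> U \<and> local_orthonormal_frame A H (perp (\<lambda>x. span {\<xi> x}) H) U q F"
proof -
  interpret h: inner_form "H y" for y using inner_form_metric[OF H] .
  define q where "q = CARD('n) - 1"
  have q: "Suc q = CARD('n)" by (simp add: q_def)
  then have "q < CARD('n)" by simp
  from orthonormal_fields_exist[OF H \<xi> this, of x]
  obtain U F where U: "open U" "x \<in> U" and F: "\<And>i. i < q \<Longrightarrow> smooth_field_on A U (F i)"
    and on: "\<And>y i. y \<in> U \<Longrightarrow> i < q \<Longrightarrow> H y (\<xi> y) (F i y) = 0"
    "\<And>y i j. y \<in> U \<Longrightarrow> i < q \<Longrightarrow> j < q \<Longrightarrow> H y (F i y) (F j y) = (if i = j then 1 else 0)"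
    by metis
  have "span ((\<lambda>i. F i y) ` {..<q}) = perp (\<lambda>x. span {\<xi> x}) H y" if "y \<in> U" for y
    using h.orthonormal_span_perp[where y = y and q = q and f = "\<lambda>i. F i y" and \<xi> = "\<xi> y"]
      on that \<xi>(2) q h.perp_span_iff[where H = H and x = y and \<xi> = \<xi>] by auto
  then have "local_orthonormal_frame A H (perp (\<lambda>x. span {\<xi> x}) H) U q F"
    using U F on by (auto simp: local_orthonormal_frame_def)
  then show ?thesis using U by blast
qed

text \<open>Every admissible frame leads to the same expression: brackets of frame fields become
  entries of the differential of the dual form, and the sum of outer squares of the frame is
  \<open>inv_perp\<close>. Hence the arbitrary choice in the definition has a determined
  value.\<close>

lemma integrability_normsq_eq:
  assumes H: "riemannian_metric A H" and \<xi>: "smooth_field_on A UNIV \<xi>" "\<And>x. \<xi> x \<noteq> 0"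
    and c: "c \<in> A" "x \<in> fst c"
  shows "integrability_normsq A (\<lambda>x. span {\<xi> x}) H x
    = normsq_coord (gmat A c H x) (omat A c (\<lambda>y. H y (\<xi> y)) x) (components A c x (\<xi> x))"
proof -
  let ?E = "\<lambda>x. span {\<xi> x}" and ?\<theta> = "\<lambda>y. H y (\<xi> y)"
  interpret h: inner_form "H y" for y using inner_form_metric[OF H] .
  have \<theta>: "C1_form A ?\<theta>" by (rule dual_form_C1[OF H \<xi>(1)])
  define \<kappa> where "\<kappa> = H x (\<xi> x) (\<xi> x)"
  have \<kappa>: "\<kappa> > 0" using h.pos \<xi>(2) by (simp add: \<kappa>_def)
  have main: "s = normsq_coord (gmat A c H x) (omat A c ?\<theta> x) (components A c x (\<xi> x))"
    if x: "x \<in> U" and fr: "local_orthonormal_frame A H (perp ?E H) U q F"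
      and s: "s = (\<Sum>i<q. \<Sum>j<q. H x (F i x) (F i x) * H x (F j x) (F j x) *
               H x (integrability_tensor A ?E H (F i) (F j) x) (integrability_tensor A ?E H (F i) (F j) x))"
    for s U q F
  proof -
    have U: "open U" and F: "\<And>i. i < q \<Longrightarrow> smooth_field_on A U (F i)"
      and sp: "\<And>y. y \<in> U \<Longrightarrow> span ((\<lambda>i. F i y) ` {..<q}) = perp ?E H y"
      and on0: "\<And>y i j. y \<in> U \<Longrightarrow> i < q \<Longrightarrow> j < q \<Longrightarrow> \<bar>H y (F i y) (F j y)\<bar> = (if i = j then 1 else 0)"
      using fr by (auto simp: local_orthonormal_frame_def)
    \<comment> \<open>The definition allows frame vectors of squared length -1; positivity of the
      metric excludes that sign.\<close>
    have on: "H y (F i y) (F j y) = (if i = j then 1 else 0)" if "y \<in> U" "i < q" "j < q" for y i j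
    proof -
      have "H y (F i y) (F i y) \<ge> 0" using h.pos[of "F i y" y] by (cases "F i y = 0") (auto simp: h.simps)
      then show ?thesis using on0[OF that] by (auto split: if_splits)
    qed
    have pp: "H y (\<xi> y) (F i y) = 0" if "y \<in> U" "i < q" for y i
      using sp[OF that(1)] span_base[of "F i y" "(\<lambda>i. F i y) ` {..<q}"] that h.perp_span_iff[where H = H and x = y and \<xi> = \<xi>] by auto
    define f where "f i = components A c x (F i x)" for i
    define x' where "x' = components A c x (\<xi> x)"
    define G where "G = gmat A c H x"
    define W where "W = omat A c ?\<theta> x"
    have \<kappa>': "x' \<bullet> (G *v x') = \<kappa>" by (simp add: \<kappa>_def gmat_components[OF H c] x'_def G_def)
    have summand: "H x (F i x) (F i x) * H x (F j x) (F j x) *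
        H x (integrability_tensor A ?E H (F i) (F j) x) (integrability_tensor A ?E H (F i) (F j) x)
        = (f i \<bullet> (W *v f j))\<^sup>2 / (4 * \<kappa>)" if "i < q" "j < q" for i j
    proof -
      have "?\<theta> x (lie_bracket A (F i) (F j) x) = - dform A (chart_at A x) ?\<theta> x (F i x) (F j x)"
        by (rule form_lie_bracket[OF \<theta> U x F F]) (use pp that in auto)
      also have "dform A (chart_at A x) ?\<theta> x (F i x) (F j x) = dform A c ?\<theta> x (f i) (f j)"
        unfolding f_def components_eq by (rule dform_transition[OF \<theta> chart_at c, symmetric])
      also have "\<dots> = f i \<bullet> (W *v f j)" unfolding W_def by (rule dform_omat[OF \<theta> c])
      finally have b: "H x (\<xi> x) (lie_bracket A (F i) (F j) x) = - (f i \<bullet> (W *v f j))" .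
      show ?thesis
        using \<kappa> on[OF x] that
        by (simp add: integrability_tensor_def h.tang_eq[where H = H and x = x and \<xi> = \<xi>, OF refl \<xi>(2)] h.simps b \<kappa>_def[symmetric]
            power2_eq_square field_simps)
    qed
    define P where "P = (\<Sum>i<q. outer (f i) (f i))"
    \<comment> \<open>Completeness of the basis formed by the frame and \<open>\<xi>\<close>: the
      matrix rebuilds the coordinates \<open>w\<close> of any vector from its inner products with
      these fields. The weight \<open>1 / \<kappa>\<close> accounts for the length of
      \<open>\<xi>\<close>.\<close>
    have "(P + (1 / \<kappa>) *\<^sub>R outer x' x') ** G = mat 1"
    proof (subst matrix_eq, rule allI)
      fix w
      define v where "v = cvec A c x w"
      define u where "u = v - (H x (\<xi> x) v / \<kappa>) *\<^sub>R \<xi> x"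
      have w: "w = components A c x v" using c by (simp add: v_def)
      have "u \<in> span ((\<lambda>i. F i x) ` {..<q})"
        unfolding sp[OF x] using h.perp_span_iff[where H = H and x = x and \<xi> = \<xi>] \<kappa> by (simp add: u_def h.simps \<kappa>_def[symmetric])
      from h.orthonormal_expand[OF on[OF x] this] have "u = (\<Sum>i<q. H x (F i x) u *\<^sub>R F i x)" by simp
      moreover have "H x (F i x) u = H x (F i x) v" if "i < q" for i
        using pp[OF x that] h.sym[of x "F i x" "\<xi> x"] by (simp add: u_def h.simps)
      ultimately have "v = (\<Sum>i<q. H x (F i x) v *\<^sub>R F i x) + (H x (\<xi> x) v / \<kappa>) *\<^sub>R \<xi> x"
        by (simp add: u_def algebra_simps)
      then have "w = components A c x ((\<Sum>i<q. H x (F i x) v *\<^sub>R F i x) + (H x (\<xi> x) v / \<kappa>) *\<^sub>R \<xi> x)"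
        unfolding w by (rule arg_cong)
      also have "\<dots> = (\<Sum>i<q. H x (F i x) v *\<^sub>R f i) + (H x (\<xi> x) v / \<kappa>) *\<^sub>R x'"
        unfolding f_def x'_def
        by (simp only: linear_add[OF components_linear[OF c]] linear_sum[OF components_linear[OF c]]
            linear_scale[OF components_linear[OF c]])
      finally have "w = (\<Sum>i<q. H x (F i x) v *\<^sub>R f i) + (H x (\<xi> x) v / \<kappa>) *\<^sub>R x'" .
      moreover have "H x y v = components A c x y \<bullet> (G *v w)" for y
        unfolding G_def w by (rule gmat_components[OF H c])
      ultimately show "(P + (1 / \<kappa>) *\<^sub>R outer x' x') ** G *v w = mat 1 *v w"
        by (simp add: matrix_vector_mul_assoc[symmetric] matrix_vector_mult_add_rdistrib P_def
            sum_matrix_vector outer_mult_vector scaleR_matrix_vector f_def x'_def)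
    qed
    then have "matrix_inv G = P + (1 / \<kappa>) *\<^sub>R outer x' x'" by (rule matrix_inv_eqI)
    then have P: "inv_perp G x' = P" by (simp add: inv_perp_def \<kappa>')
    have "s = (\<Sum>i<q. \<Sum>j<q. (f i \<bullet> (W *v f j))\<^sup>2 / (4 * \<kappa>))" unfolding s using summand by simp
    also have "\<dots> = (\<Sum>i<q. \<Sum>j<q. (f i \<bullet> (W *v f j))\<^sup>2) / (4 * \<kappa>)" by (simp add: sum_divide_distrib)
    also have "\<dots> = normsq_coord G W x'"
      using sum_sq_eq_trace[of W f "{..<q}"] transpose_omat[of c ?\<theta> x]
      by (simp add: normsq_coord_def P \<kappa>' P_def W_def)
    finally show ?thesis by (simp add: G_def W_def x'_def)
  qed
  have "\<exists>s U q F. x \<in> U \<and> local_orthonormal_frame A H (perp ?E H) U q F \<and>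
        s = (\<Sum>i<q. \<Sum>j<q. H x (F i x) (F i x) * H x (F j x) (F j x) *
               H x (integrability_tensor A ?E H (F i) (F j) x) (integrability_tensor A ?E H (F i) (F j) x))"
    using local_frame_exists[OF H \<xi>, of x] by blast
  from someI_ex[OF this] show ?thesis
    unfolding integrability_normsq_def using main by blast
qed

end

section \<open>Change of variables for nonnegative integrals\<close>

text \<open>The change of variables theorems of HOL-Analysis require a well-ordered index type; a copy of
  the index type with the order induced by an enumeration removes this restriction.\<close>

typedef 'n ix = "UNIV :: 'n set" ..

instance ix :: (finite) finite
  by standard (metis (full_types) Abs_ix_cases UNIV_I ex_new_if_finite finite finite_imageI imageI)

instantiation ix :: (finite) wellorder
begin

definition "x \<le> y \<longleftrightarrow> to_nat (Rep_ix x) \<le> to_nat (Rep_ix y)"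
definition "x < y \<longleftrightarrow> to_nat (Rep_ix x) < to_nat (Rep_ix y)"

instance
proof
  fix x y z :: "'a ix" and P
  show "(x < y) = (x \<le> y \<and> \<not> y \<le> x)" "x \<le> x" "x \<le> y \<Longrightarrow> y \<le> z \<Longrightarrow> x \<le> z" "x \<le> y \<or> y \<le> x"
    by (auto simp: less_eq_ix_def less_ix_def)
  show "x \<le> y \<Longrightarrow> y \<le> x \<Longrightarrow> x = y"
    by (auto simp: less_eq_ix_def Rep_ix_inject)
  show "P z" if step: "\<And>x. (\<And>y. y < x \<Longrightarrow> P y) \<Longrightarrow> P x"
  proof (induction "to_nat (Rep_ix z)" arbitrary: z rule: less_induct)
    case less
    show ?case by (rule step, rule less) (simp add: less_ix_def)
  qed
qed

end

lemma bij_Rep_ix: "bij (Rep_ix :: 'n ix \<Rightarrow> 'n)"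
  by (rule bijI') (auto simp: Rep_ix_inject intro: Abs_ix_inverse[symmetric])

lemma det_reindex:
  fixes M :: "real ^ 'n::finite ^ 'n" and e :: "'m::finite \<Rightarrow> 'n"
  assumes "bij e"
  shows "det (\<chi> i j. M $ e i $ e j) = det M"
proof -
  have inj: "inj_on e UNIV" and inv: "inv e (e x) = x" "e (inv e y) = y" for x y
    using assms by (auto simp: bij_def surj_f_inv_f)
  have b: "bij_betw e UNIV UNIV" "bij_betw (inv e) UNIV UNIV" using assms bij_imp_bij_inv by auto
  show ?thesis
    unfolding det_def
  proof (rule sum.reindex_bij_witness[of _ "map_permutation UNIV (inv e)" "map_permutation UNIV e"])
    fix p :: "'m \<Rightarrow> 'm" assume p: "p \<in> {p. p permutes UNIV}"
    show "map_permutation UNIV (inv e) (map_permutation UNIV e p) = p"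
      by (rule map_permutation_compose_inv[OF b(1)]) (use p inv in auto)
    show "map_permutation UNIV e p \<in> {p. p permutes UNIV}"
      using map_permutation_permutes[OF b(1)] p by auto
    have "(\<Prod>i\<in>UNIV. M $ i $ map_permutation UNIV e p i) = (\<Prod>i\<in>UNIV. M $ e i $ map_permutation UNIV e p (e i))"
      using prod.reindex_bij_betw[OF b(1), of "\<lambda>i. M $ i $ map_permutation UNIV e p i"] by simp
    then show "of_int (sign (map_permutation UNIV e p)) * (\<Prod>i\<in>UNIV. M $ i $ map_permutation UNIV e p i)
      = of_int (sign p) * (\<Prod>i\<in>UNIV. (\<chi> i j. M $ e i $ e j) $ i $ p i)"
      using p by (simp add: sign_map_permutation[OF inj(1)] map_permutation_apply[OF inj(1)])
  next
    fix p :: "'n \<Rightarrow> 'n" assume p: "p \<in> {p. p permutes UNIV}"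
    show "map_permutation UNIV e (map_permutation UNIV (inv e) p) = p"
      by (rule map_permutation_compose_inv[OF b(2)]) (use p inv in auto)
    show "map_permutation UNIV (inv e) p \<in> {p. p permutes UNIV}"
      using map_permutation_permutes[OF b(2)] p by auto
  qed
qed

text \<open>\<open>has_measure_differentiable_image\<close> relates images of finite measure to
  integrable Jacobians. The infinite case follows by contradiction: an image of finite measure would
  make the Jacobian integrable.\<close>

lemma emeasure_differentiable_image_wellorder:
  fixes f :: "real ^ 'n::{finite,wellorder} \<Rightarrow> real ^ 'n::_"
  assumes S: "S \<in> sets borel" "f ` S \<in> sets borel" and inj: "inj_on f S"
    and der: "\<And>x. x \<in> S \<Longrightarrow> (f has_derivative f' x) (at x)"
    and m: "(\<lambda>x. indicator S x * \<bar>det (matrix (f' x))\<bar>) \<in> borel_measurable borel"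
  shows "emeasure lborel (f ` S) = (\<integral>\<^sup>+x. ennreal (indicator S x * \<bar>det (matrix (f' x))\<bar>) \<partial>lborel)"
    (is "_ = ?I")
proof -
  have S': "S \<in> sets lebesgue" using S by auto
  have der': "(f has_derivative f' x) (at x within S)" if "x \<in> S" for x
    using der[OF that] has_derivative_at_withinI by blast
  note * = has_measure_differentiable_image[OF S' der' inj]
  show ?thesis
  proof (cases "?I = \<infinity>")
    case True
    have "emeasure lborel (f ` S) = \<infinity>"
    proof (rule ccontr)
      assume "emeasure lborel (f ` S) \<noteq> \<infinity>"
      then have "f ` S \<in> lmeasurable" using S by (auto simp: fmeasurable_def less_top)
      then have "((\<lambda>x. \<bar>det (matrix (f' x))\<bar>) has_integral measure lebesgue (f ` S)) S" using * by blast
      from nn_integral_has_integral_lebesgue[OF _ this] True show False by simp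
    qed
    then show ?thesis using True by simp
  next
    case False
    then obtain r where r: "r \<ge> 0" "?I = ennreal r"
      by (cases ?I) auto
    have "((\<lambda>x. indicator S x * \<bar>det (matrix (f' x))\<bar>) has_integral r) UNIV"
      by (rule nn_integral_has_integral[OF m _ r(2,1)]) simp
    then have "((\<lambda>x. \<bar>det (matrix (f' x))\<bar>) has_integral r) S"
      unfolding has_integral_restrict_UNIV[of S, symmetric]
      by (rule has_integral_eq[rotated]) (auto simp: indicator_def)
    then have "f ` S \<in> lmeasurable" "measure lebesgue (f ` S) = r" using * by blast+
    then have "emeasure lebesgue (f ` S) = ennreal r" by (metis emeasure_eq_measure2)
    then show ?thesis unfolding r(2) using S(2) by simp
  qed
qed

text \<open>Relabelling coordinates sends boxes to boxes with the same side lengths, and the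
  measures of boxes determine Lebesgue measure.\<close>

lemma lborel_reindex:
  fixes e :: "'m::finite \<Rightarrow> 'n::finite"
  assumes "bij e"
  shows "distr lborel borel (\<lambda>v :: real ^ 'n. \<chi> i. v $ e i) = (lborel :: (real ^ 'm) measure)"
proof (rule sym, rule lborel_eqI)
  let ?T = "\<lambda>v :: real ^ 'n. \<chi> i. v $ e i" and ?R = "\<lambda>v :: real ^ 'm. \<chi> i. v $ inv e i"
  have inv: "inv e (e x) = x" "e (inv e y) = y" for x y
    using assms by (auto simp: bij_def surj_f_inv_f)
  have T: "?T \<in> borel_measurable lborel"
    by (auto intro!: borel_measurable_continuous_onI continuous_intros)
  fix l u :: "real ^ 'm" assume lu: "\<And>b. b \<in> Basis \<Longrightarrow> l \<bullet> b \<le> u \<bullet> b"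
  have le: "l $ i \<le> u $ i" for i using lu[of "axis i 1"] by (simp add: inner_axis axis_in_Basis_iff)
  have "?T -` box l u = box (?R l) (?R u)"
    by (auto simp: mem_box_cart) (metis inv)+
  then have "emeasure (distr lborel borel ?T) (box l u) = emeasure lborel (box (?R l) (?R u))"
    using T by (subst emeasure_distr) auto
  also have "\<dots> = (\<Prod>b\<in>Basis. (?R u - ?R l) \<bullet> b)"
    by (rule emeasure_lborel_box) (use le in \<open>auto simp: Basis_vec_def inner_axis\<close>)
  also have "(\<Prod>b\<in>Basis. (?R u - ?R l) \<bullet> b) = (\<Prod>i\<in>UNIV. u $ inv e i - l $ inv e i)"
    by (simp add: Basis_vec_def UNION_singleton_eq_range prod.reindex inj_on_def axis_eq_axis inner_axis)
  also have "\<dots> = (\<Prod>i\<in>UNIV. u $ i - l $ i)"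
    by (rule prod.reindex_bij_betw[OF bij_imp_bij_inv[OF assms]])
  also have "\<dots> = (\<Prod>b\<in>Basis. (u - l) \<bullet> b)"
    by (simp add: Basis_vec_def UNION_singleton_eq_range prod.reindex inj_on_def axis_eq_axis inner_axis)
  finally show "emeasure (distr lborel borel ?T) (box l u) = (\<Prod>b\<in>Basis. (u - l) \<bullet> b)" .
qed simp

text \<open>The map is conjugated by the relabelling \<open>T\<close>, which preserves Lebesgue
  measure and leaves the Jacobian determinant unchanged.\<close>

lemma emeasure_differentiable_image:
  fixes f :: "real ^ 'n::finite \<Rightarrow> real ^ 'n"
  assumes S: "S \<in> sets borel" "f ` S \<in> sets borel" and inj: "inj_on f S"
    and der: "\<And>x. x \<in> S \<Longrightarrow> (f has_derivative f' x) (at x)"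
    and m: "(\<lambda>x. indicator S x * \<bar>det (matrix (f' x))\<bar>) \<in> borel_measurable borel"
  shows "emeasure lborel (f ` S) = (\<integral>\<^sup>+x. ennreal (indicator S x * \<bar>det (matrix (f' x))\<bar>) \<partial>lborel)"
proof -
  define e :: "'n ix \<Rightarrow> 'n" where "e = Rep_ix"
  define T where "T = (\<lambda>v :: real ^ 'n. (\<chi> i. v $ e i) :: real ^ 'n ix)"
  define R where "R = (\<lambda>v :: real ^ 'n ix. (\<chi> i. v $ inv e i) :: real ^ 'n)"
  have e: "bij e" by (simp add: e_def bij_Rep_ix)
  have e': "bij (inv e)" by (rule bij_imp_bij_inv[OF e])
  have RT [simp]: "R (T v) = v" and TR [simp]: "T (R w) = w" for v w
    using e by (auto simp: R_def T_def vec_eq_iff bij_def surj_f_inv_f)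
  have linT: "linear T" and linR: "linear R" by (auto simp: T_def R_def linear_iff vec_eq_iff)
  have Tm: "T \<in> borel_measurable borel" and Rm: "R \<in> borel_measurable borel"
    by (auto intro!: borel_measurable_continuous_onI linear_continuous_on linear_conv_bounded_linear[THEN iffD1] linT linR)
  have Tl: "distr lborel borel T = lborel" using lborel_reindex[OF e] by (simp add: T_def)
  have Timg: "T ` B = R -` B" for B by (auto simp: image_iff) (metis TR)
  have borelT: "T ` B \<in> sets borel" if "B \<in> sets borel" for B
    using measurable_sets[OF Rm that] by (simp add: Timg)
  define F where "F = (\<lambda>w. T (f (R w)))"
  define F' where "F' = (\<lambda>w h. T (f' (R w) (R h)))"
  have det: "det (matrix (F' (T x))) = det (matrix (f' x))" for x
  proof -
    have "matrix (F' (T x)) = (\<chi> i j. matrix (f' x) $ e i $ e j)"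
    proof -
      have "R (axis j 1) = axis (e j) 1" for j
      proof -
        have "inv e i = j \<longleftrightarrow> i = e j" for i using bij_inv_eq_iff[OF e, of j i] by metis
        then show ?thesis by (simp add: vec_eq_iff R_def axis_def)
      qed
      then have "F' (T x) (axis j 1) $ i = f' x (axis (e j) 1) $ e i" for i j
        by (simp only: F'_def RT) (simp add: T_def)
      then show ?thesis by (simp add: vec_eq_iff matrix_def)
    qed
    then show ?thesis using det_reindex[OF e, of "matrix (f' x)"] by simp
  qed
  have FS: "F ` T ` S = T ` f ` S" by (auto simp: F_def image_iff)
  have ind: "indicator (T ` S) (T x) = (indicator S x :: real)" for x :: "real ^ 'n"
    by (auto simp: indicator_def) (metis RT)
  have meas: "(\<lambda>w. indicator (T ` S) w * \<bar>det (matrix (F' w))\<bar>) \<in> borel_measurable borel"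
  proof -
    have "(\<lambda>w. indicator S (R w) * \<bar>det (matrix (f' (R w)))\<bar>) \<in> borel_measurable borel"
      using measurable_compose[OF Rm m] .
    moreover have "indicator (T ` S) w * \<bar>det (matrix (F' w))\<bar> = indicator S (R w) * \<bar>det (matrix (f' (R w)))\<bar>" for w
      using ind[of "R w"] det[of "R w"] by simp
    ultimately show ?thesis by simp
  qed
  have vT: "T -` T ` B = B" for B by (auto simp: image_iff) (metis RT)
  have "emeasure lborel (f ` S) = emeasure lborel (T -` T ` f ` S \<inter> space lborel)" by (simp add: vT)
  also have "\<dots> = emeasure (distr lborel borel T) (T ` f ` S)"
    by (rule emeasure_distr[symmetric]) (use Tm borelT[OF S(2)] in auto)
  also have "\<dots> = emeasure lborel (F ` T ` S)" by (simp add: Tl FS)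
  also have "\<dots> = (\<integral>\<^sup>+w. ennreal (indicator (T ` S) w * \<bar>det (matrix (F' w))\<bar>) \<partial>lborel)"
  proof (rule emeasure_differentiable_image_wellorder)
    show "T ` S \<in> sets borel" "F ` T ` S \<in> sets borel" using borelT S FS by auto
    show "inj_on F (T ` S)" unfolding F_def inj_on_def using inj by (auto simp: inj_on_def) (metis RT)
    show "(F has_derivative F' w) (at w)" if "w \<in> T ` S" for w
      unfolding F_def F'_def
      by (intro bounded_linear.has_derivative[OF linear_conv_bounded_linear[THEN iffD1, OF linT]]
          has_derivative_compose[OF bounded_linear.has_derivative[OF linear_conv_bounded_linear[THEN iffD1, OF linR] has_derivative_ident]] der)
        (use that in auto)
    show "(\<lambda>x. indicator (T ` S) x * \<bar>det (matrix (F' x))\<bar>) \<in> borel_measurable borel" by (rule meas)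
  qed
  also have "\<dots> = (\<integral>\<^sup>+w. ennreal (indicator (T ` S) w * \<bar>det (matrix (F' w))\<bar>) \<partial>distr lborel borel T)"
    by (simp add: Tl)
  also have "\<dots> = (\<integral>\<^sup>+x. ennreal (indicator (T ` S) (T x) * \<bar>det (matrix (F' (T x)))\<bar>) \<partial>lborel)"
    by (rule nn_integral_distr) (use Tm meas in auto)
  also have "\<dots> = (\<integral>\<^sup>+x. ennreal (indicator S x * \<bar>det (matrix (f' x))\<bar>) \<partial>lborel)"
    by (simp add: ind det)
  finally show ?thesis .
qed

lemma borel_measurable_on_open:
  fixes f :: "'a::topological_space \<Rightarrow> real"
  assumes "continuous_on U f" "open U"
  shows "(\<lambda>x. indicator U x * f x) \<in> borel_measurable borel"
  using borel_measurable_continuous_on_indicator[OF _ assms(1)] assms(2) by simp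

lemma borel_measurable_if_open:
  fixes f :: "'a::topological_space \<Rightarrow> 'b::topological_space"
  assumes "continuous_on U f" "open U"
  shows "(\<lambda>x. if x \<in> U then f x else a) \<in> borel_measurable borel"
  using measurable_restrict_space_iff[of U borel a borel f] borel_measurable_continuous_on_restrict[OF assms(1)]
    assms(2) by simp

lemma nn_integral_differentiable_image:
  fixes f :: "real ^ 'n::finite \<Rightarrow> real ^ 'n"
  assumes U: "open U" "open (f ` U)" and inj: "inj_on f U"
    and der: "\<And>x. x \<in> U \<Longrightarrow> (f has_derivative f' x) (at x)"
    and inv: "continuous_on (f ` U) (inv_into U f)"
    and D: "continuous_on U (\<lambda>x. det (matrix (f' x)))"
    and w: "w \<in> borel_measurable borel" and S: "S \<in> sets borel" "S \<subseteq> U"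
  shows "(\<integral>\<^sup>+y\<in>f ` S. w y \<partial>lborel) = (\<integral>\<^sup>+x\<in>S. w (f x) * ennreal \<bar>det (matrix (f' x))\<bar> \<partial>lborel)"
proof -
  define D' where "D' x = indicator U x * \<bar>det (matrix (f' x))\<bar>" for x
  \<comment> \<open>The extension by 0 makes the map Borel on the whole space. The value is never
    seen, since the density \<open>D'\<close> vanishes outside \<open>U\<close>.\<close>
  define F where "F x = (if x \<in> U then f x else 0)" for x
  have cf: "continuous_on U f"
    using der has_derivative_continuous continuous_at_imp_continuous_on by blast
  have D'm [measurable]: "D' \<in> borel_measurable borel"
    unfolding D'_def[abs_def] by (rule borel_measurable_on_open) (use D U in \<open>auto intro: continuous_intros\<close>)
  have Fm [measurable]: "F \<in> borel_measurable borel"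
    unfolding F_def[abs_def] by (rule borel_measurable_if_open[OF cf U(1)])
  have im: "f ` B \<in> sets borel" if B: "B \<in> sets borel" "B \<subseteq> U" for B
  proof -
    have "y \<in> f ` B \<longleftrightarrow> y \<in> f ` U \<and> inv_into U f y \<in> B" for y
    proof
      assume "y \<in> f ` B"
      then obtain x where x: "x \<in> B" "y = f x" by blast
      then show "y \<in> f ` U \<and> inv_into U f y \<in> B"
        using B(2) inv_into_f_f[OF inj, of x] by auto
    next
      assume y: "y \<in> f ` U \<and> inv_into U f y \<in> B"
      then show "y \<in> f ` B" using f_inv_into_f[of y f U] by (metis imageI)
    qed
    then have "f ` B = f ` U \<inter> (\<lambda>y. if y \<in> f ` U then inv_into U f y else undefined) -` B"
      by (intro set_eqI) (simp only: Int_iff vimage_eq, metis)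
    moreover have "(\<lambda>y. if y \<in> f ` U then inv_into U f y else undefined) -` B \<in> sets borel"
      using measurable_sets[OF borel_measurable_if_open[OF inv U(2)] B(1)] by simp
    ultimately show ?thesis using U by auto
  qed
  have eq: "density lborel (indicator (f ` U)) = distr (density lborel D') borel F"
  proof (rule measure_eqI)
    fix B assume "B \<in> sets (density lborel (indicator (f ` U)))"
    then have B: "B \<in> sets borel" by simp
    define C where "C = U \<inter> F -` B"
    have C: "C \<in> sets borel" "C \<subseteq> U" using measurable_sets[OF Fm B] U by (auto simp: C_def)
    have fC: "f ` C = f ` U \<inter> B" by (auto simp: C_def F_def)
    have cm: "(\<lambda>x. indicator C x * \<bar>det (matrix (f' x))\<bar>) \<in> borel_measurable borel"
    proof -
      have "indicator C x * \<bar>det (matrix (f' x))\<bar> = indicator C x * D' x" for x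
        using C by (auto simp: D'_def indicator_def)
      then have "(\<lambda>x. indicator C x * \<bar>det (matrix (f' x))\<bar>) = (\<lambda>x. indicator C x * D' x)" by (rule ext)
      then show ?thesis using C by simp
    qed
    have "emeasure (density lborel (indicator (f ` U))) B = emeasure lborel (f ` C)"
      using B U fC by (subst emeasure_density) (auto simp: nn_integral_indicator[symmetric] indicator_inter_arith[symmetric]
          simp del: nn_integral_indicator intro!: nn_integral_cong split: split_indicator)
    also have "\<dots> = (\<integral>\<^sup>+x. ennreal (indicator C x * \<bar>det (matrix (f' x))\<bar>) \<partial>lborel)"
      by (rule emeasure_differentiable_image[OF C(1) im[OF C]])
        (use C inj der cm in \<open>auto intro: inj_on_subset\<close>)
    also have "\<dots> = (\<integral>\<^sup>+x. ennreal (D' x) * indicator (F -` B) x \<partial>lborel)"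
      by (rule nn_integral_cong) (auto simp: D'_def C_def split: split_indicator)
    also have "\<dots> = emeasure (distr (density lborel D') borel F) B"
      using B measurable_sets[OF Fm B] by (simp add: emeasure_distr emeasure_density)
    finally show "emeasure (density lborel (indicator (f ` U))) B = emeasure (distr (density lborel D') borel F) B" .
  qed simp
  have "(\<integral>\<^sup>+y\<in>f ` S. w y \<partial>lborel) = (\<integral>\<^sup>+y. w y * indicator (f ` S) y \<partial>density lborel (indicator (f ` U)))"
  proof (subst nn_integral_density)
    have "indicator (f ` S) y = indicator (f ` U) y * (indicator (f ` S) y :: ennreal)" for y
      using S(2) by (auto split: split_indicator)
    then show "(\<integral>\<^sup>+y\<in>f ` S. w y \<partial>lborel) = (\<integral>\<^sup>+y. indicator (f ` U) y * (w y * indicator (f ` S) y) \<partial>lborel)"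
      by (intro nn_integral_cong) (metis mult.left_commute)
  qed (use w im[OF S] U in auto)
  also have "\<dots> = (\<integral>\<^sup>+y. w y * indicator (f ` S) y \<partial>distr (density lborel D') borel F)" by (simp only: eq)
  also have "\<dots> = (\<integral>\<^sup>+x. w (F x) * indicator (f ` S) (F x) \<partial>density lborel D')"
    using w im[OF S] by (subst nn_integral_distr) auto
  also have "\<dots> = (\<integral>\<^sup>+x. ennreal (D' x) * (w (F x) * indicator (f ` S) (F x)) \<partial>lborel)"
    using w im[OF S] by (subst nn_integral_density) auto
  also have "\<dots> = (\<integral>\<^sup>+x\<in>S. w (f x) * ennreal \<bar>det (matrix (f' x))\<bar> \<partial>lborel)"
  proof (rule nn_integral_cong)
    fix x
    have "x \<in> U \<Longrightarrow> f x \<in> f ` S \<longleftrightarrow> x \<in> S" using inj_on_image_mem_iff[OF inj _ S(2)] by blast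
    then show "ennreal (D' x) * (w (F x) * indicator (f ` S) (F x))
      = w (f x) * ennreal \<bar>det (matrix (f' x))\<bar> * indicator S x"
      using S(2) by (auto simp: D'_def F_def mult_ac split: split_indicator)
  qed
  finally show ?thesis .
qed

section \<open>Smoothness and positivity of the Gram determinant\<close>

lemma Ck_det:
  fixes M :: "'a::euclidean_space \<Rightarrow> real ^ 'n::finite ^ 'n"
  assumes "\<And>i j. Ck k (\<lambda>x. M x $ i $ j) S" "open S"
  shows "Ck k (\<lambda>x. det (M x)) S"
  unfolding det_def by (intro Ck_sum Ck_mult Ck_prod Ck_const assms)

lemma matrix_eqI_inner:
  fixes M N :: "real ^ 'n::finite ^ 'm::finite"
  assumes "\<And>u v. u \<bullet> (M *v v) = u \<bullet> (N *v v)"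
  shows "M = N"
  unfolding matrix_eq using assms vector_eq_ldot by blast

lemma inner_transpose_mult: "u \<bullet> (transpose M *v v) = (M *v u) \<bullet> (v :: real ^ 'n::finite)"
  by (metis transpose_matrix_vector inner_commute dot_lmul_matrix)

text \<open>Every matrix on the segment from \<open>mat 1\<close> to \<open>M\<close> is positive
  definite, hence injective, so the determinant cannot pass through 0 on its way from 1.\<close>

lemma det_pos_if_pos_definite:
  fixes M :: "real ^ 'n::finite ^ 'n"
  assumes pos: "\<And>v. v \<noteq> 0 \<Longrightarrow> v \<bullet> (M *v v) > 0"
  shows "det M > 0"
proof -
  define P where "P t = (1 - t) *\<^sub>R mat 1 + t *\<^sub>R M" for t :: real
  have nz: "det (P t) \<noteq> 0" if "0 \<le> t" "t \<le> 1" for t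
  proof
    assume "det (P t) = 0"
    then obtain v where v: "v \<noteq> 0" "P t *v v = 0"
      using matrix_left_invertible_ker[of "P t"] invertible_det_nz[of "P t"] invertible_left_inverse[of "P t"]
      by blast
    have "0 = v \<bullet> (P t *v v)" using v by simp
    also have "\<dots> = (1 - t) * (v \<bullet> v) + t * (v \<bullet> (M *v v))"
      by (simp add: P_def matrix_vector_mult_add_rdistrib scaleR_matrix_vector inner_add_right)
    also have "\<dots> > 0"
    proof (cases "t = 0")
      case False
      then show ?thesis using pos[OF v(1)] that
        by (intro add_nonneg_pos mult_pos_pos mult_nonneg_nonneg) auto
    qed (use v in simp)
    finally show False by simp
  qed
  have cont: "continuous_on {0..1} (\<lambda>t. det (P t))"
  proof -
    have "continuous_on UNIV (\<lambda>t. det (P t))"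
      unfolding det_def P_def by (intro continuous_intros)
    then show ?thesis by (rule continuous_on_subset) simp
  qed
  show ?thesis
  proof (rule ccontr)
    assume "\<not> det M > 0"
    then have "det (P 1) \<le> 0" "0 \<le> det (P 0)" by (auto simp: P_def)
    then obtain t where "0 \<le> t" "t \<le> 1" "det (P t) = 0"
      using IVT2'[of "\<lambda>t. det (P t)" 1 0 0] cont by auto
    then show False using nz by blast
  qed
qed

context smooth_manifold
begin

lemma matrix_tdiff:
  assumes "c \<in> A" "d \<in> A" "x \<in> fst c" "x \<in> fst d"
  shows "matrix (tdiff c d x) *v v = tdiff c d x v"
  using matrix_works tdiff_linear[OF assms] by (simp add: linear_matrix_vector_mul_eq matrix_vector_mul)

lemma gmat_transition:
  assumes H: "riemannian_metric A H" and c: "c \<in> A" "x \<in> fst c" and d: "d \<in> A" "x \<in> fst d"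
  shows "gmat A c H x = transpose (matrix (tdiff c d x)) ** gmat A d H x ** matrix (tdiff c d x)"
proof (rule matrix_eqI_inner)
  fix u v
  have "u \<bullet> (gmat A c H x *v v) = tdiff c d x u \<bullet> (gmat A d H x *v tdiff c d x v)"
    using c d by (simp add: gmat_eq[OF H, symmetric] cvec_tdiff)
  then show "u \<bullet> (gmat A c H x *v v)
      = u \<bullet> (transpose (matrix (tdiff c d x)) ** gmat A d H x ** matrix (tdiff c d x) *v v)"
    using c d by (simp add: matrix_vector_mul_assoc[symmetric] inner_transpose_mult matrix_tdiff
        del: transpose_matrix_vector)
qed

lemma gmat_pos:
  assumes "riemannian_metric A H" "c \<in> A" "x \<in> fst c" "v \<noteq> 0"
  shows "v \<bullet> (gmat A c H x *v v) > 0"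
proof -
  have "cvec A c x v \<noteq> 0"
    using components_cvec_same[OF assms(2,3), of v] linear_0[OF components_linear[OF assms(2,3)]] assms(4)
    by metis
  then show ?thesis
    using assms(1) gmat_eq[OF assms(1-3), of v v] unfolding riemannian_metric_def by metis
qed

lemma gmat_sym: "riemannian_metric A H \<Longrightarrow> gmat A c H x $ i $ j = gmat A c H x $ j $ i"
  by (simp add: gmat_def bmat_def riemannian_metric_def)

lemma det_gmat_pos:
  "riemannian_metric A H \<Longrightarrow> c \<in> A \<Longrightarrow> x \<in> fst c \<Longrightarrow> det (gmat A c H x) > 0"
  by (rule det_pos_if_pos_definite) (rule gmat_pos)

lemma gmat_Ck:
  assumes "riemannian_metric A H" "c \<in> A"
  shows "Ck k (\<lambda>z. gmat A c H (chart_inv c z) $ i $ j) (snd c ` fst c)"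
proof -
  have "smooth_function_on A (fst c) (\<lambda>x. H x (cvec A c x (axis i 1)) (cvec A c x (axis j 1)))"
    using assms by (intro metric_smooth smooth_field_cvec) auto
  from smooth_functionD[OF this assms(2), of k] show ?thesis by (simp add: gmat_def bmat_def)
qed

section \<open>The Riemannian volume measure\<close>

definition cdens :: "('a, 'n) chart \<Rightarrow> ('a, 'n) two_tensor \<Rightarrow> real ^ 'n \<Rightarrow> real" where
  "cdens c H z = indicator (snd c ` fst c) z * sqrt (det (gmat A c H (chart_inv c z)))"

definition cinv :: "('a, 'n) chart \<Rightarrow> real ^ 'n \<Rightarrow> 'a" where
  "cinv c z = (if z \<in> snd c ` fst c then chart_inv c z else undefined)"

text \<open>A measure on the whole manifold carried by the domain of \<open>c\<close>. The factor
  \<open>cdens\<close> vanishes off the chart image, so the default value in \<open>cinv\<close>,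
  which only secures Borel measurability, carries no mass.\<close>

definition chart_volume :: "('a, 'n) chart \<Rightarrow> ('a, 'n) two_tensor \<Rightarrow> 'a measure" where
  "chart_volume c H = distr (density lborel (\<lambda>z. ennreal (cdens c H z))) borel (cinv c)"

definition is_volume :: "('a, 'n) two_tensor \<Rightarrow> 'a measure \<Rightarrow> bool" where
  "is_volume H \<mu> \<longleftrightarrow> sets \<mu> = sets borel \<and>
     (\<forall>c\<in>A. \<forall>B\<in>sets borel. B \<subseteq> fst c \<longrightarrow>
        emeasure \<mu> B = (\<integral>\<^sup>+z\<in>snd c ` B. ennreal (sqrt (gram_det A H c (chart_inv c z))) \<partial>lborel))"

lemma cdens_Ck: "riemannian_metric A H \<Longrightarrow> c \<in> A \<Longrightarrow>
    Ck k (\<lambda>z. sqrt (det (gmat A c H (chart_inv c z)))) (snd c ` fst c)"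
  by (rule Ck_sqrt[OF Ck_det[OF gmat_Ck]]) (auto intro: det_gmat_pos)

lemma cdens_measurable:
  assumes "riemannian_metric A H" "c \<in> A"
  shows "cdens c H \<in> borel_measurable borel"
  unfolding cdens_def[abs_def]
  by (rule borel_measurable_on_open[OF Ck_continuous_on[OF cdens_Ck[OF assms, of 0]]]) (use assms in simp)

lemma cdens_nonneg: "riemannian_metric A H \<Longrightarrow> c \<in> A \<Longrightarrow> cdens c H z \<ge> 0"
  using det_gmat_pos[of H c] by (fastforce simp: cdens_def less_imp_le split: split_indicator)

lemma cinv_measurable: "c \<in> A \<Longrightarrow> cinv c \<in> borel_measurable borel"
  unfolding cinv_def[abs_def] by (rule borel_measurable_if_open) (auto intro: chart_continuous)

lemma image_chart_eq: "c \<in> A \<Longrightarrow> B \<subseteq> fst c \<Longrightarrow> snd c ` B = snd c ` fst c \<inter> cinv c -` B"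
  by (auto simp: cinv_def)

lemma image_chart_borel: "c \<in> A \<Longrightarrow> B \<in> sets borel \<Longrightarrow> B \<subseteq> fst c \<Longrightarrow> snd c ` B \<in> sets borel"
  unfolding image_chart_eq using measurable_sets[OF cinv_measurable, of c B] by simp

lemma emeasure_chart_volume:
  assumes H: "riemannian_metric A H" and c: "c \<in> A" and B: "B \<in> sets borel"
  shows "emeasure (chart_volume c H) B = (\<integral>\<^sup>+z\<in>snd c ` (B \<inter> fst c). ennreal (sqrt (gram_det A H c (chart_inv c z))) \<partial>lborel)"
proof -
  note [measurable] = cinv_measurable[OF c] cdens_measurable[OF H c]
  have "emeasure (chart_volume c H) B = (\<integral>\<^sup>+z. ennreal (cdens c H z) * indicator (cinv c -` B) z \<partial>lborel)"
    unfolding chart_volume_def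
    using B measurable_sets[OF cinv_measurable[OF c] B] by (simp add: emeasure_distr emeasure_density)
  also have "\<dots> = (\<integral>\<^sup>+z\<in>snd c ` (B \<inter> fst c). ennreal (sqrt (gram_det A H c (chart_inv c z))) \<partial>lborel)"
  proof (rule nn_integral_cong)
    fix z
    have "z \<in> snd c ` (B \<inter> fst c) \<longleftrightarrow> z \<in> snd c ` fst c \<and> cinv c z \<in> B" using c by (auto simp: cinv_def)
    then show "ennreal (cdens c H z) * indicator (cinv c -` B) z
      = ennreal (sqrt (gram_det A H c (chart_inv c z))) * indicator (snd c ` (B \<inter> fst c)) z"
      by (auto simp: cdens_def gram_det_eq split: split_indicator)
  qed
  finally show ?thesis .
qed

text \<open>The Gram matrices in two charts are congruent through the Jacobian of the transition
  map, so the square roots of their determinants differ by its absolute determinant. This is exactly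
  the factor in the change of variables.\<close>

lemma chart_volume_transition:
  assumes H: "riemannian_metric A H" and c: "c \<in> A" and d: "d \<in> A" and B: "B \<in> sets borel" "B \<subseteq> fst c" "B \<subseteq> fst d"
  shows "emeasure (chart_volume d H) B = emeasure (chart_volume c H) B"
proof -
  define U where "U = snd c ` (fst c \<inter> fst d)"
  define f where "f = snd d \<circ> chart_inv c"
  have U: "open U" using open_chart_inter[OF c d] by (simp add: U_def)
  have fU: "f ` U = snd d ` (fst c \<inter> fst d)"
    using c by (force simp: f_def U_def image_image)
  have inj: "inj_on f U"
    unfolding f_def U_def inj_on_def using c d inj_on_chart[OF d] by (auto simp: inj_on_def)
  have iv: "inv_into U f y = (snd c \<circ> chart_inv d) y" if y: "y \<in> f ` U" for y
  proof -
    obtain x where x: "x \<in> fst c" "x \<in> fst d" "y = snd d x" using y fU by auto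
    have "inv_into U f (f (snd c x)) = snd c x" by (rule inv_into_f_f[OF inj]) (use x in \<open>auto simp: U_def\<close>)
    then show ?thesis using x c d by (simp add: f_def)
  qed
  have fB: "snd d ` B = f ` snd c ` B" using B c by (force simp: f_def image_image)
  have em: "emeasure (chart_volume e H) B = (\<integral>\<^sup>+z\<in>snd e ` B. ennreal (cdens e H z) \<partial>lborel)"
    if e: "e \<in> A" and Be: "B \<subseteq> fst e" for e
  proof -
    have "ennreal (sqrt (gram_det A H e (chart_inv e z))) * indicator (snd e ` B) z
        = ennreal (cdens e H z) * indicator (snd e ` B) z" for z
      using image_mono[OF Be, of "snd e"] by (auto simp: cdens_def gram_det_eq split: split_indicator)
    then show ?thesis using Be by (simp add: emeasure_chart_volume[OF H e B(1)] Int_absorb2)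
  qed
  have "emeasure (chart_volume d H) B = (\<integral>\<^sup>+z\<in>snd d ` B. ennreal (cdens d H z) \<partial>lborel)"
    by (rule em[OF d B(3)])
  also have "\<dots> = (\<integral>\<^sup>+z\<in>snd c ` B. ennreal (cdens d H (f z)) * ennreal \<bar>det (matrix (frechet_derivative f (at z)))\<bar> \<partial>lborel)"
    unfolding fB
  proof (rule nn_integral_differentiable_image[OF U _ inj])
    show "open (f ` U)" using open_chart_inter[OF d c] by (simp add: fU Int_commute)
    show "(f has_derivative frechet_derivative f (at x)) (at x)" if "x \<in> U" for x
      unfolding f_def by (rule Ck_has_derivative[OF Ck_transition[OF c d]]) (use that in \<open>simp add: U_def\<close>)
    have "continuous_on (f ` U) (snd c \<circ> chart_inv d)"
      using Ck_continuous_on[OF Ck_transition[OF d c, of 0]] by (simp add: fU Int_commute)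
    then show "continuous_on (f ` U) (inv_into U f)"
      by (rule continuous_on_cong[THEN iffD1, rotated -1]) (use iv in auto)
    show "continuous_on U (\<lambda>x. det (matrix (frechet_derivative f (at x))))"
    proof (rule Ck_continuous_on[OF Ck_det[of 0]])
      show "Ck 0 (\<lambda>x. matrix (frechet_derivative f (at x)) $ i $ j) U" for i j
        using Ck_vec_nth[OF Ck_dd[OF Ck_transition[OF c d, of "Suc 0"]] open_chart_inter[OF c d], of "axis j 1" i]
        by (simp add: matrix_def f_def U_def)
    qed (rule U)
    show "(\<lambda>y. ennreal (cdens d H y)) \<in> borel_measurable borel" using cdens_measurable[OF H d] by simp
    show "snd c ` B \<in> sets borel" by (rule image_chart_borel[OF c B(1,2)])
    show "snd c ` B \<subseteq> U" using B by (auto simp: U_def)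
  qed
  also have "\<dots> = (\<integral>\<^sup>+z\<in>snd c ` B. ennreal (cdens c H z) \<partial>lborel)"
  proof (rule nn_integral_cong)
    fix z
    show "ennreal (cdens d H (f z)) * ennreal \<bar>det (matrix (frechet_derivative f (at z)))\<bar> * indicator (snd c ` B) z
      = ennreal (cdens c H z) * indicator (snd c ` B) z"
    proof (cases "z \<in> snd c ` B")
      case True
      then obtain x where x: "z = snd c x" "x \<in> B" by auto
      then have xc: "x \<in> fst c" and xd: "x \<in> fst d" using B by auto
      have fz: "f z = snd d x" using x xc c by (simp add: f_def)
      have td: "frechet_derivative f (at z) = tdiff c d x" by (simp add: tdiff_def f_def x)
      have "det (gmat A c H x) = det (matrix (tdiff c d x)) ^ 2 * det (gmat A d H x)"
        unfolding gmat_transition[OF H c xc d xd] by (simp add: det_mul det_transpose power2_eq_square)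
      then have "sqrt (det (gmat A c H x)) = \<bar>det (matrix (tdiff c d x))\<bar> * sqrt (det (gmat A d H x))"
        by (simp add: real_sqrt_mult)
      then have "cdens c H z = cdens d H (f z) * \<bar>det (matrix (frechet_derivative f (at z)))\<bar>"
        unfolding td fz unfolding x(1) using xc xd c d by (simp add: cdens_def)
      then show ?thesis using cdens_nonneg[OF H d] by (simp add: ennreal_mult)
    qed simp
  qed
  also have "\<dots> = emeasure (chart_volume c H) B"
    by (rule em[OF c B(2), symmetric])
  finally show ?thesis .
qed

section \<open>Gluing the chart volumes into one Borel measure\<close>

lemma countable_subatlas: "\<exists>C :: nat \<Rightarrow> ('a, 'n) chart. (\<forall>k. C k \<in> A) \<and> (\<Union>k. fst (C k)) = UNIV"
proof -
  obtain \<F> where F: "\<F> \<subseteq> fst ` A" "countable \<F>" "\<Union>\<F> = \<Union>(fst ` A)"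
    by (rule Lindelof[of "fst ` A"]) (use open_chart(1) in blast)+
  have un: "\<Union>\<F> = UNIV" using F(3) atlas by (auto simp: smooth_atlas_def)
  then have ne: "\<F> \<noteq> {}" by auto
  have "\<forall>k. \<exists>c. c \<in> A \<and> fst c = from_nat_into \<F> k"
  proof
    fix k
    have "from_nat_into \<F> k \<in> fst ` A" using from_nat_into[OF ne, of k] F(1) by blast
    then show "\<exists>c. c \<in> A \<and> fst c = from_nat_into \<F> k" by auto
  qed
  from choice[OF this] obtain C :: "nat \<Rightarrow> ('a, 'n) chart"
    where C: "\<And>k. C k \<in> A" "\<And>k. fst (C k) = from_nat_into \<F> k" by blast
  have "(\<Union>k. fst (C k)) = \<Union>\<F>"
    using range_from_nat_into[OF ne F(2)] by (simp add: C)
  then show ?thesis using C(1) un by (intro exI[of _ C]) simp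
qed

text \<open>Countably many charts suffice by second countability; cutting away the earlier domains
  makes the pieces disjoint Borel sets, each still inside one chart.\<close>

lemma chart_partition:
  obtains C :: "nat \<Rightarrow> ('a, 'n) chart" and D where
    "\<And>k. C k \<in> A" "\<And>k. D k \<in> sets borel" "\<And>k. D k \<subseteq> fst (C k)" "disjoint_family D" "(\<Union>k. D k) = UNIV"
proof -
  obtain C :: "nat \<Rightarrow> ('a, 'n) chart" where C: "\<And>k. C k \<in> A" "(\<Union>k. fst (C k)) = UNIV"
    using countable_subatlas by blast
  have "range (disjointed (\<lambda>k. fst (C k))) \<subseteq> sets borel"
    by (rule sets.range_disjointed_sets) (use C open_chart(1) borel_open in blast)
  then show ?thesis
    by (intro that[of C "disjointed (\<lambda>k. fst (C k))"])
      (use C disjointed_subset[of "\<lambda>k. fst (C k)"] disjoint_family_disjointed UN_disjointed_eq[of "\<lambda>k. fst (C k)"] in auto)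
qed

lemma emeasure_eq_suminf:
  assumes "sets \<mu> = sets borel" "B \<in> sets borel" "\<And>k. D k \<in> sets borel" "disjoint_family D" "(\<Union>k. D k) = UNIV"
  shows "emeasure \<mu> B = (\<Sum>k. emeasure \<mu> (B \<inter> D k))"
proof -
  have "(\<Sum>k. emeasure \<mu> (B \<inter> D k)) = emeasure \<mu> (\<Union>k. B \<inter> D k)"
  proof (rule suminf_emeasure)
    show "disjoint_family (\<lambda>k. B \<inter> D k)" using assms(4) unfolding disjoint_family_on_def by blast
  qed (use assms in auto)
  then show ?thesis using assms(5) by (simp flip: Int_UN_distrib)
qed

lemma is_volume_unique:
  assumes "is_volume H \<mu>" "is_volume H \<nu>"
  shows "\<mu> = \<nu>"
proof -
  obtain C :: "nat \<Rightarrow> ('a, 'n) chart" and D where CD: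
    "\<And>k. C k \<in> A" "\<And>k. D k \<in> sets borel" "\<And>k. D k \<subseteq> fst (C k)" "disjoint_family D" "(\<Union>k. D k) = UNIV"
    using chart_partition by metis
  have s: "sets \<mu> = sets borel" "sets \<nu> = sets borel" using assms by (auto simp: is_volume_def)
  show ?thesis
  proof (rule measure_eqI)
    fix B assume "B \<in> sets \<mu>"
    then have B: "B \<in> sets borel" using s by simp
    have "emeasure \<mu> (B \<inter> D k) = emeasure \<nu> (B \<inter> D k)" for k
    proof -
      have "B \<inter> D k \<in> sets borel" "B \<inter> D k \<subseteq> fst (C k)" using B CD(2,3) by auto
      then show ?thesis using assms[unfolded is_volume_def] CD(1)[of k] by simp
    qed
    then show "emeasure \<mu> B = emeasure \<nu> B"
      using emeasure_eq_suminf[OF s(1) B CD(2,4,5)] emeasure_eq_suminf[OF s(2) B CD(2,4,5)] by simp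
  qed (simp add: s)
qed

text \<open>The candidate adds up the chart volumes of the pieces of a partition. Agreement of chart
  volumes on overlaps gives the required value in every chart of the atlas, not only in those of the
  partition.\<close>

lemma is_volume_exists:
  assumes H: "riemannian_metric A H"
  shows "\<exists>\<mu>. is_volume H \<mu>"
proof -
  obtain C :: "nat \<Rightarrow> ('a, 'n) chart" and D where CD:
    "\<And>k. C k \<in> A" "\<And>k. D k \<in> sets borel" "\<And>k. D k \<subseteq> fst (C k)" "disjoint_family D" "(\<Union>k. D k) = UNIV"
    using chart_partition by metis
  define F where "F B = (\<Sum>k. emeasure (chart_volume (C k) H) (B \<inter> D k))" for B
  define \<mu> where "\<mu> = measure_of UNIV (sets borel) F"
  have sc: "sets (chart_volume c H) = sets borel" for c by (simp add: chart_volume_def)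
  have sets: "sets \<mu> = sets borel"
    unfolding \<mu>_def using sets.sigma_sets_eq[of borel] by simp
  have em: "emeasure \<mu> B = F B" if B: "B \<in> sets borel" for B
  proof (rule emeasure_measure_of[OF \<mu>_def])
    show "positive (sets \<mu>) F" by (simp add: positive_def F_def)
    show "countably_additive (sets \<mu>) F"
    proof (rule countably_additiveI)
      fix X :: "nat \<Rightarrow> 'a set" assume X: "range X \<subseteq> sets \<mu>" "disjoint_family X"
      \<comment> \<open>Countable additivity amounts to exchanging two series of nonnegative terms;
        one of them is written as an integral over \<open>count_space\<close> so that
        \<open>nn_integral_suminf\<close> applies.\<close>
      have "(\<Sum>i. F (X i)) = (\<integral>\<^sup>+i. (\<Sum>k. emeasure (chart_volume (C k) H) (X i \<inter> D k)) \<partial>count_space UNIV)"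
        by (simp add: F_def nn_integral_count_space_nat)
      also have "\<dots> = (\<Sum>k. (\<integral>\<^sup>+i. emeasure (chart_volume (C k) H) (X i \<inter> D k) \<partial>count_space UNIV))"
        by (rule nn_integral_suminf) simp
      also have "\<dots> = (\<Sum>k. emeasure (chart_volume (C k) H) ((\<Union>i. X i) \<inter> D k))"
      proof (rule suminf_cong)
        fix k
        have "(\<integral>\<^sup>+i. emeasure (chart_volume (C k) H) (X i \<inter> D k) \<partial>count_space UNIV)
          = (\<Sum>i. emeasure (chart_volume (C k) H) (X i \<inter> D k))" by (rule nn_integral_count_space_nat)
        also have "\<dots> = emeasure (chart_volume (C k) H) (\<Union>i. X i \<inter> D k)"
        proof (rule suminf_emeasure)
          show "range (\<lambda>i. X i \<inter> D k) \<subseteq> sets (chart_volume (C k) H)"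
            using X(1) CD(2) unfolding sc sets by auto
          show "disjoint_family (\<lambda>i. X i \<inter> D k)"
            using X(2) unfolding disjoint_family_on_def by blast
        qed
        finally show "(\<integral>\<^sup>+i. emeasure (chart_volume (C k) H) (X i \<inter> D k) \<partial>count_space UNIV)
          = emeasure (chart_volume (C k) H) ((\<Union>i. X i) \<inter> D k)" by simp
      qed
      finally show "(\<Sum>i. F (X i)) = F (\<Union>i. X i)" by (simp add: F_def)
    qed
  qed (use B sets in auto)
  have "is_volume H \<mu>"
    unfolding is_volume_def
  proof (intro conjI ballI impI sets)
    fix c B assume c: "c \<in> A" and B: "B \<in> sets borel" "B \<subseteq> fst c"
    have "emeasure \<mu> B = (\<Sum>k. emeasure (chart_volume c H) (B \<inter> D k))"
      unfolding em[OF B(1)] F_def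
    proof (rule suminf_cong)
      fix k
      have "B \<inter> D k \<in> sets borel" using B CD(2) by auto
      then show "emeasure (chart_volume (C k) H) (B \<inter> D k) = emeasure (chart_volume c H) (B \<inter> D k)"
        by (rule chart_volume_transition[OF H c CD(1)]) (use B CD(3) in auto)
    qed
    also have "\<dots> = emeasure (chart_volume c H) B"
      by (rule emeasure_eq_suminf[OF sc B(1) CD(2,4,5), symmetric])
    finally show "emeasure \<mu> B = (\<integral>\<^sup>+z\<in>snd c ` B. ennreal (sqrt (gram_det A H c (chart_inv c z))) \<partial>lborel)"
      using B by (simp add: emeasure_chart_volume[OF H c] Int_absorb2)
  qed
  then show ?thesis by blast
qed

lemma volume_measure_eqI: "is_volume H \<mu> \<Longrightarrow> volume_measure A H = \<mu>"
  unfolding volume_measure_def is_volume_def[symmetric] using is_volume_unique by blast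

lemma is_volume_volume_measure: "riemannian_metric A H \<Longrightarrow> is_volume H (volume_measure A H)"
  using is_volume_exists volume_measure_eqI by metis

lemma sets_volume_measure [measurable_cong]:
  "riemannian_metric A H \<Longrightarrow> sets (volume_measure A H) = sets borel"
  using is_volume_volume_measure by (simp add: is_volume_def)

lemma emeasure_volume_measure:
  assumes H: "riemannian_metric A H" and c: "c \<in> A" and B: "B \<in> sets borel" "B \<subseteq> fst c"
  shows "emeasure (volume_measure A H) B = emeasure (chart_volume c H) B"
  using is_volume_volume_measure[OF H] c B
  by (simp add: is_volume_def emeasure_chart_volume[OF H c] Int_absorb2)

lemma density_chart_eq:
  assumes H: "riemannian_metric A H" and c: "c \<in> A"
  shows "density (volume_measure A H) (indicator (fst c)) = chart_volume c H"
proof (rule measure_eqI)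
  fix B assume "B \<in> sets (density (volume_measure A H) (indicator (fst c)))"
  then have B: "B \<in> sets borel" using sets_volume_measure[OF H] by simp
  have o: "fst c \<in> sets borel" using c by simp
  have i: "indicator (fst c) x * indicator B x = (indicator (B \<inter> fst c) x :: ennreal)" for x
    by (auto split: split_indicator)
  have "emeasure (density (volume_measure A H) (indicator (fst c))) B = emeasure (volume_measure A H) (B \<inter> fst c)"
    using B o sets_volume_measure[OF H] by (subst emeasure_density) (auto simp: i borel_measurable_indicator)
  also have "\<dots> = emeasure (chart_volume c H) (B \<inter> fst c)"
    by (rule emeasure_volume_measure[OF H c]) (use B o in auto)
  also have "\<dots> = emeasure (chart_volume c H) B"
    using B o by (simp add: emeasure_chart_volume[OF H c] Int_assoc)
  finally show "emeasure (density (volume_measure A H) (indicator (fst c))) B = emeasure (chart_volume c H) B" .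
qed (simp add: sets_volume_measure[OF H] chart_volume_def)

text \<open>Allows all metrics of a family to be integrated against one fixed measure: a
  chart-independent ratio of Gram determinants is the square of the relative volume density.\<close>

lemma volume_measure_density:
  fixes r :: "'a \<Rightarrow> real"
  assumes H: "riemannian_metric A H" and r: "r \<in> borel_measurable borel" "\<And>x. r x \<ge> 0"
    and eq: "\<And>c x. c \<in> A \<Longrightarrow> x \<in> fst c \<Longrightarrow> det (gmat A c H' x) = (r x)\<^sup>2 * det (gmat A c H x)"
  shows "volume_measure A H' = density (volume_measure A H) (\<lambda>x. ennreal (r x))"
proof (rule volume_measure_eqI)
  let ?V = "volume_measure A H"
  show "is_volume H' (density ?V (\<lambda>x. ennreal (r x)))"
    unfolding is_volume_def
  proof (intro conjI ballI impI)
    show "sets (density ?V (\<lambda>x. ennreal (r x))) = sets borel" by (simp add: sets_volume_measure[OF H])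
    fix c B assume c: "c \<in> A" and B: "B \<in> sets borel" "B \<subseteq> fst c"
    note [measurable] = cinv_measurable[OF c] cdens_measurable[OF H c] r(1) B(1)
    have rV: "r \<in> borel_measurable ?V" using r(1) by (simp cong: measurable_cong_sets add: sets_volume_measure[OF H])
    have oV: "fst c \<in> sets ?V" "B \<in> sets ?V" using c B by (auto simp: sets_volume_measure[OF H])
    have "emeasure (density ?V (\<lambda>x. ennreal (r x))) B = (\<integral>\<^sup>+x. ennreal (r x) * indicator B x \<partial>?V)"
      using rV oV by (simp add: emeasure_density)
    also have "\<dots> = (\<integral>\<^sup>+x. indicator (fst c) x * (ennreal (r x) * indicator B x) \<partial>?V)"
      by (rule nn_integral_cong) (use B in \<open>auto split: split_indicator\<close>)
    also have "\<dots> = (\<integral>\<^sup>+x. ennreal (r x) * indicator B x \<partial>density ?V (indicator (fst c)))"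
      using rV oV by (subst nn_integral_density) auto
    also have "\<dots> = (\<integral>\<^sup>+x. ennreal (r x) * indicator B x \<partial>chart_volume c H)"
      by (simp only: density_chart_eq[OF H c])
    also have "\<dots> = (\<integral>\<^sup>+z. ennreal (r (cinv c z)) * indicator B (cinv c z) \<partial>density lborel (\<lambda>z. ennreal (cdens c H z)))"
      unfolding chart_volume_def by (rule nn_integral_distr) auto
    also have "\<dots> = (\<integral>\<^sup>+z. ennreal (cdens c H z) * (ennreal (r (cinv c z)) * indicator B (cinv c z)) \<partial>lborel)"
      by (rule nn_integral_density) auto
    also have "\<dots> = (\<integral>\<^sup>+z\<in>snd c ` B. ennreal (sqrt (gram_det A H' c (chart_inv c z))) \<partial>lborel)"
    proof (rule nn_integral_cong)
      fix z
      show "ennreal (cdens c H z) * (ennreal (r (cinv c z)) * indicator B (cinv c z))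
        = ennreal (sqrt (gram_det A H' c (chart_inv c z))) * indicator (snd c ` B) z"
      proof (cases "z \<in> snd c ` fst c")
        case True
        then obtain x where x: "z = snd c x" "x \<in> fst c" by auto
        have z: "cinv c z = x" "chart_inv c z = x" using x c by (auto simp: cinv_def)
        have "z \<in> snd c ` B \<longleftrightarrow> x \<in> B" using image_chart_eq[OF c B(2)] True by (auto simp: z)
        moreover have "sqrt (gram_det A H' c x) = cdens c H z * r x"
          using True r(2) by (simp add: gram_det_eq eq[OF c x(2)] cdens_def z real_sqrt_mult)
        ultimately show ?thesis
          using r(2) cdens_nonneg[OF H c] by (auto simp: z ennreal_mult split: split_indicator)
      next
        case False
        then have "z \<notin> snd c ` B" using B by auto
        then show ?thesis using False by (simp add: cdens_def)
      qed
    qed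
    finally show "emeasure (density ?V (\<lambda>x. ennreal (r x))) B
      = (\<integral>\<^sup>+z\<in>snd c ` B. ennreal (sqrt (gram_det A H' c (chart_inv c z))) \<partial>lborel)" .
  qed
qed

lemma integral_volume_chart:
  fixes F :: "'a \<Rightarrow> real"
  assumes H: "riemannian_metric A H" and c: "c \<in> A" and F: "F \<in> borel_measurable borel"
    and supp: "\<And>x. x \<notin> fst c \<Longrightarrow> F x = 0"
  shows "(\<integral>x. F x \<partial>volume_measure A H) = (\<integral>z. cdens c H z * F (cinv c z) \<partial>lborel)"
proof -
  let ?V = "volume_measure A H"
  note [measurable] = cinv_measurable[OF c] cdens_measurable[OF H c] F
  have FV: "F \<in> borel_measurable ?V" using F by (simp cong: measurable_cong_sets add: sets_volume_measure[OF H])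
  have oV: "fst c \<in> sets ?V" using c by (auto simp: sets_volume_measure[OF H])
  have "(\<integral>x. F x \<partial>?V) = (\<integral>x. indicator (fst c) x *\<^sub>R F x \<partial>?V)"
    by (rule Bochner_Integration.integral_cong) (use supp in \<open>auto split: split_indicator\<close>)
  also have "\<dots> = (\<integral>x. F x \<partial>density ?V (\<lambda>x. ennreal (indicator (fst c) x)))"
    using FV oV by (subst integral_density) auto
  also have "\<dots> = (\<integral>x. F x \<partial>chart_volume c H)"
    by (simp add: ennreal_indicator density_chart_eq[OF H c])
  also have "\<dots> = (\<integral>z. F (cinv c z) \<partial>density lborel (\<lambda>z. ennreal (cdens c H z)))"
    unfolding chart_volume_def by (rule integral_distr) auto
  also have "\<dots> = (\<integral>z. cdens c H z *\<^sub>R F (cinv c z) \<partial>lborel)"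
    by (rule integral_density) (use cdens_nonneg[OF H c] in auto)
  finally show ?thesis by simp
qed

end

section \<open>Differentiation under the integral sign\<close>

lemma integrable_indicator_continuous:
  fixes f :: "'a::t2_space \<Rightarrow> real"
  assumes M: "sets M = sets borel" "emeasure M K < \<infinity>" and K: "compact K" "continuous_on K f"
    and \<Omega>: "\<Omega> \<in> sets borel" "\<Omega> \<subseteq> K"
  shows "integrable M (\<lambda>x. indicator \<Omega> x * f x)"
proof -
  have Kb: "K \<in> sets borel" using compact_imp_closed[OF K(1)] by simp
  obtain B where B: "\<And>x. x \<in> K \<Longrightarrow> \<bar>f x\<bar> \<le> B"
    using compact_imp_bounded[OF compact_continuous_image[OF K(2,1)]] by (auto simp: bounded_iff)
  have "(\<lambda>x. indicator K x *\<^sub>R f x) \<in> borel_measurable borel"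
    by (rule borel_measurable_continuous_on_indicator[OF Kb K(2)])
  then have m: "(\<lambda>x. indicator K x * f x) \<in> borel_measurable M"
    using M(1) by (simp cong: measurable_cong_sets)
  have "integrable M (\<lambda>x. indicator \<Omega> x *\<^sub>R (indicator K x * f x))"
  proof (rule integrableI_bounded_set_indicator[OF _ m, of _ B])
    show "\<Omega> \<in> sets M" using \<Omega> M by simp
    show "emeasure M \<Omega> < \<infinity>" using emeasure_mono[OF \<Omega>(2), of M] M Kb by (simp add: le_less_trans)
    show "AE x in M. x \<in> \<Omega> \<longrightarrow> norm (indicator K x * f x) \<le> B"
      using B \<Omega>(2) by (intro AE_I2) (auto simp: subset_iff)
  qed
  moreover have "indicator \<Omega> x *\<^sub>R (indicator K x * f x) = indicator \<Omega> x * f x" for x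
    using \<Omega>(2) by (auto split: split_indicator)
  ultimately show ?thesis by (simp only:)
qed

text \<open>On a smaller compact time interval times \<open>K\<close> the time derivative is bounded
  by some \<open>B\<close>. The mean value inequality bounds the difference quotients by
  \<open>B\<close>, and dominated convergence applies because \<open>K\<close> has finite
  measure.\<close>

lemma has_real_derivative_integral_compact:
  fixes F F' :: "real \<Rightarrow> 'a::t2_space \<Rightarrow> real"
  assumes M: "sets M = sets borel" "emeasure M K < \<infinity>" and K: "compact K"
    and \<Omega>: "\<Omega> \<in> sets borel" "\<Omega> \<subseteq> K" and "\<epsilon> > 0"
    and der: "\<And>t x. \<bar>t\<bar> < \<epsilon> \<Longrightarrow> x \<in> K \<Longrightarrow> ((\<lambda>t. F t x) has_real_derivative F' t x) (at t)"
    and cont: "\<And>t. \<bar>t\<bar> < \<epsilon> \<Longrightarrow> continuous_on K (F t)"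
    and cont': "continuous_on ({-\<epsilon><..<\<epsilon>} \<times> K) (\<lambda>(t, x). F' t x)"
  shows "((\<lambda>t. \<integral>x. indicator \<Omega> x * F t x \<partial>M) has_real_derivative (\<integral>x. indicator \<Omega> x * F' 0 x \<partial>M)) (at 0)"
proof -
  define \<delta> where "\<delta> = \<epsilon> / 2"
  have \<delta>: "0 < \<delta>" "\<delta> < \<epsilon>" using \<open>\<epsilon> > 0\<close> by (auto simp: \<delta>_def)
  have "compact ({-\<delta>..\<delta>} \<times> K)" by (intro compact_Times K) simp
  moreover have "continuous_on ({-\<delta>..\<delta>} \<times> K) (\<lambda>(t, x). F' t x)"
    by (rule continuous_on_subset[OF cont']) (use \<delta> in auto)
  ultimately have "bounded ((\<lambda>(t, x). F' t x) ` ({-\<delta>..\<delta>} \<times> K))"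
    by (intro compact_imp_bounded compact_continuous_image)
  then obtain B where B: "\<And>t x. t \<in> {-\<delta>..\<delta>} \<Longrightarrow> x \<in> K \<Longrightarrow> \<bar>F' t x\<bar> \<le> B"
    by (fastforce simp: bounded_iff)
  have lip: "\<bar>F t x - F 0 x\<bar> \<le> B * \<bar>t\<bar>" if t: "\<bar>t\<bar> < \<delta>" and x: "x \<in> K" for t x
  proof -
    have "norm (F t x - F 0 x) \<le> B * norm (t - 0)"
    proof (rule field_differentiable_bound[of "{-\<delta>..\<delta>}"])
      fix s assume s: "s \<in> {-\<delta>..\<delta>}"
      show "((\<lambda>t. F t x) has_field_derivative F' s x) (at s within {-\<delta>..\<delta>})"
        by (rule has_field_derivative_at_within[OF der[OF _ x]]) (use s \<delta> in auto)
      show "norm (F' s x) \<le> B" using B[OF s x] by simp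
    qed (use t in auto)
    then show ?thesis by simp
  qed
  have int: "integrable M (\<lambda>x. indicator \<Omega> x * F t x)" if "\<bar>t\<bar> < \<epsilon>" for t
    by (rule integrable_indicator_continuous[OF M K cont[OF that] \<Omega>])
  have c0: "continuous_on K (F' 0)"
    using continuous_on_compose2[OF cont', of K "\<lambda>x. (0, x)"] \<delta>
      continuous_on_Pair[OF continuous_on_const[of K 0] continuous_on_id[of K]] by (fastforce simp: image_subset_iff)
  have int': "integrable M (\<lambda>x. indicator \<Omega> x * F' 0 x)"
    by (rule integrable_indicator_continuous[OF M K c0 \<Omega>])
  have intB: "integrable M (\<lambda>x. indicator \<Omega> x * B)"
    by (rule integrable_indicator_continuous[OF M K _ \<Omega>]) simp
  let ?Q = "\<lambda>t x. indicator \<Omega> x * ((F t x - F 0 x) / t)"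
  have "((\<lambda>t. \<integral>x. ?Q t x \<partial>M) \<longlongrightarrow> (\<integral>x. indicator \<Omega> x * F' 0 x \<partial>M)) (at 0 within {-\<delta><..<\<delta>})"
    unfolding tendsto_at_iff_sequentially
  proof (intro allI impI)
    fix X :: "nat \<Rightarrow> real" assume X: "\<forall>i. X i \<in> {-\<delta><..<\<delta>} - {0}" "X \<longlonglongrightarrow> 0"
    have Xi: "\<bar>X i\<bar> < \<delta>" "\<bar>X i\<bar> < \<epsilon>" "X i \<noteq> 0" for i using X(1) \<delta> by (auto simp: abs_less_iff) (smt (verit) greaterThanLessThan_iff)+
    show "((\<lambda>t. \<integral>x. ?Q t x \<partial>M) \<circ> X) \<longlonglongrightarrow> (\<integral>x. indicator \<Omega> x * F' 0 x \<partial>M)"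
      unfolding o_def
    proof (rule integral_dominated_convergence[of _ M _ "\<lambda>x. indicator \<Omega> x * B"])
      show "(\<lambda>x. indicator \<Omega> x * F' 0 x) \<in> borel_measurable M" using int' by blast
      show "?Q (X i) \<in> borel_measurable M" for i
      proof -
        have "integrable M (\<lambda>x. (indicator \<Omega> x * F (X i) x - indicator \<Omega> x * F 0 x) / X i)"
          using int[of "X i"] int[of 0] Xi \<delta> by (intro integrable_divide Bochner_Integration.integrable_diff) auto
        then have "(\<lambda>x. (indicator \<Omega> x * F (X i) x - indicator \<Omega> x * F 0 x) / X i) \<in> borel_measurable M" by blast
        then show ?thesis by (simp add: right_diff_distrib)
      qed
      show "AE x in M. (\<lambda>i. ?Q (X i) x) \<longlonglongrightarrow> indicator \<Omega> x * F' 0 x"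
      proof (rule AE_I2)
        fix x
        show "(\<lambda>i. ?Q (X i) x) \<longlonglongrightarrow> indicator \<Omega> x * F' 0 x"
        proof (cases "x \<in> \<Omega>")
          case True
          then have "((\<lambda>t. F t x) has_real_derivative F' 0 x) (at 0)" using der[of 0 x] \<Omega>(2) \<open>\<epsilon> > 0\<close> by auto
          then have "((\<lambda>t. (F t x - F 0 x) / (t - 0)) \<longlongrightarrow> F' 0 x) (at 0)" by (simp add: has_field_derivative_iff)
          then have "(\<lambda>i. (F (X i) x - F 0 x) / (X i - 0)) \<longlonglongrightarrow> F' 0 x"
            by (rule filterlim_compose) (use X Xi in \<open>simp add: filterlim_at\<close>)
          then show ?thesis using True by simp
        qed simp
      qed
      show "AE x in M. norm (?Q (X i) x) \<le> indicator \<Omega> x * B" for i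
      proof (rule AE_I2)
        fix x
        show "norm (?Q (X i) x) \<le> indicator \<Omega> x * B"
          using lip[OF Xi(1), of x i] Xi(3)[of i] \<Omega>(2)
          by (cases "x \<in> \<Omega>") (auto simp: abs_mult divide_simps)
      qed
    qed (rule intB)
  qed
  then have "((\<lambda>t. \<integral>x. ?Q t x \<partial>M) \<longlongrightarrow> (\<integral>x. indicator \<Omega> x * F' 0 x \<partial>M)) (at 0)"
    using at_within_open[of 0 "{-\<delta><..<\<delta>}"] \<delta> by simp
  moreover have "\<forall>\<^sub>F t in at 0. (\<integral>x. ?Q t x \<partial>M)
      = ((\<integral>x. indicator \<Omega> x * F t x \<partial>M) - (\<integral>x. indicator \<Omega> x * F 0 x \<partial>M)) / (t - 0)"
  proof -
    have "\<forall>\<^sub>F t in at 0. t \<in> {-\<epsilon><..<\<epsilon>}" by (rule eventually_at_in_open') (use \<open>\<epsilon> > 0\<close> in auto)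
    then show ?thesis
    proof eventually_elim
      case (elim t)
      then have "\<bar>t\<bar> < \<epsilon>" by auto
      have "(\<integral>x. ?Q t x \<partial>M) = (\<integral>x. (indicator \<Omega> x * F t x - indicator \<Omega> x * F 0 x) / t \<partial>M)"
        by (simp add: right_diff_distrib)
      also have "\<dots> = ((\<integral>x. indicator \<Omega> x * F t x \<partial>M) - (\<integral>x. indicator \<Omega> x * F 0 x \<partial>M)) / t"
        using int[of t] int[of 0] \<open>\<bar>t\<bar> < \<epsilon>\<close> \<open>\<epsilon> > 0\<close> by simp
      finally show ?case by simp
    qed
  qed
  ultimately show ?thesis
    unfolding has_field_derivative_iff by (rule Lim_transform_eventually)
qed

text \<open>By translation invariance the integral of \<open>V (z + t *\<^sub>R v)\<close> does not
  depend on \<open>t\<close>; its derivative at 0 is the integral of \<open>dd V v\<close>.\<close>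

lemma integral_dd_compact_support:
  fixes V :: "'a::euclidean_space \<Rightarrow> real"
  assumes V: "Ck (Suc 0) V UNIV" and K: "compact K" "\<And>z. z \<notin> K \<Longrightarrow> V z = 0"
  shows "integrable lborel (dd V v)" "(\<integral>z. dd V v z \<partial>lborel) = 0"
proof -
  \<comment> \<open>All translates with parameter in [-1, 1] are supported in this one compact set,
    as differentiation under the integral requires.\<close>
  define L where "L = (\<lambda>(t, z). z - t *\<^sub>R v) ` ({-1..1} \<times> K)"
  have L: "compact L"
    unfolding L_def by (intro compact_continuous_image compact_Times K) (auto simp: case_prod_beta intro!: continuous_intros)
  have KL: "K \<subseteq> L"
  proof
    fix z assume "z \<in> K"
    then show "z \<in> L" unfolding L_def by (intro image_eqI[of _ _ "(0, z)"]) auto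
  qed
  have dd0: "dd V v z = 0" if "z \<notin> K" for z
  proof -
    have "frechet_derivative V (at z) = frechet_derivative (\<lambda>z. 0) (at z)"
      by (rule frechet_derivative_cong_open[of "- K"]) (use that K compact_imp_closed in auto)
    then show ?thesis using dd_eq[OF has_derivative_const[of "0::real"]] by simp
  qed
  have eq: "indicator L z * dd V v z = dd V v z" for z
    using dd0[of z] KL by (auto split: split_indicator)
  have Lfin: "emeasure lborel L < \<infinity>" using emeasure_compact_finite[OF L] by simp
  have Lb: "L \<in> sets borel" using compact_imp_closed[OF L] by simp
  have cd: "continuous_on UNIV (dd V v)" using V by simp
  have "integrable lborel (\<lambda>z. indicator L z * dd V v z)"
    by (rule integrable_indicator_continuous[OF _ Lfin L continuous_on_subset[OF cd] Lb]) auto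
  then show "integrable lborel (dd V v)" by (simp add: eq)
  have D: "((\<lambda>t. \<integral>z. indicator L z * V (z + t *\<^sub>R v) \<partial>lborel) has_real_derivative
      (\<integral>z. indicator L z * dd V v (z + 0 *\<^sub>R v) \<partial>lborel)) (at 0)"
  proof (rule has_real_derivative_integral_compact[OF _ Lfin L Lb order_refl zero_less_one])
    fix t z
    have "((\<lambda>t. z + t *\<^sub>R v) has_derivative (\<lambda>r. r *\<^sub>R v)) (at t)" by (auto intro!: derivative_eq_intros)
    from has_derivative_compose[OF this Ck_has_derivative[OF V UNIV_I]]
    have "((\<lambda>t. V (z + t *\<^sub>R v)) has_derivative (\<lambda>r. dd V (r *\<^sub>R v) (z + t *\<^sub>R v))) (at t)" .
    moreover have "linear (frechet_derivative V (at (z + t *\<^sub>R v)))"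
      using Ck_has_derivative[OF V UNIV_I] has_derivative_linear by blast
    then have "(\<lambda>r. dd V (r *\<^sub>R v) (z + t *\<^sub>R v)) = (*) (dd V v (z + t *\<^sub>R v))"
      by (auto simp: linear_scale)
    ultimately show "((\<lambda>t. V (z + t *\<^sub>R v)) has_real_derivative dd V v (z + t *\<^sub>R v)) (at t)"
      by (simp add: has_field_derivative_def)
    have cV: "continuous_on UNIV V" by (rule Ck_continuous_on[OF V])
    show "continuous_on L (\<lambda>z. V (z + t *\<^sub>R v))"
      by (rule continuous_on_compose2[OF cV]) (auto intro!: continuous_intros)
  next
    show "continuous_on ({- 1<..<1} \<times> L) (\<lambda>(t, z). dd V v (z + t *\<^sub>R v))"
      unfolding case_prod_beta by (rule continuous_on_compose2[OF cd]) (auto intro!: continuous_intros)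
  qed simp
  have "(\<integral>z. indicator L z * V (z + t *\<^sub>R v) \<partial>lborel) = (\<integral>z. V z \<partial>lborel)" if t: "t \<in> {-1<..<1}" for t
  proof -
    have "indicator L z * V (z + t *\<^sub>R v) = V (t *\<^sub>R v + z)" for z
    proof (cases "z + t *\<^sub>R v \<in> K")
      case True
      then have "z \<in> L" unfolding L_def using t by (intro image_eqI[of _ _ "(t, z + t *\<^sub>R v)"]) auto
      then show ?thesis by (simp add: add.commute)
    qed (use K(2)[of "z + t *\<^sub>R v"] in \<open>simp add: add.commute\<close>)
    then have "(\<integral>z. indicator L z * V (z + t *\<^sub>R v) \<partial>lborel) = (\<integral>z. V (t *\<^sub>R v + z) \<partial>lborel)" by simp
    also have "\<dots> = (\<integral>z. V z \<partial>distr lborel borel ((+) (t *\<^sub>R v)))"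
      by (rule integral_distr[symmetric])
        (auto intro!: borel_measurable_continuous_onI Ck_continuous_on[OF V])
    also have "\<dots> = (\<integral>z. V z \<partial>lborel)" by (simp only: lborel_distr_plus)
    finally show ?thesis .
  qed
  then have "((\<lambda>t. \<integral>z. indicator L z * V (z + t *\<^sub>R v) \<partial>lborel) has_real_derivative 0) (at 0)"
    by (intro has_field_derivative_transform_within_open[OF DERIV_const[of "\<integral>z. V z \<partial>lborel"], where S = "{-1<..<1}"]) auto
  from DERIV_unique[OF this D] show "(\<integral>z. dd V v z \<partial>lborel) = 0" by (simp add: eq)
qed

section \<open>Integration on the manifold\<close>

definition C1_fun :: "('a, 'n::finite) chart set \<Rightarrow> ('a \<Rightarrow> real) \<Rightarrow> bool" where
  "C1_fun A \<zeta> \<longleftrightarrow> (\<forall>c\<in>A. Ck (Suc 0) (\<lambda>z. \<zeta> (chart_inv c z)) (snd c ` fst c))"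

section \<open>Once differentiable bump functions and integration by charts\<close>

lemma DERIV_max_sq: "((\<lambda>s::real. (max 0 s)\<^sup>2) has_real_derivative 2 * max 0 s) (at s)"
proof -
  consider "s < 0" | "s = 0" | "s > 0" by linarith
  then show ?thesis
  proof cases
    case 1
    then have z: "2 * max 0 s = 0" by simp
    show ?thesis
      unfolding z by (rule has_field_derivative_transform_within_open[where f = "\<lambda>s. 0" and S = "{..<0}"]) (use 1 in auto)
  next
    case 2
    have "((\<lambda>h::real. max 0 h) \<longlongrightarrow> max 0 0) (at 0)" by (intro tendsto_intros)
    then have "((\<lambda>h::real. max 0 h) \<longlongrightarrow> 0) (at 0)" by simp
    then have "((\<lambda>h::real. ((max 0 h)\<^sup>2 - 0) / (h - 0)) \<longlongrightarrow> 0) (at 0)"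
    proof (rule Lim_transform_eventually[OF _ eventually_mono[OF eventually_neq_at_within[of 0]]])
      fix h :: real assume "h \<noteq> 0"
      then show "max 0 h = ((max 0 h)\<^sup>2 - 0) / (h - 0)" by (simp add: power2_eq_square max_def)
    qed
    then show ?thesis using 2 by (simp add: has_field_derivative_iff)
  next
    case 3
    have "((\<lambda>s::real. s\<^sup>2) has_real_derivative 2 * s) (at s)" by (auto intro!: derivative_eq_intros)
    then have "((\<lambda>s::real. (max 0 s)\<^sup>2) has_real_derivative 2 * s) (at s)"
      by (rule has_field_derivative_transform_within_open[where S = "{0<..}"]) (use 3 in auto)
    then show ?thesis using 3 by simp
  qed
qed

text \<open>The square of the positive part is C^1, which yields a bump supported in a closed ball
  without exponential functions; a single derivative is all that the localisation uses.\<close>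

lemma Ck_bump: "Ck (Suc 0) (\<lambda>z::'a::euclidean_space. (max 0 (r - (z - z0) \<bullet> (z - z0)))\<^sup>2) UNIV"
proof (rule Ck_compose[of _ "\<lambda>s. (max 0 s)\<^sup>2" UNIV])
  show "Ck (Suc 0) (\<lambda>s::real. (max 0 s)\<^sup>2) UNIV"
    by (rule Ck_SucI[OF open_UNIV DERIV_max_sq[unfolded has_field_derivative_def]])
      (auto intro!: continuous_intros)
  show "Ck (Suc 0) (\<lambda>z. r - (z - z0) \<bullet> (z - z0)) UNIV"
    by (intro Ck_diff Ck_inner Ck_const Ck_id open_UNIV)
qed auto

context smooth_manifold
begin

lemma chart_ball:
  obtains c r where "c \<in> A" "x \<in> fst c" "r > 0" "cball (snd c x) r \<subseteq> snd c ` fst c"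
proof -
  have "open (snd (chart_at A x) ` fst (chart_at A x))" "snd (chart_at A x) x \<in> snd (chart_at A x) ` fst (chart_at A x)"
    using chart_at by auto
  then show ?thesis using that[of "chart_at A x"] chart_at by (metis open_contains_cball)
qed

lemma chart_inv_compact:
  "c \<in> A \<Longrightarrow> compact K \<Longrightarrow> K \<subseteq> snd c ` fst c \<Longrightarrow> compact (chart_inv c ` K)"
  by (rule compact_continuous_image[OF continuous_on_subset[OF chart_continuous(2)]])

lemma chart_inv_open: "c \<in> A \<Longrightarrow> open O' \<Longrightarrow> O' \<subseteq> snd c ` fst c \<Longrightarrow> open (chart_inv c ` O')"
proof -
  assume c: "c \<in> A" and O': "open O'" "O' \<subseteq> snd c ` fst c"
  have "chart_inv c ` O' = fst c \<inter> snd c -` O'"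
    using c O'(2) by (auto simp: image_iff subset_iff) (metis chart_inv_left)
  then show ?thesis using continuous_open_preimage[OF chart_continuous(1)[OF c]] c O' by simp
qed

lemma volume_compact_finite:
  assumes H: "riemannian_metric A H" and K: "compact K"
  shows "emeasure (volume_measure A H) K < \<infinity>"
proof -
  let ?V = "volume_measure A H"
  have loc: "\<exists>N. open N \<and> x \<in> N \<and> emeasure ?V N < \<infinity>" for x
  proof -
    obtain c r where c: "c \<in> A" "x \<in> fst c" and r: "r > 0" "cball (snd c x) r \<subseteq> snd c ` fst c"
      using chart_ball .
    define N where "N = chart_inv c ` ball (snd c x) r"
    have sub: "ball (snd c x) r \<subseteq> snd c ` fst c" using r ball_subset_cball by blast
    have N: "open N" unfolding N_def by (rule chart_inv_open[OF c(1) open_ball sub])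
    have xN: "x \<in> N" unfolding N_def using r c by (intro image_eqI[of _ _ "snd c x"]) auto
    have Nc: "N \<subseteq> fst c" using sub c by (force simp: N_def subset_iff)
    have sN: "snd c ` N = ball (snd c x) r"
      using sub c by (force simp: N_def image_image subset_iff)
    have cd: "continuous_on (cball (snd c x) r) (\<lambda>z. sqrt (det (gmat A c H (chart_inv c z))))"
      by (rule continuous_on_subset[OF Ck_continuous_on[OF cdens_Ck[OF H c(1), of 0]] r(2)])
    obtain B where B: "\<And>z. z \<in> cball (snd c x) r \<Longrightarrow> \<bar>sqrt (det (gmat A c H (chart_inv c z)))\<bar> \<le> B"
      using compact_imp_bounded[OF compact_continuous_image[OF cd compact_cball]]
      unfolding bounded_iff by (metis imageI real_norm_def)
    have "emeasure ?V N = (\<integral>\<^sup>+z\<in>ball (snd c x) r. ennreal (sqrt (det (gmat A c H (chart_inv c z)))) \<partial>lborel)"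
      using N Nc by (simp add: emeasure_volume_measure[OF H c(1)] emeasure_chart_volume[OF H c(1)] Int_absorb2 sN gram_det_eq)
    also have "\<dots> \<le> (\<integral>\<^sup>+z\<in>ball (snd c x) r. ennreal B \<partial>lborel)"
    proof (rule nn_integral_mono)
      fix z
      show "ennreal (sqrt (det (gmat A c H (chart_inv c z)))) * indicator (ball (snd c x) r) z
          \<le> ennreal B * indicator (ball (snd c x) r) z"
        using B[of z] by (auto split: split_indicator intro!: ennreal_leI)
    qed
    also have "\<dots> = ennreal B * emeasure lborel (ball (snd c x) r)" by (simp add: nn_integral_cmult_indicator)
    also have "\<dots> < \<infinity>" using emeasure_lborel_ball_finite[of "snd c x" r] by (simp add: ennreal_mult_less_top)
    finally show ?thesis using N xN by blast
  qed
  then obtain N where N: "\<And>x. open (N x)" "\<And>x. x \<in> N x" "\<And>x. emeasure ?V (N x) < \<infinity>" by metis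
  have "K \<subseteq> (\<Union>x\<in>K. N x)" using N(2) by blast
  then obtain T where T: "T \<subseteq> K" "finite T" "K \<subseteq> (\<Union>x\<in>T. N x)"
    by (rule compactE_image[OF K, of K N, rotated]) (use N(1) in auto)
  have "emeasure ?V K \<le> emeasure ?V (\<Union>x\<in>T. N x)"
    using T N(1) by (intro emeasure_mono) (auto simp: sets_volume_measure[OF H])
  also have "\<dots> \<le> (\<Sum>x\<in>T. emeasure ?V (N x))"
    using T N(1) by (intro emeasure_subadditive_finite) (auto simp: sets_volume_measure[OF H])
  also have "\<dots> < \<infinity>" using N(3) T(2) by (induction T rule: infinite_finite_induct) auto
  finally show ?thesis .
qed

text \<open>In a chart the density is strictly positive, so measure zero would make a nonempty open
  subset of Euclidean space negligible. Positivity of the total volume is needed for the normalising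
  quotients.\<close>

lemma volume_open_pos:
  assumes H: "riemannian_metric A H" and U: "open U" "U \<noteq> {}"
  shows "emeasure (volume_measure A H) U > 0"
proof (rule ccontr)
  let ?V = "volume_measure A H"
  assume "\<not> ?thesis"
  then have U0: "emeasure ?V U = 0" by simp
  obtain x where x: "x \<in> U" using U by blast
  define c where "c = chart_at A x"
  have c: "c \<in> A" "x \<in> fst c" using chart_at by (auto simp: c_def)
  define B where "B = U \<inter> fst c"
  have B: "open B" "B \<subseteq> fst c" "B \<noteq> {}" using U c x by (auto simp: B_def)
  have "emeasure ?V B = 0"
    using emeasure_mono[of B U ?V] U U0 by (simp add: B_def sets_volume_measure[OF H])
  moreover have "emeasure ?V B = (\<integral>\<^sup>+z. ennreal (cdens c H z) * indicator (snd c ` B) z \<partial>lborel)"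
  proof -
    have "ennreal (sqrt (det (gmat A c H (chart_inv c z)))) * indicator (snd c ` B) z
        = ennreal (cdens c H z) * indicator (snd c ` B) z" for z
      using image_mono[OF B(2), of "snd c"] by (auto simp: cdens_def split: split_indicator)
    then show ?thesis
      using B by (simp add: emeasure_volume_measure[OF H c(1)] emeasure_chart_volume[OF H c(1)] Int_absorb2 gram_det_eq)
  qed
  ultimately have ae: "AE z in lborel. ennreal (cdens c H z) * indicator (snd c ` B) z = 0"
    using cdens_measurable[OF H c(1)] open_chart_image'[OF c(1) B(1,2)]
    by (subst nn_integral_0_iff_AE[symmetric]) auto
  have out: "z \<notin> snd c ` B" if "ennreal (cdens c H z) * indicator (snd c ` B) z = 0" for z
  proof
    assume z: "z \<in> snd c ` B"
    then obtain y where "y \<in> fst c" "z = snd c y" using B by auto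
    then have "cdens c H z > 0" using det_gmat_pos[OF H c(1), of y] c by (simp add: cdens_def)
    then show False using that z by simp
  qed
  have "snd c ` B \<in> sets lborel" using open_chart_image'[OF c(1) B(1,2)] by simp
  then have "snd c ` B \<in> null_sets lborel"
    using AE_iff_null_sets[of "snd c ` B" lborel] eventually_mono[OF ae out] by simp
  then have "negligible (snd c ` B)"
    unfolding negligible_iff_null_sets by (simp add: null_sets_completionI)
  then show False
    using open_not_negligible[OF open_chart_image'[OF c(1) B(1,2)]] B(3) by simp
qed

text \<open>The density times \<open>F\<close> is a coordinate divergence. Since \<open>K\<close> is
  compact inside the open chart image, the extension of \<open>V\<close> by 0 is C^1 on the whole
  space, and each partial derivative integrates to 0.\<close>

lemma integral_chart_divergence:
  fixes V :: "real ^ 'n \<Rightarrow> real ^ 'n" and F :: "'a \<Rightarrow> real"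
  assumes H: "riemannian_metric A H" and c: "c \<in> A" and F: "F \<in> borel_measurable borel" "\<And>x. x \<notin> fst c \<Longrightarrow> F x = 0"
    and V: "\<And>i. Ck (Suc 0) (\<lambda>z. V z $ i) (snd c ` fst c)"
    and K: "compact K" "K \<subseteq> snd c ` fst c" "\<And>z. z \<in> snd c ` fst c - K \<Longrightarrow> V z = 0"
    and div: "\<And>x. x \<in> fst c \<Longrightarrow>
      sqrt (det (gmat A c H x)) * F x = (\<Sum>i\<in>UNIV. dd (\<lambda>z. V z $ i) (axis i 1) (snd c x))"
  shows "(\<integral>x. F x \<partial>volume_measure A H) = 0"
proof -
  define W where "W i z = (if z \<in> snd c ` fst c then V z $ i else 0)" for i z
  have oK: "open (- K)" using K(1) compact_imp_closed by blast
  have W0: "W i z = 0" if "z \<notin> K" for i z using K(3)[of z] that by (auto simp: W_def)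
  have W: "Ck (Suc 0) (W i) UNIV" for i
  proof (rule Ck_local)
    fix z :: "real ^ 'n"
    show "\<exists>T. open T \<and> z \<in> T \<and> Ck (Suc 0) (W i) T"
    proof (cases "z \<in> K")
      case True
      have "Ck (Suc 0) (W i) (snd c ` fst c)"
        by (rule Ck_cong[OF _ _ V[of i]]) (use c in \<open>auto simp: W_def\<close>)
      then show ?thesis using True K c open_chart(2)[OF c] by blast
    next
      case False
      have "Ck (Suc 0) (W i) (- K)"
        by (rule Ck_cong[OF oK _ Ck_const[of _ 0]]) (simp add: W0)
      then show ?thesis using False oK by blast
    qed
  qed
  note ddW = integral_dd_compact_support[OF W K(1) W0]
  have "(\<integral>x. F x \<partial>volume_measure A H) = (\<integral>z. cdens c H z * F (cinv c z) \<partial>lborel)"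
    by (rule integral_volume_chart[OF H c F])
  also have "\<dots> = (\<integral>z. (\<Sum>i\<in>UNIV. dd (W i) (axis i 1) z) \<partial>lborel)"
  proof (rule Bochner_Integration.integral_cong[OF refl])
    fix z
    show "cdens c H z * F (cinv c z) = (\<Sum>i\<in>UNIV. dd (W i) (axis i 1) z)"
    proof (cases "z \<in> snd c ` fst c")
      case True
      then obtain x where x: "x \<in> fst c" "z = snd c x" by auto
      have "dd (W i) (axis i 1) z = dd (\<lambda>z. V z $ i) (axis i 1) z" for i
        using frechet_derivative_cong_open[OF open_chart(2)[OF c] True, of "W i" "\<lambda>z. V z $ i"] by (simp add: W_def)
      then show ?thesis using div[OF x(1)] x c by (simp add: cdens_def cinv_def)
    next
      case False
      then have zK: "z \<in> - K" using K(2) by auto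
      have "dd (W i) (axis i 1) z = dd (\<lambda>z. 0) (axis i 1) z" for i
        using frechet_derivative_cong_open[OF oK zK, of "W i" "\<lambda>z. 0"] W0 by simp
      then have "dd (W i) (axis i 1) z = 0" for i
        using dd_eq[OF has_derivative_const[of "0::real"]] by simp
      then show ?thesis using False by (simp add: cdens_def)
    qed
  qed
  also have "\<dots> = 0" using ddW by (subst Bochner_Integration.integral_sum) auto
  finally show ?thesis .
qed

text \<open>Regularity across the edge of the chart: the compact set carrying the bump is closed
  because the space is Hausdorff, so its complement and the chart domain are two open sets covering
  the manifold, and the bump is C^1 on each.\<close>

lemma C1_bump:
  assumes c: "c \<in> A" and r: "r > 0" "cball z0 r \<subseteq> snd c ` fst c"
  defines "\<zeta> \<equiv> \<lambda>y. if y \<in> fst c then (max 0 (r\<^sup>2 - (snd c y - z0) \<bullet> (snd c y - z0)))\<^sup>2 else 0"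
  shows "C1_fun A \<zeta>" "\<And>y. y \<notin> chart_inv c ` cball z0 r \<Longrightarrow> \<zeta> y = 0" "\<And>y. \<zeta> y \<ge> 0"
    "\<And>y. y \<in> chart_inv c ` ball z0 r \<Longrightarrow> \<zeta> y > 0"
proof -
  define b where "b z = (max 0 (r\<^sup>2 - (z - z0) \<bullet> (z - z0)))\<^sup>2" for z :: "real ^ 'n"
  have b: "Ck (Suc 0) b UNIV" unfolding b_def by (rule Ck_bump)
  have ip: "(z - z0) \<bullet> (z - z0) = (dist z0 z)\<^sup>2" for z
    unfolding dist_norm norm_minus_commute[of z0] by (simp add: power2_norm_eq_inner)
  define L where "L = chart_inv c ` cball z0 r"
  have L: "compact L" "closed L" unfolding L_def using chart_inv_compact[OF c compact_cball r(2)] compact_imp_closed by auto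
  show out: "\<zeta> y = 0" if y: "y \<notin> chart_inv c ` cball z0 r" for y
  proof (cases "y \<in> fst c")
    case True
    have "snd c y \<notin> cball z0 r"
      using y True c by (metis chart_inv_left imageI)
    then have "r \<le> dist z0 (snd c y)" by simp
    then have "r\<^sup>2 \<le> (dist z0 (snd c y))\<^sup>2" using r by (intro power_mono) auto
    then show ?thesis by (simp add: \<zeta>_def ip)
  qed (simp add: \<zeta>_def)
  show "\<zeta> y \<ge> 0" for y by (simp add: \<zeta>_def)
  show "\<zeta> y > 0" if "y \<in> chart_inv c ` ball z0 r" for y
  proof -
    from that obtain z where z: "z \<in> ball z0 r" "y = chart_inv c z" by blast
    then have "z \<in> snd c ` fst c" using r ball_subset_cball by blast
    then have y: "y \<in> fst c" "snd c y = z" using z c by auto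
    have "(dist z0 z)\<^sup>2 < r\<^sup>2" using z r by (intro power_strict_mono) auto
    then show ?thesis using y by (simp add: \<zeta>_def ip)
  qed
  show "C1_fun A \<zeta>"
    unfolding C1_fun_def
  proof (intro ballI Ck_local)
    fix d z assume d: "d \<in> A" and z: "z \<in> snd d ` fst d"
    then obtain y where y: "y \<in> fst d" "z = snd d y" by auto
    show "\<exists>T. open T \<and> z \<in> T \<and> Ck (Suc 0) (\<lambda>z. \<zeta> (chart_inv d z)) T"
    proof (cases "y \<in> L")
      case True
      then have yc: "y \<in> fst c" using r(2) c by (force simp: L_def subset_iff)
      have o: "open (snd d ` (fst d \<inter> fst c))" by (rule open_chart_inter[OF d c])
      have "Ck (Suc 0) (\<lambda>z. b ((snd c \<circ> chart_inv d) z)) (snd d ` (fst d \<inter> fst c))"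
        by (rule Ck_compose[OF b Ck_transition[OF d c] _ o]) simp
      then have "Ck (Suc 0) (\<lambda>z. \<zeta> (chart_inv d z)) (snd d ` (fst d \<inter> fst c))"
        by (rule Ck_cong[OF o, rotated]) (use d in \<open>auto simp: \<zeta>_def b_def\<close>)
      then show ?thesis using o y yc by blast
    next
      case False
      have o: "open (snd d ` (- L \<inter> fst d))" by (rule open_chart_image[OF d]) (use L in auto)
      have "Ck (Suc 0) (\<lambda>z. \<zeta> (chart_inv d z)) (snd d ` (- L \<inter> fst d))"
        by (rule Ck_cong[OF o _ Ck_const[of _ 0]]) (use d out in \<open>auto simp: L_def[symmetric]\<close>)
      then show ?thesis using o y False by blast
    qed
  qed
qed

text \<open>An unnormalised partition of unity: the sum is only required to be positive on
  \<open>K\<close>. Division by it is postponed until it is applied to a form that vanishes off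
  \<open>K\<close>.\<close>

lemma bump_cover:
  assumes K: "compact K"
  obtains I :: "'a set" and c \<zeta> L where "finite I" "\<And>i. i \<in> I \<Longrightarrow> c i \<in> A" "\<And>i. i \<in> I \<Longrightarrow> C1_fun A (\<zeta> i)"
    "\<And>i y. i \<in> I \<Longrightarrow> y \<notin> L i \<Longrightarrow> \<zeta> i y = 0" "\<And>i. i \<in> I \<Longrightarrow> compact (L i)" "\<And>i. i \<in> I \<Longrightarrow> L i \<subseteq> fst (c i)"
    "\<And>y. (\<Sum>i\<in>I. \<zeta> i y) \<ge> 0" "\<And>y. y \<in> K \<Longrightarrow> (\<Sum>i\<in>I. \<zeta> i y) > 0"
proof -
  have "\<exists>c \<zeta> L N. c \<in> A \<and> C1_fun A \<zeta> \<and> (\<forall>y. y \<notin> L \<longrightarrow> \<zeta> y = 0) \<and> compact L \<and> L \<subseteq> fst c \<and>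
     (\<forall>y. \<zeta> y \<ge> 0) \<and> open N \<and> x \<in> N \<and> (\<forall>y\<in>N. \<zeta> y > 0)" for x
  proof -
    obtain c r where c: "c \<in> A" "x \<in> fst c" and r: "r > 0" "cball (snd c x) r \<subseteq> snd c ` fst c"
      using chart_ball .
    have sub: "ball (snd c x) r \<subseteq> snd c ` fst c" using r ball_subset_cball by blast
    have xN: "x \<in> chart_inv c ` ball (snd c x) r" using r c by (intro image_eqI[of _ _ "snd c x"]) auto
    have Lc: "chart_inv c ` cball (snd c x) r \<subseteq> fst c"
      using r(2) c by (force simp: subset_iff)
    show ?thesis
      using C1_bump[OF c(1) r] chart_inv_compact[OF c(1) compact_cball r(2)] Lc c(1) xN chart_inv_open[OF c(1) open_ball sub]
      by blast
  qed
  then obtain c \<zeta> L N where P: "\<And>x. c x \<in> A" "\<And>x. C1_fun A (\<zeta> x)" "\<And>x y. y \<notin> L x \<Longrightarrow> \<zeta> x y = 0"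
    "\<And>x. compact (L x)" "\<And>x. L x \<subseteq> fst (c x)" "\<And>x y. \<zeta> x y \<ge> (0::real)" "\<And>x. open (N x)" "\<And>x. x \<in> N x"
    "\<And>x y. y \<in> N x \<Longrightarrow> \<zeta> x y > 0" by metis
  have "K \<subseteq> (\<Union>x\<in>K. N x)" using P(8) by blast
  then obtain I where I: "I \<subseteq> K" "finite I" "K \<subseteq> (\<Union>x\<in>I. N x)"
    by (rule compactE_image[OF K, of K N, rotated]) (use P(7) in auto)
  have "(\<Sum>i\<in>I. \<zeta> i y) > 0" if "y \<in> K" for y
  proof -
    obtain x where "x \<in> I" "y \<in> N x" using I(3) \<open>y \<in> K\<close> by auto
    then show ?thesis using sum_pos2[OF I(2), of x "\<lambda>i. \<zeta> i y"] P by auto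
  qed
  then show ?thesis using that[of I c \<zeta> L] I P by (simp add: sum_nonneg)
qed

end

section \<open>Derivatives of determinants and inverse matrices\<close>

lemma outer_mult: "outer u v ** M = outer u (v v* (M :: real ^ 'n::finite ^ 'n))"
  by (simp add: vec_eq_iff outer_def matrix_matrix_mult_def vector_matrix_mult_def sum_distrib_left mult_ac)

lemma mult_outer: "(M :: real ^ 'n::finite ^ 'n) ** outer u v = outer (M *v u) v"
  by (simp add: vec_eq_iff outer_def matrix_matrix_mult_def matrix_vector_mult_def sum_distrib_left mult_ac)

lemma outer_mult_outer: "outer u v ** outer w x = (v \<bullet> w) *\<^sub>R outer u (x :: real ^ 'n::finite)"
  by (simp add: mult_outer outer_mult_vector) (simp add: outer_def vec_eq_iff)

lemma trace_outer: "trace (outer u v) = u \<bullet> (v :: real ^ 'n::finite)"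
  by (simp add: trace_def outer_def inner_vec_def)

lemma outer_zero [simp]: "outer 0 v = 0" "outer u 0 = 0"
  by (simp_all add: outer_def vec_eq_iff)

lemma bounded_bilinear_matrix_mult:
  "bounded_bilinear ((**) :: real ^ 'n::finite ^ 'n \<Rightarrow> real ^ 'n ^ 'n \<Rightarrow> real ^ 'n ^ 'n)"
  by (subst bilinear_conv_bounded_bilinear[symmetric])
    (auto simp: bilinear_def linear_iff matrix_ring)

lemma bounded_bilinear_matrix_vector:
  "bounded_bilinear ((*v) :: real ^ 'n::finite ^ 'n \<Rightarrow> real ^ 'n \<Rightarrow> real ^ 'n)"
  by (subst bilinear_conv_bounded_bilinear[symmetric])
    (auto simp: bilinear_def linear_iff matrix_vector_mult_add_rdistrib matrix_vector_right_distrib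
      scaleR_matrix_vector matrix_vector_mult_scaleR)

lemma bounded_linear_trace: "bounded_linear (trace :: real ^ 'n::finite ^ 'n \<Rightarrow> real)"
  by (subst linear_conv_bounded_linear[symmetric]) (auto simp: linear_iff trace_ring)

lemma bounded_bilinear_outer: "bounded_bilinear (outer :: real ^ 'n::finite \<Rightarrow> real ^ 'n \<Rightarrow> real ^ 'n ^ 'n)"
  by (subst bilinear_conv_bounded_bilinear[symmetric])
    (auto simp: bilinear_def linear_iff outer_def vec_eq_iff algebra_simps)

lemmas Ck_matrix_mult = Ck_bilinear[OF bounded_bilinear_matrix_mult]
lemmas Ck_matrix_vector = Ck_bilinear[OF bounded_bilinear_matrix_vector]
lemmas Ck_outer = Ck_bilinear[OF bounded_bilinear_outer]
lemmas Ck_trace = Ck_linear[OF bounded_linear_trace]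

lemma Ck_matrix:
  fixes M :: "'a::euclidean_space \<Rightarrow> real ^ 'n::finite ^ 'n"
  assumes "\<And>i j. Ck k (\<lambda>x. M x $ i $ j) S" "open S"
  shows "Ck k M S"
  by (intro Ck_vec assms)

lemma Ck_matrix_nth:
  fixes M :: "'a::euclidean_space \<Rightarrow> real ^ 'n::finite ^ 'n"
  shows "Ck k M S \<Longrightarrow> open S \<Longrightarrow> Ck k (\<lambda>x. M x $ i $ j) S"
  by (intro Ck_vec_nth)

lemma invertible_iff_det: "invertible M \<longleftrightarrow> det (M :: real ^ 'n::finite ^ 'n) \<noteq> 0"
  by (rule invertible_det_nz)

text \<open>Writing \<open>D = C ** M\<close>, each row of \<open>D\<close> is a combination of rows
  of \<open>M\<close>, and by multilinearity only the diagonal coefficient of \<open>C\<close>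
  contributes to the determinant with that row replaced.\<close>

lemma det_replace_row:
  fixes M D :: "real ^ 'n::finite ^ 'n"
  assumes M: "invertible M"
  shows "(\<Sum>i\<in>UNIV. det (\<chi> k. if k = i then D $ i else M $ k)) = det M * trace (matrix_inv M ** D)"
proof -
  define C where "C = D ** matrix_inv M"
  have "D = C ** M" by (simp add: C_def matrix_mul_assoc[symmetric] matrix_inv[OF M])
  then have D: "D $ i = (\<Sum>k\<in>UNIV. C $ i $ k *s row k M)" for i
    by (simp add: vec_eq_iff matrix_matrix_mult_def row_def)
  have "det (\<chi> k. if k = i then D $ i else M $ k) = C $ i $ i * det M" for i
  proof -
    have "(\<chi> k. if k = i then D $ i else M $ k)
      = (\<chi> k. if k = i then (\<Sum>j\<in>UNIV. C $ i $ j *s row j M) else row k M)"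
      by (simp add: vec_eq_iff D row_def)
    then show ?thesis using cramer_lemma_transpose[where x = "C $ i" and A = M and k = i] by simp
  qed
  then have "(\<Sum>i\<in>UNIV. det (\<chi> k. if k = i then D $ i else M $ k)) = trace C * det M"
    by (simp add: trace_def sum_distrib_right)
  then show ?thesis using trace_mul_sym[of D "matrix_inv M"] by (simp add: C_def)
qed

text \<open>Jacobi's formula: the product rule in the permutation expansion collects into
  determinants with one row replaced.\<close>

lemma det_has_derivative:
  fixes M :: "'a::real_normed_vector \<Rightarrow> real ^ 'n::finite ^ 'n"
  assumes M: "(M has_derivative M') (at x)" "invertible (M x)"
  shows "((\<lambda>y. det (M y)) has_derivative (\<lambda>h. det (M x) * trace (matrix_inv (M x) ** M' h))) (at x)"
proof -
  have e: "((\<lambda>y. M y $ i $ j) has_derivative (\<lambda>h. M' h $ i $ j)) (at x)" for i j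
    by (intro bounded_linear.has_derivative[OF bounded_linear_vec_nth] M(1))
  have "((\<lambda>y. det (M y)) has_derivative
    (\<lambda>h. \<Sum>p | p permutes UNIV. of_int (sign p) *
       (\<Sum>i\<in>UNIV. M' h $ i $ p i * (\<Prod>j\<in>UNIV - {i}. M x $ j $ p j)))) (at x)"
    unfolding det_def by (intro has_derivative_sum has_derivative_mult_right has_derivative_prod e)
  moreover have "(\<Sum>p | p permutes UNIV. of_int (sign p) *
       (\<Sum>i\<in>UNIV. M' h $ i $ p i * (\<Prod>j\<in>UNIV - {i}. M x $ j $ p j)))
     = det (M x) * trace (matrix_inv (M x) ** M' h)" for h
  proof -
    have "(\<Prod>k\<in>UNIV. (if k = i then M' h $ i else M x $ k) $ p k)
      = M' h $ i $ p i * (\<Prod>j\<in>UNIV - {i}. M x $ j $ p j)" for i p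
      by (subst prod.remove[of UNIV i]) (auto intro!: prod.cong)
    then have "(\<Sum>i\<in>UNIV. det (\<chi> k. if k = i then M' h $ i else M x $ k))
      = (\<Sum>i\<in>UNIV. \<Sum>p | p permutes UNIV. of_int (sign p) * (M' h $ i $ p i * (\<Prod>j\<in>UNIV - {i}. M x $ j $ p j)))"
      by (simp add: det_def)
    also have "\<dots> = (\<Sum>p | p permutes UNIV. of_int (sign p) *
       (\<Sum>i\<in>UNIV. M' h $ i $ p i * (\<Prod>j\<in>UNIV - {i}. M x $ j $ p j)))"
      by (subst sum.swap) (simp add: sum_distrib_left)
    finally show ?thesis using det_replace_row[OF M(2), of "M' h"] by simp
  qed
  ultimately show ?thesis by simp
qed

text \<open>Cramer's rule for the columns of the inverse. Its entries become quotients of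
  determinants, from which the C^k property of the inverse follows.\<close>

lemma matrix_inv_nth:
  fixes M :: "real ^ 'n::finite ^ 'n"
  assumes "det M \<noteq> 0"
  shows "matrix_inv M $ k $ l = det (\<chi> i j. if j = k then axis l 1 $ i else M $ i $ j) / det M"
proof -
  have "M *v (matrix_inv M *v axis l 1) = axis l 1"
    using assms by (simp add: matrix_vector_mul_assoc matrix_inv invertible_iff_det)
  then have "matrix_inv M *v axis l 1 = (\<chi> k. det (\<chi> i j. if j = k then axis l 1 $ i else M $ i $ j) / det M)"
    using cramer[OF assms] by blast
  then have "(matrix_inv M *v axis l 1) $ k = det (\<chi> i j. if j = k then axis l 1 $ i else M $ i $ j) / det M"
    by simp
  then show ?thesis by (simp add: matrix_vector_mult_basis column_def)
qed

lemma Ck_matrix_inv: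
  fixes M :: "'a::euclidean_space \<Rightarrow> real ^ 'n::finite ^ 'n"
  assumes M: "Ck k M S" and S: "open S" and nz: "\<And>x. x \<in> S \<Longrightarrow> det (M x) \<noteq> 0"
  shows "Ck k (\<lambda>x. matrix_inv (M x)) S"
proof (rule Ck_matrix[OF _ S])
  fix a b
  have "Ck k (\<lambda>x. det (\<chi> i j. if j = a then axis b 1 $ i else M x $ i $ j) / det (M x)) S"
  proof (rule Ck_divide[OF Ck_det[OF _ S] Ck_det[OF Ck_matrix_nth[OF M S] S] nz S])
    fix i j
    show "Ck k (\<lambda>x. (\<chi> i j. if j = a then axis b 1 $ i else M x $ i $ j) $ i $ j) S"
      using Ck_matrix_nth[OF M S] by (cases "j = a") simp_all
  qed
  then show "Ck k (\<lambda>x. matrix_inv (M x) $ a $ b) S"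
    by (rule Ck_cong[OF S, rotated]) (simp add: matrix_inv_nth nz)
qed

lemma dd_bilinear:
  assumes "bounded_bilinear h" "Ck (Suc k) f S" "Ck (Suc l) g S" "x \<in> S"
  shows "dd (\<lambda>x. h (f x) (g x)) v x = h (f x) (dd g v x) + h (dd f v x) (g x)"
  by (rule dd_eq) (rule bounded_bilinear.FDERIV[OF assms(1)] Ck_has_derivative assms)+

lemma dd_linear:
  assumes "bounded_linear h" "Ck (Suc k) f S" "x \<in> S"
  shows "dd (\<lambda>x. h (f x)) v x = h (dd f v x)"
  by (rule dd_linear_comp[OF assms(1)]) (use assms in auto)

lemma dd_cong_open:
  assumes "open S" "x \<in> S" "\<And>y. y \<in> S \<Longrightarrow> f y = g y"
  shows "dd f v x = dd g v x"
  using frechet_derivative_cong_open[OF assms] by simp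

lemma dd_const [simp]: "dd (\<lambda>x. a) v x = 0"
  by (rule dd_eq[OF has_derivative_const])

lemma dd_matrix_inv:
  fixes M :: "'a::euclidean_space \<Rightarrow> real ^ 'n::finite ^ 'n"
  assumes M: "Ck (Suc k) M S" and S: "open S" "x \<in> S" and nz: "\<And>x. x \<in> S \<Longrightarrow> det (M x) \<noteq> 0"
  shows "dd (\<lambda>x. matrix_inv (M x)) v x = - (matrix_inv (M x) ** dd M v x ** matrix_inv (M x))"
proof -
  let ?N = "\<lambda>x. matrix_inv (M x)"
  have inv: "invertible (M y)" if "y \<in> S" for y using nz[OF that] by (simp add: invertible_iff_det)
  have "dd (\<lambda>x. ?N x ** M x) v x = dd (\<lambda>x. mat 1 :: real ^ 'n ^ 'n) v x"
    by (rule dd_cong_open[OF S]) (simp add: matrix_inv inv)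
  then have "?N x ** dd M v x + dd ?N v x ** M x = 0"
    using dd_bilinear[OF bounded_bilinear_matrix_mult Ck_matrix_inv[OF M S(1) nz] M S(2)] by simp
  then have "(?N x ** dd M v x + dd ?N v x ** M x) ** ?N x = 0" by simp
  then show ?thesis
    by (simp add: matrix_ring matrix_mul_assoc[symmetric] matrix_inv inv[OF S(2)] eq_neg_iff_add_eq_0 add.commute)
qed

lemma dd_det:
  fixes M :: "'a::euclidean_space \<Rightarrow> real ^ 'n::finite ^ 'n"
  assumes "Ck (Suc k) M S" "x \<in> S" "det (M x) \<noteq> 0"
  shows "dd (\<lambda>x. det (M x)) v x = det (M x) * trace (matrix_inv (M x) ** dd M v x)"
  by (rule dd_eq[OF det_has_derivative[OF Ck_has_derivative[OF assms(1,2)]]])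
    (simp add: assms(3) invertible_iff_det)

section \<open>Linear algebra of contact metric structures\<close>

text \<open>A contact metric structure at one point of a chart: \<open>G\<close> is the Gram matrix,
  \<open>\<Phi>\<close> the matrix of \<phi>, and \<open>\<xi>\<close>, \<open>\<eta>\<close> are
  component vectors. With the normalisation in use, \<open>G ** \<Phi>\<close> is the matrix of
  \<open>ext_deriv\<close>, half of that of \<open>dform\<close>.\<close>

locale contact_matrices =
  fixes G \<Phi> :: "real ^ 'n::finite ^ 'n" and \<xi> \<eta> :: "real ^ 'n"
  assumes G_pos: "v \<noteq> 0 \<Longrightarrow> v \<bullet> (G *v v) > 0" and G_sym: "transpose G = G"
    and eta: "\<eta> = G *v \<xi>" and unit: "\<eta> \<bullet> \<xi> = 1"
    and Phi_sq: "\<Phi> ** \<Phi> = outer \<xi> \<eta> - mat 1" and skew: "transpose (G ** \<Phi>) = - (G ** \<Phi>)"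
    and Phi_xi: "\<Phi> *v \<xi> = 0"
begin

lemma det_G: "det G > 0"
  by (rule det_pos_if_pos_definite[OF G_pos])

lemma G_inv: "matrix_inv G ** G = mat 1" "G ** matrix_inv G = mat 1"
  using det_G by (simp_all add: matrix_inv invertible_iff_det)

lemma G_inner: "u \<bullet> (G *v v) = (G *v u) \<bullet> v"
  using inner_transpose_mult[of u G v] G_sym by simp

lemma Ginv_eta: "matrix_inv G *v \<eta> = \<xi>"
  by (simp add: eta matrix_vector_mul_assoc G_inv)

lemma eta_Ginv: "\<eta> \<bullet> (matrix_inv G *v v) = \<xi> \<bullet> v"
  using G_inner[of \<xi> "matrix_inv G *v v"] by (simp add: eta matrix_vector_mul_assoc G_inv)

lemma eta_Phi: "\<eta> \<bullet> (\<Phi> *v v) = 0"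
proof -
  have "\<eta> \<bullet> (\<Phi> *v v) = \<xi> \<bullet> ((G ** \<Phi>) *v v)"
    by (simp add: eta G_inner matrix_vector_mul_assoc[symmetric])
  also have "\<dots> = - (\<xi> \<bullet> (transpose (G ** \<Phi>) *v v))"
    unfolding skew by (simp add: matrix_vector_minus_left)
  also have "\<dots> = - (((G ** \<Phi>) *v \<xi>) \<bullet> v)" by (simp only: inner_transpose_mult)
  also have "\<dots> = 0" by (simp add: matrix_vector_mul_assoc[symmetric] Phi_xi)
  finally show ?thesis .
qed

lemma eta_Phi_left: "\<eta> v* \<Phi> = 0"
  using eta_Phi[of "\<eta> v* \<Phi>"] dot_lmul_matrix[of \<eta> \<Phi> "\<eta> v* \<Phi>"] by simp

lemma xi_G_left: "\<xi> v* G = \<eta>"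
  using G_sym transpose_matrix_vector[of G \<xi>] by (simp add: eta)

lemma inv_perp_G: "inv_perp G \<xi> = matrix_inv G - outer \<xi> \<xi>"
  using unit by (simp add: inv_perp_def eta inner_commute)

lemma inv_perp_mult: "(matrix_inv G - outer \<xi> \<xi>) ** (G ** \<Phi>) = \<Phi>"
  by (simp add: matrix_ring matrix_mul_assoc G_inv outer_mult xi_G_left eta_Phi_left)

text \<open>Raising an index turns the differential of \<eta> into
  \<open>2 *\<^sub>R \<Phi>\<close>, and \<open>\<Phi> ** \<Phi>\<close> is minus the projection
  onto the complement, of rank one less than the dimension. The factor 4 from the two differentials
  cancels the one in the denominator.\<close>

lemma normsq_coord_contact: "normsq_coord G (2 *\<^sub>R (G ** \<Phi>)) \<xi> = real CARD('n) - 1"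
proof -
  have "\<xi> \<bullet> (G *v \<xi>) = 1" using unit by (simp add: eta inner_commute)
  moreover have "inv_perp G \<xi> ** (2 *\<^sub>R (G ** \<Phi>)) = 2 *\<^sub>R \<Phi>"
    by (simp add: inv_perp_G matrix_scaleR_right inv_perp_mult)
  then have "inv_perp G \<xi> ** (2 *\<^sub>R (G ** \<Phi>)) ** inv_perp G \<xi> ** (2 *\<^sub>R (G ** \<Phi>)) = 4 *\<^sub>R (\<Phi> ** \<Phi>)"
    by (simp add: matrix_mul_assoc[symmetric] matrix_scaleR_left matrix_scaleR_right)
  ultimately show ?thesis
    using unit by (simp add: normsq_coord_def trace_ring Phi_sq trace_outer trace_I inner_commute)
qed

text \<open>The two contributions to the derivative of the squared norm. Varying the inverse metric
  brings in \<open>\<Phi> ** \<Phi>\<close> and so the metric trace of \<open>h\<close>, the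
  \<xi>-correction dropping out by \<open>h\<close>(\<xi>,\<xi>) = 0. Varying the differential gives
  its contraction with the bivector dual to d\<eta>.\<close>

lemma trace_first_variation:
  assumes h: "\<xi> \<bullet> (h *v \<xi>) = 0"
  defines "P \<equiv> matrix_inv G - outer \<xi> \<xi>" and "W \<equiv> 2 *\<^sub>R (G ** \<Phi>)"
  shows "trace (- (matrix_inv G ** h ** matrix_inv G) ** W ** P ** W) = 4 * trace (matrix_inv G ** h)"
    and "trace (P ** W' ** P ** W) = 2 * trace (\<Phi> ** matrix_inv G ** W')"
proof -
  have PW: "P ** W = 2 *\<^sub>R \<Phi>" by (simp add: P_def W_def matrix_scaleR_right inv_perp_mult)
  have "- (matrix_inv G ** h ** matrix_inv G) ** W ** P ** W
    = - (matrix_inv G ** h ** (matrix_inv G ** G) ** (4 *\<^sub>R (\<Phi> ** \<Phi>)))"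
    unfolding matrix_mul_assoc[symmetric] PW
    by (simp add: W_def matrix_ring matrix_mul_assoc)
  also have "\<dots> = 4 *\<^sub>R (matrix_inv G ** h) - 4 *\<^sub>R outer (matrix_inv G *v (h *v \<xi>)) \<eta>"
    by (simp add: G_inv Phi_sq matrix_ring mult_outer matrix_vector_mul_assoc scaleR_diff_right)
  finally show "trace (- (matrix_inv G ** h ** matrix_inv G) ** W ** P ** W) = 4 * trace (matrix_inv G ** h)"
    using eta_Ginv[of "h *v \<xi>"] h by (simp add: trace_ring trace_outer inner_commute)
  have "P ** W' ** P ** W = P ** W' ** (2 *\<^sub>R \<Phi>)" by (simp add: matrix_mul_assoc[symmetric] PW)
  then have "trace (P ** W' ** P ** W) = 2 * trace (P ** W' ** \<Phi>)"
    by (simp add: matrix_scaleR_right trace_scaleR)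
  also have "\<dots> = 2 * trace (\<Phi> ** P ** W')" by (metis trace_mul_sym matrix_mul_assoc)
  also have "\<Phi> ** P = \<Phi> ** matrix_inv G" by (simp add: P_def matrix_diff_right mult_outer Phi_xi)
  finally show "trace (P ** W' ** P ** W) = 2 * trace (\<Phi> ** matrix_inv G ** W')" .
qed

text \<open>The nondegenerate form \<open>N = d\<eta> + \<eta> \<otimes> \<eta>\<close>; up to sign its determinant is that of the metric.\<close>

definition "N = G ** \<Phi> + outer \<eta> \<eta>"
definition "M = outer \<xi> \<xi> - \<Phi> ** matrix_inv G"

lemma MN: "M ** N = mat 1"
proof -
  have "\<Phi> ** matrix_inv G ** (G ** \<Phi>) = \<Phi> ** \<Phi>" by (metis G_inv(1) matrix_mul_assoc matrix_mul_rid)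
  moreover have "\<Phi> ** matrix_inv G ** outer \<eta> \<eta> = 0"
    by (simp add: mult_outer matrix_vector_mul_assoc[symmetric] Ginv_eta Phi_xi)
  moreover have "outer \<xi> \<xi> ** (G ** \<Phi>) = 0"
    by (simp add: matrix_mul_assoc outer_mult xi_G_left eta_Phi_left)
  moreover have "outer \<xi> \<xi> ** outer \<eta> \<eta> = outer \<xi> \<eta>"
    using unit by (simp add: outer_mult_outer inner_commute)
  ultimately show ?thesis by (simp add: M_def N_def matrix_ring Phi_sq)
qed

lemma matrix_inv_N: "matrix_inv N = M"
  by (rule matrix_inv_eqI[OF MN])

text \<open>\<open>N\<close> is \<open>G\<close> times \<open>\<Phi> + outer \<xi> \<eta>\<close>,
  whose square is 1 on \<xi> and -1 on the kernel of \<eta>. The fourth power is therefore the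
  identity and the determinant is 1 or -1; squaring avoids deciding which.\<close>

lemma det_N_sq: "(det N)\<^sup>2 = (det G)\<^sup>2"
proof -
  define C where "C = \<Phi> + outer \<xi> \<eta>"
  have "N = G ** C" unfolding N_def C_def by (simp add: matrix_ring mult_outer eta)
  have CC: "C ** C = 2 *\<^sub>R outer \<xi> \<eta> - mat 1"
    using unit by (simp add: C_def matrix_ring Phi_sq mult_outer outer_mult eta_Phi_left Phi_xi outer_mult_vector
        scaleR_2 inner_commute matrix_vector_mult_add_rdistrib)
  have "(C ** C) ** (C ** C) = mat 1"
  proof -
    define Q where "Q = outer \<xi> \<eta>"
    have "Q ** Q = Q" using unit by (simp add: Q_def outer_mult_outer)
    then have "(2 *\<^sub>R Q - mat 1) ** (2 *\<^sub>R Q - mat 1) = 2 *\<^sub>R (2 *\<^sub>R Q - Q) - (2 *\<^sub>R Q - mat 1)"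
      by (simp only: matrix_diff_left matrix_diff_right matrix_scaleR_left matrix_scaleR_right matrix_mul_lid matrix_mul_rid)
    also have "\<dots> = mat 1" by (simp add: vec_eq_iff)
    finally show ?thesis unfolding CC Q_def .
  qed
  then have "(det C * det C) * (det C * det C) = 1" by (metis det_mul det_I)
  then have "det C * det C = 1"
    using zero_le_square[of "det C"] by (metis abs_of_nonneg abs_square_eq_1 power2_eq_square)
  then show ?thesis by (simp add: \<open>N = G ** C\<close> det_mul power2_eq_square algebra_simps)
qed

lemma det_N: "det N \<noteq> 0"
  using det_N_sq det_G by auto

text \<open>The equation for a Hamiltonian field: \<open>2 *\<^sub>R (G ** \<Phi>)\<close> is the
  matrix of the full differential of \<eta>, and by skewness inserting \<open>w\<close> in its first
  slot returns \<open>b\<close>. It is solvable within the kernel of \<eta> because \<open>b\<close>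
  annihilates \<xi>.\<close>

lemma N_hamiltonian:
  assumes "b \<bullet> \<xi> = 0"
  defines "w \<equiv> (1/2) *\<^sub>R (\<Phi> *v (matrix_inv G *v b))"
  shows "(2 *\<^sub>R (G ** \<Phi>)) *v w = - b" "\<eta> \<bullet> w = 0"
proof -
  have "(2 *\<^sub>R (G ** \<Phi>)) *v w = G *v ((\<Phi> ** \<Phi>) *v (matrix_inv G *v b))"
    by (simp add: w_def matrix_scaleR_left scaleR_matrix_vector matrix_vector_mult_scaleR matrix_vector_mul_assoc
        matrix_mul_assoc)
  also have "\<dots> = - b"
    unfolding Phi_sq matrix_vector_mult_diff_rdistrib outer_mult_vector eta_Ginv
    using assms(1) by (simp add: inner_commute matrix_vector_mul_assoc G_inv matrix_vector_mult_diff_distrib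
        linear_neg[OF matrix_vector_mul_linear])
  finally show "(2 *\<^sub>R (G ** \<Phi>)) *v w = - b" .
  show "\<eta> \<bullet> w = 0" by (simp add: w_def eta_Phi)
qed

text \<open>The \<xi>-part of \<open>M\<close> is symmetric and so annihilates the skew
  \<open>Q\<close>. Both terms with \<open>b\<close> vanish by \<open>b\<close>(\<xi>) = 0 together
  with the fact that \<Phi> kills \<xi> and has range in the kernel of \<eta>.\<close>

lemma trace_M_source:
  assumes b: "b \<bullet> \<xi> = 0" and Q: "transpose Q = - Q"
  shows "trace (M ** ((1/2) *\<^sub>R Q + outer b \<eta> + outer \<eta> b)) = - trace (\<Phi> ** matrix_inv G ** Q) / 2"
proof -
  have "\<xi> \<bullet> (transpose Q *v \<xi>) = (Q *v \<xi>) \<bullet> \<xi>" by (rule inner_transpose_mult)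
  then have "\<xi> \<bullet> (Q *v \<xi>) = 0" unfolding Q by (simp add: matrix_vector_minus_left inner_commute)
  then have "trace (M ** Q) = - trace (\<Phi> ** matrix_inv G ** Q)"
    by (simp add: M_def matrix_ring trace_ring trace_outer_mult)
  moreover have "trace (M ** outer b \<eta>) = 0"
    using b unit eta_Phi[of "matrix_inv G *v b"]
    by (simp add: M_def mult_outer trace_outer matrix_vector_mult_diff_rdistrib outer_mult_vector
        matrix_vector_mul_assoc inner_diff_left inner_commute)
  moreover have "trace (M ** outer \<eta> b) = 0"
    using b unit by (simp add: M_def mult_outer trace_outer matrix_vector_mult_diff_rdistrib outer_mult_vector
        matrix_vector_mul_assoc[symmetric] Ginv_eta Phi_xi inner_commute)
  ultimately show ?thesis by (simp add: matrix_ring trace_ring)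
qed

end

section \<open>A divergence identity on contact metric manifolds\<close>

definition curl :: "(real ^ 'n::finite \<Rightarrow> real ^ 'n) \<Rightarrow> real ^ 'n \<Rightarrow> real ^ 'n ^ 'n" where
  "curl b z = (\<chi> i j. dd b (axis i 1) z $ j - dd b (axis j 1) z $ i)"

lemma dd_nth:
  fixes f :: "'a::euclidean_space \<Rightarrow> 'b::euclidean_space ^ 'n::finite"
  shows "Ck (Suc k) f S \<Longrightarrow> x \<in> S \<Longrightarrow> dd (\<lambda>x. f x $ i) v x = dd f v x $ i"
  by (rule dd_linear[OF bounded_linear_vec_nth])

lemma Ck_curl:
  assumes "Ck (Suc k) b S" "open S"
  shows "Ck k (curl b) S"
  unfolding curl_def[abs_def]
  by (rule Ck_matrix[OF _ assms(2)]) (use assms in \<open>simp, intro Ck_diff Ck_vec_nth, auto\<close>)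

lemma dd_curl:
  assumes "Ck (Suc (Suc 0)) b S" "open S" "z \<in> S"
  shows "dd (curl b) v z $ i $ j = dd (dd b (axis i 1)) v z $ j - dd (dd b (axis j 1)) v z $ i"
proof -
  have "dd (curl b) v z $ i $ j = dd (\<lambda>x. curl b x $ i $ j) v z"
    using dd_nth[OF Ck_vec_nth[OF Ck_curl[OF assms(1,2)] assms(2)] assms(3), of i j v]
      dd_nth[OF Ck_curl[OF assms(1,2)] assms(3), of i v] by simp
  also have "\<dots> = dd (\<lambda>x. dd b (axis i 1) x $ j - dd b (axis j 1) x $ i) v z" by (simp add: curl_def)
  also have "\<dots> = dd (dd b (axis i 1)) v z $ j - dd (dd b (axis j 1)) v z $ i"
    by (rule dd_eq) (intro has_derivative_diff bounded_linear.has_derivative[OF bounded_linear_vec_nth]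
        Ck_has_derivative[OF Ck_dd[OF assms(1)] assms(3)])
  finally show ?thesis .
qed

text \<open>The square of the exterior derivative is zero; in the cyclic sum the second derivatives
  cancel in pairs by symmetry.\<close>

lemma curl_closed:
  assumes "Ck (Suc (Suc 0)) b S" "open S" "z \<in> S"
  shows "dd (curl b) (axis i 1) z $ j $ k + dd (curl b) (axis j 1) z $ k $ i + dd (curl b) (axis k 1) z $ i $ j = 0"
  unfolding dd_curl[OF assms]
  using dd_commute[OF assms, of "axis i 1" "axis j 1"] dd_commute[OF assms, of "axis i 1" "axis k 1"]
    dd_commute[OF assms, of "axis j 1" "axis k 1"] by simp

text \<open>The trace of \<open>M ** L\<close>, with \<open>L\<close> the Lie derivative of
  \<open>N\<close> along \<open>w\<close>, is evaluated twice: through Jacobi's formula as twice the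
  divergence of \<open>w\<close>, and through Cartan's formula as a contraction of the differential
  of \<open>b\<close>.\<close>

lemma contact_divergence:
  fixes G \<Phi> :: "real ^ 'n::finite \<Rightarrow> real ^ 'n ^ 'n" and \<xi> \<eta> b :: "real ^ 'n \<Rightarrow> real ^ 'n"
  assumes U: "open U" "z \<in> U"
    and cm: "\<And>z. z \<in> U \<Longrightarrow> contact_matrices (G z) (\<Phi> z) (\<xi> z) (\<eta> z)"
    and G: "Ck (Suc 0) G U" and \<Phi>: "Ck (Suc 0) \<Phi> U" and \<eta>: "Ck (Suc (Suc 0)) \<eta> U" and b: "Ck (Suc 0) b U"
    and curl: "\<And>z. z \<in> U \<Longrightarrow> curl \<eta> z = 2 *\<^sub>R (G z ** \<Phi> z)"
    and b\<xi>: "\<And>z. z \<in> U \<Longrightarrow> b z \<bullet> \<xi> z = 0"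
  defines "V \<equiv> \<lambda>z. sqrt (det (G z)) *\<^sub>R ((1/2) *\<^sub>R (\<Phi> z *v (matrix_inv (G z) *v b z)))"
  shows "(\<Sum>i\<in>UNIV. dd (\<lambda>z. V z $ i) (axis i 1) z)
    = - (1/4) * sqrt (det (G z)) * trace (\<Phi> z ** matrix_inv (G z) ** curl b z)"
    and "Ck (Suc 0) V U"
proof -
  interpret c: contact_matrices "G z" "\<Phi> z" "\<xi> z" "\<eta> z" using cm U by blast
  define w where "w z = (1/2) *\<^sub>R (\<Phi> z *v (matrix_inv (G z) *v b z))" for z
  define S where "S z = sqrt (det (G z))" for z
  define N where "N z = G z ** \<Phi> z + outer (\<eta> z) (\<eta> z)" for z
  define M where "M = c.M"
  have detG: "det (G y) > 0" if "y \<in> U" for y using contact_matrices.det_G[OF cm[OF that]] .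
  then have detG': "det (G y) \<noteq> 0" if "y \<in> U" for y using that by fastforce
  have \<eta>1: "Ck (Suc 0) \<eta> U" by (rule Ck_SucD[OF \<eta>])
  have w: "Ck (Suc 0) w U"
    unfolding w_def[abs_def]
    by (intro Ck_scaleR Ck_const Ck_matrix_vector Ck_matrix_inv G \<Phi> b U detG')
  have dG: "Ck (Suc 0) (\<lambda>z. det (G z)) U" by (rule Ck_det[OF Ck_matrix_nth[OF G U(1)] U(1)])
  have S: "Ck (Suc 0) S U"
    unfolding S_def[abs_def] by (rule Ck_sqrt[OF dG detG U(1)])
  show "Ck (Suc 0) V U"
    using Ck_scaleR[OF S w U(1)] by (simp add: V_def S_def w_def)
  have N: "Ck (Suc 0) N U"
    unfolding N_def[abs_def] by (intro Ck_add Ck_matrix_mult Ck_outer G \<Phi> \<eta>1 U)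
  have cl: "Ck (Suc 0) (curl \<eta>) U" by (rule Ck_curl[OF \<eta> U(1)])
  let ?e = "\<lambda>i. axis i (1::real)"
  have Nz: "N z = c.N" by (simp add: N_def c.N_def)
  \<comment> \<open>Jacobi's formula is applied to both sides of (det N)^2 = (det G)^2, so
    derivatives of the metric volume can be read off from \<open>N\<close>.\<close>
  have ddN: "trace (matrix_inv (G z) ** dd G v z) = trace (M ** dd N v z)" for v
  proof -
    have dN: "Ck (Suc 0) (\<lambda>z. det (N z)) U" by (rule Ck_det[OF Ck_matrix_nth[OF N U(1)] U(1)])
    have sq: "dd (\<lambda>z. f z * f z) v z = 2 * f z * dd f v z" if "Ck (Suc 0) f U" for f :: "real ^ 'n \<Rightarrow> real"
      using dd_bilinear[OF bounded_bilinear_mult that that U(2)] by simp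
    have "dd (\<lambda>z. det (N z) * det (N z)) v z = dd (\<lambda>z. det (G z) * det (G z)) v z"
      by (rule dd_cong_open[OF U])
        (use contact_matrices.det_N_sq[OF cm] in \<open>simp add: N_def contact_matrices.N_def[OF cm] power2_eq_square\<close>)
    then have "2 * (det (N z))\<^sup>2 * trace (matrix_inv (N z) ** dd N v z) = 2 * (det (G z))\<^sup>2 * trace (matrix_inv (G z) ** dd G v z)"
      unfolding sq[OF dN] sq[OF dG]
      using dd_det[OF N U(2), of v] dd_det[OF G U(2) detG'[OF U(2)], of v] c.det_N
      by (simp add: Nz power2_eq_square mult_ac)
    then show ?thesis using c.det_N_sq c.det_G by (simp add: Nz c.matrix_inv_N M_def)
  qed
  have ddS: "dd S v z = S z * trace (M ** dd N v z) / 2" for v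
  proof -
    have "S y * S y = det (G y)" if "y \<in> U" for y using detG[OF that] by (simp add: S_def)
    then have "dd (\<lambda>z. S z * S z) v z = dd (\<lambda>z. det (G z)) v z" by (intro dd_cong_open[OF U])
    then have "2 * S z * dd S v z = det (G z) * trace (M ** dd N v z)"
      using dd_bilinear[OF bounded_bilinear_mult S S U(2), of v] dd_det[OF G U(2) detG'[OF U(2)], of v] ddN by simp
    moreover have "det (G z) = S z * S z" "S z > 0" using detG[OF U(2)] by (auto simp: S_def)
    ultimately show ?thesis by simp
  qed
  define B where "B = (\<chi> i j. dd w (?e j) z $ i)"
  \<comment> \<open>The coordinate expression of the Lie derivative of the bilinear form
    \<open>N\<close> along \<open>w\<close>: the derivative in the direction \<open>w\<close> plus
    one Jacobian term for each slot.\<close>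
  define L where "L = (\<Sum>i\<in>UNIV. w z $ i *\<^sub>R dd N (?e i) z) + transpose B ** N z + N z ** B"
  have "(\<Sum>i\<in>UNIV. dd (\<lambda>z. V z $ i) (?e i) z) = (\<Sum>i\<in>UNIV. S z * dd w (?e i) z $ i + dd S (?e i) z * w z $ i)"
  proof (rule sum.cong[OF refl])
    fix i
    have "(\<lambda>z. V z $ i) = (\<lambda>z. S z * (w z $ i))" by (simp add: V_def S_def w_def)
    then show "dd (\<lambda>z. V z $ i) (?e i) z = S z * dd w (?e i) z $ i + dd S (?e i) z * w z $ i"
      using dd_bilinear[OF bounded_bilinear_mult S Ck_vec_nth[OF w U(1)] U(2)] dd_nth[OF w U(2)] by simp
  qed
  also have "\<dots> = S z * trace B + S z / 2 * (\<Sum>i\<in>UNIV. w z $ i * trace (M ** dd N (?e i) z))"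
  proof -
    have "trace B = (\<Sum>i\<in>UNIV. dd w (?e i) z $ i)" by (simp add: trace_def B_def)
    then show ?thesis by (simp add: ddS sum.distrib sum_distrib_left mult_ac)
  qed
  \<comment> \<open>Each of the two Jacobian terms in \<open>L\<close> contributes
    \<open>trace B\<close>, because \<open>M\<close> inverts \<open>N\<close>; together with the
    derivative of \<open>N\<close> along \<open>w\<close> they give twice the divergence.\<close>
  also have "\<dots> = S z / 2 * trace (M ** L)"
  proof -
    have "N z ** M = mat 1" using c.MN by (simp add: Nz M_def matrix_left_right_inverse)
    moreover have "trace (M ** (transpose B ** N z)) = trace (N z ** (M ** transpose B))"
      by (subst matrix_mul_assoc) (rule trace_mul_sym)
    ultimately have 1: "trace (M ** (transpose B ** N z)) = trace B"
      by (simp add: matrix_mul_assoc) (simp add: trace_def transpose_def)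
    have 2: "trace (M ** (N z ** B)) = trace B" using c.MN by (simp add: matrix_mul_assoc Nz M_def)
    have 3: "trace (M ** (\<Sum>i\<in>UNIV. w z $ i *\<^sub>R dd N (?e i) z)) = (\<Sum>i\<in>UNIV. w z $ i * trace (M ** dd N (?e i) z))"
      by (subst trace_mul_sym) (simp add: matrix_mult_sum_left trace_sum matrix_scaleR_left trace_scaleR trace_mul_sym[of M])
    show ?thesis unfolding L_def matrix_add_ldistrib trace_add 1 2 3 by (simp add: algebra_simps)
  qed
  \<comment> \<open>Cartan's formula in components. It rests on the derivatives of the two
    identities satisfied by \<open>w\<close>: contraction with the differential of \<eta> is
    \<open>b\<close>, and contraction with \<eta> is 0.\<close>
  also have "L = (1/2) *\<^sub>R curl b z + outer (b z) (\<eta> z) + outer (\<eta> z) (b z)"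
  proof -
    let ?\<omega> = "curl \<eta>"
    have sk: "?\<omega> y $ i $ j = - ?\<omega> y $ j $ i" for y i j by (simp add: curl_def)
    have e1: "(\<Sum>i\<in>UNIV. w y $ i * ?\<omega> y $ i $ k) = b y $ k" if "y \<in> U" for y k
    proof -
      have "(?\<omega> y *v w y) $ k = - b y $ k"
        using contact_matrices.N_hamiltonian(1)[OF cm[OF that], of "b y"] b\<xi>[OF that] by (simp add: curl[OF that] w_def)
      then have "(\<Sum>i\<in>UNIV. ?\<omega> y $ k $ i * w y $ i) = - b y $ k" by (simp add: matrix_vector_mult_def)
      then show ?thesis by (simp add: sk[of y k] sum_negf mult.commute)
    qed
    have e2: "(\<Sum>i\<in>UNIV. w y $ i * \<eta> y $ i) = 0" if "y \<in> U" for y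
      using contact_matrices.N_hamiltonian(2)[OF cm[OF that], of "b y"] b\<xi>[OF that]
      by (simp add: w_def inner_vec_def mult.commute)
    have d1: "(\<Sum>i\<in>UNIV. w z $ i * dd ?\<omega> v z $ i $ k + dd w v z $ i * ?\<omega> z $ i $ k) = dd b v z $ k" for v k
    proof -
      have "dd (\<lambda>y. \<Sum>i\<in>UNIV. w y $ i * ?\<omega> y $ i $ k) v z = (\<Sum>i\<in>UNIV. w z $ i * dd ?\<omega> v z $ i $ k + dd w v z $ i * ?\<omega> z $ i $ k)"
        by (rule dd_eq) (intro has_derivative_sum has_derivative_mult bounded_linear.has_derivative[OF bounded_linear_vec_nth]
            Ck_has_derivative[OF w U(2)] Ck_has_derivative[OF cl U(2)])
      moreover have "dd (\<lambda>y. \<Sum>i\<in>UNIV. w y $ i * ?\<omega> y $ i $ k) v z = dd (\<lambda>y. b y $ k) v z"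
        by (rule dd_cong_open[OF U]) (rule e1)
      ultimately show ?thesis using dd_nth[OF b U(2)] by simp
    qed
    have d2: "(\<Sum>i\<in>UNIV. w z $ i * dd \<eta> v z $ i + dd w v z $ i * \<eta> z $ i) = 0" for v
    proof -
      have "dd (\<lambda>y. \<Sum>i\<in>UNIV. w y $ i * \<eta> y $ i) v z = (\<Sum>i\<in>UNIV. w z $ i * dd \<eta> v z $ i + dd w v z $ i * \<eta> z $ i)"
        by (rule dd_eq) (intro has_derivative_sum has_derivative_mult bounded_linear.has_derivative[OF bounded_linear_vec_nth]
            Ck_has_derivative[OF w U(2)] Ck_has_derivative[OF \<eta>1 U(2)])
      moreover have "dd (\<lambda>y. \<Sum>i\<in>UNIV. w y $ i * \<eta> y $ i) v z = dd (\<lambda>y. 0) v z"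
        by (rule dd_cong_open[OF U]) (rule e2)
      ultimately show ?thesis by simp
    qed
    have Neq: "N y = (1/2) *\<^sub>R ?\<omega> y + outer (\<eta> y) (\<eta> y)" if "y \<in> U" for y
      by (simp add: N_def curl[OF that])
    have dN: "dd N v z $ j $ k = (1/2) * dd ?\<omega> v z $ j $ k + (\<eta> z $ j * dd \<eta> v z $ k + dd \<eta> v z $ j * \<eta> z $ k)" for v j k
    proof -
      have "dd N v z = dd (\<lambda>y. (1/2) *\<^sub>R ?\<omega> y + outer (\<eta> y) (\<eta> y)) v z"
        by (rule dd_cong_open[OF U]) (rule Neq)
      also have "\<dots> = (1/2) *\<^sub>R dd ?\<omega> v z + (outer (\<eta> z) (dd \<eta> v z) + outer (dd \<eta> v z) (\<eta> z))"
        by (rule dd_eq) (intro has_derivative_add has_derivative_scaleR_right bounded_bilinear.FDERIV[OF bounded_bilinear_outer]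
            Ck_has_derivative[OF \<eta>1 U(2)] Ck_has_derivative[OF cl U(2)])
      finally show ?thesis by (simp add: outer_def)
    qed
    show ?thesis
    proof (simp only: vec_eq_iff, intro allI)
      fix j k
      have "L $ j $ k = (\<Sum>i\<in>UNIV. w z $ i * dd N (?e i) z $ j $ k + dd w (?e j) z $ i * N z $ i $ k + N z $ j $ i * dd w (?e k) z $ i)"
        by (simp add: L_def matrix_matrix_mult_def transpose_def B_def sum.distrib)
      also have "\<dots> = (\<Sum>i\<in>UNIV. (1/2) * (w z $ i * dd ?\<omega> (?e j) z $ i $ k + dd w (?e j) z $ i * ?\<omega> z $ i $ k)
           - (1/2) * (w z $ i * dd ?\<omega> (?e k) z $ i $ j + dd w (?e k) z $ i * ?\<omega> z $ i $ j)
           + \<eta> z $ k * (w z $ i * ?\<omega> z $ i $ j) + \<eta> z $ k * (w z $ i * dd \<eta> (?e j) z $ i + dd w (?e j) z $ i * \<eta> z $ i)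
           + \<eta> z $ j * (w z $ i * ?\<omega> z $ i $ k) + \<eta> z $ j * (w z $ i * dd \<eta> (?e k) z $ i + dd w (?e k) z $ i * \<eta> z $ i))"
      proof (rule sum.cong[OF refl])
        fix i
        have "dd ?\<omega> (?e k) z $ i $ j = - dd ?\<omega> (?e k) z $ j $ i" for i j k by (simp add: dd_curl[OF \<eta> U])
        \<comment> \<open>Closedness trades the derivative in the summed direction \<open>i\<close>
          for derivatives in the free directions \<open>j\<close> and \<open>k\<close>, where the
          differentiated contraction identities apply.\<close>
        then have c: "dd ?\<omega> (?e i) z $ j $ k = dd ?\<omega> (?e j) z $ i $ k - dd ?\<omega> (?e k) z $ i $ j"
          using curl_closed[OF \<eta> U, of i j k] by (smt (verit))
        have o: "?\<omega> z $ i $ j = dd \<eta> (?e i) z $ j - dd \<eta> (?e j) z $ i" "?\<omega> z $ i $ k = dd \<eta> (?e i) z $ k - dd \<eta> (?e k) z $ i"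
          by (simp_all add: curl_def)
        have Nij: "N z $ i $ k = (1/2) * ?\<omega> z $ i $ k + \<eta> z $ i * \<eta> z $ k"
          "N z $ j $ i = - (1/2) * ?\<omega> z $ i $ j + \<eta> z $ j * \<eta> z $ i"
          using sk[of z j i] by (simp_all add: Neq[OF U(2)] outer_def)
        show "w z $ i * dd N (?e i) z $ j $ k + dd w (?e j) z $ i * N z $ i $ k + N z $ j $ i * dd w (?e k) z $ i
          = (1/2) * (w z $ i * dd ?\<omega> (?e j) z $ i $ k + dd w (?e j) z $ i * ?\<omega> z $ i $ k)
           - (1/2) * (w z $ i * dd ?\<omega> (?e k) z $ i $ j + dd w (?e k) z $ i * ?\<omega> z $ i $ j)
           + \<eta> z $ k * (w z $ i * ?\<omega> z $ i $ j) + \<eta> z $ k * (w z $ i * dd \<eta> (?e j) z $ i + dd w (?e j) z $ i * \<eta> z $ i)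
           + \<eta> z $ j * (w z $ i * ?\<omega> z $ i $ k) + \<eta> z $ j * (w z $ i * dd \<eta> (?e k) z $ i + dd w (?e k) z $ i * \<eta> z $ i)"
          unfolding dN Nij c o by (simp add: algebra_simps)
      qed
      also have "\<dots> = (1/2) * dd b (?e j) z $ k - (1/2) * dd b (?e k) z $ j + \<eta> z $ k * b z $ j + \<eta> z $ j * b z $ k"
        unfolding sum.distrib sum_subtractf sum_distrib_left[symmetric] using e1[OF U(2)] d1 d2
        by (simp add: sum.distrib)
      finally show "L $ j $ k = ((1/2) *\<^sub>R curl b z + outer (b z) (\<eta> z) + outer (\<eta> z) (b z)) $ j $ k"
        by (simp add: curl_def outer_def algebra_simps)
    qed
  qed
  also have "S z / 2 * trace (M ** ((1/2) *\<^sub>R curl b z + outer (b z) (\<eta> z) + outer (\<eta> z) (b z)))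
    = - (1/4) * sqrt (det (G z)) * trace (\<Phi> z ** matrix_inv (G z) ** curl b z)"
    unfolding M_def
    by (subst c.trace_M_source[OF b\<xi>[OF U(2)]]) (simp_all add: S_def curl_def transpose_def vec_eq_iff)
  finally show "(\<Sum>i\<in>UNIV. dd (\<lambda>z. V z $ i) (axis i 1) z)
    = - (1/4) * sqrt (det (G z)) * trace (\<Phi> z ** matrix_inv (G z) ** curl b z)" .
qed

section \<open>Contact metric structures in coordinates\<close>

definition form_vec ::
  "('a, 'n::finite) chart set \<Rightarrow> ('a, 'n) chart \<Rightarrow> ('a, 'n) one_form \<Rightarrow> real ^ 'n \<Rightarrow> real ^ 'n" where
  "form_vec A c \<beta> z = (\<chi> i. form_rep A c \<beta> (axis i 1) z)"

definition endo_mat ::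
  "('a, 'n::finite) chart set \<Rightarrow> ('a, 'n) chart \<Rightarrow> ('a, 'n) endo_field \<Rightarrow> 'a \<Rightarrow> real ^ 'n ^ 'n" where
  "endo_mat A c \<phi> x = matrix (\<lambda>v. components A c x (\<phi> x (cvec A c x v)))"

lemma transpose_scaleR: "transpose (a *\<^sub>R (M :: real ^ 'n::finite ^ 'n)) = a *\<^sub>R transpose M"
  by (simp add: transpose_def vec_eq_iff)

context smooth_manifold
begin

lemma Ck_form_vec:
  "(\<And>v. Ck k (form_rep A c \<beta> v) (snd c ` fst c)) \<Longrightarrow> c \<in> A \<Longrightarrow> Ck k (form_vec A c \<beta>) (snd c ` fst c)"
  by (rule Ck_vec) (simp_all add: form_vec_def)

lemma C1_formD: "C1_form A \<beta> \<Longrightarrow> c \<in> A \<Longrightarrow> Ck (Suc 0) (form_rep A c \<beta> v) (snd c ` fst c)"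
  unfolding C1_form_def by blast

lemma C1_form_linear: "C1_form A \<beta> \<Longrightarrow> linear (\<beta> x)"
  unfolding C1_form_def by blast

lemma C1_form_vec: "C1_form A \<beta> \<Longrightarrow> c \<in> A \<Longrightarrow> Ck (Suc 0) (form_vec A c \<beta>) (snd c ` fst c)"
  by (rule Ck_form_vec[OF C1_formD])

lemma form_vec_inner:
  assumes "linear (\<beta> x)" "c \<in> A" "x \<in> fst c"
  shows "form_vec A c \<beta> (snd c x) \<bullet> v = \<beta> x (cvec A c x v)"
proof -
  have lin: "linear (\<lambda>v. \<beta> x (cvec A c x v))"
    using linear_compose[OF cvec_linear[OF assms(2,3)] assms(1)] by (simp add: o_def)
  have "\<beta> x (cvec A c x v) = \<beta> x (cvec A c x (\<Sum>i\<in>UNIV. v $ i *\<^sub>R axis i 1))"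
    using basis_expansion[of v] by (simp add: scalar_mult_eq_scaleR)
  also have "\<dots> = (\<Sum>i\<in>UNIV. v $ i * \<beta> x (cvec A c x (axis i 1)))"
    using linear_sum[OF lin, of "\<lambda>i. v $ i *\<^sub>R axis i 1" UNIV] linear_scale[OF lin] by simp
  finally show ?thesis using assms by (simp add: form_vec_def form_rep_def inner_vec_def mult.commute)
qed

lemma curl_form_vec:
  assumes \<beta>: "C1_form A \<beta>" and c: "c \<in> A" "x \<in> fst c"
  shows "curl (form_vec A c \<beta>) (snd c x) = omat A c \<beta> x"
proof -
  have "dd (form_vec A c \<beta>) v (snd c x) $ j = dd (form_rep A c \<beta> (axis j 1)) v (snd c x)" for v j
    using dd_nth[OF C1_form_vec[OF \<beta> c(1)], of "snd c x" j v] c by (simp add: form_vec_def)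
  then show ?thesis by (simp add: vec_eq_iff curl_def omat_def bmat_def dform_def)
qed

lemma omat_transition:
  assumes \<beta>: "C1_form A \<beta>" and c: "c \<in> A" "x \<in> fst c" and d: "d \<in> A" "x \<in> fst d"
  shows "omat A c \<beta> x = transpose (matrix (tdiff c d x)) ** omat A d \<beta> x ** matrix (tdiff c d x)"
proof (rule matrix_eqI_inner)
  fix u v
  show "u \<bullet> (omat A c \<beta> x *v v)
      = u \<bullet> (transpose (matrix (tdiff c d x)) ** omat A d \<beta> x ** matrix (tdiff c d x) *v v)"
    using c d by (simp add: matrix_vector_mul_assoc[symmetric] inner_transpose_mult matrix_tdiff
        dform_omat[OF \<beta>, symmetric] dform_transition[OF \<beta>] del: transpose_matrix_vector)
qed

lemma endo_mat_mult:
  assumes "linear (\<phi> x)" "c \<in> A" "x \<in> fst c"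
  shows "endo_mat A c \<phi> x *v v = components A c x (\<phi> x (cvec A c x v))"
proof -
  have "linear (\<lambda>v. components A c x (\<phi> x (cvec A c x v)))"
    using linear_compose[OF linear_compose[OF cvec_linear[OF assms(2,3)] assms(1)] components_linear[OF assms(2,3)]]
    by (simp add: o_def)
  then show ?thesis
    using matrix_works unfolding endo_mat_def by (simp add: linear_matrix_vector_mul_eq)
qed

lemma components_transition:
  "c \<in> A \<Longrightarrow> x \<in> fst c \<Longrightarrow> d \<in> A \<Longrightarrow> x \<in> fst d \<Longrightarrow> tdiff c d x (components A c x v) = components A d x v"
  using components_cvec[of c x d "components A c x v"] by simp

lemma endo_mat_transition:
  assumes \<phi>: "linear (\<phi> x)" and c: "c \<in> A" "x \<in> fst c" and d: "d \<in> A" "x \<in> fst d"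
  shows "matrix (tdiff c d x) ** endo_mat A c \<phi> x = endo_mat A d \<phi> x ** matrix (tdiff c d x)"
  unfolding matrix_eq using c d
  by (simp add: matrix_vector_mul_assoc[symmetric] matrix_tdiff endo_mat_mult[of \<phi>, OF \<phi>] components_transition cvec_tdiff)

lemma tdiff_matrix_inverse:
  assumes c: "c \<in> A" "x \<in> fst c" and d: "d \<in> A" "x \<in> fst d"
  shows "matrix (tdiff d c x) ** matrix (tdiff c d x) = mat 1"
  unfolding matrix_eq using c d
  by (simp add: matrix_vector_mul_assoc[symmetric] matrix_tdiff tdiff_compose tdiff_refl)

lemma gmat_invertible: "riemannian_metric A H \<Longrightarrow> c \<in> A \<Longrightarrow> x \<in> fst c \<Longrightarrow> invertible (gmat A c H x)"
  using det_gmat_pos[of H c x] by (simp add: invertible_iff_det)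

lemma smooth_one_form_Ck:
  assumes "smooth_one_form A \<beta>" "c \<in> A"
  shows "Ck k (form_rep A c \<beta> v) (snd c ` fst c)"
proof -
  have "smooth_function_on A (fst c) (\<lambda>x. \<beta> x (cvec A c x v))"
    using assms smooth_field_cvec[OF assms(2)] open_chart(1) unfolding smooth_one_form_def by blast
  from smooth_functionD[OF this assms(2), of k] show ?thesis by (simp add: form_rep_def[abs_def])
qed

lemma C1_fun_continuous:
  assumes "C1_fun A f"
  shows "continuous_on UNIV f"
proof (rule continuous_on_chartwise)
  fix c assume "c \<in> A"
  then have "Ck (Suc 0) (\<lambda>z. f (chart_inv c z)) (snd c ` fst c)" using assms by (simp add: C1_fun_def)
  then show "continuous_on (snd c ` (UNIV \<inter> fst c)) (f \<circ> chart_inv c)"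
    using Ck_continuous_on by (fastforce simp: o_def)
qed simp

lemma dform_eq_0_open:
  assumes c: "c \<in> A" "x \<in> fst c" and O: "open O'" "x \<in> O'" "\<And>y v. y \<in> O' \<Longrightarrow> \<beta> y v = 0"
  shows "omat A c \<beta> x = 0"
proof -
  have "dd (form_rep A c \<beta> v) u (snd c x) = dd (\<lambda>z. 0) u (snd c x)" for u v
    by (rule dd_cong_open[OF open_chart_image[OF c(1) O(1)]]) (use c O in \<open>auto simp: form_rep_def\<close>)
  then show ?thesis by (simp add: omat_def bmat_def dform_def vec_eq_iff)
qed

lemma omat_sum:
  assumes "\<And>i. i \<in> I \<Longrightarrow> C1_form A (\<beta> i)" "c \<in> A" "x \<in> fst c"
  shows "omat A c (\<lambda>x v. \<Sum>i\<in>I. \<beta> i x v) x = (\<Sum>i\<in>I. omat A c (\<beta> i) x)"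
proof -
  have "dd (form_rep A c (\<lambda>x v. \<Sum>i\<in>I. \<beta> i x v) v) u (snd c x) = (\<Sum>i\<in>I. dd (form_rep A c (\<beta> i) v) u (snd c x))" for u v
  proof (rule dd_eq)
    have "((\<lambda>z. \<Sum>i\<in>I. form_rep A c (\<beta> i) v z) has_derivative
        (\<lambda>u. \<Sum>i\<in>I. dd (form_rep A c (\<beta> i) v) u (snd c x))) (at (snd c x))"
      by (rule has_derivative_sum, rule Ck_has_derivative[OF C1_formD]) (use assms in auto)
    then show "(form_rep A c (\<lambda>x v. \<Sum>i\<in>I. \<beta> i x v) v has_derivative
        (\<lambda>u. \<Sum>i\<in>I. dd (form_rep A c (\<beta> i) v) u (snd c x))) (at (snd c x))"
      by (simp add: form_rep_def[abs_def])
  qed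
  then show ?thesis by (simp add: vec_eq_iff omat_def bmat_def dform_def sum_subtractf)
qed

end

section \<open>Contact metric structures on a manifold and the integral of
  \<open>dtr\<close>\<close>

locale contact_manifold = smooth_manifold A
  for A :: "('a::{t2_space, second_countable_topology}, 'n::finite) chart set" +
  fixes m :: nat and \<phi> :: "('a, 'n) endo_field" and \<xi> :: "'a \<Rightarrow> real ^ 'n"
    and \<eta> :: "('a, 'n) one_form" and g :: "('a, 'n) two_tensor"
  assumes cms: "contact_metric_structure A m \<phi> \<xi> \<eta> g"
begin

lemma card: "CARD('n) = 2 * m + 1"
  using cms by (simp add: contact_metric_structure_def contact_form_def)

lemma contact: "contact_form A m \<eta>" and reeb: "reeb_field A \<eta> \<xi>"
  and phi_smooth: "smooth_endo_field A \<phi>" and metric: "riemannian_metric A g"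
  using cms unfolding contact_metric_structure_def by (elim conjE; simp)+

lemma eta_eq: "\<eta> x v = g x (\<xi> x) v"
  and phi_sq: "\<phi> x (\<phi> x v) = - v + \<eta> x v *\<^sub>R \<xi> x"
  and ext_deriv_eta: "open U \<Longrightarrow> smooth_field_on A U X \<Longrightarrow> smooth_field_on A U Y \<Longrightarrow> x \<in> U
    \<Longrightarrow> ext_deriv A \<eta> X Y x = g x (X x) (\<phi> x (Y x))"
  using cms unfolding contact_metric_structure_def by (elim conjE; simp)+

lemma eta_smooth: "smooth_one_form A \<eta>"
  using contact unfolding contact_form_def by (elim conjE)

lemma xi_smooth: "smooth_field_on A UNIV \<xi>" and eta_xi: "\<eta> x (\<xi> x) = 1"
  and ext_deriv_xi: "open U \<Longrightarrow> smooth_field_on A U X \<Longrightarrow> x \<in> U \<Longrightarrow> ext_deriv A \<eta> \<xi> X x = 0"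
  using reeb unfolding reeb_field_def by (elim conjE; simp)+

sublocale gx: inner_form "g x" for x
  by (rule inner_form_metric[OF metric])

lemma phi_linear: "linear (\<phi> x)"
  using phi_smooth by (simp add: smooth_endo_field_def)

lemma eta_C1: "C1_form A \<eta>"
  by (rule smooth_one_form_C1[OF eta_smooth])

lemma xi_nonzero: "\<xi> x \<noteq> 0"
  using eta_xi[of x] gx.simps eta_eq by (metis zero_neq_one)

text \<open>The structure equations are given for vector fields. Coordinate fields realise arbitrary
  vectors at \<open>x\<close>, which turns the equations into pointwise ones; the 2 undoes the
  normalisation of \<open>ext_deriv\<close>.\<close>

lemma dform_eta_chart_at: "dform A (chart_at A x) \<eta> x u v = 2 * g x u (\<phi> x v)"
  and dform_xi_chart_at: "dform A (chart_at A x) \<eta> x (\<xi> x) v = 0"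
proof -
  define c where "c = chart_at A x"
  have c: "c \<in> A" "x \<in> fst c" using chart_at by (auto simp: c_def)
  note f = smooth_field_cvec[OF c(1)] and o = open_chart(1)[OF c(1)]
  have cx: "cvec A c x w = w" for w by (simp add: c_def)
  have "ext_deriv A \<eta> (\<lambda>x. cvec A c x u) (\<lambda>x. cvec A c x v) x = g x (cvec A c x u) (\<phi> x (cvec A c x v))"
    by (rule ext_deriv_eta[OF o f f c(2)])
  then show "dform A (chart_at A x) \<eta> x u v = 2 * g x u (\<phi> x v)"
    using ext_deriv_eq_dform[OF eta_C1 o c(2) f[of u] f[of v]] by (simp add: cx)
  have "ext_deriv A \<eta> \<xi> (\<lambda>x. cvec A c x v) x = 0"
    by (rule ext_deriv_xi[OF o f c(2)])
  then show "dform A (chart_at A x) \<eta> x (\<xi> x) v = 0"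
    using ext_deriv_eq_dform[OF eta_C1 o c(2) smooth_field_on_subset[OF xi_smooth subset_UNIV] f[of v]] by (simp add: cx)
qed

lemma phi_xi: "\<phi> x (\<xi> x) = 0"
proof -
  have "2 * g x u (\<phi> x (\<xi> x)) = 0" for u
    using dform_xi_chart_at[of x u] dform_swap[of "chart_at A x" \<eta> x u "\<xi> x"] dform_eta_chart_at[of x u "\<xi> x"] by simp
  then show ?thesis using gx.eq_zeroI[of x "\<phi> x (\<xi> x)"] by simp
qed

lemma dform_eta:
  assumes "c \<in> A" "x \<in> fst c"
  shows "dform A c \<eta> x u v = 2 * g x (cvec A c x u) (\<phi> x (cvec A c x v))"
  using dform_transition[OF eta_C1 assms chart_at, of u v] dform_eta_chart_at[of x] by (simp add: cvec_def)

lemma omat_eta: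
  assumes "c \<in> A" "x \<in> fst c"
  shows "omat A c \<eta> x = 2 *\<^sub>R (gmat A c g x ** endo_mat A c \<phi> x)"
proof (rule matrix_eqI_inner)
  fix u v
  have "g x (cvec A c x u) (\<phi> x (cvec A c x v)) = u \<bullet> (gmat A c g x *v (endo_mat A c \<phi> x *v v))"
    unfolding endo_mat_mult[of \<phi>, OF phi_linear assms] gmat_eq[OF metric assms, symmetric] using assms by simp
  then show "u \<bullet> (omat A c \<eta> x *v v) = u \<bullet> ((2 *\<^sub>R (gmat A c g x ** endo_mat A c \<phi> x)) *v v)"
    using dform_eta[OF assms, of u v] dform_omat[OF eta_C1 assms, of u v]
    by (simp add: scaleR_matrix_vector matrix_vector_mul_assoc)
qed

lemma contact_matrices:
  assumes c: "c \<in> A" "x \<in> fst c"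
  shows "contact_matrices (gmat A c g x) (endo_mat A c \<phi> x) (components A c x (\<xi> x)) (form_vec A c \<eta> (snd c x))"
proof
  show "v \<noteq> 0 \<Longrightarrow> 0 < v \<bullet> (gmat A c g x *v v)" for v by (rule gmat_pos[OF metric c])
  show "transpose (gmat A c g x) = gmat A c g x" using gmat_sym[OF metric, of c x] by (simp add: transpose_def vec_eq_iff)
  have e: "form_vec A c \<eta> (snd c x) \<bullet> v = \<eta> x (cvec A c x v)" for v
    by (rule form_vec_inner[OF C1_form_linear[OF eta_C1] c])
  show "form_vec A c \<eta> (snd c x) = gmat A c g x *v components A c x (\<xi> x)"
  proof (rule vector_eq_rdot[THEN iffD1], intro allI)
    fix v
    have "\<eta> x (cvec A c x v) = g x (cvec A c x v) (cvec A c x (components A c x (\<xi> x)))"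
      using c gx.sym by (simp add: eta_eq)
    then show "form_vec A c \<eta> (snd c x) \<bullet> v = (gmat A c g x *v components A c x (\<xi> x)) \<bullet> v"
      unfolding e gmat_eq[OF metric c] by (simp add: inner_commute)
  qed
  show "form_vec A c \<eta> (snd c x) \<bullet> components A c x (\<xi> x) = 1" using c eta_xi by (simp add: e)
  show "endo_mat A c \<phi> x ** endo_mat A c \<phi> x = outer (components A c x (\<xi> x)) (form_vec A c \<eta> (snd c x)) - mat 1"
    unfolding matrix_eq using c
    by (simp add: matrix_vector_mul_assoc[symmetric] endo_mat_mult[of \<phi>, OF phi_linear] phi_sq
        matrix_vector_mult_diff_rdistrib outer_mult_vector e
        linear_add[OF components_linear] linear_scale[OF components_linear] linear_neg[OF components_linear]
        linear_diff[OF components_linear])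
  show "endo_mat A c \<phi> x *v components A c x (\<xi> x) = 0"
    using c linear_0[OF components_linear[OF c]] by (simp add: endo_mat_mult[of \<phi>, OF phi_linear] phi_xi)
  \<comment> \<open>Skewness of \<open>gmat\<close> times \<open>endo_mat\<close> is inherited from
    the differential of \<eta>, of which it is one half.\<close>
  define X where "X = gmat A c g x ** endo_mat A c \<phi> x"
  have "transpose (2 *\<^sub>R X) = - (2 *\<^sub>R X)"
    using transpose_omat[of c \<eta> x] unfolding omat_eta[OF c] X_def .
  then have "2 *\<^sub>R transpose X = 2 *\<^sub>R (- X)" by (simp only: transpose_scaleR scaleR_minus_right)
  then have "transpose X = - X" by (rule scaleR_left_imp_eq[rotated]) simp
  then show "transpose (gmat A c g x ** endo_mat A c \<phi> x) = - (gmat A c g x ** endo_mat A c \<phi> x)"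
    unfolding X_def .
qed

lemma endo_mat_Ck:
  assumes c: "c \<in> A"
  shows "Ck k (\<lambda>z. endo_mat A c \<phi> (chart_inv c z)) (snd c ` fst c)"
proof (rule Ck_matrix)
  fix i j
  have "smooth_field_on A (fst c) (\<lambda>x. \<phi> x (cvec A c x (axis j 1)))"
    using phi_smooth smooth_field_cvec[OF c] open_chart(1)[OF c] unfolding smooth_endo_field_def by blast
  from smooth_fieldD[OF this c, of k] have "Ck k (local_rep A c (\<lambda>x. \<phi> x (cvec A c x (axis j 1)))) (snd c ` fst c)" by simp
  from Ck_vec_nth[OF this, of i] c show "Ck k (\<lambda>z. endo_mat A c \<phi> (chart_inv c z) $ i $ j) (snd c ` fst c)"
    by (simp add: endo_mat_def matrix_def local_rep_def)
qed (use c in simp)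

lemma gmat_matrix_Ck: "c \<in> A \<Longrightarrow> Ck k (\<lambda>z. gmat A c g (chart_inv c z)) (snd c ` fst c)"
  by (rule Ck_matrix) (auto intro: gmat_Ck[OF metric])

text \<open>The contraction of \<open>d\<beta>\<close> with the bivector dual to \<open>d\<eta>\<close>, which does not depend on the chart.\<close>

definition dtrace :: "('a, 'n) chart \<Rightarrow> ('a, 'n) one_form \<Rightarrow> 'a \<Rightarrow> real" where
  "dtrace c \<beta> x = - trace (endo_mat A c \<phi> x ** matrix_inv (gmat A c g x) ** omat A c \<beta> x)"

text \<open>The inverse Gram matrix times the differential transforms like an endomorphism, as does
  the matrix of \<phi>; the product is conjugated by the Jacobian and its trace is
  unchanged.\<close>

lemma dtrace_transition:
  assumes \<beta>: "C1_form A \<beta>" and c: "c \<in> A" "x \<in> fst c" and d: "d \<in> A" "x \<in> fst d"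
  shows "dtrace c \<beta> x = dtrace d \<beta> x"
proof -
  let ?J = "matrix (tdiff c d x)" and ?K = "matrix (tdiff d c x)"
  let ?G = "gmat A d g x" and ?W = "omat A d \<beta> x"
  have KJ: "?K ** ?J = mat 1" and JK: "?J ** ?K = mat 1" using c d by (simp_all add: tdiff_matrix_inverse)
  have tKJ: "transpose ?K ** transpose ?J = mat 1"
    using JK by (simp add: matrix_transpose_mul[symmetric] transpose_mat)
  have Gi: "matrix_inv ?G ** ?G = mat 1" by (rule matrix_inv(1)[OF gmat_invertible[OF metric d]])
  have "matrix_inv (gmat A c g x) = ?K ** matrix_inv ?G ** transpose ?K"
  proof (rule matrix_inv_eqI)
    have "?K ** matrix_inv ?G ** transpose ?K ** gmat A c g x
      = ?K ** (matrix_inv ?G ** ((transpose ?K ** transpose ?J) ** ?G)) ** ?J"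
      unfolding gmat_transition[OF metric c d] by (simp only: matrix_mul_assoc)
    then show "?K ** matrix_inv ?G ** transpose ?K ** gmat A c g x = mat 1" by (simp add: tKJ Gi KJ)
  qed
  then have "matrix_inv (gmat A c g x) ** omat A c \<beta> x
      = ?K ** (matrix_inv ?G ** ((transpose ?K ** transpose ?J) ** ?W)) ** ?J"
    unfolding omat_transition[OF \<beta> c d] by (simp only: matrix_mul_assoc)
  then have 1: "matrix_inv (gmat A c g x) ** omat A c \<beta> x = ?K ** (matrix_inv ?G ** ?W) ** ?J" by (simp add: tKJ)
  have 2: "endo_mat A c \<phi> x ** ?K = ?K ** endo_mat A d \<phi> x"
    using endo_mat_transition[of \<phi>, OF phi_linear d c] by simp
  have "endo_mat A c \<phi> x ** (matrix_inv (gmat A c g x) ** omat A c \<beta> x)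
    = ?K ** (endo_mat A d \<phi> x ** (matrix_inv ?G ** ?W) ** ?J)"
    unfolding 1 using 2 by (simp add: matrix_mul_assoc)
  then have "trace (endo_mat A c \<phi> x ** (matrix_inv (gmat A c g x) ** omat A c \<beta> x))
    = trace (endo_mat A d \<phi> x ** (matrix_inv ?G ** ?W) ** (?J ** ?K))"
    using trace_mul_sym[of ?K "endo_mat A d \<phi> x ** (matrix_inv ?G ** ?W) ** ?J"] by (simp only: matrix_mul_assoc)
  then show ?thesis by (simp add: dtrace_def JK matrix_mul_assoc)
qed

definition "dtr \<beta> x = dtrace (chart_at A x) \<beta> x"

lemma dtr_eq: "C1_form A \<beta> \<Longrightarrow> c \<in> A \<Longrightarrow> x \<in> fst c \<Longrightarrow> dtr \<beta> x = dtrace c \<beta> x"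
  unfolding dtr_def by (rule dtrace_transition) (use chart_at in auto)

lemma dtr_continuous:
  assumes \<beta>: "C1_form A \<beta>"
  shows "continuous_on UNIV (dtr \<beta>)"
proof (rule continuous_on_chartwise)
  fix c assume c: "c \<in> A"
  have o: "open (snd c ` fst c)" using c by simp
  have "Ck 0 (\<lambda>z. - trace (endo_mat A c \<phi> (chart_inv c z) ** matrix_inv (gmat A c g (chart_inv c z)) ** curl (form_vec A c \<beta>) z)) (snd c ` fst c)"
    by (intro Ck_minus Ck_trace Ck_matrix_mult Ck_matrix_inv endo_mat_Ck gmat_matrix_Ck Ck_curl C1_form_vec c o \<beta>)
      (use det_gmat_pos[OF metric c] c in \<open>fastforce\<close>)
  then have "Ck 0 (dtr \<beta> \<circ> chart_inv c) (snd c ` fst c)"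
    by (rule Ck_cong[OF o, rotated]) (use c curl_form_vec[OF \<beta> c] in \<open>auto simp: dtr_eq[OF \<beta> c] dtrace_def\<close>)
  then show "continuous_on (snd c ` (UNIV \<inter> fst c)) (dtr \<beta> \<circ> chart_inv c)" by simp
qed simp

lemma dtr_eq_0:
  assumes K: "closed K" "\<And>y v. y \<notin> K \<Longrightarrow> \<beta> y v = 0" and x: "x \<notin> K"
  shows "dtr \<beta> x = 0"
proof -
  have "omat A (chart_at A x) \<beta> x = 0"
    by (rule dform_eq_0_open[OF chart_at, where O' = "- K"]) (use assms in auto)
  then show ?thesis by (simp add: dtr_def dtrace_def trace_def matrix_matrix_mult_def)
qed

lemma integral_dtr_chart:
  assumes \<beta>: "C1_form A \<beta>" and \<beta>\<xi>: "\<And>x. \<beta> x (\<xi> x) = 0" and c: "c \<in> A"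
    and L: "compact L" "L \<subseteq> fst c" "\<And>y v. y \<notin> L \<Longrightarrow> \<beta> y v = 0"
  shows "(\<integral>x. dtr \<beta> x \<partial>volume_measure A g) = 0"
proof -
  let ?U = "snd c ` fst c"
  define G where "G z = gmat A c g (chart_inv c z)" for z
  define \<Phi> where "\<Phi> z = endo_mat A c \<phi> (chart_inv c z)" for z
  define b where "b = form_vec A c \<beta>"
  define V where "V z = sqrt (det (G z)) *\<^sub>R ((1/2) *\<^sub>R (\<Phi> z *v (matrix_inv (G z) *v b z)))" for z
  have U: "open ?U" using c by simp
  have cm: "contact_matrices (G z) (\<Phi> z) (components A c (chart_inv c z) (\<xi> (chart_inv c z))) (form_vec A c \<eta> z)"
    if "z \<in> ?U" for z
    using contact_matrices[OF c, of "chart_inv c z"] that c by (auto simp: G_def \<Phi>_def)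
  have GC: "Ck (Suc 0) G ?U" "Ck (Suc 0) \<Phi> ?U"
    unfolding G_def[abs_def] \<Phi>_def[abs_def] by (intro gmat_matrix_Ck endo_mat_Ck c)+
  have \<eta>2: "Ck (Suc (Suc 0)) (form_vec A c \<eta>) ?U" by (rule Ck_form_vec[OF smooth_one_form_Ck[OF eta_smooth c] c])
  have b: "Ck (Suc 0) b ?U" unfolding b_def by (rule C1_form_vec[OF \<beta> c])
  have cu: "curl (form_vec A c \<eta>) z = 2 *\<^sub>R (G z ** \<Phi> z)" if "z \<in> ?U" for z
    using that curl_form_vec[OF eta_C1 c] omat_eta[OF c] c by (auto simp: G_def \<Phi>_def)
  have b\<xi>: "b z \<bullet> components A c (chart_inv c z) (\<xi> (chart_inv c z)) = 0" if z: "z \<in> ?U" for z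
  proof -
    obtain x where x: "x \<in> fst c" "z = snd c x" using z by auto
    then show ?thesis
      using form_vec_inner[OF C1_form_linear[OF \<beta>] c x(1), where v = "components A c x (\<xi> x)"] \<beta>\<xi> c by (simp add: b_def)
  qed
  note div = contact_divergence[OF U _ cm GC \<eta>2 b cu b\<xi>, folded V_def]
  have b0: "b z = 0" if "z \<in> ?U - snd c ` L" for z
  proof -
    obtain x where x: "x \<in> fst c" "z = snd c x" using \<open>z \<in> ?U - snd c ` L\<close> by blast
    then have "x \<notin> L" using that by blast
    moreover have "chart_inv c z = x" using x c by simp
    ultimately show ?thesis using L(3)[of x] by (simp add: b_def form_vec_def form_rep_def vec_eq_iff)
  qed
  \<comment> \<open>The quarter is the constant in \<open>contact_divergence\<close>: the field
    \<open>V\<close> has coordinate divergence equal to the density times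
    \<open>dtr \<beta> / 4\<close>.\<close>
  have "(\<integral>x. dtr \<beta> x / 4 \<partial>volume_measure A g) = 0"
  proof (rule integral_chart_divergence[OF metric c, where V = V and K = "snd c ` L"])
    show "(\<lambda>x. dtr \<beta> x / 4) \<in> borel_measurable borel"
      using borel_measurable_continuous_onI[OF dtr_continuous[OF \<beta>]] by simp
    show "dtr \<beta> x / 4 = 0" if "x \<notin> fst c" for x
      using dtr_eq_0[of L \<beta> x] L that compact_imp_closed[OF L(1)] by auto
    show "Ck (Suc 0) (\<lambda>z. V z $ i) ?U" for i
    \<comment> \<open>\<open>contact_divergence\<close> is stated at a point of the open set, so a
      chart with empty domain has to be treated apart.\<close>
    proof (cases "?U = {}")
      case True then show ?thesis by simp
    next
      case False
      then obtain z where "z \<in> ?U" by blast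
      from Ck_vec_nth[OF div(2)[OF this] U] show ?thesis by (simp add: V_def)
    qed
    show "compact (snd c ` L)"
      by (rule compact_continuous_image[OF continuous_on_subset[OF chart_continuous(1)[OF c] L(2)] L(1)])
    show "snd c ` L \<subseteq> ?U" using L(2) by auto
    show "V z = 0" if "z \<in> ?U - snd c ` L" for z using b0[OF that] by (simp add: V_def)
    show "sqrt (det (gmat A c g x)) * (dtr \<beta> x / 4) = (\<Sum>i\<in>UNIV. dd (\<lambda>z. V z $ i) (axis i 1) (snd c x))"
      if x: "x \<in> fst c" for x
    proof -
      have "snd c x \<in> ?U" using x by simp
      from div(1)[OF this] show ?thesis
        using x c curl_form_vec[OF \<beta> c x]
        by (simp add: V_def G_def \<Phi>_def b_def dtr_eq[OF \<beta> c x] dtrace_def)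
    qed
  qed
  then show ?thesis by simp
qed

text \<open>The form is cut into finitely many forms, each supported in one chart. Multiplication by
  functions preserves \<beta>(\<xi>) = 0, so the local result applies to every piece.\<close>

lemma integral_dtr:
  assumes \<beta>: "C1_form A \<beta>" and \<beta>\<xi>: "\<And>x. \<beta> x (\<xi> x) = 0"
    and K: "compact K" "\<And>y v. y \<notin> K \<Longrightarrow> \<beta> y v = 0"
  shows "(\<integral>x. dtr \<beta> x \<partial>volume_measure A g) = 0"
proof -
  obtain I :: "'a set" and c \<zeta> L where I: "finite I" and c: "\<And>i. i \<in> I \<Longrightarrow> c i \<in> A"
    and \<zeta>: "\<And>i. i \<in> I \<Longrightarrow> C1_fun A (\<zeta> i)" "\<And>i y. i \<in> I \<Longrightarrow> y \<notin> L i \<Longrightarrow> \<zeta> i y = 0"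
    and L: "\<And>i. i \<in> I \<Longrightarrow> compact (L i)" "\<And>i. i \<in> I \<Longrightarrow> L i \<subseteq> fst (c i)"
    and T: "\<And>y. (\<Sum>i\<in>I. \<zeta> i y) \<ge> 0" "\<And>y. y \<in> K \<Longrightarrow> (\<Sum>i\<in>I. \<zeta> i y) > 0"
    by (rule bump_cover[OF K(1)]) (rule that)
  define T where "T y = (\<Sum>i\<in>I. \<zeta> i y)" for y
  \<comment> \<open>The quotient by \<open>T\<close> is C^1 everywhere: near points of
    \<open>K\<close> the sum is positive, and off the closed set \<open>K\<close> the form is 0,
    whatever \<open>T\<close> is there.\<close>
  define \<gamma> where "\<gamma> i y v = \<zeta> i y * (\<beta> y v / T y)" for i y v
  have TC: "Ck (Suc 0) (\<lambda>z. T (chart_inv d z)) (snd d ` fst d)" if "d \<in> A" for d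
    unfolding T_def by (rule Ck_sum) (use \<zeta>(1) that in \<open>auto simp: C1_fun_def\<close>)
  then have "C1_fun A T" by (simp add: C1_fun_def)
  then have Topen: "open {y. T y > 0}"
    by (intro open_Collect_less continuous_on_const C1_fun_continuous)
  have Kc: "closed K" by (rule compact_imp_closed[OF K(1)])
  have \<gamma>C: "C1_form A (\<gamma> i)" if i: "i \<in> I" for i
    unfolding C1_form_def
  proof (intro conjI allI ballI Ck_local)
    show "linear (\<gamma> i x)" for x
      using C1_form_linear[OF \<beta>, of x] unfolding \<gamma>_def[abs_def] linear_iff by (simp add: field_simps add_divide_distrib)
    fix d v z assume d: "d \<in> A" and z: "z \<in> snd d ` fst d"
    then obtain y where y: "y \<in> fst d" "z = snd d y" by auto
    show "\<exists>T. open T \<and> z \<in> T \<and> Ck (Suc 0) (form_rep A d (\<gamma> i) v) T"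
    proof (cases "y \<in> K")
      case True
      define O' where "O' = snd d ` ({y. T y > 0} \<inter> fst d)"
      have O': "open O'" "O' \<subseteq> snd d ` fst d" "z \<in> O'"
        using open_chart_image[OF d Topen] T(2)[OF True] y by (auto simp: O'_def T_def)
      have "Ck (Suc 0) (\<lambda>z. \<zeta> i (chart_inv d z) * (form_rep A d \<beta> v z / T (chart_inv d z))) O'"
        by (intro Ck_mult Ck_divide O'(1) Ck_subset[OF TC[OF d] O'(2)] Ck_subset[OF C1_formD[OF \<beta> d] O'(2)]
            Ck_subset[OF _ O'(2)]) (use \<zeta>(1)[OF i] d in \<open>auto simp: C1_fun_def O'_def\<close>)
      then have "Ck (Suc 0) (form_rep A d (\<gamma> i) v) O'" by (simp add: form_rep_def[abs_def] \<gamma>_def)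
      then show ?thesis using O' by blast
    next
      case False
      define O' where "O' = snd d ` (- K \<inter> fst d)"
      have O': "open O'" "z \<in> O'" using open_chart_image[OF d, of "- K"] Kc y False by (auto simp: O'_def)
      have "Ck (Suc 0) (form_rep A d (\<gamma> i) v) O'"
        by (rule Ck_cong[OF O'(1) _ Ck_const[of _ 0]]) (use d K(2) in \<open>auto simp: O'_def form_rep_def \<gamma>_def\<close>)
      then show ?thesis using O' by blast
    qed
  qed
  have \<gamma>\<xi>: "\<gamma> i x (\<xi> x) = 0" for i x by (simp add: \<gamma>_def \<beta>\<xi>)
  have \<gamma>0: "\<gamma> i y v = 0" if "i \<in> I" "y \<notin> L i" for i y v using \<zeta>(2)[OF that] by (simp add: \<gamma>_def)
  have sum: "\<beta> = (\<lambda>y v. \<Sum>i\<in>I. \<gamma> i y v)"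
  proof (intro ext)
    fix y v
    have "(\<Sum>i\<in>I. \<gamma> i y v) = T y * (\<beta> y v / T y)" by (simp only: \<gamma>_def T_def sum_distrib_right)
    also have "\<dots> = \<beta> y v" using T(2)[of y] K(2)[of y v] by (cases "y \<in> K") (auto simp: T_def)
    finally show "\<beta> y v = (\<Sum>i\<in>I. \<gamma> i y v)" by simp
  qed
  have dsum: "dtr \<beta> x = (\<Sum>i\<in>I. dtr (\<gamma> i) x)" for x
    unfolding dtr_def dtrace_def sum_negf
    by (subst sum) (simp add: omat_sum[OF \<gamma>C chart_at] trace_sum[symmetric] trace_mul_sym[of "_ ** _"] matrix_mult_sum_left)
  have int: "integrable (volume_measure A g) (dtr (\<gamma> i))" if i: "i \<in> I" for i
  proof -
    have Lc: "closed (L i)" by (rule compact_imp_closed[OF L(1)[OF i]])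
    have "integrable (volume_measure A g) (\<lambda>x. indicator (L i) x * dtr (\<gamma> i) x)"
      by (rule integrable_indicator_continuous[OF sets_volume_measure[OF metric] volume_compact_finite[OF metric L(1)[OF i]]
            L(1)[OF i] continuous_on_subset[OF dtr_continuous[OF \<gamma>C[OF i]]]]) (use Lc in auto)
    moreover have "indicator (L i) x * dtr (\<gamma> i) x = dtr (\<gamma> i) x" for x
      using dtr_eq_0[OF Lc \<gamma>0[OF i], where x = x] by (auto split: split_indicator)
    ultimately show ?thesis by simp
  qed
  have "(\<integral>x. dtr \<beta> x \<partial>volume_measure A g) = (\<Sum>i\<in>I. \<integral>x. dtr (\<gamma> i) x \<partial>volume_measure A g)"
    unfolding dsum by (rule Bochner_Integration.integral_sum) (rule int)
  also have "\<dots> = 0"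
    by (rule sum.neutral) (use integral_dtr_chart[OF \<gamma>C \<gamma>\<xi> c L \<gamma>0] in blast)
  finally show ?thesis .
qed

end

section \<open>Rescaling a metric along and orthogonally to \<open>\<xi>\<close>\<close>

text \<open>By Jacobi's formula the determinant \<open>D t\<close> satisfies D' = D/t on positive
  reals, because the outer product is a projection of trace 1; thus \<open>D t / t\<close> is
  constant and equals its value at 1.\<close>

lemma det_add_outer:
  fixes x y :: "real ^ 'n::finite"
  assumes xy: "x \<bullet> y = 1" and u: "u > 0"
  shows "det (mat 1 + (u - 1) *\<^sub>R outer x y) = u"
proof -
  define Q where "Q = outer x y"
  have QQ: "Q ** Q = Q" using xy by (simp add: Q_def outer_mult_outer inner_commute)
  have tQ: "trace Q = 1" using xy by (simp add: Q_def trace_outer)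
  define D where "D t = det (mat 1 + (t - 1) *\<^sub>R Q)" for t
  have inv: "(mat 1 + (1 / t - 1) *\<^sub>R Q) ** (mat 1 + (t - 1) *\<^sub>R Q) = mat 1" if "t > 0" for t
  proof -
    have "(mat 1 + (1 / t - 1) *\<^sub>R Q) ** (mat 1 + (t - 1) *\<^sub>R Q)
      = mat 1 + ((t - 1) + (1 / t - 1) + (1 / t - 1) * (t - 1)) *\<^sub>R Q"
      by (simp add: matrix_add_rdistrib matrix_add_ldistrib matrix_scaleR_left matrix_scaleR_right QQ)
        (simp add: vec_eq_iff algebra_simps)
    also have "(t - 1) + (1 / t - 1) + (1 / t - 1) * (t - 1) = 0" using that by (simp add: field_simps)
    finally show ?thesis by simp
  qed
  have dD: "(D has_real_derivative D t / t) (at t)" if t: "t > 0" for t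
  proof -
    have i: "invertible (mat 1 + (t - 1) *\<^sub>R Q)"
      using inv[OF t] invertible_left_inverse by blast
    have "((\<lambda>t. mat 1 + (t - 1) *\<^sub>R Q) has_derivative (\<lambda>h. h *\<^sub>R Q)) (at t)"
      by (auto intro!: derivative_eq_intros)
    from det_has_derivative[OF this i]
    have "(D has_derivative (\<lambda>h. D t * trace ((mat 1 + (1 / t - 1) *\<^sub>R Q) ** (h *\<^sub>R Q)))) (at t)"
      by (simp add: D_def[abs_def] matrix_inv_eqI[OF inv[OF t]])
    moreover have "trace ((mat 1 + (1 / t - 1) *\<^sub>R Q) ** (h *\<^sub>R Q)) = h / t" for h
      by (simp add: matrix_ring QQ trace_ring tQ algebra_simps)
    ultimately have "(D has_derivative (\<lambda>h. D t * (h / t))) (at t)" by simp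
    moreover have "(\<lambda>h. D t * (h / t)) = (*) (D t / t)" by (simp add: fun_eq_iff)
    ultimately show ?thesis by (simp only: has_field_derivative_def)
  qed
  have "\<exists>c. \<forall>t\<in>{0<..}. D t / t = c"
  proof (rule has_field_derivative_zero_constant)
    fix t :: real assume "t \<in> {0<..}"
    then have t: "t > 0" by simp
    show "((\<lambda>t. D t / t) has_field_derivative 0) (at t within {0<..})"
      by (rule has_field_derivative_at_within) (use t dD[OF t] in \<open>auto intro!: derivative_eq_intros\<close>)
  qed simp
  then obtain c where c: "\<And>t. t > 0 \<Longrightarrow> D t / t = c" by auto
  have "D u / u = D 1 / 1" using c[OF u] c[of 1] by simp
  then show ?thesis using u by (simp add: D_def Q_def)
qed

text \<open>The terms with \<open>a\<close> and \<open>b\<close> come from differentiating the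
  scaling factor. Since \<open>P\<close> kills \<open>b\<close> on both sides, what is left of them
  in the product has trace 0.\<close>

lemma trace_rescaled:
  fixes P W :: "real ^ 'n::finite ^ 'n" and a b :: "real ^ 'n" and k :: real
  assumes "P *v b = 0" "b v* P = 0"
  defines "W' \<equiv> k *\<^sub>R W + outer a b - outer b a"
  shows "trace (P ** W' ** P ** W') = k\<^sup>2 * trace (P ** W ** P ** W)"
proof -
  have PW: "P ** W' = k *\<^sub>R (P ** W) + outer (P *v a) b"
    by (simp add: W'_def matrix_ring mult_outer assms(1))
  have 1: "outer w b ** (P ** X) = 0" for w X
    by (simp add: matrix_mul_assoc outer_mult assms(2))
  have b: "b \<bullet> (P *v v) = 0" for v by (metis assms(2) dot_lmul_matrix inner_zero_left)
  have "P ** W' ** P ** W' = (P ** W') ** (P ** W')" by (simp add: matrix_mul_assoc)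
  also have "\<dots> = k\<^sup>2 *\<^sub>R (P ** W ** (P ** W)) + k *\<^sub>R outer (P ** W *v (P *v a)) b"
    unfolding PW using b
    by (simp add: matrix_add_rdistrib matrix_add_ldistrib matrix_scaleR_left matrix_scaleR_right 1 mult_outer
        outer_mult_vector power2_eq_square scaleR_add_right matrix_vector_mult_add_rdistrib scaleR_matrix_vector
        bounded_bilinear.scaleR_left[OF bounded_bilinear_outer])
  finally show ?thesis using b[of "W *v (P *v a)"]
    by (simp add: trace_ring trace_outer matrix_mul_assoc matrix_vector_mul_assoc inner_commute)
qed

context smooth_manifold
begin

lemma omat_scale:
  assumes \<beta>: "C1_form A \<beta>" and \<kappa>: "C1_fun A \<kappa>" and c: "c \<in> A" "x \<in> fst c"
  shows "\<exists>a. omat A c (\<lambda>x v. \<kappa> x * \<beta> x v) x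
    = \<kappa> x *\<^sub>R omat A c \<beta> x + outer a (form_vec A c \<beta> (snd c x)) - outer (form_vec A c \<beta> (snd c x)) a"
proof -
  define a where "a = (\<chi> i. dd (\<lambda>z. \<kappa> (chart_inv c z)) (axis i 1) (snd c x))"
  have z: "snd c x \<in> snd c ` fst c" using c by auto
  have \<kappa>C: "Ck (Suc 0) (\<lambda>z. \<kappa> (chart_inv c z)) (snd c ` fst c)" using \<kappa> c by (simp add: C1_fun_def)
  have "dd (form_rep A c (\<lambda>x v. \<kappa> x * \<beta> x v) v) u (snd c x)
    = \<kappa> x * dd (form_rep A c \<beta> v) u (snd c x) + dd (\<lambda>z. \<kappa> (chart_inv c z)) u (snd c x) * form_rep A c \<beta> v (snd c x)" for u v
    using dd_bilinear[OF bounded_bilinear_mult \<kappa>C C1_formD[OF \<beta> c(1), of v] z, of u] c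
    by (simp add: form_rep_def[abs_def])
  then have "omat A c (\<lambda>x v. \<kappa> x * \<beta> x v) x
    = \<kappa> x *\<^sub>R omat A c \<beta> x + outer a (form_vec A c \<beta> (snd c x)) - outer (form_vec A c \<beta> (snd c x)) a"
    by (simp add: vec_eq_iff omat_def bmat_def dform_def outer_def a_def form_vec_def algebra_simps)
  then show ?thesis by blast
qed

lemma smooth_function_C1: "smooth_function_on A UNIV f \<Longrightarrow> C1_fun A f"
  unfolding C1_fun_def using smooth_functionD[of UNIV f] by (simp del: Ck.simps)

end

text \<open>One computation for both normalisations: \<open>s\<close> scales the complement of the
  unit field \<xi> and \<open>\<kappa>\<close> its direction. The perpendicular case has
  \<open>\<kappa>\<close> equal to 1 and \<open>s\<close> constant; the case along \<xi> has
  \<open>s\<close> equal to 1.\<close>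

locale rescaled_metric = smooth_manifold A
  for A :: "('a::{t2_space, second_countable_topology}, 'n::finite) chart set" +
  fixes G :: "('a, 'n) two_tensor" and \<xi> :: "'a \<Rightarrow> real ^ 'n" and s :: real and \<kappa> :: "'a \<Rightarrow> real"
  assumes G: "riemannian_metric A G" and \<xi>: "smooth_field_on A UNIV \<xi>" and unit: "G x (\<xi> x) (\<xi> x) = 1"
    and s: "s > 0" and \<kappa>: "smooth_function_on A UNIV \<kappa>" and \<kappa>_pos: "\<kappa> x > 0"
begin

definition H :: "('a, 'n) two_tensor" where
  "H x u v = s * (G x u v - G x (\<xi> x) u * G x (\<xi> x) v) + \<kappa> x * (G x (\<xi> x) u * G x (\<xi> x) v)"

sublocale Gx: inner_form "G x" for x
  by (rule inner_form_metric[OF G])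

lemma xi_nonzero: "\<xi> x \<noteq> 0"
  using unit[of x] Gx.simps by (metis zero_neq_one)

lemma H_metric: "riemannian_metric A H"
  unfolding riemannian_metric_def
proof (intro conjI allI impI)
  fix x u v
  show "bilinear (H x)"
    unfolding bilinear_def linear_iff by (simp add: H_def Gx.simps algebra_simps)
  show "H x u v = H x v u" using Gx.sym[of x u v] by (simp add: H_def mult.commute)
  assume u: "u \<noteq> 0"
  define a where "a = G x (\<xi> x) u"
  define w where "w = u - a *\<^sub>R \<xi> x"
  have "G x w w = G x u u - a * a"
    using Gx.sym[of x u "\<xi> x"] unit[of x] by (simp add: w_def a_def Gx.simps algebra_simps)
  then have e: "H x u u = s * G x w w + \<kappa> x * (a * a)" by (simp add: H_def a_def)
  show "H x u u > 0"
  proof (cases "w = 0")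
    case True
    then have "a \<noteq> 0" using u by (auto simp: w_def)
    then show ?thesis using True \<kappa>_pos[of x] by (auto simp: e Gx.simps zero_less_mult_iff linorder_neq_iff)
  next
    case False
    show ?thesis
      unfolding e by (intro add_pos_nonneg mult_pos_pos s Gx.pos[OF False] mult_nonneg_nonneg[OF _ zero_le_square])
        (simp add: less_imp_le[OF \<kappa>_pos])
  qed
next
  fix U X Y assume U: "open U" and X: "smooth_field_on A U X" and Y: "smooth_field_on A U Y"
  have \<xi>U: "smooth_field_on A U \<xi>" by (rule smooth_field_on_subset[OF \<xi>]) simp
  have \<kappa>U: "smooth_function_on A U \<kappa>" by (rule smooth_function_on_subset[OF \<kappa>]) simp
  note m = metric_smooth[OF G U]
  show "smooth_function_on A U (\<lambda>x. H x (X x) (Y x))"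
    unfolding H_def
    by (rule smooth_function_add[OF U smooth_function_mult[OF U smooth_function_const smooth_function_diff[OF U m[OF X Y]
            smooth_function_mult[OF U m[OF \<xi>U X] m[OF \<xi>U Y]]]]
          smooth_function_mult[OF U \<kappa>U smooth_function_mult[OF U m[OF \<xi>U X] m[OF \<xi>U Y]]]])
qed

lemma H_xi: "H x (\<xi> x) v = \<kappa> x * G x (\<xi> x) v"
  by (simp add: H_def unit)

context
  fixes c :: "('a, 'n) chart" and x :: 'a and M :: "real ^ 'n ^ 'n" and w b :: "real ^ 'n"
  assumes c: "c \<in> A" "x \<in> fst c"
  defines "M \<equiv> gmat A c G x" and "w \<equiv> components A c x (\<xi> x)" and "b \<equiv> gmat A c G x *v components A c x (\<xi> x)"
begin

lemma b_inner: "b \<bullet> v = G x (\<xi> x) (cvec A c x v)"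
  using gmat_eq[OF G c, of v w] Gx.sym[of x] c by (simp add: b_def w_def inner_commute)

lemma b_w: "b \<bullet> w = 1"
  using b_inner[of w] c unit by (simp add: w_def)

lemma form_vec_b: "form_vec A c (\<lambda>x. G x (\<xi> x)) (snd c x) = b"
  by (rule vector_eq_rdot[THEN iffD1], intro allI)
    (use form_vec_inner[OF Gx.linear_right c] b_inner in simp)

lemma M_inv: "matrix_inv M ** M = mat 1" "M ** matrix_inv M = mat 1"
  using matrix_inv[OF gmat_invertible[OF G c]] by (simp_all add: M_def)

lemma Minv_b: "matrix_inv M *v b = w"
  unfolding b_def M_def[symmetric] w_def[symmetric] by (simp add: matrix_vector_mul_assoc M_inv)

lemma M_sym: "transpose M = M"
  using gmat_sym[OF G, of c x] by (simp add: transpose_def vec_eq_iff M_def)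

lemma w_M: "w v* M = b"
  using transpose_matrix_vector[of M w] by (simp add: M_sym) (simp add: b_def M_def w_def)

lemma gmat_H: "gmat A c H x = M ** (s *\<^sub>R mat 1 + (\<kappa> x - s) *\<^sub>R outer w b)"
proof (rule matrix_eqI_inner)
  fix u v
  have "u \<bullet> (gmat A c H x *v v) = H x (cvec A c x u) (cvec A c x v)" by (rule gmat_eq[OF H_metric c, symmetric])
  also have "\<dots> = s * (u \<bullet> (M *v v)) + (\<kappa> x - s) * ((b \<bullet> u) * (b \<bullet> v))"
    unfolding b_inner H_def M_def gmat_eq[OF G c, symmetric] by (simp add: algebra_simps)
  also have "\<dots> = u \<bullet> (M ** (s *\<^sub>R mat 1 + (\<kappa> x - s) *\<^sub>R outer w b) *v v)"
    by (simp add: matrix_ring mult_outer matrix_vector_mult_add_rdistrib scaleR_matrix_vector outer_mult_vector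
        inner_add_right) (simp add: M_def w_def b_def inner_commute)
  finally show "u \<bullet> (gmat A c H x *v v) = u \<bullet> (M ** (s *\<^sub>R mat 1 + (\<kappa> x - s) *\<^sub>R outer w b) *v v)" .
qed

lemma det_H: "det (gmat A c H x) = s ^ (CARD('n) - 1) * \<kappa> x * det (gmat A c G x)"
proof -
  have "s *\<^sub>R mat 1 + (\<kappa> x - s) *\<^sub>R outer w b = s *\<^sub>R (mat 1 + (\<kappa> x / s - 1) *\<^sub>R outer w b)"
  proof -
    have "s * (\<kappa> x / s - 1) = \<kappa> x - s" using s by (simp add: field_simps)
    then show ?thesis by (simp add: scaleR_add_right)
  qed
  also have "\<dots> = (s *\<^sub>R mat 1) ** (mat 1 + (\<kappa> x / s - 1) *\<^sub>R outer w b)" by (simp add: matrix_scaleR_left)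
  finally have "det (s *\<^sub>R mat 1 + (\<kappa> x - s) *\<^sub>R outer w b)
      = det (s *\<^sub>R mat 1 :: real ^ 'n ^ 'n) * (\<kappa> x / s)"
    using det_add_outer[of w b "\<kappa> x / s"] b_w s \<kappa>_pos[of x] by (simp add: det_mul inner_commute)
  also have "det (s *\<^sub>R mat 1 :: real ^ 'n ^ 'n) = s ^ CARD('n)"
    by (subst det_diagonal) (simp_all add: mat_def)
  also have "s ^ CARD('n) * (\<kappa> x / s) = s ^ (CARD('n) - 1) * \<kappa> x"
    using s by (simp add: power_eq_if[of s "CARD('n)"])
  finally show ?thesis by (simp add: gmat_H det_mul M_def)
qed

text \<open>The two inverse metrics contribute \<open>1 / s\<close> each. The dual form is
  multiplied by \<open>\<kappa>\<close>, hence its differential too, up to terms invisible to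
  \<open>P\<close>; of the resulting square one factor is consumed by the squared length of \<xi> in
  the denominator.\<close>

lemma normsq_H:
  "integrability_normsq A (\<lambda>x. span {\<xi> x}) H x = \<kappa> x / s\<^sup>2 * integrability_normsq A (\<lambda>x. span {\<xi> x}) G x"
proof -
  let ?W = "omat A c (\<lambda>x. G x (\<xi> x)) x" and ?W' = "omat A c (\<lambda>x. H x (\<xi> x)) x"
  define P where "P = matrix_inv M - outer w w"
  have wb: "w \<bullet> b = 1" using b_w by (simp add: inner_commute)
  have Pb: "P *v b = 0"
    using wb by (simp add: P_def matrix_vector_mult_diff_rdistrib Minv_b outer_mult_vector)
  have "b \<bullet> (P *v v) = 0" for v
  proof -
    have "b \<bullet> (matrix_inv M *v v) = (w v* M) \<bullet> (matrix_inv M *v v)" by (simp add: w_M)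
    also have "\<dots> = w \<bullet> v" unfolding dot_lmul_matrix by (simp add: matrix_vector_mul_assoc M_inv)
    finally show ?thesis
      using b_w by (simp add: P_def matrix_vector_mult_diff_rdistrib outer_mult_vector inner_diff_right)
  qed
  then have bP: "b v* P = 0"
    using dot_lmul_matrix[of b P "b v* P"] by simp
  have inv: "matrix_inv (gmat A c H x) = (1 / s) *\<^sub>R P + (1 / \<kappa> x) *\<^sub>R outer w w"
  proof (rule matrix_inv_eqI)
    have "P ** M = mat 1 - outer w b" by (simp add: P_def matrix_diff_left M_inv outer_mult w_M)
    then have 1: "P ** (M ** Z) = (mat 1 - outer w b) ** Z" for Z by (simp add: matrix_mul_assoc)
    have 2: "outer w w ** (M ** Z) = outer w b ** Z" for Z by (simp add: matrix_mul_assoc outer_mult w_M)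
    have Q: "outer w b ** outer w b = outer w b" using b_w by (simp add: outer_mult_outer)
    have sn: "s \<noteq> 0" "\<kappa> x \<noteq> 0" using s \<kappa>_pos[of x] by auto
    have "((1 / s) *\<^sub>R P + (1 / \<kappa> x) *\<^sub>R outer w w) ** gmat A c H x
      = (1 / s) *\<^sub>R ((mat 1 - outer w b) ** (s *\<^sub>R mat 1 + (\<kappa> x - s) *\<^sub>R outer w b))
        + (1 / \<kappa> x) *\<^sub>R (outer w b ** (s *\<^sub>R mat 1 + (\<kappa> x - s) *\<^sub>R outer w b))"
      unfolding gmat_H matrix_add_rdistrib matrix_scaleR_left 1 2 ..
    also have "(mat 1 - outer w b) ** (s *\<^sub>R mat 1 + (\<kappa> x - s) *\<^sub>R outer w b) = s *\<^sub>R (mat 1 - outer w b)"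
      by (simp add: matrix_diff_left matrix_add_ldistrib matrix_scaleR_right Q scaleR_diff_right)
    also have "outer w b ** (s *\<^sub>R mat 1 + (\<kappa> x - s) *\<^sub>R outer w b) = \<kappa> x *\<^sub>R outer w b"
      by (simp add: matrix_add_ldistrib matrix_scaleR_right Q scaleR_add_left[symmetric])
    finally show "((1 / s) *\<^sub>R P + (1 / \<kappa> x) *\<^sub>R outer w w) ** gmat A c H x = mat 1"
      using sn by simp
  qed
  have kH: "w \<bullet> (gmat A c H x *v w) = \<kappa> x"
    using gmat_components[OF H_metric c, of "\<xi> x" "\<xi> x"] by (simp add: H_xi unit w_def)
  have kG: "w \<bullet> (M *v w) = 1"
    using gmat_components[OF G c, of "\<xi> x" "\<xi> x"] by (simp add: unit w_def M_def)
  obtain a where W': "?W' = \<kappa> x *\<^sub>R ?W + outer a b - outer b a"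
    using omat_scale[OF dual_form_C1[OF G \<xi>] smooth_function_C1[OF \<kappa>] c] unfolding form_vec_b H_xi by blast
  have pH: "inv_perp (gmat A c H x) w = (1 / s) *\<^sub>R P" by (simp add: inv_perp_def inv kH)
  have pG: "inv_perp M w = P" by (simp add: inv_perp_def kG P_def)
  have "integrability_normsq A (\<lambda>x. span {\<xi> x}) H x = normsq_coord (gmat A c H x) ?W' w"
    unfolding w_def by (rule integrability_normsq_eq[OF H_metric \<xi> xi_nonzero c])
  also have "\<dots> = - (trace (P ** ?W' ** P ** ?W') / s\<^sup>2) / (4 * \<kappa> x)"
    by (simp add: normsq_coord_def pH kH matrix_scaleR_left matrix_scaleR_right trace_scaleR power2_eq_square)
  also have "trace (P ** ?W' ** P ** ?W') = (\<kappa> x)\<^sup>2 * trace (P ** ?W ** P ** ?W)"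
    unfolding W' by (rule trace_rescaled[OF Pb bP])
  also have "- ((\<kappa> x)\<^sup>2 * trace (P ** ?W ** P ** ?W) / s\<^sup>2) / (4 * \<kappa> x) = \<kappa> x / s\<^sup>2 * normsq_coord M ?W w"
    using \<kappa>_pos[of x] by (simp add: normsq_coord_def pG kG power2_eq_square field_simps)
  also have "normsq_coord M ?W w = integrability_normsq A (\<lambda>x. span {\<xi> x}) G x"
    unfolding w_def M_def by (rule integrability_normsq_eq[OF G \<xi> xi_nonzero c, symmetric])
  finally show ?thesis .
qed

end

end

section \<open>One-parameter families\<close>

lemma slice_has_derivative:
  fixes f :: "real \<times> 'a::euclidean_space \<Rightarrow> 'b::real_normed_vector"
  assumes "Ck (Suc k) f T" "(t, z) \<in> T"
  shows "((\<lambda>z. f (t, z)) has_derivative (\<lambda>v. dd f (0, v) (t, z))) (at z)"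
    and "((\<lambda>t. f (t, z)) has_vector_derivative dd f (1, 0) (t, z)) (at t)"
proof -
  note D = Ck_has_derivative[OF assms]
  have "((\<lambda>z. (t, z)) has_derivative (\<lambda>v. (0, v))) (at z)" by (auto intro!: derivative_eq_intros)
  from has_derivative_compose[OF this D]
  show "((\<lambda>z. f (t, z)) has_derivative (\<lambda>v. dd f (0, v) (t, z))) (at z)" .
  have "((\<lambda>t. (t, z)) has_derivative (\<lambda>r. (r, 0))) (at t)" by (auto intro!: derivative_eq_intros)
  from has_derivative_compose[OF this D]
  have "((\<lambda>t. f (t, z)) has_derivative (\<lambda>r. dd f (r, 0) (t, z))) (at t)" .
  then show "((\<lambda>t. f (t, z)) has_vector_derivative dd f (1, 0) (t, z)) (at t)"
    unfolding has_vector_derivative_def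
  proof (rule has_derivative_eq_rhs, intro ext)
    fix r
    show "dd f (r, 0) (t, z) = r *\<^sub>R dd f (1, 0) (t, z)"
  proof -
    have "dd f (r *\<^sub>R (1, 0)) (t, z) = r *\<^sub>R dd f (1, 0) (t, z)"
      by (rule linear_scale[OF has_derivative_linear[OF D]])
    then show ?thesis by simp
  qed
  qed
qed

lemma Ck_snd:
  fixes f :: "'a::euclidean_space \<Rightarrow> 'b::real_normed_vector"
  assumes "Ck k f S" "open T" "open S"
  shows "Ck k (\<lambda>(t::real, z). f z) (T \<times> S)"
proof -
  have "Ck k (\<lambda>p. f (snd p)) (T \<times> S)"
    by (rule Ck_compose[OF assms(1) Ck_bounded_linear[OF bounded_linear_snd]])
      (use assms in \<open>auto intro: open_Times\<close>)
  then show ?thesis by (simp add: case_prod_beta')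
qed

section \<open>Families of functions and the comparison of volumes\<close>

context smooth_manifold
begin

text \<open>Regularity is joint in time and coordinates: this makes the time derivative jointly
  continuous, as differentiation under the integral demands.\<close>

definition C1_family :: "real \<Rightarrow> (real \<Rightarrow> 'a \<Rightarrow> real) \<Rightarrow> bool" where
  "C1_family \<epsilon> F \<longleftrightarrow> (\<forall>c\<in>A. Ck (Suc 0) (\<lambda>(t, z). F t (chart_inv c z)) ({-\<epsilon><..<\<epsilon>} \<times> snd c ` fst c))"

lemma C1_familyD: "C1_family \<epsilon> F \<Longrightarrow> c \<in> A \<Longrightarrow> Ck (Suc 0) (\<lambda>(t, z). F t (chart_inv c z)) ({-\<epsilon><..<\<epsilon>} \<times> snd c ` fst c)"
  unfolding C1_family_def by blast

lemma open_family_domain: "c \<in> A \<Longrightarrow> open ({-\<epsilon><..<\<epsilon>::real} \<times> snd c ` fst c)"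
  by (intro open_Times) auto

lemma C1_familyI:
  assumes "\<And>c. c \<in> A \<Longrightarrow> Ck (Suc 0) (f c) ({-\<epsilon><..<\<epsilon>} \<times> snd c ` fst c)"
    and "\<And>c t x. c \<in> A \<Longrightarrow> \<bar>t\<bar> < \<epsilon> \<Longrightarrow> x \<in> fst c \<Longrightarrow> F t x = f c (t, snd c x)"
  shows "C1_family \<epsilon> F"
  unfolding C1_family_def
proof
  fix c assume c: "c \<in> A"
  show "Ck (Suc 0) (\<lambda>(t, z). F t (chart_inv c z)) ({-\<epsilon><..<\<epsilon>} \<times> snd c ` fst c)"
    by (rule Ck_cong[OF open_family_domain[OF c] _ assms(1)[OF c]]) (use c assms(2)[OF c] in auto)
qed

lemma family_vector_derivative:
  assumes F: "C1_family \<epsilon> F" and c: "c \<in> A" "x \<in> fst c" and t: "\<bar>t\<bar> < \<epsilon>"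
  shows "((\<lambda>t. F t x) has_real_derivative dd (\<lambda>(t, z). F t (chart_inv c z)) (1, 0) (t, snd c x)) (at t)"
proof -
  have "(t, snd c x) \<in> {-\<epsilon><..<\<epsilon>} \<times> snd c ` fst c" using c t by (auto simp: abs_less_iff)
  from slice_has_derivative(2)[OF C1_familyD[OF F c(1)] this] show ?thesis
    using c by (simp add: has_real_derivative_iff_has_vector_derivative)
qed

lemma family_has_derivative:
  "C1_family \<epsilon> F \<Longrightarrow> \<bar>t\<bar> < \<epsilon> \<Longrightarrow> ((\<lambda>t. F t x) has_real_derivative deriv (\<lambda>t. F t x) t) (at t)"
  using family_vector_derivative[OF _ chart_at] DERIV_imp_deriv by metis

lemma continuous_on_joint_chartwise:
  fixes F :: "real \<Rightarrow> 'a \<Rightarrow> real"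
  assumes "open I" "\<And>c. c \<in> A \<Longrightarrow> continuous_on (I \<times> snd c ` fst c) (\<lambda>(t, z). F t (chart_inv c z))"
  shows "continuous_on (I \<times> UNIV) (\<lambda>(t, x). F t x)"
  unfolding continuous_on_eq_continuous_at[OF open_Times[OF assms(1) open_UNIV]]
proof
  fix p :: "real \<times> 'a" assume p: "p \<in> I \<times> UNIV"
  define c where "c = chart_at A (snd p)"
  have c: "c \<in> A" "snd p \<in> fst c" using chart_at by (auto simp: c_def)
  have o: "open (I \<times> fst c)" using assms(1) c by (intro open_Times) auto
  have "continuous_on (I \<times> fst c) (\<lambda>p. (\<lambda>(t, z). F t (chart_inv c z)) (fst p, snd c (snd p)))"
    by (rule continuous_on_compose2[OF assms(2)[OF c(1)]])
      (auto intro!: continuous_intros continuous_on_compose2[OF chart_continuous(1)[OF c(1)]])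
  then have "continuous_on (I \<times> fst c) (\<lambda>(t, x). F t x)"
    by (rule continuous_on_eq) (use c in auto)
  then show "isCont (\<lambda>(t, x). F t x) p"
    using continuous_on_eq_continuous_at[OF o, of "\<lambda>(t, x). F t x"] p c by (cases p) auto
qed

lemma family_deriv_continuous:
  assumes F: "C1_family \<epsilon> F"
  shows "continuous_on ({-\<epsilon><..<\<epsilon>} \<times> UNIV) (\<lambda>(t, x). deriv (\<lambda>t. F t x) t)"
proof (rule continuous_on_joint_chartwise)
  fix c assume c: "c \<in> A"
  have "continuous_on ({-\<epsilon><..<\<epsilon>} \<times> snd c ` fst c) (dd (\<lambda>(t, z). F t (chart_inv c z)) (1, 0))"
    using Ck_dd[OF C1_familyD[OF F c]] by simp
  then show "continuous_on ({-\<epsilon><..<\<epsilon>} \<times> snd c ` fst c) (\<lambda>(t, z). deriv (\<lambda>t. F t (chart_inv c z)) t)"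
  proof (rule continuous_on_eq)
    fix p assume p: "p \<in> {-\<epsilon><..<\<epsilon>} \<times> snd c ` fst c"
    then obtain t x where tx: "p = (t, snd c x)" "x \<in> fst c" "\<bar>t\<bar> < \<epsilon>" by auto
    then show "dd (\<lambda>(t, z). F t (chart_inv c z)) (1, 0) p = (\<lambda>(t, z). deriv (\<lambda>t. F t (chart_inv c z)) t) p"
      using DERIV_imp_deriv[OF family_vector_derivative[OF F c tx(2,3)]] c by simp
  qed
qed simp

lemma family_continuous:
  assumes F: "C1_family \<epsilon> F" and t: "\<bar>t\<bar> < \<epsilon>"
  shows "continuous_on UNIV (F t)"
proof -
  have "continuous_on ({-\<epsilon><..<\<epsilon>} \<times> UNIV) (\<lambda>(t, x). F t x)"
    by (rule continuous_on_joint_chartwise) (use Ck_continuous_on[OF C1_familyD[OF F]] in auto)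
  then have "continuous_on UNIV (\<lambda>x. (\<lambda>(t, x). F t x) (t, x))"
    by (rule continuous_on_compose2) (use t in \<open>auto simp: abs_less_iff intro!: continuous_intros\<close>)
  then show ?thesis by simp
qed

lemma C1_family_mult:
  assumes "C1_family \<epsilon> F" "C1_family \<epsilon> F'"
  shows "C1_family \<epsilon> (\<lambda>t x. F t x * F' t x)"
  by (rule C1_familyI[OF Ck_mult[OF C1_familyD[OF assms(1)] C1_familyD[OF assms(2)] open_family_domain]]) auto

lemma family_leibniz:
  assumes F: "C1_family \<epsilon> F" and \<epsilon>: "\<epsilon> > 0" and H: "riemannian_metric A H"
    and K: "compact K" and \<Omega>: "\<Omega> \<in> sets borel" "\<Omega> \<subseteq> K"
  shows "((\<lambda>t. \<integral>x. indicator \<Omega> x * F t x \<partial>volume_measure A H) has_real_derivative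
      (\<integral>x. indicator \<Omega> x * deriv (\<lambda>t. F t x) 0 \<partial>volume_measure A H)) (at 0)"
  by (rule has_real_derivative_integral_compact[OF sets_volume_measure[OF H] volume_compact_finite[OF H K] K \<Omega> \<epsilon>
        family_has_derivative[OF F] continuous_on_subset[OF family_continuous[OF F] subset_UNIV]
        continuous_on_subset[OF family_deriv_continuous[OF F]]]) auto

lemma family_integrable:
  assumes F: "C1_family \<epsilon> F" and t: "\<bar>t\<bar> < \<epsilon>" and H: "riemannian_metric A H"
    and K: "compact K" and \<Omega>: "\<Omega> \<in> sets borel" "\<Omega> \<subseteq> K"
  shows "integrable (volume_measure A H) (\<lambda>x. indicator \<Omega> x * F t x)"
    and "integrable (volume_measure A H) (\<lambda>x. indicator \<Omega> x * deriv (\<lambda>t. F t x) t)"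
proof -
  note i = integrable_indicator_continuous[OF sets_volume_measure[OF H] volume_compact_finite[OF H K] K _ \<Omega>]
  show "integrable (volume_measure A H) (\<lambda>x. indicator \<Omega> x * F t x)"
    by (rule i[OF continuous_on_subset[OF family_continuous[OF F t]]]) simp
  have "continuous_on UNIV (\<lambda>x. (\<lambda>(t, x). deriv (\<lambda>t. F t x) t) (t, x))"
    by (rule continuous_on_compose2[OF family_deriv_continuous[OF F]])
      (use t in \<open>auto simp: abs_less_iff intro!: continuous_intros\<close>)
  then have "continuous_on UNIV (\<lambda>x. deriv (\<lambda>t. F t x) t)" by simp
  then show "integrable (volume_measure A H) (\<lambda>x. indicator \<Omega> x * deriv (\<lambda>t. F t x) t)"
    by (rule i[OF continuous_on_subset]) simp
qed

lemma borel_family: "C1_family \<epsilon> F \<Longrightarrow> \<bar>t\<bar> < \<epsilon> \<Longrightarrow> F t \<in> borel_measurable borel"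
  by (rule borel_measurable_continuous_onI[OF family_continuous])

lemma Vol_density:
  fixes r :: "'a \<Rightarrow> real"
  assumes H: "riemannian_metric A H" and r: "r \<in> borel_measurable borel" "\<And>x. r x \<ge> 0"
    and eq: "\<And>c x. c \<in> A \<Longrightarrow> x \<in> fst c \<Longrightarrow> det (gmat A c H' x) = (r x)\<^sup>2 * det (gmat A c H x)"
    and \<Omega>: "\<Omega> \<in> sets borel"
  shows "Vol A \<Omega> H' = (\<integral>x. indicator \<Omega> x * r x \<partial>volume_measure A H)"
proof -
  let ?V = "volume_measure A H"
  have rV: "r \<in> borel_measurable ?V" using r(1) by (simp cong: measurable_cong_sets add: sets_volume_measure[OF H])
  have \<Omega>V: "\<Omega> \<in> sets ?V" using \<Omega> by (simp add: sets_volume_measure[OF H])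
  have "Vol A \<Omega> H' = measure (density ?V (\<lambda>x. ennreal (r x))) \<Omega>"
    unfolding Vol_def by (simp add: volume_measure_density[OF H r eq])
  also have "\<dots> = (\<integral>x. indicator \<Omega> x \<partial>density ?V (\<lambda>x. ennreal (r x)))"
    using \<Omega>V by simp
  also have "\<dots> = (\<integral>x. r x *\<^sub>R indicator \<Omega> x \<partial>?V)"
    by (rule integral_density) (use rV r(2) \<Omega>V in auto)
  finally show ?thesis by (simp add: mult.commute)
qed

lemma action_density:
  fixes r :: "'a \<Rightarrow> real"
  assumes H: "riemannian_metric A H" and r: "r \<in> borel_measurable borel" "\<And>x. r x \<ge> 0"
    and eq: "\<And>c x. c \<in> A \<Longrightarrow> x \<in> fst c \<Longrightarrow> det (gmat A c H' x) = (r x)\<^sup>2 * det (gmat A c H x)"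
    and \<Omega>: "\<Omega> \<in> sets borel" and m: "integrability_normsq A E H' \<in> borel_measurable borel"
  shows "action A E \<Omega> H' = (\<integral>x. indicator \<Omega> x * (r x * integrability_normsq A E H' x) \<partial>volume_measure A H)"
proof -
  let ?V = "volume_measure A H" and ?N = "integrability_normsq A E H'"
  have rV: "r \<in> borel_measurable ?V" using r(1) by (simp cong: measurable_cong_sets add: sets_volume_measure[OF H])
  have mV: "?N \<in> borel_measurable ?V" using m by (simp cong: measurable_cong_sets add: sets_volume_measure[OF H])
  have \<Omega>V: "\<Omega> \<in> sets ?V" using \<Omega> by (simp add: sets_volume_measure[OF H])
  have "action A E \<Omega> H' = (\<integral>x. indicator \<Omega> x *\<^sub>R ?N x \<partial>density ?V (\<lambda>x. ennreal (r x)))"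
    unfolding action_def set_lebesgue_integral_def by (simp add: volume_measure_density[OF H r eq])
  also have "\<dots> = (\<integral>x. r x *\<^sub>R (indicator \<Omega> x *\<^sub>R ?N x) \<partial>?V)"
    by (rule integral_density) (use rV mV r(2) \<Omega>V in auto)
  finally show ?thesis by (simp add: mult_ac)
qed

lemma det_gmat_ratio:
  assumes H: "riemannian_metric A H" and H': "riemannian_metric A H'" and c: "c \<in> A" "x \<in> fst c" and d: "d \<in> A" "x \<in> fst d"
  shows "det (gmat A c H' x) / det (gmat A c H x) = det (gmat A d H' x) / det (gmat A d H x)"
proof -
  have "det (matrix (tdiff d c x)) * det (matrix (tdiff c d x)) = 1"
    using tdiff_matrix_inverse[OF c d] by (metis det_mul det_I)
  then have "det (matrix (tdiff c d x)) \<noteq> 0" by auto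
  then show ?thesis
    unfolding gmat_transition[OF H c d] gmat_transition[OF H' c d] by (simp add: det_mul det_transpose)
qed

text \<open>The density of the volume of \<open>H'\<close> relative to that of \<open>H\<close>.
  Both Gram determinants change by the same squared Jacobian, so the preferred chart may be replaced
  by any other.\<close>

definition vdens :: "('a, 'n) two_tensor \<Rightarrow> ('a, 'n) two_tensor \<Rightarrow> 'a \<Rightarrow> real" where
  "vdens H H' x = sqrt (det (gmat A (chart_at A x) H' x) / det (gmat A (chart_at A x) H x))"

lemma vdens_eq:
  "riemannian_metric A H \<Longrightarrow> riemannian_metric A H' \<Longrightarrow> c \<in> A \<Longrightarrow> x \<in> fst c \<Longrightarrow>
    vdens H H' x = sqrt (det (gmat A c H' x) / det (gmat A c H x))"
  unfolding vdens_def by (rule arg_cong[where f = sqrt], rule det_gmat_ratio) (use chart_at in auto)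

lemma vdens_sq:
  "riemannian_metric A H \<Longrightarrow> riemannian_metric A H' \<Longrightarrow> c \<in> A \<Longrightarrow> x \<in> fst c \<Longrightarrow>
    det (gmat A c H' x) = (vdens H H' x)\<^sup>2 * det (gmat A c H x)"
proof -
  assume H: "riemannian_metric A H" "riemannian_metric A H'" and c: "c \<in> A" "x \<in> fst c"
  have pos: "det (gmat A c H x) > 0" "det (gmat A c H' x) > 0" using det_gmat_pos H c by auto
  have "(vdens H H' x)\<^sup>2 = det (gmat A c H' x) / det (gmat A c H x)"
    unfolding vdens_eq[OF H c] using pos by (intro real_sqrt_pow2 divide_nonneg_pos) auto
  then show ?thesis using pos by simp
qed

lemma vdens_pos: "riemannian_metric A H \<Longrightarrow> riemannian_metric A H' \<Longrightarrow> vdens H H' x > 0"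
  unfolding vdens_def using det_gmat_pos[OF _ chart_at] by simp

end

section \<open>The family \<open>G t\<close> in charts and the derivative of the form dual to
  \<xi>\<close>

locale contact_variation = contact_manifold A m \<phi> \<xi> \<eta> g
  for A :: "('a::{t2_space, second_countable_topology}, 'n::finite) chart set"
    and m \<phi> \<xi> \<eta> g +
  fixes \<epsilon> :: real and G :: "real \<Rightarrow> ('a, 'n) two_tensor"
  assumes variation: "metric_variation A g \<epsilon> G"
begin

abbreviation "tdom c \<equiv> {-\<epsilon><..<\<epsilon>} \<times> snd c ` fst c"
abbreviation "E \<equiv> \<lambda>x. span {\<xi> x}"

text \<open>These are maps on pairs, so that time and space derivatives are both directional
  derivatives, along \<open>(1, 0)\<close> and \<open>(0, v)\<close>, and commute by
  \<open>dd_commute\<close>.\<close>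

definition "Mt c = (\<lambda>(t, z). gmat A c (G t) (chart_inv c z))"
definition "bt c = (\<lambda>(t, z). form_vec A c (\<lambda>x. G t x (\<xi> x)) z)"
definition "Wt c = (\<lambda>(t, z). omat A c (\<lambda>x. G t x (\<xi> x)) (chart_inv c z))"

lemma eps: "\<epsilon> > 0" and G0: "G 0 = g"
  and Gt: "\<bar>t\<bar> < \<epsilon> \<Longrightarrow> riemannian_metric A (G t)"
  using variation unfolding metric_variation_def by (elim conjE; simp)+

lemma G_smooth:
  "open U \<Longrightarrow> smooth_field_on A U X \<Longrightarrow> smooth_field_on A U Y \<Longrightarrow> c \<in> A \<Longrightarrow>
    Ck k (\<lambda>(t, z). G t (chart_inv c z) (X (chart_inv c z)) (Y (chart_inv c z))) ({-\<epsilon><..<\<epsilon>} \<times> snd c ` (U \<inter> fst c))"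
  using variation unfolding metric_variation_def smooth_on_def by blast

lemma Mt_Ck:
  assumes c: "c \<in> A"
  shows "Ck k (Mt c) (tdom c)"
proof (rule Ck_matrix[OF _ open_family_domain[OF c]])
  fix i j
  show "Ck k (\<lambda>p. Mt c p $ i $ j) (tdom c)"
    using G_smooth[OF open_chart(1)[OF c] smooth_field_cvec[OF c, of "axis i 1"] smooth_field_cvec[OF c, of "axis j 1"] c, of k]
    by (simp add: Mt_def gmat_def bmat_def case_prod_beta')
qed

lemma bt_Ck:
  assumes c: "c \<in> A"
  shows "Ck k (bt c) (tdom c)"
proof (rule Ck_vec[OF _ open_family_domain[OF c]])
  fix i
  show "Ck k (\<lambda>p. bt c p $ i) (tdom c)"
    using G_smooth[OF open_chart(1)[OF c] smooth_field_on_subset[OF xi_smooth] smooth_field_cvec[OF c, of "axis i 1"] c, of k]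
    by (simp add: bt_def form_vec_def form_rep_def case_prod_beta')
qed

lemma theta_C1: "\<bar>t\<bar> < \<epsilon> \<Longrightarrow> C1_form A (\<lambda>x. G t x (\<xi> x))"
  by (rule dual_form_C1[OF Gt xi_smooth])

lemma Wt_eq:
  assumes c: "c \<in> A" and p: "p \<in> tdom c"
  shows "Wt c p $ i $ j = dd (bt c) (0, axis i 1) p $ j - dd (bt c) (0, axis j 1) p $ i"
proof -
  obtain t x where tx: "p = (t, snd c x)" "\<bar>t\<bar> < \<epsilon>" "x \<in> fst c" using p by auto
  have "dd (form_vec A c (\<lambda>x. G t x (\<xi> x))) v (snd c x) = dd (bt c) (0, v) p" for v
    using dd_eq[OF slice_has_derivative(1)[OF bt_Ck[OF c, of "Suc 0"]], of t "snd c x" v] p tx by (simp add: bt_def)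
  moreover have "Wt c p = curl (form_vec A c (\<lambda>x. G t x (\<xi> x))) (snd c x)"
    using curl_form_vec[OF theta_C1 c tx(3)] tx c by (simp add: Wt_def)
  ultimately show ?thesis by (simp add: curl_def)
qed

lemma Wt_Ck:
  assumes c: "c \<in> A"
  shows "Ck k (Wt c) (tdom c)"
proof (rule Ck_matrix[OF _ open_family_domain[OF c]])
  fix i j
  show "Ck k (\<lambda>p. Wt c p $ i $ j) (tdom c)"
    by (rule Ck_cong[OF open_family_domain[OF c] Wt_eq[OF c, symmetric]])
      (intro Ck_diff Ck_vec_nth Ck_dd bt_Ck c open_family_domain | simp)+
qed

lemma bt_inner:
  assumes "c \<in> A" "x \<in> fst c" "\<bar>t\<bar> < \<epsilon>"
  shows "bt c (t, snd c x) \<bullet> v = G t x (\<xi> x) (cvec A c x v)"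
  unfolding bt_def prod.case
  by (rule form_vec_inner[where \<beta> = "\<lambda>x. G t x (\<xi> x)", OF C1_form_linear[OF theta_C1[OF assms(3)]] assms(1,2)])

text \<open>The derivative \<open>h(\<xi>, \<cdot>)\<close> of the one-form dual to \<open>\<xi>\<close>.\<close>

definition dual_deriv :: "('a, 'n) one_form" where
  "dual_deriv x v = deriv (\<lambda>t. G t x (\<xi> x) v) 0"

lemma dual_deriv_DERIV:
  assumes c: "c \<in> A" "x \<in> fst c"
  shows "((\<lambda>t. G t x (\<xi> x) (cvec A c x v)) has_real_derivative dd (bt c) (1, 0) (0, snd c x) \<bullet> v) (at 0)"
proof -
  have "(0, snd c x) \<in> tdom c" using c eps by auto
  from slice_has_derivative(2)[OF bt_Ck[OF c(1)] this]
  have "((\<lambda>t. bt c (t, snd c x) \<bullet> v) has_vector_derivative dd (bt c) (1, 0) (0, snd c x) \<bullet> v) (at 0)"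
    by (rule bounded_linear.has_vector_derivative[OF bounded_linear_inner_left])
  then have "((\<lambda>t. bt c (t, snd c x) \<bullet> v) has_real_derivative dd (bt c) (1, 0) (0, snd c x) \<bullet> v) (at 0)"
    by (simp add: has_real_derivative_iff_has_vector_derivative)
  then show ?thesis
    by (rule has_field_derivative_transform_within_open[where S = "{-\<epsilon><..<\<epsilon>}"])
      (use eps bt_inner[OF c] in auto)
qed

lemma dual_deriv_eq:
  "c \<in> A \<Longrightarrow> x \<in> fst c \<Longrightarrow> dual_deriv x (cvec A c x v) = dd (bt c) (1, 0) (0, snd c x) \<bullet> v"
  unfolding dual_deriv_def by (rule DERIV_imp_deriv[OF dual_deriv_DERIV])

lemma dual_deriv_C1: "C1_form A dual_deriv"
  unfolding C1_form_def
proof (intro conjI allI ballI)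
  fix x
  show "linear (dual_deriv x)"
    using dual_deriv_eq[OF chart_at, of x] by (auto simp: linear_iff inner_add_right)
next
  fix c v assume c: "c \<in> A"
  have o: "open (snd c ` fst c)" using c by simp
  have "Ck (Suc 0) (\<lambda>z. dd (bt c) (1, 0) (0, z) \<bullet> v) (snd c ` fst c)"
    by (intro Ck_inner Ck_const o Ck_compose[OF Ck_dd[OF bt_Ck[OF c]]] Ck_Pair Ck_id) (use eps in auto)
  then show "Ck (Suc 0) (form_rep A c dual_deriv v) (snd c ` fst c)"
    by (rule Ck_cong[OF o, rotated]) (use c in \<open>auto simp: form_rep_def dual_deriv_eq[OF c]\<close>)
qed

text \<open>The time derivative passes through the exterior derivative by symmetry of mixed second
  derivatives.\<close>

lemma dd_Wt:
  assumes c: "c \<in> A" "x \<in> fst c"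
  shows "dd (Wt c) (1, 0) (0, snd c x) = omat A c dual_deriv x"
proof -
  let ?p = "(0, snd c x)"
  have p: "?p \<in> tdom c" using c eps by auto
  note o = open_family_domain[OF c(1), of \<epsilon>]
  have b2: "Ck (Suc k) (dd (bt c) v) (tdom c)" for k v by (rule Ck_dd[OF bt_Ck[OF c(1)]])
  have 1: "dd (Wt c) (1, 0) ?p $ i $ j = dd (dd (bt c) (1, 0)) (0, axis i 1) ?p $ j - dd (dd (bt c) (1, 0)) (0, axis j 1) ?p $ i" for i j
  proof -
    have "dd (Wt c) (1, 0) ?p $ i $ j = dd (\<lambda>p. Wt c p $ i $ j) (1, 0) ?p"
      using dd_nth[OF Ck_vec_nth[OF Wt_Ck[OF c(1)] o] p, of i j "(1, 0)"] dd_nth[OF Wt_Ck[OF c(1)] p, of i "(1, 0)"] by simp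
    also have "\<dots> = dd (\<lambda>p. dd (bt c) (0, axis i 1) p $ j - dd (bt c) (0, axis j 1) p $ i) (1, 0) ?p"
      by (rule dd_cong_open[OF o p]) (rule Wt_eq[OF c(1)])
    also have "\<dots> = dd (dd (bt c) (0, axis i 1)) (1, 0) ?p $ j - dd (dd (bt c) (0, axis j 1)) (1, 0) ?p $ i"
      by (rule dd_eq) (intro has_derivative_diff bounded_linear.has_derivative[OF bounded_linear_vec_nth] Ck_has_derivative[OF b2 p])
    finally show ?thesis
      using dd_commute[OF bt_Ck[OF c(1)] o p, of "(0, axis i 1)" "(1, 0)"]
        dd_commute[OF bt_Ck[OF c(1)] o p, of "(0, axis j 1)" "(1, 0)"] by simp
  qed
  have 2: "dd (form_rep A c dual_deriv v) u (snd c x) = dd (dd (bt c) (1, 0)) (0, u) ?p \<bullet> v" for u v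
  proof -
    have "dd (form_rep A c dual_deriv v) u (snd c x) = dd (\<lambda>z. dd (bt c) (1, 0) (0, z) \<bullet> v) u (snd c x)"
      by (rule dd_cong_open[of "snd c ` fst c"]) (use c in \<open>auto simp: form_rep_def dual_deriv_eq[OF c(1)]\<close>)
    also have "\<dots> = dd (dd (bt c) (1, 0)) (0, u) ?p \<bullet> v"
      by (rule dd_eq) (rule has_derivative_inner_left[OF slice_has_derivative(1)[OF b2 p]])
    finally show ?thesis .
  qed
  show ?thesis
    unfolding vec_eq_iff 1 by (simp add: omat_def bmat_def dform_def 2 inner_axis)
qed

end

section \<open>Volume-normalised variations orthogonal to \<open>\<xi>\<close>\<close>

lemma dd_time_const:
  fixes f :: "real \<times> 'a::euclidean_space \<Rightarrow> 'b::real_normed_vector"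
  assumes "Ck (Suc k) f T" "(t, z) \<in> T" "\<And>s. f (s, z) = a"
  shows "dd f (1, 0) (t, z) = 0"
  using slice_has_derivative(2)[OF assms(1,2)] vector_derivative_unique_at[OF _ has_vector_derivative_const]
  by (simp add: assms(3))

context smooth_manifold
begin

lemma family_deriv_eq:
  assumes F: "C1_family \<epsilon> F" and c: "c \<in> A" "x \<in> fst c" and t: "\<bar>t\<bar> < \<epsilon>"
    and f: "\<And>t x. \<bar>t\<bar> < \<epsilon> \<Longrightarrow> x \<in> fst c \<Longrightarrow> F t x = f (t, snd c x)"
  shows "deriv (\<lambda>t. F t x) t = dd f (1, 0) (t, snd c x)"
proof -
  have "deriv (\<lambda>t. F t x) t = dd (\<lambda>(t, z). F t (chart_inv c z)) (1, 0) (t, snd c x)"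
    by (rule DERIV_imp_deriv[OF family_vector_derivative[OF F c t]])
  also have "\<dots> = dd f (1, 0) (t, snd c x)"
    by (rule dd_cong_open[OF open_family_domain[OF c(1)]]) (use c t f in \<open>auto simp: abs_less_iff\<close>)
  finally show ?thesis .
qed

lemma omat_cong_open:
  assumes c: "c \<in> A" "x \<in> fst c" and O: "open O'" "x \<in> O'" "\<And>y. y \<in> O' \<Longrightarrow> \<beta> y = \<beta>' y"
  shows "omat A c \<beta> x = omat A c \<beta>' x"
proof -
  have "dd (form_rep A c \<beta> v) u (snd c x) = dd (form_rep A c \<beta>' v) u (snd c x)" for u v
    by (rule dd_cong_open[OF open_chart_image[OF c(1) O(1)]]) (use c O in \<open>auto simp: form_rep_def\<close>)
  then show ?thesis by (simp add: omat_def bmat_def dform_def vec_eq_iff)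
qed

end

locale contact_domain_variation = contact_variation A m \<phi> \<xi> \<eta> g \<epsilon> G
  for A :: "('a::{t2_space, second_countable_topology}, 'n::finite) chart set"
    and m \<phi> \<xi> \<eta> g \<epsilon> G +
  fixes \<Omega> :: "'a set"
  assumes domain: "relatively_compact_domain \<Omega>"
begin

abbreviation "\<mu> \<equiv> volume_measure A g"

lemma Omega: "\<Omega> \<in> sets borel" "\<Omega> \<subseteq> closure \<Omega>" "compact (closure \<Omega>)" "open \<Omega>" "\<Omega> \<noteq> {}"
  using domain closure_subset by (auto simp: relatively_compact_domain_def)

lemma Vol_pos:
  assumes "\<bar>t\<bar> < \<epsilon>"
  shows "Vol A \<Omega> (G t) > 0"
proof -
  note H = Gt[OF assms]
  have "emeasure (volume_measure A (G t)) \<Omega> \<le> emeasure (volume_measure A (G t)) (closure \<Omega>)"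
    by (rule emeasure_mono[OF Omega(2)]) (simp add: sets_volume_measure[OF H])
  also have "\<dots> < \<infinity>" by (rule volume_compact_finite[OF H Omega(3)])
  finally show ?thesis
    using volume_open_pos[OF H Omega(4,5)] by (simp add: Vol_def measure_def enn2real_positive_iff)
qed

lemma Vol_g_pos: "Vol A \<Omega> g > 0"
  using Vol_pos[of 0] eps by (simp add: G0)

definition "rt t x = vdens g (G t) x"

lemma rt_pos: "\<bar>t\<bar> < \<epsilon> \<Longrightarrow> rt t x > 0"
  unfolding rt_def by (rule vdens_pos[OF metric Gt])

lemma rt_eq:
  assumes "c \<in> A" "x \<in> fst c" "\<bar>t\<bar> < \<epsilon>"
  shows "rt t x = sqrt (det (Mt c (t, snd c x)) / det (gmat A c g x))"
  using vdens_eq[OF metric Gt[OF assms(3)] assms(1,2)] assms by (simp add: rt_def Mt_def)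

lemma rt_C1: "C1_family \<epsilon> rt"
proof (rule C1_familyI)
  fix c assume c: "c \<in> A"
  have d: "Ck (Suc 0) (\<lambda>(t, z). det (gmat A c g (chart_inv c z))) (tdom c)"
    by (rule Ck_snd[OF Ck_det[OF gmat_Ck[OF metric c]]]) (use c in auto)
  have p0: "det (Mt c p) > 0" "(\<lambda>(t, z). det (gmat A c g (chart_inv c z))) p > 0" if p: "p \<in> tdom c" for p
    using p det_gmat_pos[OF Gt c] det_gmat_pos[OF metric c] c by (auto simp: Mt_def abs_less_iff)
  show "Ck (Suc 0) (\<lambda>p. sqrt (det (Mt c p) / (\<lambda>(t, z). det (gmat A c g (chart_inv c z))) p)) (tdom c)"
    by (rule Ck_sqrt[OF Ck_divide[OF Ck_det[OF Ck_matrix_nth[OF Mt_Ck[OF c]]] d]])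
      (use p0 open_family_domain[OF c] in \<open>fastforce\<close>)+
next
  fix c t x assume "c \<in> A" "\<bar>t\<bar> < \<epsilon>" "x \<in> fst c"
  then show "rt t x = sqrt (det (Mt c (t, snd c x)) / (\<lambda>(t, z). det (gmat A c g (chart_inv c z))) (t, snd c x))"
    using rt_eq[of c x t] by simp
qed

lemma rt_0: "rt 0 x = 1"
proof -
  have "Mt (chart_at A x) (0, snd (chart_at A x) x) = gmat A (chart_at A x) g x"
    using chart_at by (simp add: Mt_def G0)
  then show ?thesis using rt_eq[OF chart_at, of 0 x] eps det_gmat_pos[OF metric chart_at, of x] by simp
qed

text \<open>Jacobi's formula under the square root, at a time when the ratio is 1: half the metric
  trace of the velocity of the metric.\<close>

lemma rt_deriv:
  assumes c: "c \<in> A" "x \<in> fst c"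
  shows "deriv (\<lambda>t. rt t x) 0 = trace (matrix_inv (gmat A c g x) ** dd (Mt c) (1, 0) (0, snd c x)) / 2"
proof (rule DERIV_imp_deriv)
  let ?p = "(0, snd c x)" and ?d = "det (gmat A c g x)"
  have p: "?p \<in> tdom c" using c eps by auto
  have M0: "Mt c ?p = gmat A c g x" using c by (simp add: Mt_def G0)
  have d: "?d > 0" by (rule det_gmat_pos[OF metric c])
  have "((\<lambda>t. det (Mt c (t, snd c x))) has_vector_derivative dd (\<lambda>p. det (Mt c p)) (1, 0) ?p) (at 0)"
    by (rule slice_has_derivative(2)[OF Ck_det[OF Ck_matrix_nth[OF Mt_Ck[OF c(1)]]] p])
      (use open_family_domain[OF c(1)] in auto)
  then have 1: "((\<lambda>t. det (Mt c (t, snd c x))) has_real_derivative ?d * trace (matrix_inv (gmat A c g x) ** dd (Mt c) (1, 0) ?p)) (at 0)"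
    using dd_det[OF Mt_Ck[OF c(1), of "Suc 0"] p, of "(1, 0)"] d
    by (simp add: M0 has_real_derivative_iff_has_vector_derivative)
  have "((\<lambda>t. sqrt (det (Mt c (t, snd c x)) / ?d)) has_real_derivative
      trace (matrix_inv (gmat A c g x) ** dd (Mt c) (1, 0) ?p) / 2) (at 0)"
    by (rule DERIV_cong[OF DERIV_chain2[OF DERIV_real_sqrt DERIV_cdivide[OF 1]]]) (use d in \<open>simp_all add: M0\<close>)
  then show "((\<lambda>t. rt t x) has_real_derivative
      trace (matrix_inv (gmat A c g x) ** dd (Mt c) (1, 0) ?p) / 2) (at 0)"
    by (rule has_field_derivative_transform_within_open[where S = "{-\<epsilon><..<\<epsilon>}"])
      (use eps rt_eq[OF c] in \<open>auto simp: abs_less_iff\<close>)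
qed

lemma Vol_eq: "\<bar>t\<bar> < \<epsilon> \<Longrightarrow> Vol A \<Omega> (G t) = (\<integral>x. indicator \<Omega> x * rt t x \<partial>\<mu>)"
proof (rule Vol_density[OF metric borel_family[OF rt_C1]])
  assume t: "\<bar>t\<bar> < \<epsilon>"
  show "0 \<le> rt t x" for x by (rule less_imp_le[OF rt_pos[OF t]])
  show "c \<in> A \<Longrightarrow> x \<in> fst c \<Longrightarrow> det (gmat A c (G t) x) = (rt t x)\<^sup>2 * det (gmat A c g x)" for c x
    unfolding rt_def by (rule vdens_sq[OF metric Gt[OF t]])
qed (auto simp: Omega)

definition "vt t = Vol A \<Omega> (G t) / Vol A \<Omega> g"

lemma vt_pos: "\<bar>t\<bar> < \<epsilon> \<Longrightarrow> vt t > 0"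
  unfolding vt_def using Vol_pos Vol_g_pos by simp

lemma vt_0: "vt 0 = 1"
  using Vol_g_pos by (simp add: vt_def G0)

lemma vt_DERIV:
  "(vt has_real_derivative (\<integral>x. indicator \<Omega> x * deriv (\<lambda>t. rt t x) 0 \<partial>\<mu>) / Vol A \<Omega> g) (at 0)"
proof -
  have "((\<lambda>t. (\<integral>x. indicator \<Omega> x * rt t x \<partial>\<mu>) / Vol A \<Omega> g) has_real_derivative
      (\<integral>x. indicator \<Omega> x * deriv (\<lambda>t. rt t x) 0 \<partial>\<mu>) / Vol A \<Omega> g) (at 0)"
    by (rule DERIV_cdivide[OF family_leibniz[OF rt_C1 eps metric Omega(3,1,2)]])
  then show ?thesis
    by (rule has_field_derivative_transform_within_open[where S = "{-\<epsilon><..<\<epsilon>}"])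
      (use eps Vol_eq in \<open>auto simp: vt_def abs_less_iff\<close>)
qed

lemma Vol_g_eq: "Vol A \<Omega> g = (\<integral>x. indicator \<Omega> x \<partial>\<mu>)"
  using Vol_eq[of 0] eps by (simp add: G0 rt_0)

lemma normsq_g: "integrability_normsq A E g x = 2 * real m"
proof -
  let ?c = "chart_at A x"
  have e: "(\<lambda>y. g y (\<xi> y)) = \<eta>" by (intro ext) (simp add: eta_eq)
  show ?thesis
    unfolding integrability_normsq_eq[OF metric xi_smooth xi_nonzero chart_at] e omat_eta[OF chart_at]
    using contact_matrices.normsq_coord_contact[OF contact_matrices[OF chart_at]] card by simp
qed

end

section \<open>First variation for metrics that keep \<xi> a unit vector\<close>

locale contact_perp_variation = contact_domain_variation A m \<phi> \<xi> \<eta> g \<epsilon> G \<Omega>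
  for A :: "('a::{t2_space, second_countable_topology}, 'n::finite) chart set"
    and m \<phi> \<xi> \<eta> g \<epsilon> G \<Omega> +
  assumes unit: "\<bar>t\<bar> < \<epsilon> \<Longrightarrow> G t x (\<xi> x) (\<xi> x) = 1" and supported: "supported_in g \<epsilon> G \<Omega>"
begin

definition "xt c = (\<lambda>(t::real, z). local_rep A c \<xi> z)"
definition "Pt c p = matrix_inv (Mt c p) - outer (xt c p) (xt c p)"
text \<open>This is \<open>normsq_coord\<close> with the squared length of \<xi> in its denominator
  equal to 1 at all times.\<close>

definition "ft c p = - (1/4) * trace (Pt c p ** Wt c p ** Pt c p ** Wt c p)"
definition "Ft t x = integrability_normsq A E (G t) x"

lemma xt_Ck: "c \<in> A \<Longrightarrow> Ck k (xt c) (tdom c)"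
  unfolding xt_def using smooth_fieldD[OF xi_smooth, of c k] by (intro Ck_snd) auto

lemma det_Mt: "c \<in> A \<Longrightarrow> p \<in> tdom c \<Longrightarrow> det (Mt c p) \<noteq> 0"
proof -
  assume c: "c \<in> A" and "p \<in> tdom c"
  then obtain t x where p: "p = (t, snd c x)" "x \<in> fst c" "\<bar>t\<bar> < \<epsilon>" by (auto simp: abs_less_iff)
  show ?thesis using det_gmat_pos[OF Gt[OF p(3)] c p(2)] p c by (simp add: Mt_def)
qed

lemma Pt_Ck: "c \<in> A \<Longrightarrow> Ck k (Pt c) (tdom c)"
  unfolding Pt_def[abs_def]
  by (intro Ck_diff Ck_matrix_inv Ck_outer xt_Ck Mt_Ck open_family_domain det_Mt)

lemma ft_Ck: "c \<in> A \<Longrightarrow> Ck k (ft c) (tdom c)"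
  unfolding ft_def[abs_def]
  by (intro Ck_mult Ck_const Ck_trace Ck_matrix_mult Pt_Ck Wt_Ck open_family_domain)

lemma Ft_eq:
  assumes c: "c \<in> A" "x \<in> fst c" and t: "\<bar>t\<bar> < \<epsilon>"
  shows "Ft t x = ft c (t, snd c x)"
proof -
  let ?w = "components A c x (\<xi> x)"
  have w: "?w \<bullet> (gmat A c (G t) x *v ?w) = 1"
    using gmat_components[OF Gt[OF t] c, of "\<xi> x" "\<xi> x"] unit[OF t] by simp
  have "Ft t x = normsq_coord (gmat A c (G t) x) (omat A c (\<lambda>y. G t y (\<xi> y)) x) ?w"
    unfolding Ft_def by (rule integrability_normsq_eq[OF Gt[OF t] xi_smooth xi_nonzero c])
  then show ?thesis
    using c by (simp add: normsq_coord_def inv_perp_def w ft_def Pt_def Mt_def Wt_def xt_def local_rep_def)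
qed

lemma Ft_C1: "C1_family \<epsilon> Ft"
  by (rule C1_familyI[OF ft_Ck]) (auto intro: Ft_eq)

lemma Ft_0: "Ft 0 x = 2 * real m"
  by (simp add: Ft_def G0 normsq_g)

lemma Ft_deriv:
  assumes c: "c \<in> A" "x \<in> fst c"
  shows "deriv (\<lambda>t. Ft t x) 0
    = dtrace c dual_deriv x - 2 * trace (matrix_inv (gmat A c g x) ** dd (Mt c) (1, 0) (0, snd c x))"
proof -
  let ?p = "(0, snd c x)" and ?v = "(1, 0)"
  interpret cm: contact_matrices "gmat A c g x" "endo_mat A c \<phi> x" "components A c x (\<xi> x)" "form_vec A c \<eta> (snd c x)"
    by (rule contact_matrices[OF c])
  note o = open_family_domain[OF c(1), of \<epsilon>]
  have p: "?p \<in> tdom c" using c eps by auto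
  define h where "h = dd (Mt c) ?v ?p"
  have e: "(\<lambda>y. g y (\<xi> y)) = \<eta>" by (intro ext) (simp add: eta_eq)
  have M0: "Mt c ?p = gmat A c g x" using c by (simp add: Mt_def G0)
  have W0: "Wt c ?p = 2 *\<^sub>R (gmat A c g x ** endo_mat A c \<phi> x)" using c omat_eta[OF c] by (simp add: Wt_def G0 e)
  have x0: "xt c ?p = components A c x (\<xi> x)" using c by (simp add: xt_def local_rep_def)
  have xt0: "dd (\<lambda>p. outer (xt c p) (xt c p)) ?v ?p = 0"
    by (rule dd_time_const[OF Ck_outer[OF xt_Ck xt_Ck o] p]) (use c in \<open>auto simp: xt_def\<close>)
  have P': "dd (Pt c) ?v ?p = - (matrix_inv (gmat A c g x) ** h ** matrix_inv (gmat A c g x))"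
  proof -
    have "dd (Pt c) ?v ?p = dd (\<lambda>p. matrix_inv (Mt c p)) ?v ?p - dd (\<lambda>p. outer (xt c p) (xt c p)) ?v ?p"
      unfolding Pt_def[abs_def]
      by (rule dd_eq, rule has_derivative_diff; rule Ck_has_derivative[OF _ p])
        (intro Ck_matrix_inv[OF Mt_Ck[OF c(1)] o det_Mt[OF c(1)]] Ck_outer xt_Ck c o | assumption)+
    then show ?thesis
      using dd_matrix_inv[OF Mt_Ck[OF c(1), of "Suc 0"] o p det_Mt[OF c(1)], of ?v] by (simp add: xt0 M0 h_def)
  qed
  have W': "dd (Wt c) ?v ?p = omat A c dual_deriv x" by (rule dd_Wt[OF c])
  \<comment> \<open>The squared length of \<xi> is constantly 1 along the family, so the velocity of
    the metric vanishes on (\<xi>, \<xi>).\<close>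
  have h0: "components A c x (\<xi> x) \<bullet> (h *v components A c x (\<xi> x)) = 0"
  proof -
    let ?w = "components A c x (\<xi> x)"
    have "((\<lambda>t. Mt c (t, snd c x)) has_vector_derivative h) (at 0)"
      unfolding h_def by (rule slice_has_derivative(2)[OF Mt_Ck[OF c(1)] p])
    then have "((\<lambda>t. ?w \<bullet> (Mt c (t, snd c x) *v ?w)) has_vector_derivative ?w \<bullet> (h *v ?w)) (at 0)"
      by (rule bounded_linear.has_vector_derivative[OF bounded_linear_compose[OF bounded_linear_inner_right
              bounded_bilinear.bounded_linear_left[OF bounded_bilinear_matrix_vector]], rotated])
    then have d: "((\<lambda>t. ?w \<bullet> (Mt c (t, snd c x) *v ?w)) has_real_derivative ?w \<bullet> (h *v ?w)) (at 0)"
      by (simp add: has_real_derivative_iff_has_vector_derivative)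
    have "?w \<bullet> (Mt c (t, snd c x) *v ?w) = 1" if "t \<in> {-\<epsilon><..<\<epsilon>}" for t
      using gmat_components[OF Gt c, of t "\<xi> x" "\<xi> x"] unit[of t x] that c by (auto simp: Mt_def abs_less_iff)
    then have "((\<lambda>t. 1) has_real_derivative ?w \<bullet> (h *v ?w)) (at 0)"
      by (intro has_field_derivative_transform_within_open[OF d, where S = "{-\<epsilon><..<\<epsilon>}"]) (use eps in auto)
    then show ?thesis using DERIV_unique[OF _ DERIV_const] by blast
  qed
  let ?P = "Pt c ?p" and ?W = "Wt c ?p"
  \<comment> \<open>Of the four terms of the product rule, cyclicity of the trace identifies the two
    that vary \<open>Pt\<close> and the two that vary \<open>Wt\<close>.\<close>
  have dT: "dd (\<lambda>p. trace (Pt c p ** Wt c p ** Pt c p ** Wt c p)) ?v ?p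
    = 2 * (trace (dd (Pt c) ?v ?p ** ?W ** ?P ** ?W) + trace (?P ** dd (Wt c) ?v ?p ** ?P ** ?W))"
  proof -
    note P = Pt_Ck[OF c(1), of "Suc 0"] and W = Wt_Ck[OF c(1), of "Suc 0"]
    note PW = Ck_matrix_mult[OF P W o] and m = dd_bilinear[OF bounded_bilinear_matrix_mult]
    note PWP = Ck_matrix_mult[OF PW P o]
    have "dd (\<lambda>p. trace (Pt c p ** Wt c p ** Pt c p ** Wt c p)) ?v ?p
      = trace (dd (\<lambda>p. Pt c p ** Wt c p ** Pt c p ** Wt c p) ?v ?p)"
      by (rule dd_linear[OF bounded_linear_trace Ck_matrix_mult[OF PWP W o] p])
    also have "\<dots> = trace (?P ** ?W ** ?P ** dd (Wt c) ?v ?p) + trace (?P ** ?W ** dd (Pt c) ?v ?p ** ?W)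
       + trace (?P ** dd (Wt c) ?v ?p ** ?P ** ?W) + trace (dd (Pt c) ?v ?p ** ?W ** ?P ** ?W)"
      unfolding m[OF PWP W p] m[OF PW P p] m[OF P W p] by (simp add: matrix_add_rdistrib trace_add)
    also have "trace (?P ** ?W ** ?P ** dd (Wt c) ?v ?p) = trace (?P ** dd (Wt c) ?v ?p ** ?P ** ?W)"
      using trace_mul_sym[of "?P ** ?W" "?P ** dd (Wt c) ?v ?p"] by (simp add: matrix_mul_assoc)
    also have "trace (?P ** ?W ** dd (Pt c) ?v ?p ** ?W) = trace (dd (Pt c) ?v ?p ** ?W ** ?P ** ?W)"
      using trace_mul_sym[of "?P ** ?W" "dd (Pt c) ?v ?p ** ?W"] by (simp add: matrix_mul_assoc)
    finally show ?thesis by simp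
  qed
  have "deriv (\<lambda>t. Ft t x) 0 = dd (ft c) ?v ?p"
    by (rule family_deriv_eq[OF Ft_C1 c]) (use eps Ft_eq c in auto)
  also have "\<dots> = - (1/4) * dd (\<lambda>p. trace (Pt c p ** Wt c p ** Pt c p ** Wt c p)) ?v ?p"
    unfolding ft_def[abs_def]
    by (rule dd_linear[where k = 0, OF bounded_linear_mult_right _ p])
      (intro Ck_trace Ck_matrix_mult Pt_Ck Wt_Ck c o)
  also have "\<dots> = dtrace c dual_deriv x - 2 * trace (matrix_inv (gmat A c g x) ** h)"
    unfolding dT P' W' using cm.trace_first_variation(1)[OF h0] cm.trace_first_variation(2)[OF h0, of "omat A c dual_deriv x"]
    by (simp add: Pt_def M0 x0 W0 dtrace_def field_simps)
  finally show ?thesis by (simp add: h_def)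
qed

text \<open>\<open>Ft_deriv\<close> contains -2 times the metric trace of the velocity, and four
  times \<open>rt_deriv\<close> contains +2 times the same trace.\<close>

lemma first_variation: "deriv (\<lambda>t. Ft t x) 0 + 4 * deriv (\<lambda>t. rt t x) 0 = dtr dual_deriv x"
  using Ft_deriv[OF chart_at, of x] rt_deriv[OF chart_at, of x] by (simp add: dtr_def)

text \<open>The support condition provides a neighbourhood rather than just the point, as needed for
  the squared norm, which involves first derivatives of the metric. The neighbourhood may depend on
  \<open>t\<close>.\<close>

lemma G_outside:
  assumes "x \<notin> \<Omega>" "\<bar>t\<bar> < \<epsilon>"
  shows "\<exists>N. open N \<and> x \<in> N \<and> (\<forall>y\<in>N. G t y = g y)"
proof (intro exI[of _ "- closure {y. G t y \<noteq> g y}"] conjI ballI)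
  show "x \<in> - closure {y. G t y \<noteq> g y}" using supported assms by (auto simp: supported_in_def)
  fix y assume "y \<in> - closure {y. G t y \<noteq> g y}"
  then show "G t y = g y" using closure_subset[of "{y. G t y \<noteq> g y}"] by blast
qed (rule open_Compl[OF closed_closure])

lemma deriv_eventually_const:
  fixes f :: "real \<Rightarrow> real"
  assumes "\<And>t. \<bar>t\<bar> < \<epsilon> \<Longrightarrow> f t = a"
  shows "deriv f 0 = 0"
  by (rule DERIV_imp_deriv, rule has_field_derivative_transform_within_open[OF DERIV_const[of a], where S = "{-\<epsilon><..<\<epsilon>}"])
    (use eps assms in \<open>auto simp: abs_less_iff\<close>)

text \<open>At a boundary point of \<Omega> the neighbourhoods on which \<open>G t\<close> is
  unchanged may shrink with \<open>t\<close>, so they give no common one on which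
  \<open>dual_deriv\<close> vanishes. The second claim is instead read off from
  \<open>first_variation\<close>: at the point itself the squared norm and the density are constant
  in time.\<close>

lemma outside:
  assumes x: "x \<notin> \<Omega>"
  shows "dual_deriv x v = 0" "dtr dual_deriv x = 0"
proof -
  have Gx: "G t x = g x" if "\<bar>t\<bar> < \<epsilon>" for t using G_outside[OF x that] by blast
  show "dual_deriv x v = 0"
    unfolding dual_deriv_def by (rule deriv_eventually_const[of _ "g x (\<xi> x) v"]) (simp add: Gx)
  have "Ft t x = integrability_normsq A E g x" if t: "\<bar>t\<bar> < \<epsilon>" for t
  proof -
    let ?c = "chart_at A x"
    obtain N where N: "open N" "x \<in> N" "\<forall>y\<in>N. G t y = g y" using G_outside[OF x t] by blast
    have "omat A ?c (\<lambda>y. G t y (\<xi> y)) x = omat A ?c (\<lambda>y. g y (\<xi> y)) x"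
      by (rule omat_cong_open[OF chart_at N(1,2)]) (use N(3) in simp)
    moreover have "gmat A ?c (G t) x = gmat A ?c g x" using Gx[OF t] by (simp add: gmat_def)
    ultimately show ?thesis
      unfolding Ft_def integrability_normsq_eq[OF Gt[OF t] xi_smooth xi_nonzero chart_at]
        integrability_normsq_eq[OF metric xi_smooth xi_nonzero chart_at] by simp
  qed
  then have "deriv (\<lambda>t. Ft t x) 0 = 0" by (rule deriv_eventually_const)
  moreover have "rt t x = vdens g g x" if t: "\<bar>t\<bar> < \<epsilon>" for t
    by (simp add: rt_def vdens_def gmat_def Gx[OF t])
  then have "deriv (\<lambda>t. rt t x) 0 = 0" by (rule deriv_eventually_const)
  ultimately show "dtr dual_deriv x = 0" using first_variation[of x] by simp
qed

lemma dual_deriv_xi: "dual_deriv x (\<xi> x) = 0"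
  unfolding dual_deriv_def by (rule deriv_eventually_const[of _ 1]) (simp add: unit)

lemma integral_first_variation: "(\<integral>x. indicator \<Omega> x * dtr dual_deriv x \<partial>\<mu>) = 0"
proof -
  have "(\<lambda>x. indicator \<Omega> x * dtr dual_deriv x) = dtr dual_deriv"
    by (rule ext) (use outside(2) in \<open>auto split: split_indicator\<close>)
  moreover have "(\<integral>x. dtr dual_deriv x \<partial>\<mu>) = 0"
  proof (rule integral_dtr[OF dual_deriv_C1 dual_deriv_xi Omega(3)])
    fix y v assume "y \<notin> closure \<Omega>"
    then show "dual_deriv y v = 0" using outside(1)[of y v] Omega(2) by blast
  qed
  ultimately show ?thesis by simp
qed

text \<open>The complement has rank 2m and is scaled by s = v^(-1/m). The volume density changes by
  s^m = 1/v and the squared norm by 1/s^2 = v^(2/m).\<close>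

lemma action_bar_perp:
  assumes t: "\<bar>t\<bar> < \<epsilon>" and m: "m \<ge> 1"
  shows "action A E \<Omega> (bar_perp A E (2 * m) \<Omega> g G t)
    = vt t powr (2 / real m - 1) * (\<integral>x. indicator \<Omega> x * (rt t x * Ft t x) \<partial>\<mu>)"
proof -
  define s where "s = vt t powr (- 2 / real (2 * m))"
  have v: "vt t > 0" by (rule vt_pos[OF t])
  have s: "s > 0" using v by (simp add: s_def)
  have one: "smooth_function_on A UNIV (\<lambda>x::'a. 1)" by (rule smooth_function_const)
  interpret r: rescaled_metric A "G t" \<xi> s "\<lambda>x. 1"
    by unfold_locales (use Gt[OF t] xi_smooth unit[OF t] s one in auto)
  let ?H = "bar_perp A E (2 * m) \<Omega> g G t"
  have bar: "?H = r.H"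
  proof (intro ext)
    fix x u w
    have tg: "tang E (G t) x u = G t x (\<xi> x) u *\<^sub>R \<xi> x" for u
      using r.Gx.tang_eq[where H = "G t" and x = x and \<xi> = \<xi>, OF refl xi_nonzero] unit[OF t] by simp
    have "g x (\<xi> x) (\<xi> x) = 1" using eta_xi[of x] by (simp add: eta_eq)
    moreover have "(Vol A \<Omega> (G t) / Vol A \<Omega> g) powr (- 2 / real (2 * m)) = s" by (simp add: s_def vt_def)
    ultimately show "?H x u w = r.H x u w"
      unfolding bar_perp_def norl_def tg
      using r.Gx.sym[of x u "\<xi> x"] by (simp only:) (simp add: r.H_def r.Gx.simps gx.simps unit[OF t])
  qed
  \<comment> \<open>The determinant factor is the square of the density factor 1/v.\<close>
  have sp: "s ^ (CARD('n) - 1) = (1 / vt t)\<^sup>2"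
  proof -
    have "s ^ (CARD('n) - 1) = s powr real (2 * m)" using powr_realpow[OF s, of "2 * m"] card by simp
    also have "\<dots> = vt t powr (- 2)" using m by (simp add: s_def powr_powr)
    also have "\<dots> = (1 / vt t)\<^sup>2" using v by (simp add: powr_minus power_one_over inverse_eq_divide)
    finally show ?thesis .
  qed
  have rtm: "rt t \<in> borel_measurable borel" by (rule borel_family[OF rt_C1 t])
  have N: "integrability_normsq A E ?H x = (1 / s\<^sup>2) * Ft t x" for x
    using r.normsq_H[OF chart_at, of x] by (simp add: bar Ft_def)
  have "action A E \<Omega> ?H = (\<integral>x. indicator \<Omega> x * (rt t x / vt t * integrability_normsq A E ?H x) \<partial>\<mu>)"
  proof (rule action_density[OF metric])
    show "(\<lambda>x. rt t x / vt t) \<in> borel_measurable borel" using rtm by simp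
    show "0 \<le> rt t x / vt t" for x using rt_pos[OF t, of x] v by simp
    show "det (gmat A c ?H x) = (rt t x / vt t)\<^sup>2 * det (gmat A c g x)" if c: "c \<in> A" "x \<in> fst c" for c x
      unfolding bar r.det_H[OF c] sp using vdens_sq[OF metric Gt[OF t] c] by (simp add: rt_def power_divide)
    show "integrability_normsq A E ?H \<in> borel_measurable borel"
      unfolding N[abs_def] using borel_family[OF Ft_C1 t] by simp
  qed (rule Omega)
  also have "\<dots> = (\<integral>x. (1 / (vt t * s\<^sup>2)) * (indicator \<Omega> x * (rt t x * Ft t x)) \<partial>\<mu>)"
    unfolding N by (simp add: mult_ac)
  also have "\<dots> = (1 / (vt t * s\<^sup>2)) * (\<integral>x. indicator \<Omega> x * (rt t x * Ft t x) \<partial>\<mu>)" by simp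
  also have "1 / (vt t * s\<^sup>2) = vt t powr (2 / real m - 1)"
  proof -
    have "s\<^sup>2 = s powr 2" using s by simp
    also have "\<dots> = vt t powr (- 2 / real m)" unfolding s_def powr_powr by simp
    finally have "s\<^sup>2 = vt t powr (- 2 / real m)" .
    then have "1 / s\<^sup>2 = vt t powr (2 / real m)" by (simp add: powr_minus_divide)
    then have "1 / (vt t * s\<^sup>2) = vt t powr (2 / real m) / vt t"
      by (metis divide_divide_eq_left mult.commute)
    then show ?thesis using v by (simp add: powr_diff)
  qed
  finally show ?thesis .
qed

lemma critical_perp:
  assumes m: "m \<ge> 1"
  shows "((\<lambda>t. action A E \<Omega> (bar_perp A E (2 * m) \<Omega> g G t)) has_real_derivative 0) (at 0)"
proof -
  let ?I = "\<lambda>f. \<integral>x. indicator \<Omega> x * f x \<partial>\<mu>"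
  define r' F' where "r' x = deriv (\<lambda>t. rt t x) 0" and "F' x = deriv (\<lambda>t. Ft t x) 0" for x
  have K: "((\<lambda>t. ?I (\<lambda>x. rt t x * Ft t x)) has_real_derivative ?I (\<lambda>x. deriv (\<lambda>t. rt t x * Ft t x) 0)) (at 0)"
    by (rule family_leibniz[OF C1_family_mult[OF rt_C1 Ft_C1] eps metric Omega(3,1,2)])
  have d: "deriv (\<lambda>t. rt t x * Ft t x) 0 = 2 * real m * r' x + F' x" for x
    using DERIV_mult[OF family_has_derivative[OF rt_C1, of 0 x] family_has_derivative[OF Ft_C1, of 0 x]] eps
    by (intro DERIV_imp_deriv) (simp add: r'_def F'_def rt_0 Ft_0 mult.commute)
  have int: "integrable \<mu> (\<lambda>x. indicator \<Omega> x * r' x)" "integrable \<mu> (\<lambda>x. indicator \<Omega> x * F' x)"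
    unfolding r'_def F'_def using family_integrable(2)[OF rt_C1 _ metric Omega(3,1,2), of 0]
      family_integrable(2)[OF Ft_C1 _ metric Omega(3,1,2), of 0] eps by auto
  have "?I (\<lambda>x. 2 * real m * r' x + F' x) = (\<integral>x. 2 * real m * (indicator \<Omega> x * r' x) + indicator \<Omega> x * F' x \<partial>\<mu>)"
    by (simp add: algebra_simps)
  also have "\<dots> = 2 * real m * ?I r' + ?I F'" using int by simp
  finally have K': "?I (\<lambda>x. deriv (\<lambda>t. rt t x * Ft t x) 0) = 2 * real m * ?I r' + ?I F'" by (simp add: d)
  have "0 = (\<integral>x. indicator \<Omega> x * F' x + 4 * (indicator \<Omega> x * r' x) \<partial>\<mu>)"
    using integral_first_variation by (simp add: first_variation[symmetric] r'_def F'_def algebra_simps)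
  also have "\<dots> = ?I F' + 4 * ?I r'" using int by simp
  finally have z: "?I F' + 4 * ?I r' = 0" by simp
  have K0: "?I (\<lambda>x. rt 0 x * Ft 0 x) = 2 * real m * Vol A \<Omega> g"
    by (simp add: rt_0 Ft_0 Vol_g_eq mult.commute)
  have V: "((\<lambda>t. vt t powr (2 / real m - 1)) has_real_derivative (2 / real m - 1) * (?I r' / Vol A \<Omega> g)) (at 0)"
    using DERIV_fun_powr[OF vt_DERIV, of "2 / real m - 1"] by (simp add: vt_0 r'_def)
  have "((\<lambda>t. vt t powr (2 / real m - 1) * ?I (\<lambda>x. rt t x * Ft t x)) has_real_derivative 0) (at 0)"
  proof (rule DERIV_cong[OF DERIV_mult[OF V K]])
    \<comment> \<open>Half of the balance: the weight contributes 4 - 2m times the integral of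
      \<open>r'\<close>, and the product rule 2m times the same integral plus that of
      \<open>F'\<close>; the sum is the vanishing integral \<open>z\<close>.\<close>
    have "(2 / real m - 1) * (?I r' / Vol A \<Omega> g) * (2 * real m * Vol A \<Omega> g) = (4 - 2 * real m) * ?I r'"
      using Vol_g_pos m by (simp add: field_simps)
    then show "(2 / real m - 1) * (?I r' / Vol A \<Omega> g) * ?I (\<lambda>x. rt 0 x * Ft 0 x)
      + ?I (\<lambda>x. deriv (\<lambda>t. rt t x * Ft t x) 0) * vt 0 powr (2 / real m - 1) = 0"
      unfolding K0 K' using z by (simp add: vt_0 algebra_simps)
  qed
  then show ?thesis
    by (rule has_field_derivative_transform_within_open[where S = "{-\<epsilon><..<\<epsilon>}"])
      (use eps action_bar_perp[OF _ m] in \<open>auto simp: abs_less_iff\<close>)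
qed

end

section \<open>Volume-normalised variations along \<open>\<xi>\<close>\<close>

locale contact_top_variation = contact_domain_variation A m \<phi> \<xi> \<eta> g \<epsilon> G \<Omega>
  for A :: "('a::{t2_space, second_countable_topology}, 'n::finite) chart set"
    and m \<phi> \<xi> \<eta> g \<epsilon> G \<Omega> +
  assumes fixed: "\<bar>t\<bar> < \<epsilon> \<Longrightarrow> g x (\<xi> x) u = 0 \<Longrightarrow> g x (\<xi> x) v = 0 \<Longrightarrow> G t x u v = g x u v"
    and orthogonal: "\<bar>t\<bar> < \<epsilon> \<Longrightarrow> g x (\<xi> x) v = 0 \<Longrightarrow> G t x (\<xi> x) v = 0"
begin

definition "ut t x = G t x (\<xi> x) (\<xi> x)"

lemma unit: "g x (\<xi> x) (\<xi> x) = 1"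
  using eta_xi[of x] by (simp add: eta_eq)

lemma ut_pos: "\<bar>t\<bar> < \<epsilon> \<Longrightarrow> ut t x > 0"
  unfolding ut_def by (rule inner_form.pos[OF inner_form_metric[OF Gt] xi_nonzero])

lemma ut_0: "ut 0 x = 1"
  by (simp add: ut_def G0 unit)

lemma ut_smooth: "\<bar>t\<bar> < \<epsilon> \<Longrightarrow> smooth_function_on A UNIV (ut t)"
  unfolding ut_def[abs_def] by (rule metric_smooth[OF Gt open_UNIV xi_smooth xi_smooth])

lemma ut_C1: "C1_family \<epsilon> ut"
  unfolding C1_family_def ut_def using G_smooth[OF open_UNIV xi_smooth xi_smooth, of _ "Suc 0"]
  by (simp del: Ck.simps)

text \<open>Splitting both vectors along \<xi> and its fixed complement shows that the function
  \<open>ut\<close> is the only freedom of such a variation.\<close>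

lemma G_decompose:
  assumes t: "\<bar>t\<bar> < \<epsilon>"
  shows "G t x u v = (g x u v - g x (\<xi> x) u * g x (\<xi> x) v) + ut t x * (g x (\<xi> x) u * g x (\<xi> x) v)"
proof -
  interpret h: inner_form "G t x" by (rule inner_form_metric[OF Gt[OF t]])
  define a b where "a = g x (\<xi> x) u" and "b = g x (\<xi> x) v"
  define u' v' where "u' = u - a *\<^sub>R \<xi> x" and "v' = v - b *\<^sub>R \<xi> x"
  have 0: "g x (\<xi> x) u' = 0" "g x (\<xi> x) v' = 0"
    by (simp_all add: u'_def v'_def a_def b_def gx.simps unit)
  have "G t x u v = G t x (u' + a *\<^sub>R \<xi> x) (v' + b *\<^sub>R \<xi> x)" by (simp add: u'_def v'_def)
  also have "\<dots> = G t x u' v' + ut t x * (a * b)"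
    using orthogonal[OF t 0(1)] orthogonal[OF t 0(2)] h.sym[of u' "\<xi> x"] by (simp add: h.simps ut_def)
  also have "G t x u' v' = g x u' v'" by (rule fixed[OF t 0])
  also have "\<dots> = g x u v - a * b"
    using gx.sym[of x u "\<xi> x"] by (simp add: u'_def v'_def gx.simps unit a_def[symmetric] b_def[symmetric])
  finally show ?thesis by (simp add: a_def b_def)
qed

lemma rt_sqrt:
  assumes t: "\<bar>t\<bar> < \<epsilon>"
  shows "rt t x = sqrt (ut t x)"
proof -
  interpret r: rescaled_metric A g \<xi> 1 "ut t"
    by unfold_locales (use metric xi_smooth unit ut_smooth[OF t] ut_pos[OF t] in auto)
  have "G t = r.H" by (intro ext) (simp add: G_decompose[OF t] r.H_def)
  then show ?thesis
    using r.det_H[OF chart_at, of x] det_gmat_pos[OF metric chart_at, of x] by (simp add: rt_def vdens_def)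
qed

lemma rt_deriv_ut: "deriv (\<lambda>t. rt t x) 0 = deriv (\<lambda>t. ut t x) 0 / 2"
proof (rule DERIV_imp_deriv)
  have "((\<lambda>t. sqrt (ut t x)) has_real_derivative deriv (\<lambda>t. ut t x) 0 / 2) (at 0)"
    by (rule DERIV_cong[OF DERIV_chain2[OF DERIV_real_sqrt family_has_derivative[OF ut_C1]]])
      (use eps in \<open>simp_all add: ut_0\<close>)
  then show "((\<lambda>t. rt t x) has_real_derivative deriv (\<lambda>t. ut t x) 0 / 2) (at 0)"
    by (rule has_field_derivative_transform_within_open[where S = "{-\<epsilon><..<\<epsilon>}"])
      (use eps rt_sqrt in \<open>auto simp: abs_less_iff\<close>)
qed

text \<open>For rank 1 the normalising factor is \<sigma> = v^(-2). The squared norm is linear in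
  the scaling of \<xi> and the density is its square root, so \<sigma> enters with exponent
  3/2.\<close>

lemma action_bar_top:
  assumes t: "\<bar>t\<bar> < \<epsilon>"
  shows "action A E \<Omega> (bar_top A E 1 \<Omega> g G t)
    = 2 * real m * (vt t powr (- 3) * (\<integral>x. indicator \<Omega> x * (ut t x * rt t x) \<partial>\<mu>))"
proof -
  define \<sigma> where "\<sigma> = vt t powr (- 2)"
  have v: "vt t > 0" by (rule vt_pos[OF t])
  have \<sigma>: "\<sigma> > 0" using v by (simp add: \<sigma>_def)
  let ?H = "bar_top A E 1 \<Omega> g G t"
  interpret r: rescaled_metric A g \<xi> 1 "\<lambda>x. \<sigma> * ut t x"
    by unfold_locales
      (use metric xi_smooth unit smooth_function_mult[OF open_UNIV smooth_function_const ut_smooth[OF t]] ut_pos[OF t] \<sigma> in auto)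
  interpret h: inner_form "G t x" for x by (rule inner_form_metric[OF Gt[OF t]])
  have bar: "?H = r.H"
  proof (intro ext)
    fix x u w
    have tg: "tang E g x u = g x (\<xi> x) u *\<^sub>R \<xi> x" for u
      using gx.tang_eq[where H = g and x = x and \<xi> = \<xi>, OF refl xi_nonzero] unit by simp
    have "(Vol A \<Omega> (G t) / Vol A \<Omega> g) powr (- 2 / real 1) = \<sigma>" by (simp add: \<sigma>_def vt_def)
    then show "?H x u w = r.H x u w"
      unfolding bar_top_def norl_def tg r.H_def unfolding ut_def
      using gx.sym[of x u "\<xi> x"] by (simp only:) (simp add: gx.simps h.simps unit)
  qed
  have N: "integrability_normsq A E ?H x = \<sigma> * ut t x * (2 * real m)" for x
    unfolding bar r.normsq_H[OF chart_at, of x] normsq_g by simp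
  have utm: "ut t \<in> borel_measurable borel" by (rule borel_family[OF ut_C1 t])
  have "action A E \<Omega> ?H = (\<integral>x. indicator \<Omega> x * (sqrt (\<sigma> * ut t x) * integrability_normsq A E ?H x) \<partial>\<mu>)"
  proof (rule action_density[OF metric])
    show "(\<lambda>x. sqrt (\<sigma> * ut t x)) \<in> borel_measurable borel" using utm by simp
    have pos: "\<sigma> * ut t x > 0" for x using \<sigma> ut_pos[OF t] by simp
    show "0 \<le> sqrt (\<sigma> * ut t x)" for x using less_imp_le[OF pos[of x]] by simp
    show "det (gmat A c ?H x) = (sqrt (\<sigma> * ut t x))\<^sup>2 * det (gmat A c g x)" if "c \<in> A" "x \<in> fst c" for c x
      unfolding bar r.det_H[OF that] using less_imp_le[OF pos[of x]] by simp
    show "integrability_normsq A E ?H \<in> borel_measurable borel"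
      unfolding N[abs_def] using utm by simp
  qed (rule Omega)
  also have "\<dots> = (\<integral>x. 2 * real m * (\<sigma> * sqrt \<sigma>) * (indicator \<Omega> x * (ut t x * rt t x)) \<partial>\<mu>)"
    unfolding N rt_sqrt[OF t] real_sqrt_mult by (simp add: mult_ac)
  also have "\<dots> = 2 * real m * (\<sigma> * sqrt \<sigma>) * (\<integral>x. indicator \<Omega> x * (ut t x * rt t x) \<partial>\<mu>)" by simp
  also have "\<sigma> * sqrt \<sigma> = vt t powr (- 3)"
  proof -
    have sq: "sqrt \<sigma> = vt t powr (- 1)"
      using \<sigma> by (simp add: powr_half_sqrt[symmetric] \<sigma>_def powr_powr)
    show ?thesis unfolding sq unfolding \<sigma>_def powr_add[symmetric] by simp
  qed
  finally show ?thesis by simp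
qed

lemma critical_top:
  "((\<lambda>t. action A E \<Omega> (bar_top A E 1 \<Omega> g G t)) has_real_derivative 0) (at 0)"
proof -
  let ?I = "\<lambda>f. \<integral>x. indicator \<Omega> x * f x \<partial>\<mu>"
  define u' where "u' x = deriv (\<lambda>t. ut t x) 0" for x
  have K: "((\<lambda>t. ?I (\<lambda>x. ut t x * rt t x)) has_real_derivative ?I (\<lambda>x. deriv (\<lambda>t. ut t x * rt t x) 0)) (at 0)"
    by (rule family_leibniz[OF C1_family_mult[OF ut_C1 rt_C1] eps metric Omega(3,1,2)])
  have d: "deriv (\<lambda>t. ut t x * rt t x) 0 = 3/2 * u' x" for x
    using DERIV_mult[OF family_has_derivative[OF ut_C1, of 0 x] family_has_derivative[OF rt_C1, of 0 x]] eps
    by (intro DERIV_imp_deriv) (simp add: u'_def rt_0 ut_0 rt_deriv_ut)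
  have "?I (\<lambda>x. 3/2 * u' x) = (\<integral>x. 3/2 * (indicator \<Omega> x * u' x) \<partial>\<mu>)" by (simp add: mult_ac)
  also have "\<dots> = 3/2 * ?I u'" by (rule integral_mult_right_zero)
  finally have K': "?I (\<lambda>x. deriv (\<lambda>t. ut t x * rt t x) 0) = 3/2 * ?I u'" by (simp only: d)
  have K0: "?I (\<lambda>x. ut 0 x * rt 0 x) = Vol A \<Omega> g" by (simp add: rt_0 ut_0 Vol_g_eq)
  have "?I (\<lambda>x. deriv (\<lambda>t. rt t x) 0) = (\<integral>x. 1/2 * (indicator \<Omega> x * u' x) \<partial>\<mu>)"
    by (simp add: rt_deriv_ut u'_def)
  also have "\<dots> = 1/2 * ?I u'" by (rule integral_mult_right_zero)
  finally have R: "?I (\<lambda>x. deriv (\<lambda>t. rt t x) 0) = 1/2 * ?I u'" .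
  have V: "((\<lambda>t. vt t powr (- 3)) has_real_derivative (- 3) * (1/2 * ?I u' / Vol A \<Omega> g)) (at 0)"
    using DERIV_fun_powr[OF vt_DERIV, of "- 3"] unfolding R by (simp add: vt_0)
  have "((\<lambda>t. vt t powr (- 3) * ?I (\<lambda>x. ut t x * rt t x)) has_real_derivative 0) (at 0)"
    \<comment> \<open>With I the integral of \<open>u'\<close>, the weight contributes -3 times I/2,
      the volume having derivative I/2, while the integral contributes 3/2 times I.\<close>
    by (rule DERIV_cong[OF DERIV_mult[OF V K]], unfold K0 K') (use Vol_g_pos in \<open>simp add: vt_0\<close>)
  from DERIV_cmult[OF this, of "2 * real m"]
  have "((\<lambda>t. 2 * real m * (vt t powr (- 3) * ?I (\<lambda>x. ut t x * rt t x))) has_real_derivative 0) (at 0)" by simp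
  then show ?thesis
    by (rule has_field_derivative_transform_within_open[where S = "{-\<epsilon><..<\<epsilon>}"])
      (use eps action_bar_top in \<open>auto simp: abs_less_iff\<close>)
qed

end

section \<open>Criticality\<close>

theorem proposition2p6:
  fixes A :: "('a::{t2_space, second_countable_topology}, 'n::finite) chart set"
    and m p :: nat
    and \<phi> :: "('a, 'n) endo_field" and \<xi> :: "'a \<Rightarrow> real ^ 'n"
    and \<eta> :: "('a, 'n) one_form" and g :: "('a, 'n) two_tensor"
    and E :: "('a, 'n) distribution" and \<Omega> :: "'a set"
  assumes "smooth_atlas A"
    and "m \<ge> 1" and "p = 2 * m"
    and "contact_metric_structure A m \<phi> \<xi> \<eta> g"
    and "E = (\<lambda>x. span {\<xi> x})"
    and "relatively_compact_domain \<Omega>"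
  shows "critical_bar_perp A E p \<Omega> g \<and> critical_bar_top A E 1 \<Omega> g"
proof -
  note E = assms(5)
  have cm: "contact_manifold A m \<phi> \<xi> \<eta> g"
    using assms(1,4) by (simp add: contact_manifold_def smooth_manifold_def contact_manifold_axioms_def)
  interpret contact_manifold A m \<phi> \<xi> \<eta> g by (rule cm)
  have dv: "contact_domain_variation A m \<phi> \<xi> \<eta> g \<epsilon> G \<Omega>" if "metric_variation A g \<epsilon> G" for \<epsilon> G
    using cm that assms(6)
    by (simp add: contact_domain_variation_def contact_variation_def contact_variation_axioms_def
        contact_domain_variation_axioms_def)
  have "critical_bar_perp A E p \<Omega> g"
    unfolding critical_bar_perp_def
  proof (intro allI impI)
    fix \<epsilon> G assume G: "perp_variation A E g \<epsilon> G" and S: "supported_in g \<epsilon> G \<Omega>"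
    \<comment> \<open>A perpendicular variation fixes the metric on the line spanned by \<xi>, so
      the length 1 is preserved even though the complement of \<xi> may turn.\<close>
    have unit: "G t x (\<xi> x) (\<xi> x) = 1" if "\<bar>t\<bar> < \<epsilon>" for t x
    proof -
      have "\<xi> x \<in> E x" by (simp add: E span_base)
      then have "G t x (\<xi> x) (\<xi> x) = g x (\<xi> x) (\<xi> x)" using G that unfolding perp_variation_def by blast
      then show ?thesis using eta_xi[of x] by (simp add: eta_eq)
    qed
    have "contact_perp_variation A m \<phi> \<xi> \<eta> g \<epsilon> G \<Omega>"
      using dv[of \<epsilon> G] G S unit
      by (simp add: contact_perp_variation_def contact_perp_variation_axioms_def perp_variation_def)
    then show "((\<lambda>t. action A E \<Omega> (bar_perp A E p \<Omega> g G t)) has_real_derivative 0) (at 0)"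
      unfolding E assms(3) by (rule contact_perp_variation.critical_perp) (rule assms(2))
  qed
  moreover have "critical_bar_top A E 1 \<Omega> g"
    unfolding critical_bar_top_def
  proof (intro allI impI)
    fix \<epsilon> G assume G: "top_variation A E g \<epsilon> G"
    have perp: "v \<in> perp E g x \<longleftrightarrow> g x (\<xi> x) v = 0" for x v
      unfolding E by (rule gx.perp_span_iff) (rule refl)
    have fixed: "G t x u v = g x u v" if "\<bar>t\<bar> < \<epsilon>" "g x (\<xi> x) u = 0" "g x (\<xi> x) v = 0" for t x u v
      using G that perp unfolding top_variation_def by blast
    have orthogonal: "G t x (\<xi> x) v = 0" if "\<bar>t\<bar> < \<epsilon>" "g x (\<xi> x) v = 0" for t x v
    proof -
      have "\<xi> x \<in> E x" by (simp add: E span_base)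
      then show ?thesis using G that perp unfolding top_variation_def by blast
    qed
    have "metric_variation A g \<epsilon> G" using G by (simp add: top_variation_def)
    then have "contact_top_variation A m \<phi> \<xi> \<eta> g \<epsilon> G \<Omega>"
      unfolding contact_top_variation_def contact_top_variation_axioms_def
      using dv fixed orthogonal by blast
    then show "((\<lambda>t. action A E \<Omega> (bar_top A E 1 \<Omega> g G t)) has_real_derivative 0) (at 0)"
      unfolding E by (rule contact_top_variation.critical_top)
  qed
  ultimately show ?thesis ..
qed

end
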